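(* For $r>1$, let $K(\overline{\mathbb{A}}_r^2)$ be the smallest constant for which $\overline{\mathbb{A}}_r^2$ is a $K(\overline{\mathbb{A}}_r^2)$-spectral set for every commuting pair of operators in $Q\mathbb{A}_r$. Then $$2^2\le K(\overline{\mathbb{A}}_r^2)\le\left[4+4\left(\frac{r^2+1}{r^2-1}\right)^{1/2}+\left(\frac{r^2+1}{r^2-1}\right)^2\right]\quad\text{and}\quad 2^2\le\lim_{r\to\infty}K(\overline{\mathbb{A}}_r^2)\le 3^2.$$
   Context: $\mathbb{A}_r=\{z\in\mathbb{C}: r^{-1}<|z|<r\}$, $\overline{\mathbb{A}}_r$ is its closure, and $\overline{\mathbb{A}}_r^2=\overline{\mathbb{A}}_r\times\overline{\mathbb{A}}_r$. $Q\mathbb{A}_r$ is the class of invertible bounded operators $T$ on complex Hilbert spaces with $\|T\|,\|T^{-1}\|\le r$; a commuting pair in $Q\mathbb{A}_r$ is a pair $(T_1,T_2)$ of commuting operators on a common Hilbert space, each in $Q\mathbb{A}_r$. For a compact set $X\subseteq\mathbb{C}^n$, $\mathrm{Rat}(X)$ is the algebra of rational functions $p/q$ with singularities outside $X$ (i.e. $q$ has no zeros in $X$), with supremum norm $\|\cdot\|_{\infty,X}$. For a commuting tuple $\underline T$ with Taylor joint spectrum in $X$ and $f=p/q\in\mathrm{Rat}(X)$, $f(\underline T)=p(\underline T)q(\underline T)^{-1}$. For $K>0$, $X$ is a $K$-spectral set for a commuting tuple $\underline T$ if its Taylor joint spectrum is contained in $X$ and $\|f(\underline T)\|\le K\|f\|_{\infty,X}$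 for all $f\in\mathrm{Rat}(X)$. *)

theory Defs
  imports "HOL-Analysis.Analysis" "HOL-Computational_Algebra.Polynomial"
begin

section \<open>Complex Hilbert spaces\<close>

text \<open>The inner product is antilinear in the first and linear in the second argument.\<close>

class complex_hilbert = banach +
  fixes scaleC :: "complex \<Rightarrow> 'a \<Rightarrow> 'a" (infixr \<open>*\<^sub>C\<close> 75)
    and cinner :: "'a \<Rightarrow> 'a \<Rightarrow> complex"
  assumes scaleC_of_real: "complex_of_real c *\<^sub>C x = c *\<^sub>R x"
    and scaleC_add_right: "a *\<^sub>C (x + y) = a *\<^sub>C x + a *\<^sub>C y"
    and scaleC_add_left: "(a + b) *\<^sub>C x = a *\<^sub>C x + b *\<^sub>C x"
    and scaleC_scaleC: "a *\<^sub>C b *\<^sub>C x = (a * b) *\<^sub>C x"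
    and cinner_commute: "cinner x y = cnj (cinner y x)"
    and cinner_add_right: "cinner x (y + z) = cinner x y + cinner x z"
    and cinner_scaleC_right: "cinner x (a *\<^sub>C y) = a * cinner x y"
    and cinner_ge_zero: "0 \<le> Re (cinner x x)"
    and norm_eq_sqrt_cinner: "norm x = sqrt (Re (cinner x x))"

lemma norm_scaleC: "norm (a *\<^sub>C x) = cmod a * norm (x::'a::complex_hilbert)"
proof -
  have "cinner (a *\<^sub>C x) (a *\<^sub>C x) = a * cinner (a *\<^sub>C x) x"
    by (rule cinner_scaleC_right)
  also have "cinner (a *\<^sub>C x) x = cnj (a * cinner x x)"
    by (subst cinner_commute) (simp only: cinner_scaleC_right)
  also have "a * cnj (a * cinner x x) = of_real ((cmod a)\<^sup>2) * cnj (cinner x x)"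
    using complex_norm_square[of a] by (simp add: mult.assoc[symmetric])
  finally have "Re (cinner (a *\<^sub>C x) (a *\<^sub>C x)) = (cmod a)\<^sup>2 * Re (cinner x x)"
    by simp
  then show ?thesis
    by (simp add: norm_eq_sqrt_cinner real_sqrt_mult)
qed

lemma bounded_linear_scaleC: "bounded_linear (\<lambda>x::'a::complex_hilbert. a *\<^sub>C x)"
proof (rule bounded_linear_intro[where K = "cmod a"])
  show "a *\<^sub>C (r *\<^sub>R x) = r *\<^sub>R (a *\<^sub>C x)" for r and x :: 'a
    by (simp add: scaleC_of_real[symmetric] scaleC_scaleC mult.commute)
qed (simp_all add: scaleC_add_right norm_scaleC mult.commute)


section \<open>The separable Hilbert space of square-summable sequences\<close>

typedef ell2 = "{x :: nat \<Rightarrow> complex. summable (\<lambda>n. (cmod (x n))\<^sup>2)}"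
  morphisms ell2_nth Abs_ell2
  by (rule exI[of _ "\<lambda>_. 0"]) simp

setup_lifting type_definition_ell2

lemma sq_norm_add_le: "(cmod (x + y))\<^sup>2 \<le> 2 * (cmod x)\<^sup>2 + 2 * (cmod y)\<^sup>2"
proof -
  have "(cmod (x + y))\<^sup>2 \<le> (cmod x + cmod y)\<^sup>2"
    by (intro power_mono norm_triangle_ineq) auto
  also have "\<dots> \<le> 2 * (cmod x)\<^sup>2 + 2 * (cmod y)\<^sup>2"
    using sum_squares_bound[of "cmod x" "cmod y"] by (simp add: power2_sum)
  finally show ?thesis .
qed

lemma square_summable_add:
  assumes "summable (\<lambda>n. (cmod (x n))\<^sup>2)" "summable (\<lambda>n. (cmod (y n))\<^sup>2)"
  shows "summable (\<lambda>n. (cmod (x n + y n))\<^sup>2)"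
  by (rule summable_comparison_test'[where N = 0 and
        g = "\<lambda>n. 2 * (cmod (x n))\<^sup>2 + 2 * (cmod (y n))\<^sup>2"])
     (use assms sq_norm_add_le in \<open>auto intro!: summable_add summable_mult\<close>)

lemma square_summable_scale:
  assumes "summable (\<lambda>n. (cmod (x n))\<^sup>2)"
  shows "summable (\<lambda>n. (cmod (a * x n))\<^sup>2)"
  using summable_mult[OF assms, of "(cmod a)\<^sup>2"] by (simp add: norm_mult power_mult_distrib)

lemma square_summable_inner:
  assumes "summable (\<lambda>n. (cmod (x n))\<^sup>2)" "summable (\<lambda>n. (cmod (y n))\<^sup>2)"
  shows "summable (\<lambda>n. cnj (x n) * y n)"
proof (rule summable_comparison_test'[where N = 0 and
        g = "\<lambda>n. (cmod (x n))\<^sup>2 + (cmod (y n))\<^sup>2"])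
  show "norm (cnj (x n) * y n) \<le> (cmod (x n))\<^sup>2 + (cmod (y n))\<^sup>2" for n
  proof -
    have "0 \<le> cmod (x n) * cmod (y n)" by simp
    then show ?thesis
      using sum_squares_bound[of "cmod (x n)" "cmod (y n)"] unfolding norm_mult complex_mod_cnj
      by linarith
  qed
qed (use assms in \<open>auto intro: summable_add\<close>)

instantiation ell2 :: real_vector
begin

lift_definition zero_ell2 :: ell2 is "\<lambda>_. 0" by simp
lift_definition plus_ell2 :: "ell2 \<Rightarrow> ell2 \<Rightarrow> ell2" is "\<lambda>x y n. x n + y n"
  by (rule square_summable_add)
lift_definition uminus_ell2 :: "ell2 \<Rightarrow> ell2" is "\<lambda>x n. - x n" by simp
lift_definition minus_ell2 :: "ell2 \<Rightarrow> ell2 \<Rightarrow> ell2" is "\<lambda>x y n. x n - y n"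
proof -
  fix x y :: "nat \<Rightarrow> complex"
  assume "summable (\<lambda>n. (cmod (x n))\<^sup>2)" "summable (\<lambda>n. (cmod (y n))\<^sup>2)"
  then show "summable (\<lambda>n. (cmod (x n - y n))\<^sup>2)"
    using square_summable_add[of x "\<lambda>n. - y n"] by simp
qed
lift_definition scaleR_ell2 :: "real \<Rightarrow> ell2 \<Rightarrow> ell2" is "\<lambda>c x n. complex_of_real c * x n"
  by (rule square_summable_scale)

instance
  by standard (transfer; simp add: algebra_simps)+

end

instantiation ell2 :: real_normed_vector
begin

lift_definition norm_ell2 :: "ell2 \<Rightarrow> real" is "\<lambda>x. sqrt (\<Sum>n. (cmod (x n))\<^sup>2)" .

definition "dist x y = norm (x - y)" for x y :: ell2
definition "sgn x = inverse (norm x) *\<^sub>R x" for x :: ell2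
definition "uniformity = (INF e\<in>{0<..}. principal {(x :: ell2, y). dist x y < e})"
definition "open U = (\<forall>x\<in>U. \<forall>\<^sub>F (x', y) in uniformity. x' = x \<longrightarrow> y \<in> U)" for U :: "ell2 set"

lemma L2_set_le_norm_ell2: "L2_set (\<lambda>n. cmod (ell2_nth x n)) {..<N} \<le> norm x"
  unfolding L2_set_def norm_ell2.rep_eq
  by (intro real_sqrt_le_mono sum_le_suminf) (use ell2_nth[of x] in auto)

lemma norm_ell2_le:
  assumes "\<And>N. L2_set (\<lambda>n. cmod (ell2_nth x n)) {..<N} \<le> B"
  shows "norm x \<le> B"
proof -
  have B: "0 \<le> B" using assms[of 0] by simp
  have "(\<Sum>n<N. (cmod (ell2_nth x n))\<^sup>2) \<le> B\<^sup>2" for N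
  proof -
    have "sqrt (\<Sum>n<N. (cmod (ell2_nth x n))\<^sup>2) \<le> B"
      using assms[of N] by (simp add: L2_set_def)
    then show ?thesis by (rule sqrt_le_D)
  qed
  then have "(\<Sum>n. (cmod (ell2_nth x n))\<^sup>2) \<le> B\<^sup>2"
    using ell2_nth[of x] by (intro suminf_le_const) auto
  then show ?thesis unfolding norm_ell2.rep_eq using B by (intro real_le_lsqrt) auto
qed

instance
proof
  fix x y :: ell2 and a :: real
  show "dist x y = norm (x - y)" by (rule dist_ell2_def)
  show "sgn x = inverse (norm x) *\<^sub>R x" by (rule sgn_ell2_def)
  show "uniformity = (INF e\<in>{0<..}. principal {(x :: ell2, y). dist x y < e})"
    by (rule uniformity_ell2_def)
  show "open U = (\<forall>x\<in>U. \<forall>\<^sub>F (x', y) in uniformity. x' = x \<longrightarrow> y \<in> U)" for U :: "ell2 set"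
    by (rule open_ell2_def)
  show "(norm x = 0) = (x = 0)"
  proof transfer
    fix x :: "nat \<Rightarrow> complex"
    assume "summable (\<lambda>n. (cmod (x n))\<^sup>2)"
    then show "(sqrt (\<Sum>n. (cmod (x n))\<^sup>2) = 0) = (x = (\<lambda>_. 0))"
      using suminf_eq_zero_iff[of "\<lambda>n. (cmod (x n))\<^sup>2"] by (auto simp: fun_eq_iff)
  qed
  show "norm (x + y) \<le> norm x + norm y"
  proof (rule norm_ell2_le)
    fix N
    have "L2_set (\<lambda>n. cmod (ell2_nth (x + y) n)) {..<N}
        \<le> L2_set (\<lambda>n. cmod (ell2_nth x n) + cmod (ell2_nth y n)) {..<N}"
      by (intro L2_set_mono) (auto simp: plus_ell2.rep_eq norm_triangle_ineq)
    also have "\<dots> \<le> L2_set (\<lambda>n. cmod (ell2_nth x n)) {..<N} + L2_set (\<lambda>n. cmod (ell2_nth y n)) {..<N}"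
      by (rule L2_set_triangle_ineq)
    also have "\<dots> \<le> norm x + norm y"
      by (intro add_mono L2_set_le_norm_ell2)
    finally show "L2_set (\<lambda>n. cmod (ell2_nth (x + y) n)) {..<N} \<le> norm x + norm y" .
  qed
  show "norm (a *\<^sub>R x) = \<bar>a\<bar> * norm x"
    by transfer (simp add: norm_mult power_mult_distrib suminf_mult real_sqrt_mult)
qed

end

lemma norm_ell2_nth_le: "cmod (ell2_nth x n) \<le> norm x"
proof -
  have "cmod (ell2_nth x n) \<le> L2_set (\<lambda>n. cmod (ell2_nth x n)) {..<Suc n}"
    by (rule member_le_L2_set) auto
  then show ?thesis using L2_set_le_norm_ell2[of x "Suc n"] by linarith
qed

instance ell2 :: banach
proof
  fix X :: "nat \<Rightarrow> ell2"
  assume X: "Cauchy X"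
  have "Cauchy (\<lambda>k. ell2_nth (X k) n)" for n
    unfolding Cauchy_def
  proof (intro allI impI)
    fix e :: real assume "e > 0"
    then obtain M where "\<forall>k\<ge>M. \<forall>l\<ge>M. dist (X k) (X l) < e"
      using X unfolding Cauchy_def by blast
    moreover have "dist (ell2_nth (X k) n) (ell2_nth (X l) n) \<le> dist (X k) (X l)" for k l
      using norm_ell2_nth_le[of "X k - X l" n] by (simp add: dist_norm minus_ell2.rep_eq)
    ultimately show "\<exists>M. \<forall>k\<ge>M. \<forall>l\<ge>M. dist (ell2_nth (X k) n) (ell2_nth (X l) n) < e"
      by (meson le_less_trans)
  qed
  then have "\<exists>c. (\<lambda>k. ell2_nth (X k) n) \<longlonglongrightarrow> c" for n
    using Cauchy_convergent_iff convergent_def by blast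
  then obtain y where y: "\<And>n. (\<lambda>k. ell2_nth (X k) n) \<longlonglongrightarrow> y n" by metis
  have fin: "L2_set (\<lambda>n. cmod (ell2_nth (X k) n - y n)) {..<N} \<le> e"
    if "\<forall>k\<ge>M. \<forall>l\<ge>M. dist (X k) (X l) < e" "k \<ge> M" for k M N e
  proof (rule tendsto_upperbound)
    show "(\<lambda>l. L2_set (\<lambda>n. cmod (ell2_nth (X k) n - ell2_nth (X l) n)) {..<N})
        \<longlonglongrightarrow> L2_set (\<lambda>n. cmod (ell2_nth (X k) n - y n)) {..<N}"
      unfolding L2_set_def by (intro tendsto_intros y)
    have "L2_set (\<lambda>n. cmod (ell2_nth (X k) n - ell2_nth (X l) n)) {..<N} \<le> e" if "l \<ge> M" for l
      using L2_set_le_norm_ell2[of "X k - X l" N] \<open>\<forall>k\<ge>M. \<forall>l\<ge>M. _\<close> \<open>k \<ge> M\<close> \<open>l \<ge> M\<close>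
      by (simp add: minus_ell2.rep_eq dist_norm) (meson less_le_trans le_less_trans less_imp_le)
    then show "\<forall>\<^sub>F l in sequentially.
        L2_set (\<lambda>n. cmod (ell2_nth (X k) n - ell2_nth (X l) n)) {..<N} \<le> e"
      unfolding eventually_sequentially by blast
  qed simp
  obtain M where M: "\<forall>k\<ge>M. \<forall>l\<ge>M. dist (X k) (X l) < 1"
    using X unfolding Cauchy_def by (meson zero_less_one)
  have "(\<Sum>n<N. (cmod (ell2_nth (X M) n - y n))\<^sup>2) \<le> 1" for N
    using fin[OF M, of M N] by (simp add: L2_set_def)
  then have "summable (\<lambda>n. (cmod (ell2_nth (X M) n - y n))\<^sup>2)"
    by (intro summableI_nonneg_bounded[where x = 1]) auto
  then have "summable (\<lambda>n. (cmod (ell2_nth (X M) n + (- 1) * (ell2_nth (X M) n - y n)))\<^sup>2)"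
    using ell2_nth[of "X M"] by (intro square_summable_add square_summable_scale) auto
  then have "summable (\<lambda>n. (cmod (y n))\<^sup>2)" by simp
  then have Y: "ell2_nth (Abs_ell2 y) = y" by (simp add: Abs_ell2_inverse)
  have "X \<longlonglongrightarrow> Abs_ell2 y"
    unfolding lim_sequentially
  proof (intro allI impI)
    fix e :: real assume "e > 0"
    then obtain M where M: "\<forall>k\<ge>M. \<forall>l\<ge>M. dist (X k) (X l) < e / 2"
      using X unfolding Cauchy_def by (meson half_gt_zero)
    have "dist (X k) (Abs_ell2 y) \<le> e / 2" if "k \<ge> M" for k
      unfolding dist_norm using fin[OF M that]
      by (intro norm_ell2_le) (simp add: minus_ell2.rep_eq Y)
    then show "\<exists>M. \<forall>k\<ge>M. dist (X k) (Abs_ell2 y) < e"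
      using \<open>e > 0\<close> by (intro exI[of _ M] allI impI) (rule le_less_trans[of _ "e / 2"], auto)
  qed
  then show "convergent X" unfolding convergent_def by blast
qed

instantiation ell2 :: complex_hilbert
begin

lift_definition scaleC_ell2 :: "complex \<Rightarrow> ell2 \<Rightarrow> ell2" is "\<lambda>a x n. a * x n"
  by (rule square_summable_scale)
lift_definition cinner_ell2 :: "ell2 \<Rightarrow> ell2 \<Rightarrow> complex" is "\<lambda>x y. \<Sum>n. cnj (x n) * y n" .

instance
proof
  fix x y z :: ell2 and a b :: complex and c :: real
  show "complex_of_real c *\<^sub>C x = c *\<^sub>R x" by transfer simp
  show "a *\<^sub>C (x + y) = a *\<^sub>C x + a *\<^sub>C y" by transfer (simp add: algebra_simps)
  show "(a + b) *\<^sub>C x = a *\<^sub>C x + b *\<^sub>C x" by transfer (simp add: algebra_simps)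
  show "a *\<^sub>C b *\<^sub>C x = (a * b) *\<^sub>C x" by transfer (simp add: algebra_simps)
  show "cinner x y = cnj (cinner y x)"
  proof transfer
    fix x y :: "nat \<Rightarrow> complex"
    assume "summable (\<lambda>n. (cmod (x n))\<^sup>2)" "summable (\<lambda>n. (cmod (y n))\<^sup>2)"
    then have "(\<lambda>n. cnj (y n) * x n) sums (\<Sum>n. cnj (y n) * x n)"
      by (intro summable_sums square_summable_inner)
    then have "(\<lambda>n. cnj (cnj (y n) * x n)) sums cnj (\<Sum>n. cnj (y n) * x n)"
      by (simp only: sums_cnj)
    then show "(\<Sum>n. cnj (x n) * y n) = cnj (\<Sum>n. cnj (y n) * x n)"
      by (simp add: sums_iff mult.commute)
  qed
  show "cinner x (y + z) = cinner x y + cinner x z"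
    by transfer (simp add: distrib_left suminf_add[symmetric] square_summable_inner)
  show "cinner x (a *\<^sub>C y) = a * cinner x y"
    by transfer (simp add: mult.left_commute suminf_mult square_summable_inner)
  have *: "cinner x x = complex_of_real (\<Sum>n. (cmod (ell2_nth x n))\<^sup>2)"
  proof -
    have "cinner x x = (\<Sum>n. complex_of_real ((cmod (ell2_nth x n))\<^sup>2))"
      unfolding cinner_ell2.rep_eq complex_norm_square by (simp add: mult.commute)
    then show ?thesis
      using ell2_nth[of x] by (simp add: suminf_of_real del: of_real_power)
  qed
  show "0 \<le> Re (cinner x x)"
    using ell2_nth[of x] unfolding * by (simp add: suminf_nonneg)
  show "norm x = sqrt (Re (cinner x x))"
    unfolding * norm_ell2.rep_eq by simp
qed

end


section \<open>Bounded operators and Taylor joint spectrum\<close>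

text \<open>
  The type of bounded linear maps of the library is real-linear, so complex linearity is imposed
  separately.
\<close>

definition clinear_op :: "('a::complex_hilbert \<Rightarrow>\<^sub>L 'a) \<Rightarrow> bool" where
  "clinear_op T \<longleftrightarrow> (\<forall>c x. blinfun_apply T (c *\<^sub>C x) = c *\<^sub>C blinfun_apply T x)"

lift_definition scalar_op :: "complex \<Rightarrow> 'a::complex_hilbert \<Rightarrow>\<^sub>L 'a" is "\<lambda>c x. c *\<^sub>C x"
  by (rule bounded_linear_scaleC)

definition is_inverse_op :: "('a::complex_hilbert \<Rightarrow>\<^sub>L 'a) \<Rightarrow> ('a \<Rightarrow>\<^sub>L 'a) \<Rightarrow> bool" where
  "is_inverse_op T S \<longleftrightarrow> T o\<^sub>L S = id_blinfun \<and> S o\<^sub>L T = id_blinfun"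

definition inverse_op :: "('a::complex_hilbert \<Rightarrow>\<^sub>L 'a) \<Rightarrow> 'a \<Rightarrow>\<^sub>L 'a" where
  "inverse_op T = (THE S. is_inverse_op T S)"

definition power_op :: "('a::complex_hilbert \<Rightarrow>\<^sub>L 'a) \<Rightarrow> nat \<Rightarrow> 'a \<Rightarrow>\<^sub>L 'a" where
  "power_op T n = (((o\<^sub>L) T) ^^ n) id_blinfun"

text \<open>
  Exactness at all three places of the Koszul complex
  \<open>0 \<rightarrow> H \<rightarrow> H \<oplus> H \<rightarrow> H \<rightarrow> 0\<close> of a commuting pair \<open>(A, B)\<close>.
\<close>

definition koszul_exact :: "('a::complex_hilbert \<Rightarrow>\<^sub>L 'a) \<Rightarrow> ('a \<Rightarrow>\<^sub>L 'a) \<Rightarrow> bool" where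
  "koszul_exact A B \<longleftrightarrow>
    (let d0 = (\<lambda>x. (blinfun_apply A x, blinfun_apply B x));
         d1 = (\<lambda>(x, y). blinfun_apply A y - blinfun_apply B x)
     in inj d0 \<and> range d0 = {p. d1 p = 0} \<and> surj d1)"

definition taylor_spectrum ::
    "('a::complex_hilbert \<Rightarrow>\<^sub>L 'a) \<Rightarrow> ('a \<Rightarrow>\<^sub>L 'a) \<Rightarrow> (complex \<times> complex) set" where
  "taylor_spectrum T1 T2 =
    {(l1, l2). \<not> koszul_exact (T1 - scalar_op l1) (T2 - scalar_op l2)}"


section \<open>Rational functions of two variables and spectral sets\<close>

text \<open>
  An element of \<open>complex poly poly\<close> is a polynomial in \<open>w\<close> whose coefficients are polynomials
  in \<open>z\<close>, that is, the coefficient of \<open>z ^ i * w ^ j\<close> in \<open>p\<close> is \<open>coeff (coeff p j) i\<close>.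
\<close>

definition poly_at :: "complex poly poly \<Rightarrow> complex \<times> complex \<Rightarrow> complex" where
  "poly_at p = (\<lambda>(z, w). poly (poly p [:w:]) z)"

definition poly_op ::
    "complex poly poly \<Rightarrow> ('a::complex_hilbert \<Rightarrow>\<^sub>L 'a) \<Rightarrow> ('a \<Rightarrow>\<^sub>L 'a) \<Rightarrow> 'a \<Rightarrow>\<^sub>L 'a" where
  "poly_op p T1 T2 =
    (\<Sum>j\<le>degree p. \<Sum>i\<le>degree (coeff p j).
       scalar_op (coeff (coeff p j) i) o\<^sub>L power_op T1 i o\<^sub>L power_op T2 j)"

text \<open>A rational function \<open>p / q\<close> is represented by a pair \<open>(p, q)\<close>.\<close>

definition Rat_on :: "(complex \<times> complex) set \<Rightarrow> (complex poly poly \<times> complex poly poly) set" where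
  "Rat_on X = {(p, q). \<forall>x\<in>X. poly_at q x \<noteq> 0}"

definition rat_sup_norm ::
    "(complex \<times> complex) set \<Rightarrow> complex poly poly \<times> complex poly poly \<Rightarrow> real" where
  "rat_sup_norm X = (\<lambda>(p, q). SUP x\<in>X. cmod (poly_at p x / poly_at q x))"

definition rat_op ::
    "complex poly poly \<times> complex poly poly \<Rightarrow> ('a::complex_hilbert \<Rightarrow>\<^sub>L 'a) \<Rightarrow> ('a \<Rightarrow>\<^sub>L 'a) \<Rightarrow> 'a \<Rightarrow>\<^sub>L 'a" where
  "rat_op = (\<lambda>(p, q) T1 T2. poly_op p T1 T2 o\<^sub>L inverse_op (poly_op q T1 T2))"

definition K_spectral_set ::
    "real \<Rightarrow> (complex \<times> complex) set \<Rightarrow> ('a::complex_hilbert \<Rightarrow>\<^sub>L 'a) \<Rightarrow> ('a \<Rightarrow>\<^sub>L 'a) \<Rightarrow> bool" where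
  "K_spectral_set K X T1 T2 \<longleftrightarrow>
    taylor_spectrum T1 T2 \<subseteq> X \<and>
    (\<forall>f\<in>Rat_on X. norm (rat_op f T1 T2) \<le> K * rat_sup_norm X f)"


section \<open>The quantum annulus and the spectral constant of the closed biannulus\<close>

definition annulus :: "real \<Rightarrow> complex set" where
  "annulus r = {z. inverse r < cmod z \<and> cmod z < r}"

definition closed_biannulus :: "real \<Rightarrow> (complex \<times> complex) set" where
  "closed_biannulus r = closure (annulus r) \<times> closure (annulus r)"

definition quantum_annulus :: "real \<Rightarrow> ('a::complex_hilbert \<Rightarrow>\<^sub>L 'a) set" where
  "quantum_annulus r =
    {T. clinear_op T \<and> norm T \<le> r \<and> (\<exists>S. is_inverse_op T S \<and> norm S \<le> r)}"

definition admissible_const :: "'a::complex_hilbert itself \<Rightarrow> real \<Rightarrow> real \<Rightarrow> bool" where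
  "admissible_const _ r K \<longleftrightarrow> 0 < K \<and>
    (\<forall>T1 T2 :: 'a \<Rightarrow>\<^sub>L 'a.
       T1 \<in> quantum_annulus r \<longrightarrow> T2 \<in> quantum_annulus r \<longrightarrow> T1 o\<^sub>L T2 = T2 o\<^sub>L T1 \<longrightarrow>
       K_spectral_set K (closed_biannulus r) T1 T2)"

text \<open>
  A definition cannot quantify over all Hilbert spaces, because these are types. So the constant
  is defined as the infimum of the admissible constants for the Hilbert space \<^typ>\<open>ell2\<close>.
  A number is the smallest constant for all Hilbert spaces if it is admissible for every type
  of class \<^class>\<open>complex_hilbert\<close> and below every number that is admissible for \<^typ>\<open>ell2\<close>;
  that this number has both properties is a claim, not part of the definition.
\<close>

definition biannulus_const :: "real \<Rightarrow> real" where
  "biannulus_const r = Inf {K. admissible_const TYPE(ell2) r K}"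

end

theory Submission
  imports Defs "HOL-Complex_Analysis.Complex_Analysis" "HOL-Library.Diagonal_Subsequence"
    "HOL-Real_Asymp.Real_Asymp"
begin

text \<open>
  An orbit \<open>u (n, m) = T\<^sub>1\<^sup>n T\<^sub>2\<^sup>m h\<close> is determined up to unitaries by its Gram matrix, and the bounds on
  \<open>T\<^sub>i\<close> and \<open>T\<^sub>i\<^sup>-\<^sup>1\<close> are positivity conditions on that matrix. Since \<open>1/q\<close> is a limit of Laurent
  polynomials on the closed biannulus, a constant is admissible if and only if it bounds all Laurent
  polynomials of all such families, and it is enough to consider families in \<open>ell2\<close>.

  Upper bound: a Laurent polynomial is split into four parts, analytic in \<open>z\<^sup>\<plusminus>\<^sup>1\<close> and \<open>w\<^sup>\<plusminus>\<^sup>1\<close>. Ando's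
  theorem for the contractions \<open>T\<^sub>1\<^sup>\<plusminus>\<^sup>1/r\<close> and \<open>T\<^sub>2\<^sup>\<plusminus>\<^sup>1/r\<close> bounds each part by its supremum on one of the
  four tori, and Parseval's identity compares that supremum with the one of the whole polynomial.
  This gives \<open>(2 + \<surd>a)\<^sup>2\<close> with \<open>a = (r\<^sup>2 + 1)/(r\<^sup>2 - 1)\<close>.

  Lower bound: for weighted cyclic shifts the polynomial
  \<open>r\<^sup>-\<^sup>2\<^sup>N (z\<^sup>N + z\<^sup>-\<^sup>N) (w\<^sup>N + w\<^sup>-\<^sup>N)\<close>, of supremum \<open>(1 + r\<^sup>-\<^sup>2\<^sup>N)\<^sup>2\<close>, has norm at least 4.

  Limit: up to a factor that tends to 1 as \<open>s \<rightarrow> \<infinity>\<close>, uniformly in \<open>S \<ge> s\<close>, the constant of the radius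
  \<open>s\<close> is at most the one of \<open>S\<close>, because a family for \<open>s\<close> is a small perturbation of a compression
  of one for \<open>S\<close>. So the constant is almost increasing, and it is bounded.
\<close>

text \<open>Two obstacles shape the proof. Ando's theorem needs a unitary that extends an isometry
  between defect vectors, and in infinite dimension the complements may have different dimensions.
  The pair is therefore first made nilpotent, which leaves finitely many nonzero defect vectors;
  reflections then give the unitary, and the truncation is removed by a diagonal subsequence of Gram
  matrices. Second, the constant is not obviously monotone: a pair for \<open>s\<close> is also a
  pair for \<open>S\<close>, but the supremum over the larger biannulus is larger too, so neither
  inequality is immediate. The comparison deforms the product of the contractions \<open>T/s\<close>
  and \<open>T^-1/s\<close> from the scalar s^-2 to S^-2, one variable at a time; this is why
  families and constants carry two radii. The square root in the upper bound is the sum of two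
  tails: the roots of the geometric series of ratio r^-4 that start at exponents 0 and 1 add up to
  (1 + r^-2) / sqrt (1 - r^-4) = sqrt a, and a tends to 1, which gives 3^2 in the limit.\<close>

section \<open>Calculus of the inner product\<close>

lemma scaleC_one [simp]: "1 *\<^sub>C x = (x::'a::complex_hilbert)"
  using scaleC_of_real[of 1 x] by simp

lemma scaleC_zero_left [simp]: "0 *\<^sub>C x = (0::'a::complex_hilbert)"
  using scaleC_of_real[of 0 x] by simp

lemma scaleC_zero_right [simp]: "a *\<^sub>C 0 = (0::'a::complex_hilbert)"
  using linear_0[OF bounded_linear.linear[OF bounded_linear_scaleC]] by blast

lemma scaleC_minus_left: "(- a) *\<^sub>C x = - (a *\<^sub>C (x::'a::complex_hilbert))"
  using scaleC_add_left[of a "- a" x] by (simp add: eq_neg_iff_add_eq_0 add.commute)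

lemma scaleC_diff_right: "a *\<^sub>C (x - y) = a *\<^sub>C x - a *\<^sub>C (y::'a::complex_hilbert)"
  using linear_diff[OF bounded_linear.linear[OF bounded_linear_scaleC]] by blast

lemma scaleC_diff_left: "(a - b) *\<^sub>C x = a *\<^sub>C x - b *\<^sub>C (x::'a::complex_hilbert)"
  using scaleC_add_left[of a "- b" x] by (simp add: scaleC_minus_left)

lemma scaleC_sum_right: "a *\<^sub>C (\<Sum>i\<in>F. f i) = (\<Sum>i\<in>F. a *\<^sub>C (f i::'a::complex_hilbert))"
  using linear_sum[OF bounded_linear.linear[OF bounded_linear_scaleC]] by blast

lemma scaleC_sum_left: "(\<Sum>i\<in>F. f i) *\<^sub>C x = (\<Sum>i\<in>F. f i *\<^sub>C (x::'a::complex_hilbert))"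
  by (induction F rule: infinite_finite_induct) (simp_all add: scaleC_add_left)

lemma cnj_cinner: "cnj (cinner x y) = cinner y (x::'a::complex_hilbert)"
  using cinner_commute[of y x] by simp

lemma cinner_add_left: "cinner (x + y) z = cinner x z + cinner y (z::'a::complex_hilbert)"
  by (metis cinner_add_right cinner_commute complex_cnj_add)

lemma cinner_scaleC_left: "cinner (a *\<^sub>C x) y = cnj a * cinner x (y::'a::complex_hilbert)"
  by (metis cinner_commute cinner_scaleC_right complex_cnj_mult)

lemma cinner_zero_right [simp]: "cinner x 0 = (0::complex)" for x :: "'a::complex_hilbert"
  using cinner_scaleC_right[of x 0 0] by simp

lemma cinner_zero_left [simp]: "cinner 0 x = (0::complex)" for x :: "'a::complex_hilbert"
  using cinner_scaleC_left[of 0 0 x] by simp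

lemma cinner_minus_right: "cinner x (- y) = - cinner x (y::'a::complex_hilbert)"
  using cinner_scaleC_right[of x "-1" y] by (simp add: scaleC_minus_left)

lemma cinner_minus_left: "cinner (- x) y = - cinner x (y::'a::complex_hilbert)"
  using cinner_scaleC_left[of "-1" x y] by (simp add: scaleC_minus_left)

lemma cinner_diff_right: "cinner x (y - z) = cinner x y - cinner x (z::'a::complex_hilbert)"
  using cinner_add_right[of x y "- z"] by (simp add: cinner_minus_right)

lemma cinner_diff_left: "cinner (x - y) z = cinner x z - cinner y (z::'a::complex_hilbert)"
  using cinner_add_left[of x "- y" z] by (simp add: cinner_minus_left)

lemma cinner_sum_right: "cinner x (\<Sum>i\<in>F. f i) = (\<Sum>i\<in>F. cinner x (f i::'a::complex_hilbert))"
  by (induction F rule: infinite_finite_induct) (simp_all add: cinner_add_right)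

lemma cinner_sum_left: "cinner (\<Sum>i\<in>F. f i) x = (\<Sum>i\<in>F. cinner (f i::'a::complex_hilbert) x)"
  by (induction F rule: infinite_finite_induct) (simp_all add: cinner_add_left)

lemma norm_sq_cinner: "(norm (x::'a::complex_hilbert))\<^sup>2 = Re (cinner x x)"
  by (simp add: norm_eq_sqrt_cinner cinner_ge_zero)

lemma cinner_self: "cinner x x = complex_of_real ((norm (x::'a::complex_hilbert))\<^sup>2)"
proof -
  have "Im (cinner x x) = Im (cnj (cinner x x))" using cinner_commute[of x x] by simp
  then show ?thesis by (simp add: complex_eq_iff norm_sq_cinner)
qed

lemma norm_add_sq: "(norm (x + y))\<^sup>2 = (norm x)\<^sup>2 + (norm (y::'a::complex_hilbert))\<^sup>2 + 2 * Re (cinner x y)"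
proof -
  have "Re (cinner y x) = Re (cinner x y)" using cinner_commute[of y x] by simp
  then show ?thesis by (simp add: norm_sq_cinner cinner_add_left cinner_add_right)
qed

lemma norm_diff_sq: "(norm (x - y))\<^sup>2 = (norm x)\<^sup>2 + (norm (y::'a::complex_hilbert))\<^sup>2 - 2 * Re (cinner x y)"
  using norm_add_sq[of x "- y"] by (simp add: cinner_minus_right)

lemma cmod_cinner_le: "cmod (cinner x y) \<le> norm x * norm (y::'a::complex_hilbert)"
proof (cases "y = 0")
  case False
  define t where "t = cinner y x / of_real ((norm y)\<^sup>2)"
  have ny: "(norm y)\<^sup>2 > 0" using False by simp
  have *: "cnj t * cinner y x = of_real ((cmod (cinner y x))\<^sup>2 / (norm y)\<^sup>2)"
    unfolding t_def complex_cnj_divide complex_cnj_complex_of_real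
    by (simp only: of_real_divide complex_norm_square) (simp add: mult.commute)
  have "Re (cinner x (t *\<^sub>C y)) = Re (cnj t * cinner y x)"
    by (metis cinner_commute cinner_scaleC_left complex_cnj_cnj cnj.sel(1))
  then have "0 \<le> (norm x)\<^sup>2 + (norm (t *\<^sub>C y))\<^sup>2 - 2 * ((cmod (cinner y x))\<^sup>2 / (norm y)\<^sup>2)"
    using norm_diff_sq[of x "t *\<^sub>C y"] * by (metis zero_le_power2 Re_complex_of_real)
  moreover have "(norm (t *\<^sub>C y))\<^sup>2 = (cmod (cinner y x))\<^sup>2 / (norm y)\<^sup>2"
  proof -
    have "cmod t = cmod (cinner y x) / (norm y)\<^sup>2" by (simp add: t_def norm_divide norm_power)
    then show ?thesis using ny by (simp add: norm_scaleC power_mult_distrib power_divide power2_eq_square)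
  qed
  ultimately have "(cmod (cinner y x))\<^sup>2 / (norm y)\<^sup>2 \<le> (norm x)\<^sup>2" by linarith
  then have "(cmod (cinner y x))\<^sup>2 \<le> (norm x * norm y)\<^sup>2"
    using ny by (simp add: field_simps power_mult_distrib)
  then have "cmod (cinner y x) \<le> norm x * norm y" by (rule power2_le_imp_le) simp
  moreover have "cmod (cinner x y) = cmod (cinner y x)"
    by (metis cinner_commute complex_mod_cnj)
  ultimately show ?thesis by simp
qed simp

lemma bounded_linear_cinner_right: "bounded_linear (\<lambda>y. cinner x (y::'a::complex_hilbert))"
proof (rule bounded_linear_intro[where K = "norm x"])
  show "cinner x (r *\<^sub>R y) = r *\<^sub>R cinner x y" for r y
    using cinner_scaleC_right[of x "of_real r" y] by (simp add: scaleC_of_real scaleR_conv_of_real)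
  show "norm (cinner x y) \<le> norm y * norm x" for y
    using cmod_cinner_le[of x y] by (simp add: mult.commute)
qed (rule cinner_add_right)

lemma norm_add_sq_orthogonal:
  assumes "cinner x y = 0" shows "(norm (x + y))\<^sup>2 = (norm x)\<^sup>2 + (norm (y::'a::complex_hilbert))\<^sup>2"
  using norm_add_sq[of x y] assms by simp

lemma norm_sum_sq_orthogonal:
  assumes "finite F" "\<And>i j. i \<in> F \<Longrightarrow> j \<in> F \<Longrightarrow> i \<noteq> j \<Longrightarrow> cinner (f i) (f j) = 0"
  shows "(norm (\<Sum>i\<in>F. f i))\<^sup>2 = (\<Sum>i\<in>F. (norm (f i :: 'a::complex_hilbert))\<^sup>2)"
  using assms
proof (induction F rule: finite_induct)
  case (insert a F)
  have "cinner (f a) (\<Sum>i\<in>F. f i) = 0"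
    unfolding cinner_sum_right using insert by (intro sum.neutral) auto
  then show ?case using insert by (simp add: norm_add_sq_orthogonal)
qed simp

section \<open>Families of vectors, domination and positive kernels\<close>

definition comb :: "'i set \<Rightarrow> ('i \<Rightarrow> complex) \<Rightarrow> ('i \<Rightarrow> 'a::complex_hilbert) \<Rightarrow> 'a" where
  "comb F c u = (\<Sum>x\<in>F. c x *\<^sub>C u x)"

text \<open>Equivalently, \<open>v x\<close> goes to \<open>u x\<close> under a linear contraction
  of the spans (\<open>transfer_map\<close>). Norms of combinations express this without an operator
  and allow \<open>u\<close> and \<open>v\<close> to live in different spaces.\<close>

definition sdom :: "('i \<Rightarrow> 'a::complex_hilbert) \<Rightarrow> ('i \<Rightarrow> 'b::complex_hilbert) \<Rightarrow> bool" where
  "sdom u v \<longleftrightarrow> (\<forall>F c. finite F \<longrightarrow> norm (comb F c u) \<le> norm (comb F c v))"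

definition gram :: "('i \<Rightarrow> 'a::complex_hilbert) \<Rightarrow> 'i \<Rightarrow> 'i \<Rightarrow> complex" where
  "gram u x y = cinner (u x) (u y)"

definition qf :: "('i \<Rightarrow> 'i \<Rightarrow> complex) \<Rightarrow> 'i set \<Rightarrow> ('i \<Rightarrow> complex) \<Rightarrow> complex" where
  "qf k F c = (\<Sum>x\<in>F. \<Sum>y\<in>F. cnj (c x) * c y * k x y)"

text \<open>Only the real part of the form is required to be nonnegative, so Hermitian symmetry is a
  separate clause.\<close>

definition psd :: "('i \<Rightarrow> 'i \<Rightarrow> complex) \<Rightarrow> bool" where
  "psd k \<longleftrightarrow> (\<forall>x y. k x y = cnj (k y x)) \<and> (\<forall>F c. finite F \<longrightarrow> 0 \<le> Re (qf k F c))"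

lemma psdI:
  assumes "\<And>x y. k x y = cnj (k y x)" "\<And>F c. finite F \<Longrightarrow> 0 \<le> Re (qf k F c)"
  shows "psd k"
  unfolding psd_def using assms by blast

lemma psd_hermitian: "psd k \<Longrightarrow> k x y = cnj (k y x)"
  unfolding psd_def by blast

lemma psd_qf: "psd k \<Longrightarrow> finite F \<Longrightarrow> 0 \<le> Re (qf k F c)"
  unfolding psd_def by blast

lemma qf_gram: "qf (gram u) F c = complex_of_real ((norm (comb F c u))\<^sup>2)"
proof -
  have "cinner (comb F c u) (comb F c u) = qf (gram u) F c"
    unfolding comb_def qf_def gram_def
    by (subst cinner_sum_left, subst cinner_sum_right)
       (simp add: cinner_scaleC_left cinner_scaleC_right mult_ac)
  then show ?thesis by (simp add: cinner_self)
qed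

lemma psd_gram: "psd (gram u)"
  by (rule psdI) (simp_all add: qf_gram gram_def cnj_cinner)

lemma qf_diff: "qf (\<lambda>x y. k x y - l x y) F c = qf k F c - qf l F c"
  by (simp add: qf_def algebra_simps sum_subtractf)

lemma qf_add: "qf (\<lambda>x y. k x y + l x y) F c = qf k F c + qf l F c"
  by (simp add: qf_def algebra_simps sum.distrib)

lemma qf_scale: "qf (\<lambda>x y. a * k x y) F c = a * qf k F c"
  by (simp add: qf_def sum_distrib_left algebra_simps)

lemma psd_add: "psd k \<Longrightarrow> psd l \<Longrightarrow> psd (\<lambda>x y. k x y + l x y)"
  by (rule psdI) (auto simp: qf_add psd_qf intro: arg_cong2[where f = "(+)"] psd_hermitian)

lemma psd_scale: "0 \<le> a \<Longrightarrow> psd k \<Longrightarrow> psd (\<lambda>x y. complex_of_real a * k x y)"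
  by (rule psdI) (auto simp: qf_scale psd_qf intro: psd_hermitian)

lemma comb_norm_eq_gram: "gram u = gram v \<Longrightarrow> norm (comb F c u) = norm (comb F c v)"
  using qf_gram[of u F c] qf_gram[of v F c] by (simp del: of_real_power)

text \<open>By \<open>qf_gram\<close> the form of the difference is the difference of the squared
  norms. Domination thereby becomes positivity of a kernel, which is stable under sums, pullbacks,
  weights and passage to blocks, and which depends on the Gram matrices alone.\<close>

lemma psd_diff_iff_sdom: "psd (\<lambda>x y. gram v x y - gram u x y) \<longleftrightarrow> sdom u v"
proof -
  have "gram v x y - gram u x y = cnj (gram v y x - gram u y x)" for x y
    by (simp add: gram_def cnj_cinner)
  then show ?thesis unfolding psd_def sdom_def qf_diff qf_gram by simp
qed

lemma comb_reindex: "finite F \<Longrightarrow>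
  (\<Sum>k\<in>F. c k *\<^sub>C u (g k)) = comb (g ` F) (\<lambda>x. \<Sum>k | k \<in> F \<and> g k = x. c k) u"
proof -
  assume F: "finite F"
  have "(\<Sum>k\<in>F. c k *\<^sub>C u (g k)) = (\<Sum>x\<in>g ` F. \<Sum>k | k \<in> F \<and> g k = x. c k *\<^sub>C u (g k))"
    using F by (intro sum.image_gen)
  also have "\<dots> = comb (g ` F) (\<lambda>x. \<Sum>k | k \<in> F \<and> g k = x. c k) u"
    unfolding comb_def by (intro sum.cong refl) (simp add: scaleC_sum_left)
  finally show ?thesis .
qed

lemma comb_comp: "comb F c (\<lambda>k. u (g k)) = (\<Sum>k\<in>F. c k *\<^sub>C u (g k))"
  by (simp add: comb_def)

lemma sdom_comp:
  fixes g :: "'k \<Rightarrow> 'i"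
  assumes "sdom u v" shows "sdom (\<lambda>k. u (g k)) (\<lambda>k. v (g k))"
  unfolding sdom_def
proof (intro allI impI)
  fix F :: "'k set" and c assume F: "finite F"
  show "norm (comb F c (\<lambda>k. u (g k))) \<le> norm (comb F c (\<lambda>k. v (g k)))"
    unfolding comb_comp comb_reindex[OF F] using assms F by (auto simp: sdom_def)
qed

lemma sdom_trans: "sdom u v \<Longrightarrow> sdom v w \<Longrightarrow> sdom u w"
  unfolding sdom_def by (meson order_trans)

lemma sdom_gram_cong: "gram u = gram u' \<Longrightarrow> gram v = gram v' \<Longrightarrow> sdom u v \<longleftrightarrow> sdom u' v'"
  by (simp flip: psd_diff_iff_sdom)

text \<open>The map \<open>g\<close> may identify indices: coefficients over the same fibre are
  added, and the form of the pullback is the form of \<open>k\<close> at these sums.\<close>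

lemma psd_comp:
  assumes "psd k" shows "psd (\<lambda>x y. k (g x) (g y))"
proof -
  have "0 \<le> Re (qf (\<lambda>x y. k (g x) (g y)) F c)" if F: "finite F" for F c
  proof -
    define d where "d = (\<lambda>x. \<Sum>k | k \<in> F \<and> g k = x. c k)"
    have 1: "(\<Sum>y\<in>F. c y * f (g y)) = (\<Sum>y\<in>g`F. d y * f y)" for f :: "_ \<Rightarrow> complex"
    proof -
      have "(\<Sum>y\<in>F. c y * f (g y)) = (\<Sum>x\<in>g ` F. \<Sum>k | k \<in> F \<and> g k = x. c k * f (g k))"
        using F by (intro sum.image_gen)
      also have "\<dots> = (\<Sum>y\<in>g`F. d y * f y)"
        by (intro sum.cong refl) (simp add: d_def sum_distrib_right)
      finally show ?thesis .
    qed
    have 2: "(\<Sum>y\<in>F. cnj (c y) * f (g y)) = (\<Sum>y\<in>g`F. cnj (d y) * f y)" for f :: "_ \<Rightarrow> complex"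
      using arg_cong[OF 1[of "\<lambda>y. cnj (f y)"], of cnj] by (simp add: cnj_sum)
    have "qf (\<lambda>x y. k (g x) (g y)) F c = (\<Sum>x\<in>F. cnj (c x) * (\<Sum>y\<in>F. c y * k (g x) (g y)))"
      by (simp add: qf_def sum_distrib_left mult.assoc)
    also have "\<dots> = (\<Sum>x\<in>F. cnj (c x) * (\<Sum>y\<in>g`F. d y * k (g x) y))"
      by (simp add: 1)
    also have "\<dots> = (\<Sum>x\<in>g`F. cnj (d x) * (\<Sum>y\<in>g`F. d y * k x y))"
      using 2[of "\<lambda>x. (\<Sum>y\<in>g`F. d y * k x y)"] by simp
    also have "\<dots> = qf k (g`F) d"
      by (simp add: qf_def sum_distrib_left mult.assoc)
    finally show ?thesis using assms F by (simp add: psd_qf)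
  qed
  then show ?thesis by (intro psdI psd_hermitian[OF assms])
qed

lemma psd_rank_one: "psd (\<lambda>x y. cnj (w x) * w y)"
proof -
  have "qf (\<lambda>x y. cnj (w x) * w y) F c = cnj (\<Sum>x\<in>F. c x * w x) * (\<Sum>x\<in>F. c x * w x)" for F c
    unfolding qf_def cnj_sum sum_product
    by (simp add: mult_ac)
  then show ?thesis
    by (intro psdI)
       (simp_all add: mult.commute[of "cnj _"] complex_norm_square[symmetric] del: of_real_power cnj_sum)
qed

text \<open>Pinching to the block diagonal: the form splits into the sum of the forms over the
  fibres of \<kappa>.\<close>

lemma psd_block:
  assumes "psd k" shows "psd (\<lambda>x y. if \<kappa> x = \<kappa> y then k x y else 0)"
proof -
  have "0 \<le> Re (qf (\<lambda>x y. if \<kappa> x = \<kappa> y then k x y else 0) F c)" if F: "finite F" for F c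
  proof -
    have "qf (\<lambda>x y. if \<kappa> x = \<kappa> y then k x y else 0) F c
        = (\<Sum>x\<in>F. \<Sum>y\<in>{y\<in>F. \<kappa> y = \<kappa> x}. cnj (c x) * c y * k x y)"
      unfolding qf_def using F
      by (intro sum.cong refl sum.mono_neutral_cong_right) auto
    also have "\<dots> = (\<Sum>z\<in>\<kappa>`F. \<Sum>x\<in>{x\<in>F. \<kappa> x = z}. \<Sum>y\<in>{y\<in>F. \<kappa> y = \<kappa> x}. cnj (c x) * c y * k x y)"
      using F by (rule sum.image_gen)
    also have "\<dots> = (\<Sum>z\<in>\<kappa>`F. qf k {x\<in>F. \<kappa> x = z} c)"
      unfolding qf_def by (intro sum.cong refl) auto
    finally show ?thesis using F by (auto intro!: sum_nonneg psd_qf[OF assms])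
  qed
  then show ?thesis by (intro psdI) (auto intro: psd_hermitian[OF assms])
qed

lemma comb_add:
  assumes "finite F" "finite G"
  shows "comb F c u + comb G d u
    = comb (F \<union> G) (\<lambda>x. (if x \<in> F then c x else 0) + (if x \<in> G then d x else 0)) u"
proof -
  have "comb F c u = comb (F \<union> G) (\<lambda>x. if x \<in> F then c x else 0) u"
    unfolding comb_def using assms by (intro sum.mono_neutral_cong_left) auto
  moreover have "comb G d u = comb (F \<union> G) (\<lambda>x. if x \<in> G then d x else 0) u"
    unfolding comb_def using assms by (intro sum.mono_neutral_cong_left) auto
  ultimately show ?thesis by (simp only: comb_def scaleC_add_left sum.distrib)
qed

lemma comb_scale: "a *\<^sub>C comb F c u = comb F (\<lambda>x. a * c x) u"
  by (simp add: comb_def scaleC_sum_right scaleC_scaleC)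

lemma comb_scale_fam: "comb F c (\<lambda>x. a *\<^sub>C u x) = a *\<^sub>C comb F c u"
  by (simp add: comb_def scaleC_sum_right scaleC_scaleC mult.commute)

lemma comb_singleton: "comb {x} c u = c x *\<^sub>C u x"
  by (simp add: comb_def)

section \<open>Spans, and the linear map induced by a domination\<close>

definition cspan :: "('i \<Rightarrow> 'a::complex_hilbert) \<Rightarrow> 'a set" where
  "cspan u = {comb F c u | F c. finite F}"

lemma cspanI: "finite F \<Longrightarrow> comb F c u \<in> cspan u"
  by (auto simp: cspan_def)

lemma cspan_base: "u x \<in> cspan u"
  using cspanI[of "{x}" "\<lambda>_. 1" u] by (simp add: comb_singleton)

lemma cspan_add: "v \<in> cspan u \<Longrightarrow> w \<in> cspan u \<Longrightarrow> v + w \<in> cspan u"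
  unfolding cspan_def by (auto simp: comb_add) blast

lemma cspan_scale: "v \<in> cspan u \<Longrightarrow> a *\<^sub>C v \<in> cspan u"
  by (auto simp: cspan_def comb_scale) (use cspanI cspan_def in blast)

lemma cspan_zero: "0 \<in> cspan u"
  using cspanI[of "{}" "\<lambda>_. 0" u] by (simp add: comb_def)

lemma cspan_sum: "(\<And>i. i \<in> F \<Longrightarrow> f i \<in> cspan u) \<Longrightarrow> sum f F \<in> cspan u"
  by (induction F rule: infinite_finite_induct) (auto intro: cspan_zero cspan_add)

text \<open>The choice does not depend on the representation of \<open>x\<close> when \<open>u\<close> is dominated by \<open>v\<close>.\<close>

definition transfer_map :: "('i \<Rightarrow> 'a::complex_hilbert) \<Rightarrow> ('i \<Rightarrow> 'b::complex_hilbert) \<Rightarrow> 'a \<Rightarrow> 'b" where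
  "transfer_map v u x = (SOME y. \<exists>F c. finite F \<and> x = comb F c v \<and> y = comb F c u)"

text \<open>The difference of two representations is a combination that vanishes in
  \<open>v\<close>, hence also in \<open>u\<close>.\<close>

lemma sdom_transfer_eq:
  assumes "sdom u v" "finite F" "finite G" "comb F c v = comb G d v"
  shows "comb F c u = comb G d u"
proof -
  let ?e = "\<lambda>x. (if x \<in> F then c x else 0) + (if x \<in> G then - d x else 0)"
  have *: "comb F c w - comb G d w = comb (F \<union> G) ?e w" for w :: "'a \<Rightarrow> 'x::complex_hilbert"
    unfolding comb_add[OF assms(2,3), symmetric]
    by (simp add: comb_def scaleC_minus_left sum_negf)
  have "norm (comb (F \<union> G) ?e u) \<le> norm (comb (F \<union> G) ?e v)"
    using assms(1-3) by (simp add: sdom_def)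
  then have "comb F c u - comb G d u = 0" using *[of u] *[of v] assms(4) by simp
  then show ?thesis by simp
qed

lemma transfer_comb:
  assumes "sdom u v" "finite F" shows "transfer_map v u (comb F c v) = comb F c u"
  unfolding transfer_map_def using assms
  by (intro some_equality) (auto intro: sdom_transfer_eq)

lemma transfer_base: "sdom u v \<Longrightarrow> transfer_map v u (v x) = u x"
  using transfer_comb[of u v "{x}" "\<lambda>_. 1"] by (simp add: comb_singleton)

lemma transfer_add:
  "sdom u v \<Longrightarrow> x \<in> cspan v \<Longrightarrow> y \<in> cspan v \<Longrightarrow>
    transfer_map v u (x + y) = transfer_map v u x + transfer_map v u y"
  unfolding cspan_def by (auto simp: comb_add transfer_comb)

lemma transfer_scale:
  "sdom u v \<Longrightarrow> x \<in> cspan v \<Longrightarrow> transfer_map v u (a *\<^sub>C x) = a *\<^sub>C transfer_map v u x"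
  unfolding cspan_def by (auto simp: comb_scale transfer_comb)

lemma transfer_zero: "sdom u v \<Longrightarrow> transfer_map v u 0 = 0"
  using transfer_comb[of u v "{}"] by (simp add: comb_def)

lemma transfer_sum:
  assumes "sdom u v" "\<And>i. i \<in> F \<Longrightarrow> f i \<in> cspan v"
  shows "transfer_map v u (sum f F) = (\<Sum>i\<in>F. transfer_map v u (f i))"
  using assms(2)
  by (induction F rule: infinite_finite_induct)
     (auto simp: transfer_zero[OF assms(1)] transfer_add[OF assms(1)] cspan_sum)

lemma transfer_in_cspan: "sdom u v \<Longrightarrow> x \<in> cspan v \<Longrightarrow> transfer_map v u x \<in> cspan u"
  by (auto simp: cspan_def[of v] transfer_comb intro: cspanI)

lemma norm_transfer: "sdom u v \<Longrightarrow> x \<in> cspan v \<Longrightarrow> norm (transfer_map v u x) \<le> norm x"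
  unfolding cspan_def by (auto simp: transfer_comb) (auto simp: sdom_def)

section \<open>The standard basis of \<open>ell2\<close>\<close>

lift_definition ell2_unit :: "nat \<Rightarrow> ell2" is "\<lambda>n k. if k = n then 1 else 0"
proof -
  fix n :: nat
  have "(\<lambda>k. (cmod (if k = n then 1 else 0))\<^sup>2) = (\<lambda>k. if k = n then 1 else 0)" by auto
  then show "summable (\<lambda>k. (cmod (if k = n then 1 else 0))\<^sup>2)" by simp
qed

lemma ell2_nth_sum: "ell2_nth (sum f F) n = (\<Sum>i\<in>F. ell2_nth (f i) n)"
  by (induction F rule: infinite_finite_induct) (simp_all add: zero_ell2.rep_eq plus_ell2.rep_eq)

lemma ell2_nth_comb: "ell2_nth (comb F c u) n = (\<Sum>x\<in>F. c x * ell2_nth (u x) n)"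
  by (simp add: comb_def ell2_nth_sum scaleC_ell2.rep_eq)

lemma ell2_nth_comb_unit:
  "finite F \<Longrightarrow> ell2_nth (comb F c ell2_unit) n = (if n \<in> F then c n else 0)"
  by (simp add: ell2_nth_comb ell2_unit.rep_eq if_distrib[of "\<lambda>z. _ * z"] sum.delta cong: if_cong)

lemma cinner_ell2_unit: "cinner (ell2_unit n) x = ell2_nth x n"
proof -
  have "(\<Sum>k. cnj (if k = n then 1 else 0) * ell2_nth x k) = (\<Sum>k\<in>{n}. cnj (if k = n then 1 else 0) * ell2_nth x k)"
    by (rule suminf_finite) auto
  then show ?thesis by (simp add: cinner_ell2.rep_eq ell2_unit.rep_eq)
qed

lemma cinner_comb_unit:
  "cinner (comb F c ell2_unit) x = (\<Sum>n\<in>F. cnj (c n) * ell2_nth x n)"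
  by (simp add: comb_def cinner_sum_left cinner_scaleC_left cinner_ell2_unit)

lemma norm_ell2_unit [simp]: "norm (ell2_unit n) = 1"
  using norm_sq_cinner[of "ell2_unit n"]
  by (simp add: cinner_ell2_unit ell2_unit.rep_eq power2_eq_1_iff)
     (metis norm_not_less_zero zero_less_one neg_less_0_iff_less)

lemma norm_comb_unit_sq:
  assumes "finite F" shows "(norm (comb F c ell2_unit))\<^sup>2 = (\<Sum>n\<in>F. (cmod (c n))\<^sup>2)"
proof -
  have "(norm (comb F c ell2_unit))\<^sup>2 = (\<Sum>n\<in>F. (norm (c n *\<^sub>C ell2_unit n))\<^sup>2)"
    unfolding comb_def using assms
    by (intro norm_sum_sq_orthogonal)
       (auto simp: cinner_scaleC_left cinner_scaleC_right cinner_ell2_unit ell2_unit.rep_eq)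
  then show ?thesis by (simp add: norm_scaleC)
qed

section \<open>Positive kernels are Gram matrices\<close>

lemma psd_diag_nonneg: assumes "psd k" shows "0 \<le> Re (k x x)" "Im (k x x) = 0"
proof -
  have "0 \<le> Re (qf k {x} (\<lambda>_. 1))" using assms psd_qf by blast
  then show "0 \<le> Re (k x x)" by (simp add: qf_def)
  have "k x x = cnj (k x x)" by (rule psd_hermitian[OF assms])
  then show "Im (k x x) = 0" by (metis cnj.sel(2) equal_neg_zero)
qed

text \<open>Evaluating the form at \<open>c + \<alpha> \<delta>\<^sub>a\<close>; the optimal \<open>\<alpha>\<close> gives the Schur complement.\<close>

lemma qf_update:
  assumes "psd k" "finite F"
  shows "0 \<le> Re (qf k F c) + 2 * Re (cnj \<alpha> * (\<Sum>y\<in>F. c y * k a y)) + (cmod \<alpha>)\<^sup>2 * Re (k a a)"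
proof -
  define F' where "F' = insert a F"
  define c0 where "c0 = (\<lambda>x. if x \<in> F then c x else 0)"
  define c' where "c' = (\<lambda>x. c0 x + (if x = a then \<alpha> else 0))"
  have fin: "finite F'" "a \<in> F'" using assms by (auto simp: F'_def)
  have ext: "(\<Sum>y\<in>F. c y * f y) = (\<Sum>y\<in>F'. c0 y * f y)" for f
    unfolding F'_def c0_def using assms by (intro sum.mono_neutral_cong_left) auto
  have extc: "(\<Sum>y\<in>F. cnj (c y) * f y) = (\<Sum>y\<in>F'. cnj (c0 y) * f y)" for f
    unfolding F'_def c0_def using assms by (intro sum.mono_neutral_cong_left) auto
  have upd: "(\<Sum>y\<in>F'. c' y * f y) = (\<Sum>y\<in>F. c y * f y) + \<alpha> * f a" for f
    unfolding ext c'_def using fin by (simp add: distrib_right sum.distrib if_distrib[of "\<lambda>z. z * _"] sum.delta cong: if_cong)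
  have updc: "(\<Sum>y\<in>F'. cnj (c' y) * f y) = (\<Sum>y\<in>F. cnj (c y) * f y) + cnj \<alpha> * f a" for f
    unfolding extc c'_def using fin by (simp add: distrib_right sum.distrib if_distrib[of "\<lambda>z. z * _"] if_distrib[of cnj] sum.delta cong: if_cong)
  let ?s = "\<Sum>y\<in>F. c y * k a y"
  have herm: "k x y = cnj (k y x)" for x y by (rule psd_hermitian[OF assms(1)])
  have "(\<Sum>x\<in>F. cnj (c x) * (\<alpha> * k x a)) = \<alpha> * cnj ?s"
    unfolding sum_distrib_left cnj_sum by (intro sum.cong refl) (subst herm, simp)
  then have "qf k F' c' = qf k F c + \<alpha> * cnj ?s + cnj \<alpha> * ?s + cnj \<alpha> * \<alpha> * k a a"
    unfolding qf_def mult.assoc sum_distrib_left[symmetric] upd updc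
    by (simp add: distrib_left sum.distrib)
  moreover have "Re (\<alpha> * cnj ?s) = Re (cnj \<alpha> * ?s)"
    by (metis cnj.sel(1) complex_cnj_cnj complex_cnj_mult)
  moreover have "Re (cnj \<alpha> * \<alpha> * k a a) = (cmod \<alpha>)\<^sup>2 * Re (k a a)"
    using psd_diag_nonneg(2)[OF assms(1), of a]
    by (simp add: mult.commute[of "cnj \<alpha>"] flip: complex_norm_square)
  moreover have "0 \<le> Re (qf k F' c')" using assms fin psd_qf by blast
  ultimately show ?thesis by (simp only: plus_complex.sel)
qed

lemma psd_zero_diag:
  assumes "psd k" "k a a = 0" shows "k a y = 0"
proof (rule ccontr)
  assume ne: "k a y \<noteq> 0"
  \<comment> \<open>With \<open>k a a = 0\<close> the quadratic term of \<open>qf_update\<close>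
    disappears and the linear one is unbounded. This multiple makes the value
    \<open>k y y - 2 (k y y + 1)\<close>, which is negative.\<close>
  define t where "t = (Re (k y y) + 1) / (cmod (k a y))\<^sup>2"
  have "0 \<le> Re (qf k {y} (\<lambda>_. 1)) + 2 * Re (cnj (- of_real t * k a y) * k a y)"
    using qf_update[OF assms(1), of "{y}" "\<lambda>_. 1" "- of_real t * k a y" a] assms(2) by simp
  also have "cnj (- of_real t * k a y) * k a y = - of_real (t * (cmod (k a y))\<^sup>2)"
    by (simp only: of_real_mult complex_norm_square) simp
  also have "t * (cmod (k a y))\<^sup>2 = Re (k y y) + 1" using ne by (simp add: t_def)
  finally show False using psd_diag_nonneg(1)[OF assms(1), of y] by (simp add: qf_def)
qed

lemma psd_schur_step:
  assumes "psd k" shows "psd (\<lambda>x y. k x y - k x a * k a y / k a a)"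
proof -
  have herm: "k x y = cnj (k y x)" for x y by (rule psd_hermitian[OF assms])
  have kaa: "k a a = of_real (Re (k a a))"
    using psd_diag_nonneg(2)[OF assms, of a] by (simp add: complex_eq_iff)
  have "0 \<le> Re (qf (\<lambda>x y. k x y - k x a * k a y / k a a) F c)" if F: "finite F" for F c
  proof (cases "k a a = 0")
    \<comment> \<open>Division by zero yields 0, so nothing is subtracted and the kernel is
      unchanged.\<close>
    case True
    then show ?thesis using assms F by (simp add: psd_qf)
  next
    case False
    let ?s = "\<Sum>y\<in>F. c y * k a y"
    define q where "q = Re (k a a)"
    have q: "k a a = of_real q" "q \<noteq> 0" using kaa False by (auto simp: q_def)
    have "(\<Sum>x\<in>F. cnj (c x) * k x a) = cnj ?s"
      unfolding cnj_sum by (intro sum.cong refl) (subst herm, simp)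
    moreover have "qf (\<lambda>x y. k x a * k a y / k a a) F c = (\<Sum>x\<in>F. cnj (c x) * k x a) * ?s / k a a"
      unfolding qf_def sum_product sum_divide_distrib by (simp add: mult_ac)
    ultimately have "qf (\<lambda>x y. k x a * k a y / k a a) F c = cnj ?s * ?s / k a a" by simp
    also have "\<dots> = of_real ((cmod ?s)\<^sup>2 / q)"
      by (simp only: q(1) of_real_divide complex_norm_square) simp
    finally have "Re (qf (\<lambda>x y. k x y - k x a * k a y / k a a) F c) = Re (qf k F c) - (cmod ?s)\<^sup>2 / q"
      by (simp add: qf_diff)
    moreover have "cnj (- ?s / k a a) * ?s = - of_real ((cmod ?s)\<^sup>2 / q)"
      unfolding q(1) complex_cnj_divide complex_cnj_complex_of_real
      by (simp only: of_real_divide complex_norm_square) simp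
    moreover have "(cmod (- ?s / k a a))\<^sup>2 * Re (k a a) = (cmod ?s)\<^sup>2 / q"
      using q by (simp add: norm_divide power_divide power2_eq_square)
    moreover note qf_update[OF assms F, of c "- ?s / k a a" a]
    ultimately show ?thesis by simp
  qed
  moreover have "k x y - k x a * k a y / k a a = cnj (k y x - k y a * k a x / k a a)" for x y
    using herm[of x y] herm[of x a] herm[of a y] herm[of a a] by (simp add: mult.commute)
  ultimately show ?thesis by (intro psdI)
qed

text \<open>Gaussian elimination with the pivots 0, 1, 2, ... in this order; a vanishing pivot
  subtracts nothing, because \<open>x / 0 = 0\<close>.\<close>

fun schur :: "(nat \<Rightarrow> nat \<Rightarrow> complex) \<Rightarrow> nat \<Rightarrow> nat \<Rightarrow> nat \<Rightarrow> complex" where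
  "schur k 0 x y = k x y"
| "schur k (Suc n) x y = schur k n x y - schur k n x n * schur k n n y / schur k n n n"

lemma psd_schur: "psd k \<Longrightarrow> psd (schur k n)"
proof (induction n)
  case 0
  moreover have "schur k 0 = k" by (intro ext) simp
  ultimately show ?case by simp
next
  case (Suc n)
  moreover have "schur k (Suc n) = (\<lambda>x y. schur k n x y - schur k n x n * schur k n n y / schur k n n n)"
    by (intro ext) simp
  ultimately show ?case using psd_schur_step[of "schur k n" n] by simp
qed

text \<open>A nonzero pivot cancels its own row; for a zero pivot the row vanishes already, by
  \<open>psd_zero_diag\<close>. Later steps keep these zeros.\<close>

lemma schur_eq_0:
  assumes "psd k" "x < n" shows "schur k n x y = 0" "schur k n y x = 0"
proof -
  have *: "schur k n x y = 0" for y using assms(2)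
  proof (induction n arbitrary: y)
    case (Suc n)
    show ?case
    proof (cases "x = n")
      case True
      then show ?thesis using psd_zero_diag[OF psd_schur[OF assms(1), of n], of n y]
        by (cases "schur k n n n = 0") auto
    next
      case False
      then show ?thesis using Suc by (auto simp: less_Suc_eq)
    qed
  qed simp
  show "schur k n x y = 0" by (rule *)
  have "schur k n y x = cnj (schur k n x y)" using psd_schur[OF assms(1), of n] by (rule psd_hermitian)
  then show "schur k n y x = 0" using * by simp
qed

text \<open>Row \<open>n\<close> of the triangular Cholesky factor; it is zero when the pivot
  is.\<close>

definition chol :: "(nat \<Rightarrow> nat \<Rightarrow> complex) \<Rightarrow> nat \<Rightarrow> nat \<Rightarrow> complex" where
  "chol k n x = schur k n n x / of_real (sqrt (Re (schur k n n n)))"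

lemma schur_Suc_chol:
  assumes "psd k"
  shows "schur k (Suc n) x y = schur k n x y - cnj (chol k n x) * chol k n y"
proof -
  note p = psd_schur[OF assms, of n]
  have "schur k n n n = of_real (sqrt (Re (schur k n n n))) * of_real (sqrt (Re (schur k n n n)))"
    using psd_diag_nonneg[OF p, of n] by (simp add: complex_eq_iff flip: of_real_mult)
  moreover have "schur k n x n = cnj (schur k n n x)" using p by (rule psd_hermitian)
  ultimately show ?thesis by (simp add: chol_def)
qed

lemma chol_sum:
  assumes "psd k" shows "k x y = schur k N x y + (\<Sum>n<N. cnj (chol k n x) * chol k n y)"
  by (induction N) (simp_all add: schur_Suc_chol[OF assms] del: schur.simps(2))

text \<open>The coordinates of \<open>\<beta> x\<close> are a column of the Cholesky factor and
  \<open>S\<close> is the set of nonzero pivots. The additional conclusions say that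
  \<open>\<beta>\<close> and the basis vectors with index in \<open>S\<close> have the same
  algebraic span. This is what later permits an operator to be defined on basis vectors although it
  is prescribed on \<open>\<beta>\<close>.\<close>

lemma kolmogorov_nat:
  assumes "psd k"
  obtains \<beta> :: "nat \<Rightarrow> ell2" and S where "gram \<beta> = k"
    "\<And>x n. n \<notin> S \<Longrightarrow> ell2_nth (\<beta> x) n = 0" "\<And>n. n \<in> S \<Longrightarrow> ell2_unit n \<in> cspan \<beta>"
    "\<And>x. \<beta> x = comb {..x} (ell2_nth (\<beta> x)) ell2_unit"
proof
  define \<beta> where "\<beta> = (\<lambda>x. comb {..x} (\<lambda>n. chol k n x) ell2_unit)"
  define S where "S = {n. schur k n n n \<noteq> 0}"
  have c0: "chol k n x = 0" if "x < n" for x n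
    using schur_eq_0[OF assms that] by (simp add: chol_def)
  have nth: "ell2_nth (\<beta> x) n = chol k n x" for x n
    unfolding \<beta>_def using c0[of x n] by (auto simp: ell2_nth_comb_unit not_le)
  show "gram \<beta> = k"
  proof (intro ext)
    fix x y
    have "gram \<beta> x y = (\<Sum>n<Suc x. cnj (chol k n x) * chol k n y)"
      by (simp add: gram_def \<beta>_def cinner_comb_unit lessThan_Suc_atMost nth[unfolded \<beta>_def])
    also have "\<dots> = k x y" using chol_sum[OF assms, of x y "Suc x"] schur_eq_0[OF assms, of x "Suc x" y]
      by (simp del: schur.simps(2))
    finally show "gram \<beta> x y = k x y" .
  qed
  show z: "ell2_nth (\<beta> x) n = 0" if "n \<notin> S" for x n
    using that by (simp add: nth S_def chol_def)
  show *: "\<beta> x = comb {..x} (ell2_nth (\<beta> x)) ell2_unit" for x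
  proof -
    have "ell2_nth (\<beta> x) = (\<lambda>n. chol k n x)" by (intro ext nth)
    then show ?thesis by (simp only: \<beta>_def)
  qed
  show "ell2_unit n \<in> cspan \<beta>" if "n \<in> S" for n
    using that
  \<comment> \<open>Back substitution: \<open>\<beta> n\<close> has no coordinate beyond
    \<open>n\<close>, its \<open>n\<close>-th coordinate is nonzero, and its earlier basis vectors
    are in the span by induction.\<close>
  proof (induction n rule: less_induct)
    case (less n)
    have "ell2_nth (\<beta> n) m *\<^sub>C ell2_unit m \<in> cspan \<beta>" if "m < n" for m
      using less.IH[OF that] z[of m n] by (cases "m \<in> S") (auto intro: cspan_scale cspan_zero)
    then have s: "(\<Sum>m<n. ell2_nth (\<beta> n) m *\<^sub>C ell2_unit m) \<in> cspan \<beta>" by (intro cspan_sum) auto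
    have "\<beta> n = (\<Sum>m<n. ell2_nth (\<beta> n) m *\<^sub>C ell2_unit m) + ell2_nth (\<beta> n) n *\<^sub>C ell2_unit n"
      by (subst *) (simp add: comb_def flip: lessThan_Suc_atMost)
    moreover have "ell2_nth (\<beta> n) n \<noteq> 0"
    proof -
      have "Re (schur k n n n) \<noteq> 0" using less.prems psd_diag_nonneg(2)[OF psd_schur[OF assms], of n n]
        by (auto simp: S_def complex_eq_iff)
      then show ?thesis using less.prems by (simp add: nth chol_def S_def)
    qed
    moreover have "e = inverse b *\<^sub>C (w + (-1) *\<^sub>C v)" if "w = v + b *\<^sub>C e" "b \<noteq> 0" for b and e v w :: ell2
      using that by (simp add: scaleC_minus_left scaleC_scaleC)
    ultimately have "ell2_unit n = inverse (ell2_nth (\<beta> n) n) *\<^sub>C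
        (\<beta> n + (-1) *\<^sub>C (\<Sum>m<n. ell2_nth (\<beta> n) m *\<^sub>C ell2_unit m))"
      by blast
    also have "\<dots> \<in> cspan \<beta>" by (intro cspan_scale cspan_add cspan_base s)
    finally show ?case .
  qed
qed

lemma kolmogorov:
  fixes k :: "'i::countable \<Rightarrow> 'i \<Rightarrow> complex"
  assumes "psd k"
  obtains \<beta> :: "'i \<Rightarrow> ell2" and S where "gram \<beta> = k"
    "\<And>x n. n \<notin> S \<Longrightarrow> ell2_nth (\<beta> x) n = 0" "\<And>n. n \<in> S \<Longrightarrow> ell2_unit n \<in> cspan \<beta>"
    "\<And>x. \<exists>N. \<beta> x = comb {..N} (ell2_nth (\<beta> x)) ell2_unit"
proof -
  have "psd (\<lambda>m n. k (from_nat m) (from_nat n))" by (rule psd_comp[OF assms])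
  then obtain \<beta> :: "nat \<Rightarrow> ell2" and S where *: "gram \<beta> = (\<lambda>m n. k (from_nat m) (from_nat n))"
    "\<And>x n. n \<notin> S \<Longrightarrow> ell2_nth (\<beta> x) n = 0" "\<And>n. n \<in> S \<Longrightarrow> ell2_unit n \<in> cspan \<beta>"
    "\<And>x. \<beta> x = comb {..x} (ell2_nth (\<beta> x)) ell2_unit"
    using kolmogorov_nat by blast
  \<comment> \<open>Several numbers may decode to the same index. Their vectors have the same inner
    products with all others, so they coincide, and restricting to the codes \<open>to_nat i\<close>
    loses nothing of the span.\<close>
  have "\<beta> m = \<beta> (to_nat (from_nat m :: 'i))" for m
  proof -
    have "cinner (\<beta> m - \<beta> (to_nat (from_nat m :: 'i))) (\<beta> m - \<beta> (to_nat (from_nat m :: 'i))) = 0"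
      using *(1) by (simp add: fun_eq_iff gram_def cinner_diff_left cinner_diff_right)
    then show ?thesis by (simp add: cinner_self)
  qed
  then have eq: "\<beta> = (\<lambda>m. (\<lambda>i::'i. \<beta> (to_nat i)) (from_nat m))" by auto
  have "cspan (\<lambda>m. w (from_nat m)) \<subseteq> cspan w" for w :: "'i \<Rightarrow> ell2"
    by (auto simp: cspan_def[of "\<lambda>m. w (from_nat m)"] comb_comp comb_reindex) (rule cspanI, simp)
  from ord_eq_le_trans[OF arg_cong[OF eq, of cspan] this]
  have sub: "cspan \<beta> \<subseteq> cspan (\<lambda>i::'i. \<beta> (to_nat i))" .
  show ?thesis
  proof (rule that[of "\<lambda>i. \<beta> (to_nat i)" S])
    show "gram (\<lambda>i::'i. \<beta> (to_nat i)) = k" using *(1) by (simp add: fun_eq_iff gram_def)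
    show "\<exists>N. \<beta> (to_nat x) = comb {..N} (ell2_nth (\<beta> (to_nat x))) ell2_unit" for x :: 'i
      using *(4) by blast
  qed (use *(2,3) sub in auto)
qed

section \<open>Operators on \<open>ell2\<close> given by their values on the basis\<close>

lemma ell2_partial_sum_norm:
  "norm (comb {..<N} (ell2_nth x) ell2_unit) \<le> norm x"
proof -
  have "norm (comb {..<N} (ell2_nth x) ell2_unit) = L2_set (\<lambda>n. cmod (ell2_nth x n)) {..<N}"
    unfolding L2_set_def norm_comb_unit_sq[OF finite_lessThan, symmetric] by simp
  then show ?thesis using L2_set_le_norm_ell2 by simp
qed

lemma ell2_operator_extension:
  fixes t :: "nat \<Rightarrow> ell2"
  assumes r: "0 \<le> r" and t: "\<And>N y. norm (comb {..<N} y t) \<le> r * norm (comb {..<N} y ell2_unit)"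
  obtains T where "clinear_op T" "norm T \<le> r" "\<And>n. blinfun_apply T (ell2_unit n) = t n"
    "\<And>x. (\<lambda>n. ell2_nth x n *\<^sub>C t n) sums blinfun_apply T x"
proof -
  have sm: "summable (\<lambda>n. ell2_nth x n *\<^sub>C t n)" for x
    unfolding summable_Cauchy
  proof (intro allI impI)
    fix e :: real assume e: "e > 0"
    \<comment> \<open>The denominator is \<open>r + 1\<close> because \<open>r\<close> may be
      0.\<close>
    have pos: "0 < e / (r + 1)" using e r by (intro divide_pos_pos) auto
    have "summable (\<lambda>n. (cmod (ell2_nth x n))\<^sup>2)" using ell2_nth[of x] by simp
    then obtain N where N: "\<And>m n. m \<ge> N \<Longrightarrow> norm (\<Sum>k=m..<n. (cmod (ell2_nth x k))\<^sup>2) < (e / (r + 1))\<^sup>2"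
      unfolding summable_Cauchy using zero_less_power[OF pos, of 2] by blast
    have "norm (\<Sum>k=m..<n. ell2_nth x k *\<^sub>C t k) < e" if m: "m \<ge> N" for m n
    proof -
      \<comment> \<open>The bound is assumed for initial segments only; zero coefficients below
        \<open>m\<close> turn it into a bound for the block from \<open>m\<close> to
        \<open>n\<close>, which gives the Cauchy criterion.\<close>
      define y where "y = (\<lambda>k. if m \<le> k then ell2_nth x k else 0)"
      have *: "(\<Sum>k=m..<n. ell2_nth x k *\<^sub>C t k) = comb {..<n} y t"
        unfolding comb_def y_def by (intro sum.mono_neutral_cong_left) auto
      have "(norm (comb {..<n} y ell2_unit))\<^sup>2 = (\<Sum>k=m..<n. (cmod (ell2_nth x k))\<^sup>2)"
        unfolding norm_comb_unit_sq[OF finite_lessThan] y_def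
        by (intro sum.mono_neutral_cong_right) auto
      also have "\<dots> < (e / (r + 1))\<^sup>2" using N[OF m, of n] by simp
      finally have 1: "norm (comb {..<n} y ell2_unit) < e / (r + 1)"
        by (rule power2_less_imp_less) (use pos in linarith)
      have "norm (comb {..<n} y t) \<le> r * norm (comb {..<n} y ell2_unit)" by (rule t)
      also have "\<dots> \<le> r * (e / (r + 1))" using 1 r by (intro mult_left_mono) auto
      also have "\<dots> < e" using e r by (simp add: field_simps)
      finally show ?thesis using * by simp
    qed
    then show "\<exists>N. \<forall>m\<ge>N. \<forall>n. norm (\<Sum>k=m..<n. ell2_nth x k *\<^sub>C t k) < e" by blast
  qed
  define f where "f = (\<lambda>x. \<Sum>n. ell2_nth x n *\<^sub>C t n)"
  have fs: "(\<lambda>n. ell2_nth x n *\<^sub>C t n) sums f x" for x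
    unfolding f_def by (rule summable_sums[OF sm])
  have fadd: "f (x + y) = f x + f y" for x y
    using sums_unique2[OF fs[of "x + y"]] sums_add[OF fs[of x] fs[of y]]
    by (simp add: plus_ell2.rep_eq scaleC_add_left)
  have fsc: "f (a *\<^sub>C x) = a *\<^sub>C f x" for a x
    using sums_unique2[OF fs[of "a *\<^sub>C x"]] bounded_linear.sums[OF bounded_linear_scaleC fs[of x], of a]
    by (simp add: scaleC_ell2.rep_eq scaleC_scaleC)
  have fn: "norm (f x) \<le> r * norm x" for x
  proof (rule tendsto_upperbound)
    show "(\<lambda>N. norm (\<Sum>n<N. ell2_nth x n *\<^sub>C t n)) \<longlonglongrightarrow> norm (f x)"
      using fs[of x] unfolding sums_def by (rule tendsto_norm)
    have "norm (\<Sum>n<N. ell2_nth x n *\<^sub>C t n) \<le> r * norm x" for N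
      using t[of N "ell2_nth x"] mult_left_mono[OF ell2_partial_sum_norm r, of N x]
      by (simp add: comb_def)
    then show "\<forall>\<^sub>F N in sequentially. norm (\<Sum>n<N. ell2_nth x n *\<^sub>C t n) \<le> r * norm x" by simp
  qed simp
  have bl: "bounded_linear f"
  proof (rule bounded_linear_intro[where K = r])
    show "f (a *\<^sub>R x) = a *\<^sub>R f x" for a x using fsc[of "of_real a" x] by (simp add: scaleC_of_real)
  qed (use fadd fn in \<open>auto simp: mult.commute\<close>)
  have app: "blinfun_apply (Blinfun f) = f" using bl by (rule bounded_linear_Blinfun_apply)
  show ?thesis
  proof (rule that[of "Blinfun f"])
    show "clinear_op (Blinfun f)" by (simp add: clinear_op_def app fsc)
    show "norm (Blinfun f) \<le> r" using fn r by (intro norm_blinfun_bound) (auto simp: app)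
    show "blinfun_apply (Blinfun f) (ell2_unit n) = t n" for n
    proof -
      have "(\<Sum>k. ell2_nth (ell2_unit n) k *\<^sub>C t k) = (\<Sum>k\<in>{n}. ell2_nth (ell2_unit n) k *\<^sub>C t k)"
        by (rule suminf_finite) (auto simp: ell2_unit.rep_eq)
      then show ?thesis unfolding app by (simp add: f_def ell2_unit.rep_eq)
    qed
  qed (use fs app in auto)
qed

lemma ell2_sums: "(\<lambda>n. ell2_nth x n *\<^sub>C ell2_unit n) sums x"
proof -
  obtain T where T: "\<And>x. (\<lambda>n. ell2_nth x n *\<^sub>C ell2_unit n) sums blinfun_apply T x"
    by (rule ell2_operator_extension[of 1 ell2_unit]) auto
  have "ell2_nth (blinfun_apply T x) k = ell2_nth x k" for k
  proof -
    have "(\<lambda>n. cinner (ell2_unit k) (ell2_nth x n *\<^sub>C ell2_unit n)) sums cinner (ell2_unit k) (blinfun_apply T x)"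
      by (rule bounded_linear.sums[OF bounded_linear_cinner_right T])
    moreover have "(\<lambda>n. cinner (ell2_unit k) (ell2_nth x n *\<^sub>C ell2_unit n)) sums ell2_nth x k"
      using sums_If_finite_set[of "{k}" "\<lambda>_. ell2_nth x k"]
      by (simp add: cinner_ell2_unit scaleC_ell2.rep_eq ell2_unit.rep_eq if_distrib[of "\<lambda>z. _ * z"] eq_commute[of k] cong: if_cong)
    ultimately show ?thesis using sums_unique2 by (force simp: cinner_ell2_unit)
  qed
  then have "blinfun_apply T x = x" by (intro iffD1[OF ell2_nth_inject]) auto
  then show ?thesis using T[of x] by simp
qed

lemma ell2_operator_eqI:
  assumes "clinear_op A" "clinear_op B" "\<And>n. blinfun_apply A (ell2_unit n) = blinfun_apply B (ell2_unit n)"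
  shows "A = B"
proof (rule blinfun_eqI)
  fix x :: ell2
  have "(\<lambda>n. blinfun_apply C (ell2_nth x n *\<^sub>C ell2_unit n)) sums blinfun_apply C x" for C :: "ell2 \<Rightarrow>\<^sub>L ell2"
    using bounded_linear.sums[OF blinfun.bounded_linear_right ell2_sums] .
  from this[of A] this[of B] show "blinfun_apply A x = blinfun_apply B x"
    using assms by (simp add: clinear_op_def sums_unique2)
qed

lemma clinear_op_sum_scaleC:
  "clinear_op T \<Longrightarrow> blinfun_apply T (comb F c u) = comb F c (\<lambda>x. blinfun_apply T (u x))"
  by (simp add: comb_def blinfun.sum_right clinear_op_def)

lemma ell2_nth_cspan_eq_0:
  "x \<in> cspan \<beta> \<Longrightarrow> (\<And>i. ell2_nth (\<beta> i) n = 0) \<Longrightarrow> ell2_nth x n = 0"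
  by (auto simp: cspan_def ell2_nth_comb)

text \<open>The domination makes the map from \<open>\<beta> x\<close> to
  \<open>\<beta> (g x)\<close> well defined on the span with norm at most \<open>r\<close>. Its
  image stays in the coordinates \<open>S\<close>, orthogonal to the others, so the identity on
  those can be added without raising the norm, as \<open>1 \<le> r\<close>.\<close>

lemma shift_operator:
  fixes \<beta> :: "'i \<Rightarrow> ell2"
  assumes S: "\<And>x n. n \<notin> S \<Longrightarrow> ell2_nth (\<beta> x) n = 0" "\<And>n. n \<in> S \<Longrightarrow> ell2_unit n \<in> cspan \<beta>"
    "\<And>x. \<exists>N. \<beta> x = comb {..N} (ell2_nth (\<beta> x)) ell2_unit"
  and r: "1 \<le> r" and g: "sdom (\<lambda>x. \<beta> (g x)) (\<lambda>x. complex_of_real r *\<^sub>C \<beta> x)"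
  obtains T where "clinear_op T" "norm T \<le> r" "\<And>x. blinfun_apply T (\<beta> x) = \<beta> (g x)"
    "\<And>n. n \<notin> S \<Longrightarrow> blinfun_apply T (ell2_unit n) = ell2_unit n"
proof -
  let ?v = "\<lambda>x. complex_of_real r *\<^sub>C \<beta> x" and ?u = "\<lambda>x. \<beta> (g x)"
  define L where "L = (\<lambda>x. transfer_map ?v ?u (complex_of_real r *\<^sub>C x))"
  have v: "complex_of_real r *\<^sub>C x \<in> cspan ?v" if "x \<in> cspan \<beta>" for x
    using that by (auto simp: cspan_def comb_scale_fam)
  have L_base: "L (\<beta> x) = \<beta> (g x)" for x unfolding L_def by (rule transfer_base[OF g])
  have L_scale: "L (a *\<^sub>C x) = a *\<^sub>C L x" if "x \<in> cspan \<beta>" for a x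
    using transfer_scale[OF g v[OF that], of a] by (simp add: L_def scaleC_scaleC mult.commute)
  have L_sum: "L (sum f F) = (\<Sum>i\<in>F. L (f i))" if "\<And>i. i \<in> F \<Longrightarrow> f i \<in> cspan \<beta>" for f F
    unfolding L_def scaleC_sum_right by (intro transfer_sum[OF g] v that)
  have L_norm: "norm (L x) \<le> r * norm x" if "x \<in> cspan \<beta>" for x
    using norm_transfer[OF g v[OF that]] r by (simp add: L_def norm_scaleC)
  have L_in: "L x \<in> cspan ?u" if "x \<in> cspan \<beta>" for x
    unfolding L_def by (rule transfer_in_cspan[OF g v[OF that]])
  have L_nth: "ell2_nth (L x) n = 0" if "x \<in> cspan \<beta>" "n \<notin> S" for x n
    using ell2_nth_cspan_eq_0[OF L_in[OF that(1)]] S(1)[OF that(2)] by blast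
  define t where "t = (\<lambda>n. if n \<in> S then L (ell2_unit n) else ell2_unit n)"
  have bound: "norm (comb {..<N} y t) \<le> r * norm (comb {..<N} y ell2_unit)" for N y
  proof -
    define p where "p = (\<Sum>n\<in>{..<N} \<inter> S. y n *\<^sub>C ell2_unit n)"
    define q where "q = (\<Sum>n\<in>{..<N} - S. y n *\<^sub>C ell2_unit n)"
    have pin: "p \<in> cspan \<beta>" unfolding p_def using S(2) by (intro cspan_sum cspan_scale) auto
    have "comb {..<N} y t = (\<Sum>n\<in>{..<N} \<inter> S. y n *\<^sub>C t n) + (\<Sum>n\<in>{..<N} - S. y n *\<^sub>C t n)"
      unfolding comb_def by (subst sum.union_disjoint[symmetric]) (auto intro: sum.cong)
    also have "(\<Sum>n\<in>{..<N} - S. y n *\<^sub>C t n) = q" unfolding q_def t_def by (intro sum.cong) auto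
    also have "(\<Sum>n\<in>{..<N} \<inter> S. y n *\<^sub>C t n) = L p"
      unfolding p_def using S(2) by (subst L_sum) (auto simp: L_scale t_def cspan_scale intro!: sum.cong)
    finally have 1: "comb {..<N} y t = L p + q" .
    have 2: "comb {..<N} y ell2_unit = p + q"
      unfolding comb_def p_def q_def by (subst sum.union_disjoint[symmetric]) (auto intro: sum.cong)
    have orth: "cinner z q = 0" if z: "\<And>n. n \<notin> S \<Longrightarrow> ell2_nth z n = 0" for z
    proof -
      have "cinner q z = 0" unfolding q_def cinner_sum_left cinner_scaleC_left cinner_ell2_unit
        using z by (intro sum.neutral) auto
      then show ?thesis by (metis cnj_cinner complex_cnj_zero)
    qed
    have "cinner (L p) q = 0" using L_nth[OF pin] by (rule orth)
    moreover have "cinner p q = 0" using ell2_nth_cspan_eq_0[OF pin] S(1) by (intro orth) blast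
    moreover have "(norm (L p))\<^sup>2 \<le> (r * norm p)\<^sup>2" using L_norm[OF pin] by (intro power_mono) auto
    moreover have "(norm q)\<^sup>2 \<le> r\<^sup>2 * (norm q)\<^sup>2"
      using mult_right_mono[of 1 "r\<^sup>2" "(norm q)\<^sup>2"] r by simp
    ultimately have "(norm (L p + q))\<^sup>2 \<le> (r * norm (p + q))\<^sup>2"
      by (simp add: norm_add_sq_orthogonal power_mult_distrib distrib_left)
    then show ?thesis unfolding 1 2 by (rule power2_le_imp_le) (use r in simp)
  qed
  obtain T where T: "clinear_op T" "norm T \<le> r" "\<And>n. blinfun_apply T (ell2_unit n) = t n"
    by (rule ell2_operator_extension[of r t]) (use bound r in auto)
  have "blinfun_apply T (\<beta> x) = \<beta> (g x)" for x
  proof -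
    obtain N where N: "\<beta> x = comb {..N} (ell2_nth (\<beta> x)) ell2_unit" using S(3) by blast
    have in_span: "ell2_nth (\<beta> x) n *\<^sub>C ell2_unit n \<in> cspan \<beta>" for n
      using S(1)[of n x] S(2)[of n] by (cases "n \<in> S") (auto intro: cspan_scale cspan_zero)
    have *: "ell2_nth (\<beta> x) n *\<^sub>C t n = L (ell2_nth (\<beta> x) n *\<^sub>C ell2_unit n)" for n
      using S(1)[of n x] L_scale[OF S(2), of n] L_scale[OF cspan_zero, of 0]
      by (cases "n \<in> S") (auto simp: t_def)
    have "blinfun_apply T (\<beta> x) = comb {..N} (ell2_nth (\<beta> x)) t"
      by (subst N) (simp add: clinear_op_sum_scaleC[OF T(1)] T(3))
    also have "\<dots> = L (comb {..N} (ell2_nth (\<beta> x)) ell2_unit)"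
      unfolding comb_def * by (intro L_sum[symmetric] in_span)
    also have "\<dots> = \<beta> (g x)" using N L_base by simp
    finally show ?thesis .
  qed
  then show ?thesis using that[of T] T by (simp add: t_def)
qed

section \<open>Families modelled on an orbit of a commuting pair\<close>

text \<open>The model is \<open>u (n, m) = T\<^sub>1\<^sup>n T\<^sub>2\<^sup>m h\<close> with \<open>T\<^sub>i\<close> and its inverse bounded by \<open>r\<^sub>i\<close>.\<close>

definition quantum_family :: "real \<Rightarrow> real \<Rightarrow> (int \<times> int \<Rightarrow> 'a::complex_hilbert) \<Rightarrow> bool" where
  "quantum_family r1 r2 u \<longleftrightarrow>
     sdom (\<lambda>x. u (fst x + 1, snd x)) (\<lambda>x. complex_of_real r1 *\<^sub>C u x) \<and>
     sdom (\<lambda>x. u (fst x - 1, snd x)) (\<lambda>x. complex_of_real r1 *\<^sub>C u x) \<and>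
     sdom (\<lambda>x. u (fst x, snd x + 1)) (\<lambda>x. complex_of_real r2 *\<^sub>C u x) \<and>
     sdom (\<lambda>x. u (fst x, snd x - 1)) (\<lambda>x. complex_of_real r2 *\<^sub>C u x)"

definition laurent :: "(int \<times> int) set \<Rightarrow> (int \<times> int \<Rightarrow> complex) \<Rightarrow> complex \<Rightarrow> complex \<Rightarrow> complex" where
  "laurent F c z w = (\<Sum>x\<in>F. c x * z powi fst x * w powi snd x)"

definition bdry :: "real \<Rightarrow> complex set" where
  "bdry r = {z. cmod z = r \<or> cmod z = inverse r}"

text \<open>Only the four tori enter, since by \<open>laurent_max\<close> they control the
  polynomial on the whole closed biannulus. The two radii are independent so that annuli can be
  compared in one variable at a time.\<close>

definition laurent_const :: "real \<Rightarrow> real \<Rightarrow> real \<Rightarrow> bool" where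
  "laurent_const r1 r2 K \<longleftrightarrow> (\<forall>(u :: int \<times> int \<Rightarrow> ell2) F c B. quantum_family r1 r2 u \<longrightarrow> finite F \<longrightarrow>
     (\<forall>z\<in>bdry r1. \<forall>w\<in>bdry r2. cmod (laurent F c z w) \<le> B) \<longrightarrow>
     norm (comb F c u) \<le> K * B * norm (u (0, 0)))"

lemma gram_scale: "gram (\<lambda>x. a *\<^sub>C u x) = (\<lambda>x y. cnj a * a * gram u x y)"
  by (simp add: gram_def cinner_scaleC_left cinner_scaleC_right fun_eq_iff mult_ac)

lemma gram_comp: "gram (\<lambda>x. u (g x)) = (\<lambda>x y. gram u (g x) (g y))"
  by (simp add: gram_def fun_eq_iff)

lemma gram_eq_norm: "gram u = gram v \<Longrightarrow> norm (u x) = norm (v x)"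
  using comb_norm_eq_gram[of u v "{x}" "\<lambda>_. 1"] by (simp add: comb_singleton)

lemma sdom_shift_gram_cong:
  assumes "gram u = gram v" "sdom (\<lambda>x. u (g x)) (\<lambda>x. a *\<^sub>C u (h x))"
  shows "sdom (\<lambda>x. v (g x)) (\<lambda>x. a *\<^sub>C v (h x))"
proof -
  have "gram (\<lambda>x. u (g x)) = gram (\<lambda>x. v (g x))" "gram (\<lambda>x. a *\<^sub>C u (h x)) = gram (\<lambda>x. a *\<^sub>C v (h x))"
    unfolding gram_scale gram_comp[of _ g] gram_comp[of _ h] assms(1) by auto
  from sdom_gram_cong[OF this] show ?thesis using assms(2) by simp
qed

lemma quantum_family_gram_cong: "gram u = gram v \<Longrightarrow> quantum_family r1 r2 u \<Longrightarrow> quantum_family r1 r2 v"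
  unfolding quantum_family_def by (elim conjE, intro conjI) (erule sdom_shift_gram_cong, assumption)+

text \<open>Hypotheses and conclusion depend on the Gram matrix of \<open>u\<close> alone, and the
  index set is countable, so the family can be moved into \<open>ell2\<close>.\<close>

lemma laurent_constD:
  fixes u :: "int \<times> int \<Rightarrow> 'a::complex_hilbert"
  assumes "laurent_const r1 r2 K" "quantum_family r1 r2 u" "finite F"
    "\<And>z w. z \<in> bdry r1 \<Longrightarrow> w \<in> bdry r2 \<Longrightarrow> cmod (laurent F c z w) \<le> B"
  shows "norm (comb F c u) \<le> K * B * norm (u (0, 0))"
proof -
  obtain v :: "int \<times> int \<Rightarrow> ell2" where v: "gram v = gram u"
    by (rule kolmogorov[OF psd_gram[of u]])
  have "norm (comb F c v) \<le> K * B * norm (v (0, 0))"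
    using assms quantum_family_gram_cong[OF v[symmetric] assms(2)] unfolding laurent_const_def by blast
  then show ?thesis using comb_norm_eq_gram[OF v] gram_eq_norm[OF v] by simp
qed

section \<open>Laurent polynomials on the closed annulus\<close>

lemma closure_annulus:
  assumes "r > 1" shows "closure (annulus r) = {z. inverse r \<le> cmod z \<and> cmod z \<le> r}"
proof
  have "closed {z. inverse r \<le> cmod z \<and> cmod z \<le> r}"
    by (intro closed_Collect_conj closed_Collect_le continuous_intros)
  then show "closure (annulus r) \<subseteq> {z. inverse r \<le> cmod z \<and> cmod z \<le> r}"
    by (intro closure_minimal) (auto simp: annulus_def)
  show "{z. inverse r \<le> cmod z \<and> cmod z \<le> r} \<subseteq> closure (annulus r)"
  proof
    fix z assume z: "z \<in> {z. inverse r \<le> cmod z \<and> cmod z \<le> r}"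
    have ir: "0 < inverse r" "inverse r < 1" using assms by (auto simp: field_simps)
    have z0: "cmod z > 0" using z ir by (auto intro: less_le_trans)
    define t where "t = (\<lambda>n. inverse (real (Suc n)))"
    \<comment> \<open>A boundary point is approached radially from the side of the unit circle: the
      modulus is moved from \<open>cmod z\<close> towards 1 by the fraction
      \<open>t n\<close>.\<close>
    define y where "y = (\<lambda>n. of_real (((1 - t n) * cmod z + t n) / cmod z) * z)"
    have "t \<longlonglongrightarrow> 0" unfolding t_def by (rule LIMSEQ_inverse_real_of_nat)
    then have "y \<longlonglongrightarrow> of_real (((1 - 0) * cmod z + 0) / cmod z) * z"
      unfolding y_def by (intro tendsto_intros) (use z0 in auto)
    then have lim: "y \<longlonglongrightarrow> z" using z0 by simp
    have "y n \<in> annulus r" for n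
    proof -
      have t: "0 < t n" "t n \<le> 1" by (auto simp: t_def field_simps)
      have nn: "0 \<le> (1 - t n) * cmod z + t n" using t by (intro add_nonneg_nonneg) auto
      then have cm: "cmod (y n) = (1 - t n) * cmod z + t n"
        using z0 by (simp add: y_def norm_mult norm_divide del: of_real_add of_real_mult of_real_diff)
      have "(1 - t n) * cmod z + t n * 1 < (1 - t n) * r + t n * r"
        using z t assms by (intro add_le_less_mono mult_left_mono mult_strict_left_mono) auto
      moreover have "(1 - t n) * inverse r + t n * inverse r < (1 - t n) * cmod z + t n * 1"
        using z t ir by (intro add_le_less_mono mult_left_mono mult_strict_left_mono) auto
      ultimately show ?thesis using cm by (simp add: annulus_def algebra_simps)
    qed
    then show "z \<in> closure (annulus r)" using lim unfolding closure_sequential by blast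
  qed
qed

lemma laurent1_max:
  assumes r: "r > 1" and F: "finite F"
    and B: "\<And>z. z \<in> bdry r \<Longrightarrow> cmod (\<Sum>x\<in>F. a x * z powi n x) \<le> B"
    and z: "inverse r \<le> cmod z" "cmod z \<le> r"
  shows "cmod (\<Sum>x\<in>F. a x * z powi n x) \<le> B"
proof -
  let ?S = "{z. inverse r \<le> cmod z \<and> cmod z \<le> r}" and ?f = "\<lambda>z. \<Sum>x\<in>F. a x * z powi n x"
  have cl: "closed ?S" by (intro closed_Collect_conj closed_Collect_le continuous_intros)
  have nz: "z \<noteq> 0" if "z \<in> ?S" for z
    using that r by (auto simp: field_simps)
  have hol: "?f holomorphic_on ?S"
    using nz by (auto intro!: holomorphic_intros)
  have fr: "frontier ?S \<subseteq> bdry r"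
  proof -
    have "{z. inverse r < cmod z \<and> cmod z < r} \<subseteq> interior ?S"
      by (intro interior_maximal open_Collect_conj open_Collect_less continuous_intros) auto
    then have "x \<in> bdry r" if "x \<in> ?S" "x \<notin> interior ?S" for x
      using that unfolding bdry_def by (auto dest!: contra_subsetD)
    then show ?thesis unfolding frontier_def closure_closed[OF cl] by blast
  qed
  show ?thesis
  proof (rule maximum_modulus_frontier[of ?f ?S])
    show "?f holomorphic_on interior ?S" using hol interior_subset by (rule holomorphic_on_subset)
    show "continuous_on (closure ?S) ?f"
      unfolding closure_closed[OF cl] using hol by (rule holomorphic_on_imp_continuous_on)
    show "bounded ?S" unfolding bounded_iff by auto
  qed (use fr B z in auto)
qed

lemma laurent_max:
  assumes r: "r1 > 1" "r2 > 1" and F: "finite F"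
    and B: "\<And>z w. z \<in> bdry r1 \<Longrightarrow> w \<in> bdry r2 \<Longrightarrow> cmod (laurent F c z w) \<le> B"
    and z: "inverse r1 \<le> cmod z" "cmod z \<le> r1" and w: "inverse r2 \<le> cmod w" "cmod w \<le> r2"
  shows "cmod (laurent F c z w) \<le> B"
proof -
  have 1: "cmod (laurent F c z w) \<le> B" if w: "w \<in> bdry r2" for w
    using laurent1_max[OF r(1) F, of "\<lambda>x. c x * w powi snd x" fst B z] B w z
    unfolding laurent_def by (simp add: mult_ac)
  then show ?thesis
    using laurent1_max[OF r(2) F, of "\<lambda>x. c x * z powi fst x" snd B w] w
    unfolding laurent_def by (simp add: mult_ac)
qed

section \<open>Polynomials of operators\<close>

lemma blinfun_apply_power_op: "blinfun_apply (power_op T n) h = (blinfun_apply T ^^ n) h"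
  unfolding power_op_def by (induction n) (simp_all add: id_blinfun.rep_eq)

lemma scalar_op_0: "scalar_op 0 = 0"
  by (rule blinfun_eqI) (simp add: scalar_op.rep_eq)

lemma scalar_op_add: "scalar_op (a + b) = scalar_op a + scalar_op b"
  by (rule blinfun_eqI) (simp add: scalar_op.rep_eq blinfun.add_left scaleC_add_left)

lemma poly_op_alt:
  assumes "degree p \<le> J" "\<And>j. degree (coeff p j) \<le> I"
  shows "poly_op p T1 T2 = (\<Sum>j\<le>J. \<Sum>i\<le>I. scalar_op (coeff (coeff p j) i) o\<^sub>L power_op T1 i o\<^sub>L power_op T2 j)"
proof -
  have "poly_op p T1 T2 = (\<Sum>j\<le>degree p. \<Sum>i\<le>I. scalar_op (coeff (coeff p j) i) o\<^sub>L power_op T1 i o\<^sub>L power_op T2 j)"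
    unfolding poly_op_def
    by (intro sum.cong refl sum.mono_neutral_left) (use assms in \<open>auto simp: coeff_eq_0 scalar_op_0\<close>)
  also have "\<dots> = (\<Sum>j\<le>J. \<Sum>i\<le>I. scalar_op (coeff (coeff p j) i) o\<^sub>L power_op T1 i o\<^sub>L power_op T2 j)"
    by (intro sum.mono_neutral_left) (use assms in \<open>auto simp: coeff_eq_0 scalar_op_0\<close>)
  finally show ?thesis .
qed

lemma degree_coeff_bound: "degree (coeff p j) \<le> (\<Sum>k\<le>degree p. degree (coeff p k))"
proof (cases "j \<le> degree p")
  case True
  then show ?thesis by (intro member_le_sum) auto
qed (simp add: coeff_eq_0)

lemma poly_op_add: "poly_op (p + q) T1 T2 = poly_op p T1 T2 + poly_op q T1 T2"
proof -
  define J where "J = max (degree p) (degree q)"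
  define I where "I = max (\<Sum>k\<le>degree p. degree (coeff p k)) (\<Sum>k\<le>degree q. degree (coeff q k))"
  have p: "degree p \<le> J" "degree (coeff p j) \<le> I" for j
    using degree_coeff_bound[of p j] by (auto simp: J_def I_def)
  have q: "degree q \<le> J" "degree (coeff q j) \<le> I" for j
    using degree_coeff_bound[of q j] by (auto simp: J_def I_def)
  have pq: "degree (p + q) \<le> J" "degree (coeff (p + q) j) \<le> I" for j
    using p q by (auto intro: degree_add_le)
  show ?thesis
    unfolding poly_op_alt[OF p] poly_op_alt[OF q] poly_op_alt[OF pq]
    by (simp add: scalar_op_add bounded_bilinear.add_left[OF bounded_bilinear_blinfun_compose] sum.distrib)
qed

lemma poly_op_0: "poly_op 0 T1 T2 = 0"
  by (simp add: poly_op_def scalar_op_0)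

lemma poly_op_sum: "poly_op (\<Sum>x\<in>F. p x) T1 T2 = (\<Sum>x\<in>F. poly_op (p x) T1 T2)"
  by (induction F rule: infinite_finite_induct) (simp_all add: poly_op_0 poly_op_add)

lemma poly_op_monom:
  "poly_op (monom (monom c i) j) T1 T2 = scalar_op c o\<^sub>L power_op T1 i o\<^sub>L power_op T2 j"
proof -
  have d: "degree (monom (monom c i) j) \<le> j" "degree (coeff (monom (monom c i) j) k) \<le> i" for k
    by (auto simp: degree_monom_le)
  have inner: "(\<Sum>l\<le>i. scalar_op (coeff (monom c i) l) o\<^sub>L power_op T1 l o\<^sub>L power_op T2 j)
      = scalar_op c o\<^sub>L power_op T1 i o\<^sub>L power_op T2 j"
  proof -
    have "(\<Sum>l\<le>i. scalar_op (coeff (monom c i) l) o\<^sub>L power_op T1 l o\<^sub>L power_op T2 j)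
        = (\<Sum>l\<le>i. if l = i then scalar_op c o\<^sub>L power_op T1 i o\<^sub>L power_op T2 j else 0)"
      by (rule sum.cong[OF refl]) (auto simp: scalar_op_0)
    then show ?thesis by simp
  qed
  have "poly_op (monom (monom c i) j) T1 T2
      = (\<Sum>k\<le>j. if k = j then scalar_op c o\<^sub>L power_op T1 i o\<^sub>L power_op T2 j else 0)"
    unfolding poly_op_alt[OF d]
    by (rule sum.cong[OF refl]) (auto simp: scalar_op_0 inner simp del: coeff_monom simp: coeff_monom[of "monom c i"])
  then show ?thesis by simp
qed

lemma poly_at_sum: "poly_at (\<Sum>x\<in>F. p x) zw = (\<Sum>x\<in>F. poly_at (p x) zw)"
  by (cases zw) (simp add: poly_at_def poly_sum)

lemma poly_at_monom: "poly_at (monom (monom c i) j) (z, w) = c * z ^ i * w ^ j"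
  by (simp add: poly_at_def poly_monom poly_const_pow)

lemma poly_eq_sum_monom:
  assumes "degree p \<le> J" "\<And>j. degree (coeff p j) \<le> I"
  shows "p = (\<Sum>j\<le>J. \<Sum>i\<le>I. monom (monom (coeff (coeff p j) i) i) j)"
proof -
  have "(\<Sum>i\<le>I. monom (monom (coeff (coeff p j) i) i) j) = monom (coeff p j) j" for j
    unfolding monom_sum[symmetric] using poly_as_sum_of_monoms'[OF assms(2)] by metis
  then show ?thesis using poly_as_sum_of_monoms'[OF assms(1)] by simp
qed

lemma inverse_op_eqI: "is_inverse_op T S \<Longrightarrow> inverse_op T = S"
  unfolding inverse_op_def
proof (rule the_equality)
  fix S' assume "is_inverse_op T S'" and S: "is_inverse_op T S"
  then have "blinfun_apply S' (blinfun_apply T x) = x" "blinfun_apply T (blinfun_apply S x) = x" for x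
    unfolding is_inverse_op_def by (metis blinfun_apply_blinfun_compose blinfun_apply_id_blinfun id_apply)+
  then show "S' = S" by (metis blinfun_eqI)
qed

lemma cspan_unit_operator_eqI:
  fixes \<beta> :: "'i \<Rightarrow> ell2"
  assumes S: "\<And>n. n \<in> S \<Longrightarrow> ell2_unit n \<in> cspan \<beta>"
    and AB: "clinear_op A" "clinear_op B" "\<And>x. blinfun_apply A (\<beta> x) = blinfun_apply B (\<beta> x)"
    "\<And>n. n \<notin> S \<Longrightarrow> blinfun_apply A (ell2_unit n) = blinfun_apply B (ell2_unit n)"
  shows "A = B"
proof (rule ell2_operator_eqI[OF AB(1,2)])
  fix n
  have "blinfun_apply A v = blinfun_apply B v" if "v \<in> cspan \<beta>" for v
    using that AB(3) by (auto simp: cspan_def clinear_op_sum_scaleC[OF AB(1)] clinear_op_sum_scaleC[OF AB(2)])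
  then show "blinfun_apply A (ell2_unit n) = blinfun_apply B (ell2_unit n)"
    using S AB(4) by blast
qed

lemma clinear_op_compose: "clinear_op A \<Longrightarrow> clinear_op B \<Longrightarrow> clinear_op (A o\<^sub>L B)"
  by (simp add: clinear_op_def)

lemma clinear_op_id: "clinear_op id_blinfun"
  by (simp add: clinear_op_def)

text \<open>The operators act as the identity on the coordinates that the family does not reach.\<close>

lemma quantum_family_operators:
  fixes u :: "int \<times> int \<Rightarrow> ell2"
  assumes u: "quantum_family r r u" and r: "1 \<le> r"
  obtains v :: "int \<times> int \<Rightarrow> ell2" and T1 S1 T2 S2 where "gram v = gram u"
    "T1 \<in> quantum_annulus r" "T2 \<in> quantum_annulus r" "is_inverse_op T1 S1" "is_inverse_op T2 S2"
    "T1 o\<^sub>L T2 = T2 o\<^sub>L T1"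
    "\<And>x. blinfun_apply T1 (v x) = v (fst x + 1, snd x)" "\<And>x. blinfun_apply T2 (v x) = v (fst x, snd x + 1)"
    "\<And>x. blinfun_apply S1 (v x) = v (fst x - 1, snd x)" "\<And>x. blinfun_apply S2 (v x) = v (fst x, snd x - 1)"
proof -
  obtain v :: "int \<times> int \<Rightarrow> ell2" and S where v: "gram v = gram u"
    and S: "\<And>x n. n \<notin> S \<Longrightarrow> ell2_nth (v x) n = 0" "\<And>n. n \<in> S \<Longrightarrow> ell2_unit n \<in> cspan v"
    "\<And>x. \<exists>N. v x = comb {..N} (ell2_nth (v x)) ell2_unit"
    by (rule kolmogorov[OF psd_gram[of u]]) blast
  have q: "quantum_family r r v" by (rule quantum_family_gram_cong[OF v[symmetric] u])
  note ex = shift_operator[OF S r]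
  obtain T1 where T1: "clinear_op T1" "norm T1 \<le> r" "\<And>x. blinfun_apply T1 (v x) = v (fst x + 1, snd x)"
    "\<And>n. n \<notin> S \<Longrightarrow> blinfun_apply T1 (ell2_unit n) = ell2_unit n"
    by (rule ex[where g = "\<lambda>x. (fst x + 1, snd x)"]) (use q in \<open>auto simp: quantum_family_def\<close>)
  obtain S1 where S1: "clinear_op S1" "norm S1 \<le> r" "\<And>x. blinfun_apply S1 (v x) = v (fst x - 1, snd x)"
    "\<And>n. n \<notin> S \<Longrightarrow> blinfun_apply S1 (ell2_unit n) = ell2_unit n"
    by (rule ex[where g = "\<lambda>x. (fst x - 1, snd x)"]) (use q in \<open>auto simp: quantum_family_def\<close>)
  obtain T2 where T2: "clinear_op T2" "norm T2 \<le> r" "\<And>x. blinfun_apply T2 (v x) = v (fst x, snd x + 1)"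
    "\<And>n. n \<notin> S \<Longrightarrow> blinfun_apply T2 (ell2_unit n) = ell2_unit n"
    by (rule ex[where g = "\<lambda>x. (fst x, snd x + 1)"]) (use q in \<open>auto simp: quantum_family_def\<close>)
  obtain S2 where S2: "clinear_op S2" "norm S2 \<le> r" "\<And>x. blinfun_apply S2 (v x) = v (fst x, snd x - 1)"
    "\<And>n. n \<notin> S \<Longrightarrow> blinfun_apply S2 (ell2_unit n) = ell2_unit n"
    by (rule ex[where g = "\<lambda>x. (fst x, snd x - 1)"]) (use q in \<open>auto simp: quantum_family_def\<close>)
  have inv1: "is_inverse_op T1 S1" unfolding is_inverse_op_def
    by (intro conjI; rule cspan_unit_operator_eqI[OF S(2)])
       (auto intro: clinear_op_compose clinear_op_id T1(1) S1(1) simp: T1(3,4) S1(3,4))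
  have inv2: "is_inverse_op T2 S2" unfolding is_inverse_op_def
    by (intro conjI; rule cspan_unit_operator_eqI[OF S(2)])
       (auto intro: clinear_op_compose clinear_op_id T2(1) S2(1) simp: T2(3,4) S2(3,4))
  have com: "T1 o\<^sub>L T2 = T2 o\<^sub>L T1"
    by (rule cspan_unit_operator_eqI[OF S(2)])
       (auto intro: clinear_op_compose T1(1) T2(1) simp: T1(3,4) T2(3,4))
  show ?thesis
    by (rule that[of v T1 T2 S1 S2])
       (use v inv1 inv2 com T1 T2 S1 S2 in \<open>auto simp: quantum_annulus_def\<close>)
qed

lemma blinfun_eq_iff: "A = B \<longleftrightarrow> (\<forall>x. blinfun_apply A x = blinfun_apply B x)"
  by (auto intro: blinfun_eqI)

lemma is_inverse_op_compose:
  "is_inverse_op A A' \<Longrightarrow> is_inverse_op B B' \<Longrightarrow> is_inverse_op (A o\<^sub>L B) (B' o\<^sub>L A')"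
  unfolding is_inverse_op_def blinfun_eq_iff by simp

lemma is_inverse_op_power:
  assumes "is_inverse_op A A'" shows "is_inverse_op (power_op A n) (power_op A' n)"
proof -
  have 1: "blinfun_apply A (blinfun_apply A' x) = x" "blinfun_apply A' (blinfun_apply A x) = x" for x
    using assms unfolding is_inverse_op_def blinfun_eq_iff by auto
  have "(blinfun_apply A ^^ n) ((blinfun_apply A' ^^ n) x) = x \<and>
    (blinfun_apply A' ^^ n) ((blinfun_apply A ^^ n) x) = x" for x
  proof (induction n)
    case (Suc n)
    have "(blinfun_apply A ^^ Suc n) ((blinfun_apply A' ^^ Suc n) x)
        = (blinfun_apply A ^^ n) (blinfun_apply A (blinfun_apply A' ((blinfun_apply A' ^^ n) x)))"
      by (simp add: funpow_swap1)
    moreover have "(blinfun_apply A' ^^ Suc n) ((blinfun_apply A ^^ Suc n) x)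
        = (blinfun_apply A' ^^ n) (blinfun_apply A' (blinfun_apply A ((blinfun_apply A ^^ n) x)))"
      by (simp add: funpow_swap1)
    ultimately show ?case using Suc 1 by simp
  qed simp
  then show ?thesis unfolding is_inverse_op_def blinfun_eq_iff by (simp add: blinfun_apply_power_op)
qed

lemma admissible_imp_laurent_const:
  assumes r: "r > 1" and K: "admissible_const TYPE(ell2) r K"
  shows "laurent_const r r K"
  unfolding laurent_const_def
proof (intro allI impI)
  fix u :: "int \<times> int \<Rightarrow> ell2" and F c B
  assume u: "quantum_family r r u" and F: "finite F"
    and B: "\<forall>z\<in>bdry r. \<forall>w\<in>bdry r. cmod (laurent F c z w) \<le> B"
  obtain v :: "int \<times> int \<Rightarrow> ell2" and T1 S1 T2 S2 where v: "gram v = gram u"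
    and T: "T1 \<in> quantum_annulus r" "T2 \<in> quantum_annulus r" and inv: "is_inverse_op T1 S1" "is_inverse_op T2 S2"
    and com: "T1 o\<^sub>L T2 = T2 o\<^sub>L T1"
    and sh: "\<And>x. blinfun_apply T1 (v x) = v (fst x + 1, snd x)" "\<And>x. blinfun_apply T2 (v x) = v (fst x, snd x + 1)"
    "\<And>x. blinfun_apply S1 (v x) = v (fst x - 1, snd x)" "\<And>x. blinfun_apply S2 (v x) = v (fst x, snd x - 1)"
    using quantum_family_operators[OF u] r by (metis less_imp_le)
  obtain M :: nat where M: "\<And>x. x \<in> F \<Longrightarrow> \<bar>fst x\<bar> \<le> int M \<and> \<bar>snd x\<bar> \<le> int M"
  proof
    fix x assume "x \<in> F"
    then have "nat \<bar>fst x\<bar> + nat \<bar>snd x\<bar> \<le> (\<Sum>x\<in>F. nat \<bar>fst x\<bar> + nat \<bar>snd x\<bar>)"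
      using F member_le_sum[of x F "\<lambda>x. nat \<bar>fst x\<bar> + nat \<bar>snd x\<bar>"] by simp
    then show "\<bar>fst x\<bar> \<le> int (\<Sum>x\<in>F. nat \<bar>fst x\<bar> + nat \<bar>snd x\<bar>) \<and> \<bar>snd x\<bar> \<le> int (\<Sum>x\<in>F. nat \<bar>fst x\<bar> + nat \<bar>snd x\<bar>)"
      by linarith
  qed
  define p where "p = (\<Sum>x\<in>F. monom (monom (c x) (nat (fst x + int M))) (nat (snd x + int M)))"
  \<comment> \<open>The denominator \<open>z^M w^M\<close> clears all negative exponents of the
    Laurent polynomial, and it has no zero on the biannulus.\<close>
  define q where "q = monom (monom (1::complex) M) M"
  have nz: "z \<noteq> 0" if "z \<in> closure (annulus r)" for z
    using that r unfolding closure_annulus[OF r] by (auto simp: field_simps)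
  have Rat: "(p, q) \<in> Rat_on (closed_biannulus r)"
    using nz by (auto simp: Rat_on_def closed_biannulus_def q_def poly_at_monom)
  have val: "poly_at p (z, w) / poly_at q (z, w) = laurent F c z w" if "z \<noteq> 0" "w \<noteq> 0" for z w
  proof -
    have "c x * z ^ nat (fst x + int M) * w ^ nat (snd x + int M) / (z ^ M * w ^ M)
        = c x * z powi fst x * w powi snd x" if "x \<in> F" for x
    proof -
      have "z ^ nat (fst x + int M) = z powi fst x * z ^ M"
        using M[OF that] \<open>z \<noteq> 0\<close> by (simp add: power_int_def[of z "fst x + int M", symmetric] flip: power_int_of_nat)
           (subst power_int_add[symmetric], auto)
      moreover have "w ^ nat (snd x + int M) = w powi snd x * w ^ M"
        using M[OF that] \<open>w \<noteq> 0\<close> by (simp add: power_int_def[of w "snd x + int M", symmetric] flip: power_int_of_nat)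
           (subst power_int_add[symmetric], auto)
      ultimately show ?thesis using \<open>z \<noteq> 0\<close> \<open>w \<noteq> 0\<close> by simp
    qed
    then show ?thesis
      by (simp add: p_def q_def poly_at_sum poly_at_monom laurent_def sum_divide_distrib)
  qed
  have sup: "rat_sup_norm (closed_biannulus r) (p, q) \<le> B"
    unfolding rat_sup_norm_def prod.case
  proof (rule cSUP_least)
    have "1 \<in> closure (annulus r)" using r by (simp add: closure_annulus field_simps)
    then show "closed_biannulus r \<noteq> {}" by (auto simp: closed_biannulus_def)
    fix x assume "x \<in> closed_biannulus r"
    then obtain z w where x: "x = (z, w)" "z \<in> closure (annulus r)" "w \<in> closure (annulus r)"
      by (auto simp: closed_biannulus_def)
    then show "cmod (poly_at p x / poly_at q x) \<le> B"
      using laurent_max[OF r r F, of c B z w] B val nz by (simp add: closure_annulus[OF r])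
  qed
  have "K > 0" and nrm: "norm (rat_op (p, q) T1 T2) \<le> K * rat_sup_norm (closed_biannulus r) (p, q)"
    using K T com Rat unfolding admissible_const_def K_spectral_set_def by auto
  have pw: "(blinfun_apply T1 ^^ i) (v x) = v (fst x + int i, snd x)"
    "(blinfun_apply T2 ^^ i) (v x) = v (fst x, snd x + int i)"
    "(blinfun_apply S1 ^^ i) (v x) = v (fst x - int i, snd x)"
    "(blinfun_apply S2 ^^ i) (v x) = v (fst x, snd x - int i)" for i x
    by (induction i) (auto simp: sh algebra_simps)
  have q_op: "poly_op q T1 T2 = power_op T1 M o\<^sub>L power_op T2 M"
    unfolding q_def poly_op_monom by (rule blinfun_eqI) (simp add: scalar_op.rep_eq)
  have "inverse_op (poly_op q T1 T2) = power_op S2 M o\<^sub>L power_op S1 M"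
    unfolding q_op by (intro inverse_op_eqI is_inverse_op_compose is_inverse_op_power inv)
  then have "blinfun_apply (rat_op (p, q) T1 T2) (v (0, 0)) = blinfun_apply (poly_op p T1 T2) (v (- int M, - int M))"
    by (simp add: rat_op_def blinfun_apply_power_op pw)
  also have "\<dots> = comb F c v"
    unfolding p_def poly_op_sum poly_op_monom comb_def blinfun.sum_left
  proof (intro sum.cong refl)
    fix x assume "x \<in> F"
    then have "int (nat (fst x + int M)) = fst x + int M" "int (nat (snd x + int M)) = snd x + int M"
      using M by fastforce+
    then show "blinfun_apply (scalar_op (c x) o\<^sub>L power_op T1 (nat (fst x + int M)) o\<^sub>L power_op T2 (nat (snd x + int M)))
        (v (- int M, - int M)) = c x *\<^sub>C v x"
      by (simp add: scalar_op.rep_eq blinfun_apply_power_op pw)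
  qed
  finally have "norm (comb F c v) \<le> norm (rat_op (p, q) T1 T2) * norm (v (0, 0))"
    using norm_blinfun by metis
  also have "\<dots> \<le> (K * B) * norm (v (0, 0))"
    using order_trans[OF nrm mult_left_mono[OF sup, of K]] \<open>K > 0\<close> by (intro mult_right_mono) auto
  finally show "norm (comb F c u) \<le> K * B * norm (u (0, 0))"
    using comb_norm_eq_gram[OF v] gram_eq_norm[OF v] by simp
qed

section \<open>Laurent expansion of a reciprocal on the closed biannulus\<close>

text \<open>Up to the factor \<open>2 pi i\<close> the mean is the contour integral of
  \<open>g z / z\<close>, and concentric circles are homotopic within the annulus.\<close>

lemma circle_mean_radius_indep:
  assumes hol: "g holomorphic_on {z. a < cmod z \<and> cmod z < b}" and a: "0 \<le> a"
    and s: "a < s" "s < b" and t: "a < t" "t < b"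
  shows "integral {0..1} (\<lambda>x. g (of_real s * cis (2 * pi * x))) = integral {0..1} (\<lambda>x. g (of_real t * cis (2 * pi * x)))"
proof -
  let ?S = "{z. a < cmod z \<and> cmod z < b}"
  have op: "open ?S" by (intro open_Collect_conj open_Collect_less continuous_intros)
  have cp: "circlepath 0 s x = of_real s * cis (2 * pi * x)" for s x
    by (simp add: circlepath cis_conv_exp mult_ac)
  have in_S: "circlepath 0 s x \<in> ?S" if "a < s" "s < b" for s x
    using that a by (simp add: cp norm_mult)
  have "homotopic_loops ?S (circlepath 0 s) (circlepath 0 t)"
  proof (rule homotopic_loops_linear)
    fix x :: real
    show "closed_segment (circlepath 0 s x) (circlepath 0 t x) \<subseteq> ?S"
    proof
      fix y assume "y \<in> closed_segment (circlepath 0 s x) (circlepath 0 t x)"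
      then obtain u where u: "0 \<le> u" "u \<le> 1" "y = (1 - u) *\<^sub>R circlepath 0 s x + u *\<^sub>R circlepath 0 t x"
        by (auto simp: closed_segment_def)
      have "y = of_real ((1 - u) * s + u * t) * cis (2 * pi * x)"
        using u(3) by (simp add: cp scaleR_conv_of_real algebra_simps)
      moreover have "0 \<le> (1 - u) * s + u * t" using u s t a by (intro add_nonneg_nonneg mult_nonneg_nonneg) auto
      ultimately have "cmod y = (1 - u) * s + u * t" by (simp add: norm_mult del: of_real_add of_real_mult of_real_diff)
      moreover have "(1 - u) * s + u * t \<in> {a<..<b}"
        using convexD_alt[OF convex_real_interval(8)[of a b], of s t u] s t u by simp
      ultimately show "y \<in> ?S" by simp
    qed
  qed auto
  then have eq: "contour_integral (circlepath 0 s) (\<lambda>z. g z / z) = contour_integral (circlepath 0 t) (\<lambda>z. g z / z)"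
    by (rule Cauchy_theorem_homotopic_loops[OF _ op]) (use a hol in \<open>auto intro!: holomorphic_intros\<close>)
  have "contour_integral (circlepath 0 s) (\<lambda>z. g z / z) = 2 * of_real pi * \<i> * integral {0..1} (\<lambda>x. g (of_real s * cis (2 * pi * x)))"
    if "a < s" for s
  proof -
    have s: "s \<noteq> 0" using that a by simp
    have "contour_integral (circlepath 0 s) (\<lambda>z. g z / z)
        = integral {0..1} (\<lambda>x. g (circlepath 0 s x) / circlepath 0 s x * vector_derivative (circlepath 0 s) (at x))"
      by (rule contour_integral_integral)
    also have "\<dots> = integral {0..1} (\<lambda>x. (2 * of_real pi * \<i>) * g (of_real s * cis (2 * pi * x)))"
      using s by (intro integral_cong) (simp add: vector_derivative_circlepath cp cis_conv_exp mult_ac)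
    finally show ?thesis by simp
  qed
  from this[OF s(1)] this[OF t(1)] eq show ?thesis by simp
qed

lemma continuous_on_circle_mean:
  fixes F :: "real \<Rightarrow> real \<Rightarrow> complex"
  assumes "continuous_on ({0..1} \<times> {0..1}) (\<lambda>(x, y). F x y)"
  shows "continuous_on {0..1} (\<lambda>x. integral {0..1} (F x))"
  using integral_continuous_on_param[of "{0..1}" 0 1 F] assms by (simp add: cbox_interval)

text \<open>Comparing the radii 1 and 2 shows that the mean equals \<open>2 powi k\<close> times
  itself, so it vanishes unless \<open>k = 0\<close>.\<close>

lemma circle_powi_mean: "integral {0..1} (\<lambda>x. cis (2 * pi * x) powi k) = (if k = 0 then 1 else 0)"
proof (cases "k = 0")
  case False
  have "integral {0..1} (\<lambda>x. (of_real 1 * cis (2 * pi * x)) powi k) = integral {0..1} (\<lambda>x. (of_real 2 * cis (2 * pi * x)) powi k)"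
    by (rule circle_mean_radius_indep[where a = 0 and b = 3]) (auto intro!: holomorphic_intros)
  then have "(1 - 2 powi k) * integral {0..1} (\<lambda>x. cis (2 * pi * x) powi k) = 0"
    by (simp add: power_int_mult_distrib algebra_simps)
  moreover have "(2 :: complex) powi k \<noteq> 1"
  proof
    assume "(2 :: complex) powi k = 1"
    then have "cmod (2 powi k) = 1" by simp
    then have "(2 :: real) powi k = 1" by (simp add: norm_power_int)
    moreover have "(2::real) ^ j \<noteq> 1" if "j > 0" for j using one_less_power[of "2::real" j] that by linarith
    ultimately show False using False by (auto simp: power_int_def field_simps split: if_splits)
  qed
  ultimately show ?thesis using False by simp
qed simp

lemma poly_at_eq_sum:
  assumes "degree p \<le> J" "\<And>j. degree (coeff p j) \<le> I"
  shows "poly_at p (z, w) = (\<Sum>j\<le>J. \<Sum>i\<le>I. coeff (coeff p j) i * z ^ i * w ^ j)"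
  by (subst poly_eq_sum_monom[OF assms]) (simp add: poly_at_sum poly_at_monom)

lemma continuous_on_poly_at: "continuous_on A (poly_at q)"
proof -
  have *: "poly_at q = (\<lambda>zw. \<Sum>j\<le>degree q. \<Sum>i\<le>(\<Sum>k\<le>degree q. degree (coeff q k)). coeff (coeff q j) i * fst zw ^ i * snd zw ^ j)"
    using poly_at_eq_sum[OF order_refl degree_coeff_bound] by (auto simp: fun_eq_iff)
  show ?thesis by (subst *) (intro continuous_intros)
qed

lemma nonvanishing_larger_annulus:
  assumes r: "r > 1" and q: "\<And>z w. cmod z \<in> {inverse r..r} \<Longrightarrow> cmod w \<in> {inverse r..r} \<Longrightarrow> poly_at q (z, w) \<noteq> 0"
  obtains \<rho> where "\<rho> > r" "\<And>z w. cmod z \<in> {inverse \<rho>..\<rho>} \<Longrightarrow> cmod w \<in> {inverse \<rho>..\<rho>} \<Longrightarrow> poly_at q (z, w) \<noteq> 0"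
proof -
  let ?A = "{z. inverse (r + 1) \<le> cmod z \<and> cmod z \<le> r + 1}"
  define Z where "Z = (?A \<times> ?A) \<inter> {x. poly_at q x = 0}"
  \<comment> \<open>For nonzero coordinates, \<open>\<phi> x \<le> \<rho>\<close> holds exactly if
    both lie in the closed annulus of radius \<rho>. The wanted radius is thus any one between
    \<open>r\<close> and the minimum of \<phi> on the zero set.\<close>
  define \<phi> where "\<phi> = (\<lambda>x :: complex \<times> complex. max (max (cmod (fst x)) (inverse (cmod (fst x)))) (max (cmod (snd x)) (inverse (cmod (snd x)))))"
  have "closed ?A" by (intro closed_Collect_conj closed_Collect_le continuous_intros)
  moreover have "bounded ?A" unfolding bounded_iff by auto
  ultimately have "compact (?A \<times> ?A)" by (intro compact_Times) (auto simp: compact_eq_bounded_closed)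
  then have Z: "compact Z" unfolding Z_def
    by (intro compact_Int_closed closed_Collect_eq continuous_on_poly_at continuous_intros) 
  have nz: "cmod (fst x) > 0" "cmod (snd x) > 0" if "x \<in> Z" for x
  proof -
    have "inverse (r + 1) > 0" using r by simp
    moreover have "inverse (r + 1) \<le> cmod (fst x)" "inverse (r + 1) \<le> cmod (snd x)"
      using that by (auto simp: Z_def)
    ultimately show "cmod (fst x) > 0" "cmod (snd x) > 0" by linarith+
  qed
  have cont: "continuous_on Z \<phi>" unfolding \<phi>_def
    by (intro continuous_intros) (use nz in auto)
  have big: "\<phi> x > r" if "x \<in> Z" for x
  proof (rule ccontr)
    assume "\<not> \<phi> x > r"
    then have le: "cmod (fst x) \<le> r" "inverse (cmod (fst x)) \<le> r" "cmod (snd x) \<le> r" "inverse (cmod (snd x)) \<le> r"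
      by (auto simp: \<phi>_def)
    have "inverse r \<le> cmod (fst x)" "inverse r \<le> cmod (snd x)"
      using le nz[OF that] r by (auto simp: field_simps)
    then have "poly_at q (fst x, snd x) \<noteq> 0" using le by (intro q) auto
    then show False using that by (simp add: Z_def)
  qed
  obtain m where m: "m > r" "\<And>x. x \<in> Z \<Longrightarrow> m \<le> \<phi> x"
  proof (cases "Z = {}")
    case True
    then show ?thesis using that[of "r + 1"] by auto
  next
    case False
    then show ?thesis using continuous_attains_inf[OF Z False cont] big that by blast
  qed
  \<comment> \<open>The cap \<open>r + 1\<close> is there because \<open>Z\<close> records only the
    zeros in the closed annulus of that radius.\<close>
  define \<rho> where "\<rho> = (r + min m (r + 1)) / 2"
  have \<rho>: "r < \<rho>" "\<rho> < m" "\<rho> < r + 1" using m(1) by (auto simp: \<rho>_def min_def)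
  show ?thesis
  proof (rule that[OF \<rho>(1)])
    fix z w assume zw: "cmod z \<in> {inverse \<rho>..\<rho>}" "cmod w \<in> {inverse \<rho>..\<rho>}"
    have pos: "inverse \<rho> > 0" using r \<rho> by simp
    have nz: "cmod z > 0" "cmod w > 0" using zw pos unfolding atLeastAtMost_iff by linarith+
    have inv: "inverse (cmod z) \<le> \<rho>" "inverse (cmod w) \<le> \<rho>"
      using zw nz pos le_imp_inverse_le[of "inverse \<rho>" "cmod z"] le_imp_inverse_le[of "inverse \<rho>" "cmod w"] by auto
    then have "\<phi> (z, w) \<le> \<rho>" using zw by (simp add: \<phi>_def)
    then have "(z, w) \<notin> Z" using m(2)[of "(z, w)"] \<rho> by auto
    moreover have "inverse (r + 1) \<le> inverse \<rho>" using \<rho> r by (intro le_imp_inverse_le) auto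
    ultimately show "poly_at q (z, w) \<noteq> 0" using zw \<rho> by (auto simp: Z_def)
  qed
qed

text \<open>The coefficients are Cauchy integrals of \<open>1/q\<close> over a torus. Moving the
  circles gives the geometric decay, and integrating \<open>(1/q) q = 1\<close> against a monomial
  gives the convolution identity.\<close>

lemma reciprocal_laurent:
  assumes r: "r > 1" and q: "\<And>z w. cmod z \<in> {inverse r..r} \<Longrightarrow> cmod w \<in> {inverse r..r} \<Longrightarrow> poly_at q (z, w) \<noteq> 0"
    and J: "degree q \<le> J" and I: "\<And>j. degree (coeff q j) \<le> I"
  obtains a :: "int \<times> int \<Rightarrow> complex" and C \<rho> where "\<rho> > r"
    "\<And>n m. cmod (a (n, m)) \<le> C * \<rho> powi - \<bar>n\<bar> * \<rho> powi - \<bar>m\<bar>"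
    "\<And>n m. (\<Sum>j\<le>J. \<Sum>i\<le>I. coeff (coeff q j) i * a (n - int i, m - int j)) = (if n = 0 \<and> m = 0 then 1 else 0)"
proof -
  obtain \<rho>2 where \<rho>2: "\<rho>2 > r" "\<And>z w. cmod z \<in> {inverse \<rho>2..\<rho>2} \<Longrightarrow> cmod w \<in> {inverse \<rho>2..\<rho>2} \<Longrightarrow> poly_at q (z, w) \<noteq> 0"
    using nonvanishing_larger_annulus[OF r q] by blast
  \<comment> \<open>Strictly between the two radii, so that the closed annulus of radius \<rho> lies
    in the open one where \<open>1/q\<close> is holomorphic in each variable.\<close>
  define \<rho> where "\<rho> = (r + \<rho>2) / 2"
  have \<rho>: "r < \<rho>" "\<rho> < \<rho>2" "\<rho> > 1" using \<rho>2(1) r by (auto simp: \<rho>_def)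
  have irho: "inverse \<rho>2 < inverse \<rho>" "inverse \<rho> < 1" "0 < inverse \<rho>2" using \<rho> by (auto intro: less_imp_inverse_less simp: inverse_less_1_iff)
  define h where "h = (\<lambda>z w. inverse (poly_at q (z, w)))"
  let ?R = "{inverse \<rho>..\<rho>}"
  let ?e = "\<lambda>x::real. cis (2 * pi * x)"
  define f where "f = (\<lambda>n m s t x y. (of_real s * ?e x) powi (- n) * (of_real t * ?e y) powi (- m) * h (of_real s * ?e x) (of_real t * ?e y))"
  have R: "s > 0" "inverse \<rho>2 < s" "s < \<rho>2" "\<bar>s\<bar> \<in> {inverse \<rho>2..\<rho>2}" if "s \<in> ?R" for s
  proof -
    have *: "s > 0" "inverse \<rho>2 < s" "s < \<rho>2" using that irho \<rho> unfolding atLeastAtMost_iff by linarith+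
    then show "s > 0" "inverse \<rho>2 < s" "s < \<rho>2" "\<bar>s\<bar> \<in> {inverse \<rho>2..\<rho>2}" by auto
  qed
  have nz: "poly_at q (of_real s * ?e x, of_real t * ?e y) \<noteq> 0" if "s \<in> ?R" "t \<in> ?R" for s t x y
  proof -
    have "cmod (of_real s * ?e x) = \<bar>s\<bar>" "cmod (of_real t * ?e y) = \<bar>t\<bar>" by (simp_all add: norm_mult)
    then show ?thesis using R(4)[OF that(1)] R(4)[OF that(2)] by (intro \<rho>2(2)) simp_all
  qed
  have cont: "continuous_on A (\<lambda>(x, y). f n m s t x y)" if "s \<in> ?R" "t \<in> ?R" for A n m s t
  proof -
    have "s \<noteq> 0" "t \<noteq> 0" using R(1)[OF that(1)] R(1)[OF that(2)] by auto
    then show ?thesis unfolding f_def h_def case_prod_unfold using nz[OF that]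
      by (intro continuous_intros continuous_on_compose2[OF continuous_on_poly_at[of UNIV]]) auto
  qed
  have cx: "continuous_on A (\<lambda>x. f n m s t x y)" and cy: "continuous_on A (\<lambda>y. f n m s t x y)"
    if "s \<in> ?R" "t \<in> ?R" for A n m s t x y
    using continuous_on_compose2[OF cont[OF that, of UNIV n m], of A "\<lambda>x. (x, y)"]
      continuous_on_compose2[OF cont[OF that, of UNIV n m], of A "\<lambda>y. (x, y)"]
    by (simp_all add: continuous_on_Pair continuous_on_const continuous_on_id)
  have swap: "continuous_on A (\<lambda>(x, y). f n m s t y x)" if "s \<in> ?R" "t \<in> ?R" for A n m s t
    using continuous_on_compose2[OF cont[OF that, of UNIV n m], of A "\<lambda>(x, y). (y, x)"]
    by (simp add: case_prod_unfold continuous_on_Pair continuous_on_fst continuous_on_snd continuous_on_id)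
  define a where "a = (\<lambda>(n, m). integral {0..1} (\<lambda>y. integral {0..1} (\<lambda>x. f n m 1 1 x y)))"
  have one: "1 \<in> ?R" using irho \<rho> by auto
  have hol: "(\<lambda>z. h z w) holomorphic_on {z. inverse \<rho>2 < cmod z \<and> cmod z < \<rho>2}"
    "(\<lambda>z. h w z) holomorphic_on {z. inverse \<rho>2 < cmod z \<and> cmod z < \<rho>2}" if "cmod w \<in> {inverse \<rho>2..\<rho>2}" for w
    using \<rho>2(2) that unfolding h_def poly_at_eq_sum[OF J I] by (auto intro!: holomorphic_intros)
  have rad: "integral {0..1} (\<lambda>x. f n m s t x y) = integral {0..1} (\<lambda>x. f n m s' t x y)"
    if "s \<in> ?R" "s' \<in> ?R" "t \<in> ?R" for n m s s' t y
  proof -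
    have w: "cmod (of_real t * ?e y) \<in> {inverse \<rho>2..\<rho>2}" using R(4) that by (simp add: norm_mult)
    show ?thesis unfolding f_def
      by (rule circle_mean_radius_indep[where a = "inverse \<rho>2" and b = \<rho>2 and
          g = "\<lambda>z. z powi (- n) * (of_real t * ?e y) powi (- m) * h z (of_real t * ?e y)"])
         (use irho(3) R(2,3) that in \<open>auto intro!: holomorphic_intros hol[OF w]\<close>)
  qed
  have rad2: "integral {0..1} (\<lambda>y. f n m s t x y) = integral {0..1} (\<lambda>y. f n m s t' x y)"
    if "s \<in> ?R" "t' \<in> ?R" "t \<in> ?R" for n m s t t' x
  proof -
    have w: "cmod (of_real s * ?e x) \<in> {inverse \<rho>2..\<rho>2}" using R(4) that by (simp add: norm_mult)
    show ?thesis unfolding f_def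
      by (rule circle_mean_radius_indep[where a = "inverse \<rho>2" and b = \<rho>2 and
          g = "\<lambda>z. (of_real s * ?e x) powi (- n) * z powi (- m) * h (of_real s * ?e x) z"])
         (use irho(3) R(2,3) that in \<open>auto intro!: holomorphic_intros hol[OF w]\<close>)
  qed
  have a_eq: "a (n, m) = integral {0..1} (\<lambda>x. integral {0..1} (\<lambda>y. f n m s t x y))"
    if "s \<in> ?R" "t \<in> ?R" for n m s t
  proof -
    have "a (n, m) = integral {0..1} (\<lambda>y. integral {0..1} (\<lambda>x. f n m s 1 x y))"
      unfolding a_def prod.case using rad[OF one that(1) one] by simp
    \<comment> \<open>A radius can be changed only in the inner integral, so the order of
      integration is exchanged before the second one is moved.\<close>
    also have "\<dots> = integral {0..1} (\<lambda>x. integral {0..1} (\<lambda>y. f n m s 1 x y))"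
      using integral_swap_continuous[of 0 0 1 1 "\<lambda>x y. f n m s 1 y x"] swap[OF that(1) one]
      by (simp add: cbox_interval)
    also have "\<dots> = integral {0..1} (\<lambda>x. integral {0..1} (\<lambda>y. f n m s t x y))"
      using rad2[OF that(1) that(2) one] by simp
    finally show ?thesis .
  qed
  obtain C where C: "\<And>z w. cmod z \<in> ?R \<Longrightarrow> cmod w \<in> ?R \<Longrightarrow> cmod (h z w) \<le> C"
  proof -
    let ?A = "{z. inverse \<rho> \<le> cmod z \<and> cmod z \<le> \<rho>}"
    have "closed ?A" by (intro closed_Collect_conj closed_Collect_le continuous_intros)
    moreover have "bounded ?A" unfolding bounded_iff by auto
    ultimately have "compact (?A \<times> ?A)" by (intro compact_Times) (auto simp: compact_eq_bounded_closed)
    moreover have "continuous_on (?A \<times> ?A) (\<lambda>x. inverse (poly_at q x))"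
      using \<rho>2(2) R(4) by (intro continuous_on_inverse continuous_on_poly_at) force
    ultimately have "bounded ((\<lambda>x. inverse (poly_at q x)) ` (?A \<times> ?A))"
      by (intro compact_imp_bounded compact_continuous_image)
    then obtain C where "\<forall>x\<in>?A \<times> ?A. cmod (inverse (poly_at q x)) \<le> C" unfolding bounded_iff by auto
    then show ?thesis by (intro that[of C]) (auto simp: h_def)
  qed
  have bound: "cmod (a (n, m)) \<le> C * \<rho> powi - \<bar>n\<bar> * \<rho> powi - \<bar>m\<bar>" for n m
  proof -
    \<comment> \<open>The outer circle for nonnegative exponents and the inner one for negative
      exponents: in both cases the kernel has modulus
      \<open>\<rho> powi - \<bar>n\<bar>\<close>.\<close>
    define s where "s = (if n \<ge> 0 then \<rho> else inverse \<rho>)"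
    define t where "t = (if m \<ge> 0 then \<rho> else inverse \<rho>)"
    have st: "s \<in> ?R" "t \<in> ?R" "s > 0" "t > 0" using irho \<rho> by (auto simp: s_def t_def)
    have pw: "s powi (- n) = \<rho> powi - \<bar>n\<bar>" "t powi (- m) = \<rho> powi - \<bar>m\<bar>"
      by (auto simp: s_def t_def power_int_inverse power_int_minus)
    have fb: "cmod (f n m s t x y) \<le> C * \<rho> powi - \<bar>n\<bar> * \<rho> powi - \<bar>m\<bar>" for x y
    proof -
      have "cmod (f n m s t x y) = s powi (- n) * t powi (- m) * cmod (h (of_real s * ?e x) (of_real t * ?e y))"
        using st by (simp add: f_def norm_mult norm_power_int)
      also have "\<dots> \<le> s powi (- n) * t powi (- m) * C"
        using st C[of "of_real s * ?e x" "of_real t * ?e y"] by (intro mult_left_mono) (auto simp: norm_mult)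
      finally show ?thesis by (simp add: pw mult_ac)
    qed
    have "cmod (integral {0..1} (\<lambda>y. f n m s t x y)) \<le> (C * \<rho> powi - \<bar>n\<bar> * \<rho> powi - \<bar>m\<bar>) * (1 - 0)" for x
      by (rule integral_bound) (use cy[OF st(1,2)] fb in auto)
    then show ?thesis unfolding a_eq[OF st(1,2)]
      using integral_bound[of 0 1 "\<lambda>x. integral {0..1} (\<lambda>y. f n m s t x y)" "C * \<rho> powi - \<bar>n\<bar> * \<rho> powi - \<bar>m\<bar>"]
        continuous_on_circle_mean[OF cont[OF st(1,2)]] by simp
  qed
  have conv: "(\<Sum>j\<le>J. \<Sum>i\<le>I. coeff (coeff q j) i * a (n - int i, m - int j)) = (if n = 0 \<and> m = 0 then 1 else 0)" for n m
  proof -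
    have i1: "(\<lambda>x. f n m 1 1 x y) integrable_on {0..1}" for n m y
      by (rule integrable_continuous_interval[OF cx[OF one one]])
    have i2: "(\<lambda>y. integral {0..1} (\<lambda>x. f n m 1 1 x y)) integrable_on {0..1}" for n m
      by (rule integrable_continuous_interval[OF continuous_on_circle_mean[OF swap[OF one one]]])
    have "(\<Sum>j\<le>J. \<Sum>i\<le>I. coeff (coeff q j) i * a (n - int i, m - int j))
      = integral {0..1} (\<lambda>y. integral {0..1} (\<lambda>x. \<Sum>j\<le>J. \<Sum>i\<le>I. coeff (coeff q j) i * f (n - int i) (m - int j) 1 1 x y))"
      unfolding a_def prod.case
      by (simp add: integral_sum integrable_sum i1 i2 integrable_on_mult_right)
    also have "\<dots> = integral {0..1} (\<lambda>y. integral {0..1} (\<lambda>x. ?e x powi (- n) * ?e y powi (- m)))"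
    proof (intro integral_cong)
      fix x y :: real
      have "(\<Sum>j\<le>J. \<Sum>i\<le>I. coeff (coeff q j) i * f (n - int i) (m - int j) 1 1 x y)
        = (\<Sum>j\<le>J. \<Sum>i\<le>I. (?e x powi (- n) * ?e y powi (- m) * h (?e x) (?e y)) * (coeff (coeff q j) i * ?e x ^ i * ?e y ^ j))"
      proof (intro sum.cong refl)
        fix i j
        have "?e x powi (- (n - int i)) = ?e x powi (- n) * ?e x ^ i" "?e y powi (- (m - int j)) = ?e y powi (- m) * ?e y ^ j"
          by (simp_all add: power_int_add[symmetric] flip: power_int_of_nat)
        then show "coeff (coeff q j) i * f (n - int i) (m - int j) 1 1 x y = (?e x powi (- n) * ?e y powi (- m) * h (?e x) (?e y)) * (coeff (coeff q j) i * ?e x ^ i * ?e y ^ j)"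
          by (simp add: f_def)
      qed
      also have "\<dots> = ?e x powi (- n) * ?e y powi (- m) * h (?e x) (?e y) * poly_at q (?e x, ?e y)"
        unfolding poly_at_eq_sum[OF J I] by (simp only: sum_distrib_left)
      also have "h (?e x) (?e y) * poly_at q (?e x, ?e y) = 1"
        using nz[OF one one, of x y] by (simp add: h_def)
      then have "?e x powi (- n) * ?e y powi (- m) * h (?e x) (?e y) * poly_at q (?e x, ?e y) = ?e x powi (- n) * ?e y powi (- m)"
        by (simp add: mult.assoc)
      finally show "(\<Sum>j\<le>J. \<Sum>i\<le>I. coeff (coeff q j) i * f (n - int i) (m - int j) 1 1 x y) = ?e x powi (- n) * ?e y powi (- m)" .
    qed
    also have "\<dots> = (if n = 0 \<and> m = 0 then 1 else 0)"
      by (simp add: circle_powi_mean)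
    finally show ?thesis .
  qed
  show ?thesis by (rule that[OF \<rho>(1) bound conv])
qed

section \<open>Infinite sums of operators and summable weights\<close>

lemma has_sum_sum:
  fixes f :: "'i \<Rightarrow> 'a \<Rightarrow> 'b::{topological_comm_monoid_add}"
  assumes "\<And>i. i \<in> I \<Longrightarrow> (f i has_sum s i) A"
  shows "((\<lambda>x. \<Sum>i\<in>I. f i x) has_sum (\<Sum>i\<in>I. s i)) A"
  using assms by (induction I rule: infinite_finite_induct) (auto intro: has_sum_add)

lemma has_sum_compose_left:
  "(f has_sum s) A \<Longrightarrow> ((\<lambda>x. B o\<^sub>L f x) has_sum (B o\<^sub>L s)) A"
  using has_sum_bounded_linear[OF bounded_bilinear.bounded_linear_right[OF bounded_bilinear_blinfun_compose], of f A s B]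
  by (simp add: o_def)

lemma has_sum_compose_right:
  "(f has_sum s) A \<Longrightarrow> ((\<lambda>x. f x o\<^sub>L B) has_sum (s o\<^sub>L B)) A"
  using has_sum_bounded_linear[OF bounded_bilinear.bounded_linear_left[OF bounded_bilinear_blinfun_compose], of f A s B]
  by (simp add: o_def)

lemma summable_on_int_geometric:
  fixes t :: real assumes "0 \<le> t" "t < 1" shows "(\<lambda>n::int. t powi \<bar>n\<bar>) summable_on UNIV"
proof -
  have geo: "(\<lambda>n::nat. t ^ n) summable_on UNIV"
    using assms by (intro norm_summable_imp_summable_on) (auto intro: summable_geometric)
  have 1: "(\<lambda>n::int. t powi \<bar>n\<bar>) summable_on {0..}"
    using geo by (subst summable_on_reindex_bij_betw[of int UNIV, symmetric])
      (auto simp: bij_betw_def image_def intro: exI[of _ "nat _"])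
  have 2: "(\<lambda>n::int. t powi \<bar>n\<bar>) summable_on {..0}"
    using geo by (subst summable_on_reindex_bij_betw[of "\<lambda>n. - int n" UNIV, symmetric])
      (auto simp: bij_betw_def inj_on_def image_def intro: exI[of _ "nat (- _)"])
  have "(\<lambda>n::int. t powi \<bar>n\<bar>) summable_on {..<0}"
    by (rule summable_on_subset_banach[OF 2]) auto
  then have "(\<lambda>n::int. t powi \<bar>n\<bar>) summable_on {0..} \<union> {..<0}"
    by (intro summable_on_Un_disjoint 1) auto
  moreover have "{0..} \<union> {..<0} = (UNIV :: int set)" by auto
  ultimately show ?thesis by simp
qed

lemma weighted_coeff_summable:
  fixes a :: "int \<times> int \<Rightarrow> complex"
  assumes "1 < r" "r < \<rho>" "\<And>n m. cmod (a (n, m)) \<le> C * \<rho> powi - \<bar>n\<bar> * \<rho> powi - \<bar>m\<bar>"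
  shows "(\<lambda>x. cmod (a x) * r powi \<bar>fst x\<bar> * r powi \<bar>snd x\<bar>) summable_on UNIV"
proof -
  define t where "t = r / \<rho>"
  have t: "0 \<le> t" "t < 1" using assms by (auto simp: t_def)
  let ?g = "\<lambda>x::int \<times> int. t powi \<bar>fst x\<bar> * t powi \<bar>snd x\<bar>"
  note geo = summable_on_int_geometric[OF t]
  have nn: "0 \<le> t powi k" for k using t by (intro zero_le_power_int)
  have "(\<lambda>x. norm (?g x)) summable_on (SIGMA x:UNIV. UNIV)"
    unfolding Infinite_Sum.abs_summable_on_Sigma_iff
  proof (intro conjI ballI)
    show "(\<lambda>y. norm (?g (x, y))) summable_on UNIV" for x
      using summable_on_cmult_right[OF geo, of "t powi \<bar>x\<bar>"] nn by (simp add: abs_mult)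
    have "(\<lambda>x. t powi \<bar>x\<bar> * infsum (\<lambda>n::int. t powi \<bar>n\<bar>) UNIV) summable_on UNIV"
      by (rule summable_on_cmult_left[OF geo])
    then show "(\<lambda>x. norm (infsum (\<lambda>y. norm (?g (x, y))) UNIV)) summable_on (UNIV :: int set)"
      using nn by (simp add: abs_mult infsum_cmult_right geo abs_of_nonneg infsum_nonneg)
  qed
  then have "?g summable_on UNIV" using nn by (simp add: abs_mult)
  then have "(\<lambda>x::int \<times> int. C * (t powi \<bar>fst x\<bar> * t powi \<bar>snd x\<bar>)) summable_on UNIV"
    by (rule summable_on_cmult_right)
  then show ?thesis
  proof (rule summable_on_comparison_test)
    fix x :: "int \<times> int"
    have "cmod (a x) * (r powi \<bar>fst x\<bar> * r powi \<bar>snd x\<bar>)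
        \<le> C * \<rho> powi - \<bar>fst x\<bar> * \<rho> powi - \<bar>snd x\<bar> * (r powi \<bar>fst x\<bar> * r powi \<bar>snd x\<bar>)"
      using assms(3)[of "fst x" "snd x"] assms(1)
      by (intro mult_right_mono) (auto intro!: mult_nonneg_nonneg zero_le_power_int)
    also have "\<dots> = C * (t powi \<bar>fst x\<bar> * t powi \<bar>snd x\<bar>)"
      by (simp add: t_def power_int_divide_distrib power_int_minus field_simps)
    finally show "cmod (a x) * r powi \<bar>fst x\<bar> * r powi \<bar>snd x\<bar> \<le> C * (t powi \<bar>fst x\<bar> * t powi \<bar>snd x\<bar>)"
      by (simp add: mult_ac)
  qed (use assms(1) in \<open>auto intro!: mult_nonneg_nonneg zero_le_power_int\<close>)
qed

section \<open>The group of monomials of an invertible commuting pair\<close>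

definition int_power_op :: "('a::complex_hilbert \<Rightarrow>\<^sub>L 'a) \<Rightarrow> ('a \<Rightarrow>\<^sub>L 'a) \<Rightarrow> int \<Rightarrow> 'a \<Rightarrow>\<^sub>L 'a" where
  "int_power_op T S n = (if 0 \<le> n then power_op T (nat n) else power_op S (nat (- n)))"

lemma power_op_0 [simp]: "power_op T 0 = id_blinfun"
  by (simp add: power_op_def)

lemma power_op_Suc: "power_op T (Suc n) = T o\<^sub>L power_op T n"
  by (simp add: power_op_def)

lemma int_power_op_add_1:
  assumes "is_inverse_op T S" shows "int_power_op T S (n + 1) = T o\<^sub>L int_power_op T S n"
proof (cases "0 \<le> n")
  case True
  then show ?thesis by (simp add: int_power_op_def nat_add_distrib power_op_Suc)
next
  case False
  define k where "k = nat (- n) - 1"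
  have "nat (- n) = Suc k" "n + 1 = - int k" using False by (auto simp: k_def)
  then show ?thesis using assms False
    by (auto simp: int_power_op_def power_op_Suc is_inverse_op_def blinfun_eq_iff)
qed

lemma int_power_op_diff_1:
  assumes "is_inverse_op T S" shows "int_power_op T S (n - 1) = S o\<^sub>L int_power_op T S n"
  using int_power_op_add_1[OF assms, of "n - 1"] assms by (simp add: is_inverse_op_def blinfun_eq_iff)

lemma int_power_op_add:
  assumes "is_inverse_op T S" shows "int_power_op T S (n + m) = int_power_op T S n o\<^sub>L int_power_op T S m"
proof (induction n rule: int_induct[where k = 0])
  case base
  then show ?case by (simp add: int_power_op_def blinfun_eq_iff)
next
  case (step1 i)
  have "int_power_op T S ((i + m) + 1) = T o\<^sub>L int_power_op T S (i + m)" by (rule int_power_op_add_1[OF assms])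
  then show ?case using step1 int_power_op_add_1[OF assms, of i] by (simp add: blinfun_eq_iff algebra_simps)
next
  case (step2 i)
  have "int_power_op T S ((i + m) - 1) = S o\<^sub>L int_power_op T S (i + m)" by (rule int_power_op_diff_1[OF assms])
  then show ?case using step2 int_power_op_diff_1[OF assms, of i] by (simp add: blinfun_eq_iff algebra_simps)
qed

lemma inverse_op_commute:
  assumes "is_inverse_op T S" "T o\<^sub>L B = B o\<^sub>L T" shows "S o\<^sub>L B = B o\<^sub>L S"
proof (rule blinfun_eqI)
  fix x
  have T: "blinfun_apply T (blinfun_apply S y) = y" "blinfun_apply S (blinfun_apply T y) = y"
    "blinfun_apply T (blinfun_apply B y) = blinfun_apply B (blinfun_apply T y)" for y
    using assms unfolding is_inverse_op_def blinfun_eq_iff by auto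
  have "blinfun_apply S (blinfun_apply B x) = blinfun_apply S (blinfun_apply B (blinfun_apply T (blinfun_apply S x)))"
    by (simp only: T(1))
  also have "\<dots> = blinfun_apply B (blinfun_apply S x)" by (simp only: T(2) T(3)[symmetric])
  finally show "blinfun_apply (S o\<^sub>L B) x = blinfun_apply (B o\<^sub>L S) x" by simp
qed

lemma int_power_op_commute:
  assumes "is_inverse_op T S" "T o\<^sub>L B = B o\<^sub>L T"
  shows "int_power_op T S n o\<^sub>L B = B o\<^sub>L int_power_op T S n"
proof (induction n rule: int_induct[where k = 0])
  case base
  then show ?case by (simp add: int_power_op_def blinfun_eq_iff)
next
  case (step1 i)
  then show ?case using assms(2) int_power_op_add_1[OF assms(1), of i] by (simp add: blinfun_eq_iff)
next
  case (step2 i)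
  then show ?case using inverse_op_commute[OF assms] int_power_op_diff_1[OF assms(1), of i] by (simp add: blinfun_eq_iff)
qed

lemma clinear_op_inverse:
  assumes "is_inverse_op T S" "clinear_op T" shows "clinear_op S"
  unfolding clinear_op_def
proof (intro allI)
  fix c x
  have T: "blinfun_apply T (blinfun_apply S y) = y" "blinfun_apply S (blinfun_apply T y) = y" for y
    using assms unfolding is_inverse_op_def blinfun_eq_iff by auto
  have "blinfun_apply S (c *\<^sub>C blinfun_apply T (blinfun_apply S x)) = c *\<^sub>C blinfun_apply S x"
    using assms(2) T(2) by (simp add: clinear_op_def flip: T(2)) (metis T(2))
  then show "blinfun_apply S (c *\<^sub>C x) = c *\<^sub>C blinfun_apply S x" by (simp only: T(1))
qed

lemma clinear_op_power: "clinear_op T \<Longrightarrow> clinear_op (power_op T n)"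
  by (induction n) (auto simp: power_op_Suc intro: clinear_op_compose clinear_op_id)

lemma norm_power_op: assumes "norm T \<le> r" "1 \<le> r" shows "norm (power_op T n) \<le> r ^ n"
proof (induction n)
  case 0
  show ?case using norm_blinfun_id_le by simp
next
  case (Suc n)
  have "norm (power_op T (Suc n)) \<le> norm T * norm (power_op T n)"
    unfolding power_op_Suc by (rule norm_blinfun_compose)
  also have "\<dots> \<le> r * r ^ n" using Suc assms by (intro mult_mono) auto
  finally show ?case by simp
qed

lemma norm_int_power_op: "norm T \<le> r \<Longrightarrow> norm S \<le> r \<Longrightarrow> 1 \<le> r \<Longrightarrow> norm (int_power_op T S n) \<le> r powi \<bar>n\<bar>"
  using norm_power_op[of T r "nat n"] norm_power_op[of S r "nat (- n)"]
  by (auto simp: int_power_op_def power_int_def)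

lemma norm_scalar_op: "norm (scalar_op c) \<le> cmod c"
  by (rule norm_blinfun_bound) (auto simp: scalar_op.rep_eq norm_scaleC)

locale annulus_pair =
  fixes r :: real and T1 T2 S1 S2 :: "'h::complex_hilbert \<Rightarrow>\<^sub>L 'h"
  assumes r: "1 < r" and lin: "clinear_op T1" "clinear_op T2"
    and inv: "is_inverse_op T1 S1" "is_inverse_op T2 S2"
    and nrm: "norm T1 \<le> r" "norm S1 \<le> r" "norm T2 \<le> r" "norm S2 \<le> r"
    and com: "T1 o\<^sub>L T2 = T2 o\<^sub>L T1"
begin

definition mono :: "int \<times> int \<Rightarrow> 'h \<Rightarrow>\<^sub>L 'h" where
  "mono x = int_power_op T1 S1 (fst x) o\<^sub>L int_power_op T2 S2 (snd x)"

lemma mono_add: "mono (x + y) = mono x o\<^sub>L mono y"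
proof -
  have "T2 o\<^sub>L int_power_op T1 S1 n = int_power_op T1 S1 n o\<^sub>L T2" for n
    using int_power_op_commute[OF inv(1) com] by simp
  from int_power_op_commute[OF inv(2) this]
  have c: "int_power_op T2 S2 m o\<^sub>L int_power_op T1 S1 n = int_power_op T1 S1 n o\<^sub>L int_power_op T2 S2 m" for m n .
  have "blinfun_apply (mono (x + y)) h = blinfun_apply (mono x o\<^sub>L mono y) h" for h
    using c[of "snd x" "fst y"]
    by (simp add: mono_def int_power_op_add[OF inv(1)] int_power_op_add[OF inv(2)] blinfun_eq_iff)
  then show ?thesis by (rule blinfun_eqI)
qed

lemma mono_0: "mono (0, 0) = id_blinfun"
  by (simp add: mono_def int_power_op_def blinfun_eq_iff)

lemma clinear_mono: "clinear_op (mono x)"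
  using clinear_op_inverse[OF inv(1) lin(1)] clinear_op_inverse[OF inv(2) lin(2)] lin
  by (auto simp: mono_def int_power_op_def intro!: clinear_op_compose clinear_op_power)

lemma norm_mono: "norm (mono x) \<le> r powi \<bar>fst x\<bar> * r powi \<bar>snd x\<bar>"
proof -
  have "norm (mono x) \<le> norm (int_power_op T1 S1 (fst x)) * norm (int_power_op T2 S2 (snd x))"
    unfolding mono_def by (rule norm_blinfun_compose)
  also have "\<dots> \<le> r powi \<bar>fst x\<bar> * r powi \<bar>snd x\<bar>"
    using nrm r by (intro mult_mono norm_int_power_op) (auto intro: zero_le_power_int)
  finally show ?thesis .
qed

lemma mono_T: "mono (1, 0) = T1" "mono (0, 1) = T2" "mono (-1, 0) = S1" "mono (0, -1) = S2"
  by (simp_all add: mono_def int_power_op_def power_op_Suc blinfun_eq_iff eval_nat_numeral)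

lemma quantum_family_mono: "quantum_family r r (\<lambda>x. blinfun_apply (mono x) h)"
proof -
  have *: "sdom (\<lambda>x. blinfun_apply (mono (y + x)) h) (\<lambda>x. complex_of_real r *\<^sub>C blinfun_apply (mono x) h)"
    if "norm (mono y) \<le> r" for y
    unfolding sdom_def
  proof (intro allI impI)
    fix F :: "(int \<times> int) set" and c
    have "comb F c (\<lambda>x. blinfun_apply (mono (y + x)) h) = blinfun_apply (mono y) (comb F c (\<lambda>x. blinfun_apply (mono x) h))"
      by (simp add: mono_add clinear_op_sum_scaleC[OF clinear_mono])
    also have "norm \<dots> \<le> norm (mono y) * norm (comb F c (\<lambda>x. blinfun_apply (mono x) h))" by (rule norm_blinfun)
    also have "\<dots> \<le> r * norm (comb F c (\<lambda>x. blinfun_apply (mono x) h))" using that by (intro mult_right_mono) auto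
    also have "\<dots> = norm (comb F c (\<lambda>x. complex_of_real r *\<^sub>C blinfun_apply (mono x) h))"
      using r by (simp add: comb_scale_fam norm_scaleC)
    finally show "norm (comb F c (\<lambda>x. blinfun_apply (mono (y + x)) h)) \<le> norm (comb F c (\<lambda>x. complex_of_real r *\<^sub>C blinfun_apply (mono x) h))" .
  qed
  have "(1, 0) + x = (fst x + 1, snd x)" "(-1, 0) + x = (fst x - 1, snd x)"
    "(0, 1) + x = (fst x, snd x + 1)" "(0, -1) + x = (fst x, snd x - 1)" for x :: "int \<times> int"
    by (auto simp: plus_prod_def)
  then show ?thesis unfolding quantum_family_def using *[of "(1, 0)"] *[of "(-1, 0)"] *[of "(0, 1)"] *[of "(0, -1)"] nrm
    by (simp add: mono_T)
qed

lemma poly_op_mono: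
  assumes "degree p \<le> J" "\<And>j. degree (coeff p j) \<le> I"
  shows "poly_op p T1 T2 = (\<Sum>j\<le>J. \<Sum>i\<le>I. scalar_op (coeff (coeff p j) i) o\<^sub>L mono (int i, int j))"
  unfolding poly_op_alt[OF assms] by (intro sum.cong refl) (simp add: mono_def int_power_op_def blinfun_eq_iff)

lemma scalar_mono: "mono y o\<^sub>L (scalar_op c o\<^sub>L mono x) = scalar_op c o\<^sub>L mono (y + x)"
  using clinear_mono[of y] by (simp add: mono_add blinfun_eq_iff clinear_op_def scalar_op.rep_eq)

context
  fixes q :: "complex poly poly" and a C \<rho> J I
  assumes J: "degree q \<le> J" and I: "\<And>j. degree (coeff q j) \<le> I" and \<rho>: "\<rho> > r"
    and a: "\<And>n m. cmod (a (n, m)) \<le> C * \<rho> powi - \<bar>n\<bar> * \<rho> powi - \<bar>m\<bar>"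
    and conv: "\<And>n m. (\<Sum>j\<le>J. \<Sum>i\<le>I. coeff (coeff q j) i * a (n - int i, m - int j)) = (if n = 0 \<and> m = 0 then 1 else 0)"
begin

definition wgt :: "int \<times> int \<Rightarrow> real" where
  "wgt x = cmod (a x) * r powi \<bar>fst x\<bar> * r powi \<bar>snd x\<bar>"

text \<open>The condition \<open>conv\<close> says that \<open>a\<close> is the convolution inverse
  of the coefficients of \<open>q\<close>, so this sum is the candidate for the inverse of
  \<open>q(T1, T2)\<close>.\<close>

definition series :: "'h \<Rightarrow>\<^sub>L 'h" where
  "series = infsum (\<lambda>x. scalar_op (a x) o\<^sub>L mono x) UNIV"

lemma norm_term: "norm (scalar_op (a x) o\<^sub>L mono x) \<le> wgt x"
proof -
  have "norm (scalar_op (a x) o\<^sub>L mono x) \<le> norm (scalar_op (a x) :: 'h \<Rightarrow>\<^sub>L 'h) * norm (mono x)" by (rule norm_blinfun_compose)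
  also have "\<dots> \<le> cmod (a x) * (r powi \<bar>fst x\<bar> * r powi \<bar>snd x\<bar>)"
    by (intro mult_mono norm_scalar_op norm_mono) auto
  finally show ?thesis by (simp add: wgt_def mult_ac)
qed

lemma wgt_summable: "wgt summable_on UNIV"
  unfolding wgt_def using weighted_coeff_summable[OF r \<rho> a] .

lemma abs_summable_terms: "(\<lambda>x. norm (scalar_op (a x) o\<^sub>L mono x)) summable_on A"
  by (rule summable_on_comparison_test[OF summable_on_subset_banach[OF wgt_summable]]) (auto intro: norm_term)

lemma series_has_sum: "((\<lambda>x. scalar_op (a x) o\<^sub>L mono x) has_sum series) UNIV"
  unfolding series_def by (rule has_sum_infsum[OF abs_summable_summable[OF abs_summable_terms]])

text \<open>The bound involves \<open>a\<close> and \<open>r\<close> but not the operators. The same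
  finite \<open>F\<close> therefore serves the given pair and, through scalar pairs, all points of
  the biannulus.\<close>

lemma norm_series_diff:
  assumes "finite F" shows "norm (series - (\<Sum>x\<in>F. scalar_op (a x) o\<^sub>L mono x)) \<le> infsum wgt UNIV - sum wgt F"
proof -
  have "series - (\<Sum>x\<in>F. scalar_op (a x) o\<^sub>L mono x) = infsum (\<lambda>x. scalar_op (a x) o\<^sub>L mono x) (UNIV - F)"
    unfolding series_def using assms
    by (subst infsum_Diff) (auto intro!: abs_summable_summable abs_summable_terms)
  also have "norm \<dots> \<le> infsum (\<lambda>x. norm (scalar_op (a x) o\<^sub>L mono x)) (UNIV - F)"
    by (rule norm_infsum_bound[OF abs_summable_terms])
  also have "\<dots> \<le> infsum wgt (UNIV - F)"
    by (intro infsum_mono abs_summable_terms summable_on_subset_banach[OF wgt_summable] norm_term) auto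
  also have "\<dots> = infsum wgt UNIV - sum wgt F"
    using assms by (subst infsum_Diff) (auto intro: wgt_summable)
  finally show ?thesis .
qed

lemma series_shift:
  "((\<lambda>x. scalar_op (a (x - y)) o\<^sub>L mono x) has_sum (mono y o\<^sub>L series)) UNIV"
  "((\<lambda>x. scalar_op (a (x - y)) o\<^sub>L mono x) has_sum (series o\<^sub>L mono y)) UNIV"
proof -
  have bij: "bij_betw (\<lambda>x. y + x) UNIV UNIV"
    by (rule bij_betw_byWitness[of _ "\<lambda>x. x - y"]) auto
  have "((\<lambda>x. mono y o\<^sub>L (scalar_op (a x) o\<^sub>L mono x)) has_sum (mono y o\<^sub>L series)) UNIV"
    by (rule has_sum_compose_left[OF series_has_sum])
  then show "((\<lambda>x. scalar_op (a (x - y)) o\<^sub>L mono x) has_sum (mono y o\<^sub>L series)) UNIV"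
    unfolding scalar_mono using has_sum_reindex_bij_betw[OF bij, of "\<lambda>x. scalar_op (a (x - y)) o\<^sub>L mono x"] by simp
  have "((\<lambda>x. (scalar_op (a x) o\<^sub>L mono x) o\<^sub>L mono y) has_sum (series o\<^sub>L mono y)) UNIV"
    by (rule has_sum_compose_right[OF series_has_sum])
  moreover have "(scalar_op (a x) o\<^sub>L mono x) o\<^sub>L mono y = scalar_op (a x) o\<^sub>L mono (y + x)" for x
    using mono_add[of x y] by (simp add: add.commute blinfun_eq_iff)
  ultimately show "((\<lambda>x. scalar_op (a (x - y)) o\<^sub>L mono x) has_sum (series o\<^sub>L mono y)) UNIV"
    using has_sum_reindex_bij_betw[OF bij, of "\<lambda>x. scalar_op (a (x - y)) o\<^sub>L mono x"] by simp
qed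

lemma clinear_series: "clinear_op series"
proof -
  have "scalar_op c o\<^sub>L series = series o\<^sub>L scalar_op c" for c
  proof -
    have "((\<lambda>x. scalar_op c o\<^sub>L (scalar_op (a x) o\<^sub>L mono x)) has_sum (scalar_op c o\<^sub>L series)) UNIV"
      by (rule has_sum_compose_left[OF series_has_sum])
    moreover have "((\<lambda>x. (scalar_op (a x) o\<^sub>L mono x) o\<^sub>L scalar_op c) has_sum (series o\<^sub>L scalar_op c)) UNIV"
      by (rule has_sum_compose_right[OF series_has_sum])
    moreover have "scalar_op c o\<^sub>L (scalar_op (a x) o\<^sub>L mono x) = (scalar_op (a x) o\<^sub>L mono x) o\<^sub>L scalar_op c" for x
      using clinear_mono[of x] by (simp add: blinfun_eq_iff scalar_op.rep_eq clinear_op_def scaleC_scaleC mult.commute)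
    ultimately show ?thesis using has_sum_unique by fastforce
  qed
  then show ?thesis by (simp add: clinear_op_def blinfun_eq_iff scalar_op.rep_eq)
qed

text \<open>Both products expand into the same series over the monomials. By \<open>conv\<close> all
  its coefficients vanish except that of the identity.\<close>

lemma series_inverse: "is_inverse_op (poly_op q T1 T2) series"
proof -
  let ?M = "\<lambda>i j. scalar_op (coeff (coeff q j) i)"
  have coef: "(\<Sum>j\<le>J. \<Sum>i\<le>I. ?M i j o\<^sub>L (scalar_op (a (x - (int i, int j))) o\<^sub>L mono x)) = (if x = (0, 0) then id_blinfun else 0)" for x
  proof -
    have "(\<Sum>j\<le>J. \<Sum>i\<le>I. ?M i j o\<^sub>L (scalar_op (a (x - (int i, int j))) o\<^sub>L mono x))
      = scalar_op (\<Sum>j\<le>J. \<Sum>i\<le>I. coeff (coeff q j) i * a (x - (int i, int j))) o\<^sub>L mono x"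
      by (simp add: blinfun_eq_iff blinfun.sum_left scalar_op.rep_eq scaleC_scaleC scaleC_sum_left)
    also have "(\<Sum>j\<le>J. \<Sum>i\<le>I. coeff (coeff q j) i * a (x - (int i, int j))) = (if x = (0, 0) then 1 else 0)"
      using conv[of "fst x" "snd x"] by (cases x) (auto simp: minus_prod_def)
    finally show ?thesis using mono_0 by (auto simp: scalar_op_0 blinfun_eq_iff scalar_op.rep_eq)
  qed
  have id: "((\<lambda>x::int \<times> int. if x = (0, 0) then id_blinfun else 0 :: 'h \<Rightarrow>\<^sub>L 'h) has_sum id_blinfun) UNIV"
    by (rule has_sum_finite_neutralI[of "{(0, 0)}"]) auto
  have 1: "((\<lambda>x. \<Sum>j\<le>J. \<Sum>i\<le>I. ?M i j o\<^sub>L (scalar_op (a (x - (int i, int j))) o\<^sub>L mono x)) has_sum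
     (\<Sum>j\<le>J. \<Sum>i\<le>I. ?M i j o\<^sub>L (mono (int i, int j) o\<^sub>L series))) UNIV"
    by (intro has_sum_sum has_sum_compose_left series_shift)
  have 2: "((\<lambda>x. \<Sum>j\<le>J. \<Sum>i\<le>I. ?M i j o\<^sub>L (scalar_op (a (x - (int i, int j))) o\<^sub>L mono x)) has_sum
     (\<Sum>j\<le>J. \<Sum>i\<le>I. ?M i j o\<^sub>L (series o\<^sub>L mono (int i, int j)))) UNIV"
    by (intro has_sum_sum has_sum_compose_left series_shift)
  have "poly_op q T1 T2 o\<^sub>L series = (\<Sum>j\<le>J. \<Sum>i\<le>I. ?M i j o\<^sub>L (mono (int i, int j) o\<^sub>L series))"
    unfolding poly_op_mono[OF J I] by (simp add: blinfun_eq_iff blinfun.sum_left)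
  moreover have "series o\<^sub>L poly_op q T1 T2 = (\<Sum>j\<le>J. \<Sum>i\<le>I. ?M i j o\<^sub>L (series o\<^sub>L mono (int i, int j)))"
    unfolding poly_op_mono[OF J I] using clinear_series
    by (simp add: blinfun_eq_iff blinfun.sum_left blinfun.sum_right clinear_op_def scalar_op.rep_eq)
  ultimately show ?thesis unfolding is_inverse_op_def
    using has_sum_unique[OF 1[unfolded coef] id] has_sum_unique[OF 2[unfolded coef] id] by simp
qed

end

end

lemma laurent_reindex:
  assumes "finite F"
  shows "(\<Sum>k\<in>F. c k * z powi fst (g k) * w powi snd (g k)) = laurent (g ` F) (\<lambda>x. \<Sum>k | k \<in> F \<and> g k = x. c k) z w"
proof -
  have "(\<Sum>k\<in>F. c k * z powi fst (g k) * w powi snd (g k))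
      = (\<Sum>x\<in>g ` F. \<Sum>k | k \<in> F \<and> g k = x. c k * z powi fst (g k) * w powi snd (g k))"
    using assms by (intro sum.image_gen)
  also have "\<dots> = laurent (g ` F) (\<lambda>x. \<Sum>k | k \<in> F \<and> g k = x. c k) z w"
    unfolding laurent_def by (intro sum.cong refl) (simp add: sum_distrib_right)
  finally show ?thesis .
qed

lemma laurent_const_reindexed:
  fixes u :: "int \<times> int \<Rightarrow> 'a::complex_hilbert" and F :: "'k set"
  assumes "laurent_const r1 r2 K" "quantum_family r1 r2 u" "finite F"
    "\<And>z w. z \<in> bdry r1 \<Longrightarrow> w \<in> bdry r2 \<Longrightarrow> cmod (\<Sum>k\<in>F. c k * z powi fst (g k) * w powi snd (g k)) \<le> B"
  shows "norm (\<Sum>k\<in>F. c k *\<^sub>C u (g k)) \<le> K * B * norm (u (0, 0))"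
  unfolding comb_reindex[OF assms(3)] using assms(3,4)
  by (intro laurent_constD[OF assms(1,2)]) (simp_all flip: laurent_reindex)

text \<open>Scalar pairs on \<open>ell2\<close> turn the expansion of \<open>q(T)\<^sup>-\<^sup>1\<close> into that of the function \<open>1/q\<close>.\<close>

lemma scalar_annulus_pair:
  assumes r: "1 < r" and z: "inverse r \<le> cmod z" "cmod z \<le> r" and w: "inverse r \<le> cmod w" "cmod w \<le> r"
  shows "annulus_pair r (scalar_op z :: ell2 \<Rightarrow>\<^sub>L ell2) (scalar_op w) (scalar_op (inverse z)) (scalar_op (inverse w))"
proof -
  have ir: "0 < inverse r" using r by simp
  have nz: "z \<noteq> 0" "w \<noteq> 0" using z w ir by auto
  have i: "cmod (inverse z) \<le> r" "cmod (inverse w) \<le> r"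
    using le_imp_inverse_le[OF z(1) ir] le_imp_inverse_le[OF w(1) ir] by (simp_all add: norm_inverse)
  show ?thesis
    by unfold_locales
       (use r nz i z w in \<open>auto simp: clinear_op_def is_inverse_op_def blinfun_eq_iff scalar_op.rep_eq scaleC_scaleC mult.commute intro: order_trans[OF norm_scalar_op]\<close>)
qed

lemma power_op_scalar: "power_op (scalar_op z) n = scalar_op (z ^ n)"
  by (induction n) (simp_all add: power_op_Suc blinfun_eq_iff scalar_op.rep_eq scaleC_scaleC)

lemma int_power_op_scalar: "int_power_op (scalar_op z) (scalar_op (inverse z)) n = scalar_op (z powi n)"
  by (simp add: int_power_op_def power_op_scalar power_int_def)

lemma cmod_eq_norm_scalar_ell2: "cmod c = norm (scalar_op c :: ell2 \<Rightarrow>\<^sub>L ell2)"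
proof (rule antisym)
  have "norm (blinfun_apply (scalar_op c) (ell2_unit 0)) \<le> norm (scalar_op c :: ell2 \<Rightarrow>\<^sub>L ell2) * norm (ell2_unit 0)"
    by (rule norm_blinfun)
  then show "cmod c \<le> norm (scalar_op c :: ell2 \<Rightarrow>\<^sub>L ell2)" by (simp add: scalar_op.rep_eq norm_scaleC)
qed (rule norm_scalar_op)

lemma reciprocal_laurent_approx:
  assumes r: "1 < r" and z: "inverse r \<le> cmod z" "cmod z \<le> r" and w: "inverse r \<le> cmod w" "cmod w \<le> r"
    and J: "degree q \<le> J" and I: "\<And>j. degree (coeff q j) \<le> I" and \<rho>: "\<rho> > r"
    and a: "\<And>n m. cmod (a (n, m)) \<le> C * \<rho> powi - \<bar>n\<bar> * \<rho> powi - \<bar>m\<bar>"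
    and conv: "\<And>n m. (\<Sum>j\<le>J. \<Sum>i\<le>I. coeff (coeff q j) i * a (n - int i, m - int j)) = (if n = 0 \<and> m = 0 then 1 else 0)"
    and F: "finite F"
  defines "W \<equiv> \<lambda>x. cmod (a x) * r powi \<bar>fst x\<bar> * r powi \<bar>snd x\<bar>"
  shows "cmod (1 / poly_at q (z, w) - (\<Sum>x\<in>F. a x * z powi fst x * w powi snd x)) \<le> infsum W UNIV - sum W F"
proof -
  interpret annulus_pair r "scalar_op z :: ell2 \<Rightarrow>\<^sub>L ell2" "scalar_op w" "scalar_op (inverse z)" "scalar_op (inverse w)"
    by (rule scalar_annulus_pair[OF r z w])
  have m: "mono x = scalar_op (z powi fst x * w powi snd x)" for x
    by (simp add: mono_def int_power_op_scalar blinfun_eq_iff scalar_op.rep_eq scaleC_scaleC)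
  have q: "poly_op q (scalar_op z) (scalar_op w) = (scalar_op (poly_at q (z, w)) :: ell2 \<Rightarrow>\<^sub>L ell2)"
    unfolding poly_op_alt[OF J I] poly_at_eq_sum[OF J I]
    by (simp add: power_op_scalar blinfun_eq_iff scalar_op.rep_eq scaleC_scaleC scaleC_sum_left blinfun.sum_left mult.assoc)
  have inv: "is_inverse_op (poly_op q (scalar_op z) (scalar_op w)) (series a)"
    by (rule series_inverse[OF J I \<rho> a conv])
  define Q where "Q = poly_at q (z, w)"
  have e: "Q *\<^sub>C blinfun_apply (series a) h = h" for h
    using inv unfolding is_inverse_op_def q blinfun_eq_iff by (simp add: scalar_op.rep_eq Q_def)
  \<comment> \<open>That \<open>q\<close> does not vanish at the point follows from the
    invertibility of the scalar operator \<open>Q\<close>.\<close>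
  have "Q \<noteq> 0"
  proof
    assume "Q = 0"
    then have "ell2_unit 0 = 0" using e[of "ell2_unit 0"] by simp
    then show False using norm_ell2_unit[of 0] by simp
  qed
  then have "blinfun_apply (series a) h = (1 / Q) *\<^sub>C h" for h
    using arg_cong[OF e[of h], of "\<lambda>x. (1 / Q) *\<^sub>C x"] by (simp add: scaleC_scaleC)
  then have s: "series a = scalar_op (1 / Q)" by (simp add: blinfun_eq_iff scalar_op.rep_eq)
  have "series a - (\<Sum>x\<in>F. scalar_op (a x) o\<^sub>L mono x) = scalar_op (1 / Q - (\<Sum>x\<in>F. a x * z powi fst x * w powi snd x))"
    unfolding s m
    by (simp add: blinfun_eq_iff scalar_op.rep_eq scaleC_scaleC blinfun.diff_left scaleC_diff_left scaleC_sum_left blinfun.sum_left mult.assoc)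
  then show ?thesis
    using norm_series_diff[OF J I \<rho> a conv F] unfolding cmod_eq_norm_scalar_ell2 Q_def W_def wgt_def[OF J I \<rho> a conv]
    by simp
qed

section \<open>The Koszul complex and the passage from Laurent polynomials to rational
  functions\<close>

text \<open>One invertible member of a commuting pair suffices: its inverse commutes with the other
  member and yields a contracting homotopy of the Koszul complex.\<close>

lemma koszul_exact_left:
  assumes "is_inverse_op A R" "A o\<^sub>L B = B o\<^sub>L A" shows "koszul_exact A B"
proof -
  have i: "blinfun_apply A (blinfun_apply R x) = x" "blinfun_apply R (blinfun_apply A x) = x" for x
    using assms(1) by (auto simp: is_inverse_op_def blinfun_eq_iff)
  have c: "blinfun_apply R (blinfun_apply B x) = blinfun_apply B (blinfun_apply R x)"
    "blinfun_apply A (blinfun_apply B x) = blinfun_apply B (blinfun_apply A x)" for x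
    using inverse_op_commute[OF assms] assms(2) by (auto simp: blinfun_eq_iff)
  show ?thesis unfolding koszul_exact_def Let_def
  proof (intro conjI)
    show "inj (\<lambda>x. (blinfun_apply A x, blinfun_apply B x))"
      by (intro injI) (metis i(2) prod.inject)
    show "range (\<lambda>x. (blinfun_apply A x, blinfun_apply B x)) = {p. (case p of (x, y) \<Rightarrow> blinfun_apply A y - blinfun_apply B x) = 0}"
    proof (intro set_eqI iffI)
      fix p assume "p \<in> {p. (case p of (x, y) \<Rightarrow> blinfun_apply A y - blinfun_apply B x) = 0}"
      then have "blinfun_apply A (snd p) = blinfun_apply B (fst p)" by (auto simp: case_prod_unfold)
      then have "p = (blinfun_apply A (blinfun_apply R (fst p)), blinfun_apply B (blinfun_apply R (fst p)))"
        by (metis c(1) i prod.collapse)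
      then show "p \<in> range (\<lambda>x. (blinfun_apply A x, blinfun_apply B x))" by blast
    qed (auto simp: c(2))
    show "surj (\<lambda>(x, y). blinfun_apply A y - blinfun_apply B x)"
      by (rule surjI[of _ "\<lambda>z. (0, blinfun_apply R z)"]) (simp add: i)
  qed
qed

lemma koszul_exact_right:
  assumes "is_inverse_op B R" "A o\<^sub>L B = B o\<^sub>L A" shows "koszul_exact A B"
proof -
  have i: "blinfun_apply B (blinfun_apply R x) = x" "blinfun_apply R (blinfun_apply B x) = x" for x
    using assms(1) by (auto simp: is_inverse_op_def blinfun_eq_iff)
  have c: "blinfun_apply R (blinfun_apply A x) = blinfun_apply A (blinfun_apply R x)"
    "blinfun_apply A (blinfun_apply B x) = blinfun_apply B (blinfun_apply A x)" for x
    using inverse_op_commute[OF assms(1) assms(2)[symmetric]] assms(2) by (auto simp: blinfun_eq_iff)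
  show ?thesis unfolding koszul_exact_def Let_def
  proof (intro conjI)
    show "inj (\<lambda>x. (blinfun_apply A x, blinfun_apply B x))"
      by (intro injI) (metis i(2) prod.inject)
    show "range (\<lambda>x. (blinfun_apply A x, blinfun_apply B x)) = {p. (case p of (x, y) \<Rightarrow> blinfun_apply A y - blinfun_apply B x) = 0}"
    proof (intro set_eqI iffI)
      fix p assume "p \<in> {p. (case p of (x, y) \<Rightarrow> blinfun_apply A y - blinfun_apply B x) = 0}"
      then have "blinfun_apply A (snd p) = blinfun_apply B (fst p)" by (auto simp: case_prod_unfold)
      then have "p = (blinfun_apply A (blinfun_apply R (snd p)), blinfun_apply B (blinfun_apply R (snd p)))"
        by (metis c(1) i prod.collapse)
      then show "p \<in> range (\<lambda>x. (blinfun_apply A x, blinfun_apply B x))" by blast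
    qed (auto simp: c(2))
    show "surj (\<lambda>(x, y). blinfun_apply A y - blinfun_apply B x)"
      by (rule surjI[of _ "\<lambda>z. (- blinfun_apply R z, 0)"]) (simp add: i blinfun.minus_right)
  qed
qed

text \<open>The expansion of \<open>1/q\<close> does both parts. It inverts \<open>z - l1\<close> or
  \<open>w - l2\<close> for a point outside the biannulus, which gives the spectral inclusion, and
  its partial sums reduce \<open>p/q\<close> to Laurent polynomials.\<close>

lemma laurent_const_imp_K_spectral_set:
  fixes T1 T2 :: "'h::complex_hilbert \<Rightarrow>\<^sub>L 'h"
  assumes r: "1 < r" and K: "0 < K" and laurent_const: "laurent_const r r K"
    and T: "T1 \<in> quantum_annulus r" "T2 \<in> quantum_annulus r" and com: "T1 o\<^sub>L T2 = T2 o\<^sub>L T1"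
  shows "K_spectral_set K (closed_biannulus r) T1 T2"
proof -
  obtain S1 S2 where S: "is_inverse_op T1 S1" "is_inverse_op T2 S2" "norm S1 \<le> r" "norm S2 \<le> r"
    using T by (auto simp: quantum_annulus_def)
  interpret annulus_pair r T1 T2 S1 S2
    by unfold_locales (use r T S com in \<open>auto simp: quantum_annulus_def\<close>)
  have X: "x \<in> closed_biannulus r \<longleftrightarrow> cmod (fst x) \<in> {inverse r..r} \<and> cmod (snd x) \<in> {inverse r..r}" for x
    by (cases x) (auto simp: closed_biannulus_def closure_annulus[OF r])
  have poly_inv: "\<exists>R. is_inverse_op (poly_op q T1 T2) R" if "\<And>x. x \<in> closed_biannulus r \<Longrightarrow> poly_at q x \<noteq> 0" for q
  proof -
    have "poly_at q (z, w) \<noteq> 0" if "cmod z \<in> {inverse r..r}" "cmod w \<in> {inverse r..r}" for z w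
      using that by (intro \<open>\<And>x. x \<in> closed_biannulus r \<Longrightarrow> poly_at q x \<noteq> 0\<close>) (simp add: X)
    then obtain a C \<rho> where \<rho>: "\<rho> > r"
      and "\<And>n m. cmod (a (n, m)) \<le> C * \<rho> powi - \<bar>n\<bar> * \<rho> powi - \<bar>m\<bar>"
      and "\<And>n m. (\<Sum>j\<le>degree q. \<Sum>i\<le>(\<Sum>k\<le>degree q. degree (coeff q k)). coeff (coeff q j) i * a (n - int i, m - int j)) = (if n = 0 \<and> m = 0 then 1 else 0)"
      by (rule reciprocal_laurent[OF r _ order_refl degree_coeff_bound]) (assumption | rule that)+
    from series_inverse[OF order_refl degree_coeff_bound this] show ?thesis by blast
  qed
  have spec: "taylor_spectrum T1 T2 \<subseteq> closed_biannulus r"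
  proof
    fix x assume x: "x \<in> taylor_spectrum T1 T2"
    obtain l1 l2 where l: "x = (l1, l2)" by fastforce
    have nk: "\<not> koszul_exact (T1 - scalar_op l1) (T2 - scalar_op l2)" using x by (simp add: l taylor_spectrum_def)
    have lin': "clinear_op T1" "clinear_op T2" using lin by auto
    have com': "(T1 - scalar_op l1) o\<^sub>L (T2 - scalar_op l2) = (T2 - scalar_op l2) o\<^sub>L (T1 - scalar_op l1)"
      using com lin' by (simp add: blinfun_eq_iff blinfun.diff_left blinfun.diff_right scalar_op.rep_eq clinear_op_def
          scaleC_diff_right scaleC_scaleC mult.commute algebra_simps)
    show "x \<in> closed_biannulus r"
    proof (rule ccontr)
      assume nx: "x \<notin> closed_biannulus r"
      \<comment> \<open>A point outside the product misses at least one factor, so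
        \<open>z - l1\<close> or \<open>w - l2\<close> has no zero on the biannulus.\<close>
      define q1 where "q1 = monom (monom 1 1) 0 + monom (monom (- l1) 0) 0"
      define q2 where "q2 = monom (monom 1 0) 1 + monom (monom (- l2) 0) 0"
      have at: "poly_at q1 (z, w) = z - l1" "poly_at q2 (z, w) = w - l2" for z w
        by (simp_all add: q1_def q2_def poly_at_def poly_monom)
      have op: "poly_op q1 T1 T2 = T1 - scalar_op l1" "poly_op q2 T1 T2 = T2 - scalar_op l2"
        unfolding q1_def q2_def poly_op_add poly_op_monom
        by (simp_all add: blinfun_eq_iff blinfun.diff_left blinfun.add_left scalar_op.rep_eq power_op_Suc eval_nat_numeral scaleC_minus_left)
      have "l1 \<notin> fst ` closed_biannulus r \<or> l2 \<notin> snd ` closed_biannulus r"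
        using nx by (auto simp: X l)
      then show False
      proof
        assume "l1 \<notin> fst ` closed_biannulus r"
        then have "poly_at q1 x \<noteq> 0" if "x \<in> closed_biannulus r" for x
          using that at(1)[of "fst x" "snd x"] by force
        from poly_inv[OF this] show False using koszul_exact_left com' nk unfolding op by blast
      next
        assume "l2 \<notin> snd ` closed_biannulus r"
        then have "poly_at q2 x \<noteq> 0" if "x \<in> closed_biannulus r" for x
          using that at(2)[of "fst x" "snd x"] by force
        from poly_inv[OF this] show False using koszul_exact_right com' nk unfolding op by blast
      qed
    qed
  qed
  have "norm (rat_op f T1 T2) \<le> K * rat_sup_norm (closed_biannulus r) f" if f: "f \<in> Rat_on (closed_biannulus r)" for f
  proof -
    obtain p q where pq: "f = (p, q)" by fastforce
    have nz: "\<And>x. x \<in> closed_biannulus r \<Longrightarrow> poly_at q x \<noteq> 0" using f by (auto simp: Rat_on_def pq)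
    define Iq where "Iq = (\<Sum>k\<le>degree q. degree (coeff q k))"
    define Ip where "Ip = (\<Sum>k\<le>degree p. degree (coeff p k))"
    note Jq = order_refl[of "degree q"] and Iq = degree_coeff_bound[of q, folded Iq_def]
    note Jp = order_refl[of "degree p"] and Ip = degree_coeff_bound[of p, folded Ip_def]
    have "poly_at q (z, w) \<noteq> 0" if "cmod z \<in> {inverse r..r}" "cmod w \<in> {inverse r..r}" for z w
      using that by (intro nz) (simp add: X)
    then obtain a C \<rho> where a: "\<rho> > r"
      "\<And>n m. cmod (a (n, m)) \<le> C * \<rho> powi - \<bar>n\<bar> * \<rho> powi - \<bar>m\<bar>"
      "\<And>n m. (\<Sum>j\<le>degree q. \<Sum>i\<le>Iq. coeff (coeff q j) i * a (n - int i, m - int j)) = (if n = 0 \<and> m = 0 then 1 else 0)"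
      by (rule reciprocal_laurent[OF r _ Jq Iq]) (assumption | rule that)+
    note ser = series_inverse[OF Jq Iq a]
    let ?S = "series a"
    let ?w = "\<lambda>x. cmod (a x) * r powi \<bar>fst x\<bar> * r powi \<bar>snd x\<bar>"
    have ws: "?w summable_on UNIV" by (rule weighted_coeff_summable[OF r a(1,2)])
    have rat: "rat_op f T1 T2 = poly_op p T1 T2 o\<^sub>L ?S"
      by (simp add: rat_op_def pq inverse_op_eqI[OF ser])
    define M where "M = rat_sup_norm (closed_biannulus r) f"
    have cmp: "compact (closed_biannulus r)"
    proof -
      have "bounded (closure (annulus r))" unfolding bounded_iff closure_annulus[OF r] by auto
      then show ?thesis unfolding closed_biannulus_def by (intro compact_Times) (auto simp: compact_eq_bounded_closed)
    qed
    have bd: "bdd_above ((\<lambda>x. cmod (poly_at p x / poly_at q x)) ` closed_biannulus r)"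
      by (intro compact_imp_bounded[THEN bounded_imp_bdd_above] compact_continuous_image cmp continuous_intros continuous_on_poly_at)
         (use nz in auto)
    have M: "cmod (poly_at p x / poly_at q x) \<le> M" if "x \<in> closed_biannulus r" for x
      unfolding M_def rat_sup_norm_def pq prod.case using that bd by (intro cSUP_upper) auto
    obtain P where P: "\<And>x. x \<in> closed_biannulus r \<Longrightarrow> cmod (poly_at p x) \<le> P" "P \<ge> 0"
    proof -
      have "bounded (poly_at p ` closed_biannulus r)"
        by (intro compact_imp_bounded compact_continuous_image cmp continuous_on_poly_at)
      then obtain P where "\<forall>x\<in>closed_biannulus r. cmod (poly_at p x) \<le> P" unfolding bounded_iff by auto
      moreover have "(1, 1) \<in> closed_biannulus r" using r by (simp add: X field_simps)
      ultimately show ?thesis using that[of P] norm_ge_zero order_trans by blast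
    qed
    \<comment> \<open>The finite set \<open>F\<close> truncates the expansion of \<open>1/q\<close>
      with error at most \<open>e\<close>, in operator norm as well as uniformly on the biannulus.
      The product of \<open>p\<close> with the partial sum is then a Laurent polynomial bounded by
      \<open>M + P * e\<close> on the tori.\<close>
    have main: "norm (blinfun_apply (rat_op f T1 T2) h) \<le> K * M * norm h + e * ((K * P + norm (poly_op p T1 T2)) * norm h)"
      if e: "e > 0" for h e
    proof -
      obtain F where F: "finite F" "dist (sum ?w F) (infsum ?w UNIV) \<le> e"
        using infsum_finite_approximation[OF ws e] by auto
      define tail where "tail = infsum ?w UNIV - sum ?w F"
      have tail: "tail \<le> e" using F(2) by (auto simp: tail_def dist_real_def)
      define SF where "SF = (\<Sum>x\<in>F. scalar_op (a x) o\<^sub>L mono x)"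
      have SF: "norm (?S - SF) \<le> tail"
        using norm_series_diff[OF Jq Iq a F(1)] unfolding SF_def tail_def wgt_def[OF Jq Iq a] .
      define G where "G = F \<times> {..degree p} \<times> {..Ip}"
      define cc where "cc = (\<lambda>(x, j, i). coeff (coeff p j) i * a x)"
      define g where "g = (\<lambda>(x::int \<times> int, j::nat, i::nat). (int i + fst x, int j + snd x))"
      have fin: "finite G" using F by (simp add: G_def)
      have Gsum: "(\<Sum>k\<in>G. f k) = (\<Sum>x\<in>F. \<Sum>j\<le>degree p. \<Sum>i\<le>Ip. f (x, j, i))" for f :: "_ \<Rightarrow> 'x::comm_monoid_add"
        by (simp add: G_def sum.cartesian_product case_prod_unfold)
      have e1: "blinfun_apply (poly_op p T1 T2 o\<^sub>L SF) h = (\<Sum>k\<in>G. cc k *\<^sub>C blinfun_apply (mono (g k)) h)"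
      proof -
        have "scalar_op (coeff (coeff p j) i) o\<^sub>L mono (int i, int j) o\<^sub>L (scalar_op (a x) o\<^sub>L mono x)
            = scalar_op (coeff (coeff p j) i * a x) o\<^sub>L mono (int i + fst x, int j + snd x)" for i j x
          using scalar_mono[of "(int i, int j)" "a x" x]
          by (cases x) (simp add: blinfun_eq_iff scalar_op.rep_eq scaleC_scaleC plus_prod_def flip: scaleC_scaleC)
        then have "blinfun_apply (scalar_op (coeff (coeff p j) i)) (blinfun_apply (mono (int i, int j)) (blinfun_apply (scalar_op (a x)) (blinfun_apply (mono x) h)))
            = (coeff (coeff p j) i * a x) *\<^sub>C blinfun_apply (mono (int i + fst x, int j + snd x)) h" for i j x
          by (simp add: blinfun_eq_iff scalar_op.rep_eq)
        then show ?thesis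
          unfolding poly_op_mono[OF Jp Ip] SF_def Gsum cc_def g_def prod.case
          by (simp add: blinfun.sum_left blinfun.sum_right)
      qed
      have e2: "(\<Sum>k\<in>G. cc k * z powi fst (g k) * w powi snd (g k)) = poly_at p (z, w) * (\<Sum>x\<in>F. a x * z powi fst x * w powi snd x)"
        if "z \<noteq> 0" "w \<noteq> 0" for z w
        unfolding poly_at_eq_sum[OF Jp Ip] Gsum cc_def g_def prod.case sum_distrib_left[of _ _ F]
        using that by (simp add: power_int_add mult_ac sum_distrib_left)
      have "norm (\<Sum>k\<in>G. cc k *\<^sub>C blinfun_apply (mono (g k)) h) \<le> K * (M + P * tail) * norm (blinfun_apply (mono (0, 0)) h)"
      proof (rule laurent_const_reindexed[OF laurent_const quantum_family_mono fin])
        fix z w assume zw: "z \<in> bdry r" "w \<in> bdry r"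
        have "inverse r \<le> 1" "0 < inverse r" using r by (auto simp: inverse_le_1_iff)
        then have "inverse r \<le> r" "0 < inverse r" using r by linarith+
        then have b: "inverse r \<le> cmod z" "cmod z \<le> r" "inverse r \<le> cmod w" "cmod w \<le> r" "z \<noteq> 0" "w \<noteq> 0"
          using zw r by (auto simp: bdry_def)
        then have x: "(z, w) \<in> closed_biannulus r" by (simp add: X)
        let ?L = "\<Sum>x\<in>F. a x * z powi fst x * w powi snd x"
        have t: "cmod (1 / poly_at q (z, w) - ?L) \<le> tail"
          unfolding tail_def by (rule reciprocal_laurent_approx[OF r b(1-4) Jq Iq a F(1)])
        have "poly_at p (z, w) * ?L = poly_at p (z, w) / poly_at q (z, w) - poly_at p (z, w) * (1 / poly_at q (z, w) - ?L)"
          by (simp add: algebra_simps)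
        also have "cmod \<dots> \<le> cmod (poly_at p (z, w) / poly_at q (z, w)) + cmod (poly_at p (z, w)) * cmod (1 / poly_at q (z, w) - ?L)"
          by (rule order_trans[OF norm_triangle_ineq4]) (simp add: norm_mult)
        also have "\<dots> \<le> M + P * tail" using M[OF x] P(1)[OF x] P(2) t by (intro add_mono mult_mono) auto
        finally show "cmod (\<Sum>k\<in>G. cc k * z powi fst (g k) * w powi snd (g k)) \<le> M + P * tail"
          using e2 b by simp
      qed
      also have "\<dots> \<le> K * (M + P * e) * norm h"
        using K P(2) tail by (simp add: mono_0) (intro mult_right_mono mult_left_mono add_left_mono, auto)
      finally have 1: "norm (blinfun_apply (poly_op p T1 T2 o\<^sub>L SF) h) \<le> K * (M + P * e) * norm h"
        unfolding e1 .
      have "norm (blinfun_apply (poly_op p T1 T2) (blinfun_apply (?S - SF) h)) \<le> norm (poly_op p T1 T2) * (norm (?S - SF) * norm h)"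
        by (intro order_trans[OF norm_blinfun] mult_left_mono norm_blinfun) auto
      also have "\<dots> \<le> norm (poly_op p T1 T2) * (e * norm h)"
        using SF tail by (intro mult_left_mono mult_right_mono) auto
      finally have 2: "norm (blinfun_apply (poly_op p T1 T2) (blinfun_apply (?S - SF) h)) \<le> norm (poly_op p T1 T2) * (e * norm h)" .
      have "blinfun_apply (rat_op f T1 T2) h = blinfun_apply (poly_op p T1 T2 o\<^sub>L SF) h + blinfun_apply (poly_op p T1 T2) (blinfun_apply (?S - SF) h)"
        by (simp add: rat blinfun.diff_left blinfun.diff_right)
      then show ?thesis using norm_triangle_mono[OF 1 2] by (simp add: algebra_simps)
    qed
    have "norm (blinfun_apply (rat_op f T1 T2) h) \<le> K * M * norm h" for h
    proof (rule field_le_epsilon)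
      fix e :: real assume e: "e > 0"
      define D where "D = (K * P + norm (poly_op p T1 T2)) * norm h"
      have D: "D \<ge> 0" unfolding D_def using K P(2) by (intro mult_nonneg_nonneg add_nonneg_nonneg) auto
      have "e / (D + 1) > 0" using e D by (intro divide_pos_pos) auto
      from main[OF this, of h, folded D_def]
      have "norm (blinfun_apply (rat_op f T1 T2) h) \<le> K * M * norm h + e / (D + 1) * D" .
      also have "e / (D + 1) * D \<le> e" using D e by (simp add: field_simps)
      finally show "norm (blinfun_apply (rat_op f T1 T2) h) \<le> K * M * norm h + e" by simp
    qed
    moreover have "(1, 1) \<in> closed_biannulus r" using r by (simp add: X field_simps)
    then have "0 \<le> M" by (rule order_trans[OF norm_ge_zero M])
    ultimately show ?thesis unfolding M_def[symmetric] using K by (intro norm_blinfun_bound) auto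
  qed
  then show ?thesis using spec by (simp add: K_spectral_set_def)
qed

section \<open>Direct sums of Hilbert spaces\<close>

instantiation prod :: (complex_hilbert, complex_hilbert) complex_hilbert
begin

definition scaleC_prod :: "complex \<Rightarrow> 'a \<times> 'b \<Rightarrow> 'a \<times> 'b" where
  "scaleC_prod c x = (c *\<^sub>C fst x, c *\<^sub>C snd x)"

definition cinner_prod :: "'a \<times> 'b \<Rightarrow> 'a \<times> 'b \<Rightarrow> complex" where
  "cinner_prod x y = cinner (fst x) (fst y) + cinner (snd x) (snd y)"

instance
proof
  fix x y z :: "'a \<times> 'b" and a b :: complex and c :: real
  show "complex_of_real c *\<^sub>C x = c *\<^sub>R x" by (simp add: scaleC_prod_def scaleC_of_real scaleR_prod_def)
  show "a *\<^sub>C (x + y) = a *\<^sub>C x + a *\<^sub>C y" by (simp add: scaleC_prod_def scaleC_add_right)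
  show "(a + b) *\<^sub>C x = a *\<^sub>C x + b *\<^sub>C x" by (simp add: scaleC_prod_def scaleC_add_left)
  show "a *\<^sub>C b *\<^sub>C x = (a * b) *\<^sub>C x" by (simp add: scaleC_prod_def scaleC_scaleC)
  show "cinner x y = cnj (cinner y x)" by (simp add: cinner_prod_def cnj_cinner)
  show "cinner x (y + z) = cinner x y + cinner x z" by (simp add: cinner_prod_def cinner_add_right)
  show "cinner x (a *\<^sub>C y) = a * cinner x y"
    by (simp add: cinner_prod_def scaleC_prod_def cinner_scaleC_right distrib_left)
  show "0 \<le> Re (cinner x x)" by (simp add: cinner_prod_def cinner_ge_zero)
  show "norm x = sqrt (Re (cinner x x))" by (simp add: cinner_prod_def norm_prod_def norm_sq_cinner)
qed

end

section \<open>Unitary extension by Householder reflections\<close>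

definition unitary :: "('a::complex_hilbert \<Rightarrow> 'a) \<Rightarrow> bool" where
  "unitary U \<longleftrightarrow> (\<forall>x y. U (x + y) = U x + U y) \<and> (\<forall>c x. U (c *\<^sub>C x) = c *\<^sub>C U x) \<and>
    (\<forall>x y. cinner (U x) (U y) = cinner x y) \<and> surj U"

lemma unitary_inj: assumes "unitary U" shows "inj U"
proof (rule injI)
  fix x y assume xy: "U x = U y"
  have "U (x + (-1) *\<^sub>C y) = U x + (-1) *\<^sub>C U y" using assms unfolding unitary_def by metis
  then have "U (x - y) = 0" using xy by (simp add: scaleC_minus_left)
  moreover have "cinner (U (x - y)) (U (x - y)) = cinner (x - y) (x - y)" using assms unfolding unitary_def by blast
  ultimately have "cinner (x - y) (x - y) = 0" by simp
  then show "x = y" by (simp add: cinner_self)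
qed

lemma unitary_compose: "unitary U \<Longrightarrow> unitary V \<Longrightarrow> unitary (U \<circ> V)"
  using comp_surj[of V U] unfolding unitary_def by simp

lemma unitary_inv:
  assumes "unitary U" shows "unitary (inv U)"
proof -
  note inj = unitary_inj[OF assms]
  have surj: "surj U" using assms by (simp add: unitary_def)
  have f: "U (inv U x) = x" for x using surj by (simp add: surj_f_inv_f)
  have "inv U (x + y) = inv U x + inv U y" for x y
    by (rule inv_f_eq[OF inj]) (use assms f in \<open>simp add: unitary_def\<close>)
  moreover have "inv U (c *\<^sub>C x) = c *\<^sub>C inv U x" for c x
    by (rule inv_f_eq[OF inj]) (use assms f in \<open>simp add: unitary_def\<close>)
  moreover have "cinner (inv U x) (inv U y) = cinner x y" for x y
    using assms f unfolding unitary_def by metis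
  moreover have "surj (inv U)" using inj by (rule inj_imp_surj_inv)
  ultimately show ?thesis unfolding unitary_def by blast
qed

text \<open>The coefficient of the reflection is not the usual \<open>2 / \<parallel>w\<parallel>\<^sup>2\<close> because \<open>\<langle>u, v\<rangle>\<close> need not be real.\<close>

lemma householder:
  fixes u v :: "'a::complex_hilbert"
  assumes "norm u = norm v"
  obtains R where "unitary R" "R u = v" "\<And>x. cinner u x = cinner v x \<Longrightarrow> R x = x"
proof (cases "u = v")
  case True
  have "unitary (\<lambda>x::'a. x)" by (auto simp: unitary_def)
  then show ?thesis using that[of "\<lambda>x. x"] True by auto
next
  case False
  define w where "w = u - v"
  \<comment> \<open>This value forces \<open>R u = u - w = v\<close>. That \<open>R\<close> is
    isometric is the identity \<open>key\<close> below, where the equality of the norms enters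
    through \<open>ww\<close>.\<close>
  define \<tau> where "\<tau> = 1 / cinner w u"
  define R where "R = (\<lambda>x. x - (\<tau> * cinner w x) *\<^sub>C w)"
  have uv: "cinner u u = cinner v v" using assms by (simp add: cinner_self)
  have ww: "cinner w w = cinner w u + cnj (cinner w u)"
    by (simp add: w_def cinner_diff_left cinner_diff_right cnj_cinner uv algebra_simps)
  have "cinner w w \<noteq> 0" using False by (simp add: w_def cinner_self)
  then have nz: "cinner w u \<noteq> 0" using ww by auto
  have key: "cnj \<tau> * \<tau> * cinner w w = \<tau> + cnj \<tau>"
    using nz unfolding \<tau>_def ww by (simp add: field_simps)
  have R_add: "R (x + y) = R x + R y" for x y
    by (simp add: R_def cinner_add_right distrib_left scaleC_add_left)
  have R_scale: "R (c *\<^sub>C x) = c *\<^sub>C R x" for c x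
    by (simp add: R_def cinner_scaleC_right scaleC_diff_right scaleC_scaleC mult_ac)
  have R_cinner: "cinner (R x) (R y) = cinner x y" for x y
  proof -
    have "cinner (R x) (R y) = cinner x y - \<tau> * cinner w y * cinner x w - cnj \<tau> * cinner x w * cinner w y
        + cnj \<tau> * \<tau> * cinner w w * cinner x w * cinner w y"
      by (simp add: R_def cinner_diff_left cinner_diff_right cinner_scaleC_left cinner_scaleC_right cnj_cinner algebra_simps)
    also have "\<dots> = cinner x y" unfolding key by (simp add: algebra_simps)
    finally show ?thesis .
  qed
  have R_w: "R w = (1 - \<tau> * cinner w w) *\<^sub>C w" by (simp add: R_def scaleC_diff_left)
  have nz2: "1 - \<tau> * cinner w w \<noteq> 0"
  proof
    assume "1 - \<tau> * cinner w w = 0"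
    moreover have "cnj \<tau> * (\<tau> * cinner w w) = \<tau> + cnj \<tau>" using key by (simp only: mult.assoc)
    ultimately have "cnj \<tau> = \<tau> + cnj \<tau>" by simp
    then show False using nz by (simp add: \<tau>_def)
  qed
  have surj: "surj R"
  proof (rule surjI)
    fix y
    let ?c = "\<tau> * cinner w y / (1 - \<tau> * cinner w w)"
    have "R (y + ?c *\<^sub>C w) = R y + (\<tau> * cinner w y) *\<^sub>C w"
      using nz2 by (simp only: R_add R_scale R_w scaleC_scaleC) simp
    also have "\<dots> = y" by (simp add: R_def)
    finally show "R (y + ?c *\<^sub>C w) = y" .
  qed
  show ?thesis
  proof (rule that[of R])
    show "unitary R" using R_add R_scale R_cinner surj by (auto simp: unitary_def)
    show "R u = v" using nz by (simp add: R_def \<tau>_def) (simp add: w_def)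
    show "R x = x" if "cinner u x = cinner v x" for x
      using that by (simp add: R_def w_def cinner_diff_left)
  qed
qed

text \<open>Vectors are adjusted one at a time. The reflection that takes \<open>U (u i)\<close> to
  \<open>w i\<close> fixes the earlier \<open>w x\<close>, because they have the same inner product
  with both. Finiteness of \<open>I\<close> is what makes a unitary of the whole space
  possible.\<close>

lemma unitary_extension:
  fixes u w :: "'i \<Rightarrow> 'a::complex_hilbert"
  assumes "finite I" "\<And>x y. x \<in> I \<Longrightarrow> y \<in> I \<Longrightarrow> cinner (u x) (u y) = cinner (w x) (w y)"
  obtains U where "unitary U" "\<And>x. x \<in> I \<Longrightarrow> U (u x) = w x"
proof -
  have "\<exists>U. unitary U \<and> (\<forall>x\<in>I. U (u x) = w x)" using assms
  proof (induction I rule: finite_induct)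
    case empty
    have "unitary (\<lambda>x::'a. x)" by (auto simp: unitary_def)
    then show ?case by blast
  next
    case (insert i I)
    then obtain U where U: "unitary U" "\<forall>x\<in>I. U (u x) = w x" by auto
    have c: "cinner (U x) (U y) = cinner x y" for x y using U(1) by (simp add: unitary_def)
    have "norm (U (u i)) = norm (w i)"
      using c[of "u i" "u i"] insert.prems[of i i] by (simp add: norm_eq_sqrt_cinner)
    then obtain R where R: "unitary R" "R (U (u i)) = w i" "\<And>x. cinner (U (u i)) x = cinner (w i) x \<Longrightarrow> R x = x"
      using householder by blast
    have "R (w x) = w x" if "x \<in> I" for x
    proof (rule R(3))
      have "cinner (U (u i)) (w x) = cinner (U (u i)) (U (u x))" using U(2) that by simp
      also have "\<dots> = cinner (w i) (w x)" using c insert.prems[of i x] that by simp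
      finally show "cinner (U (u i)) (w x) = cinner (w i) (w x)" .
    qed
    then have "\<forall>x\<in>insert i I. (R \<circ> U) (u x) = w x" using R(2) U(2) by simp
    then show ?case using unitary_compose[OF R(1) U(1)] by blast
  qed
  then show ?thesis using that by blast
qed

lemma psd_weight: assumes "psd k" shows "psd (\<lambda>x y. cnj (w x) * w y * k x y)"
proof (rule psdI)
  show "cnj (w x) * w y * k x y = cnj (cnj (w y) * w x * k y x)" for x y
    using psd_hermitian[OF assms, of x y] by simp
  have "qf (\<lambda>x y. cnj (w x) * w y * k x y) F c = qf k F (\<lambda>x. c x * w x)" for F c
    by (simp add: qf_def mult_ac)
  then show "0 \<le> Re (qf (\<lambda>x y. cnj (w x) * w y * k x y) F c)" if "finite F" for F c
    using psd_qf[OF assms that] by simp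
qed

lemma psd_block_restrict:
  assumes "psd k" shows "psd (\<lambda>x y. if \<kappa> x = \<kappa> y \<and> P (\<kappa> x) then k x y else 0)"
proof -
  have "psd (\<lambda>x y. if \<kappa> x = \<kappa> y then cnj (if P (\<kappa> x) then 1 else 0) * (if P (\<kappa> y) then 1 else 0) * k x y else 0)"
    by (rule psd_block[OF psd_weight[OF assms]])
  also have "(\<lambda>x y. if \<kappa> x = \<kappa> y then cnj (if P (\<kappa> x) then 1 else 0) * (if P (\<kappa> y) then 1 else 0) * k x y else 0)
    = (\<lambda>x y. if \<kappa> x = \<kappa> y \<and> P (\<kappa> x) then k x y else 0)" by (auto simp: fun_eq_iff)
  finally show ?thesis .
qed

lemma psd_cmod_le:
  fixes k :: "'i::countable \<Rightarrow> 'i \<Rightarrow> complex"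
  assumes "psd k" "k x x = of_real r" "k y y = of_real r" shows "cmod (k x y) \<le> r"
proof -
  obtain \<beta> :: "'i \<Rightarrow> ell2" where \<beta>: "gram \<beta> = k" by (rule kolmogorov[OF assms(1)])
  have k: "k x y = cinner (\<beta> x) (\<beta> y)" for x y using \<beta> by (auto simp: gram_def)
  have "(norm (\<beta> x))\<^sup>2 = r" "(norm (\<beta> y))\<^sup>2 = r" using assms(2,3) by (simp_all add: norm_sq_cinner flip: k)
  moreover have "cmod (k x y) \<le> norm (\<beta> x) * norm (\<beta> y)" unfolding k by (rule cmod_cinner_le)
  moreover have "norm (\<beta> x) = norm (\<beta> y)" using calculation(1,2) by (metis norm_ge_zero power2_eq_imp_eq)
  ultimately show ?thesis by (simp add: power2_eq_square)
qed

section \<open>Finitely supported sequences of vectors\<close>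

definition supp :: "(int \<Rightarrow> 'a::zero) \<Rightarrow> int set" where "supp x = {n. x n \<noteq> 0}"

text \<open>Outside the support of \<open>x\<close> the summands vanish. Finitely supported
  sequences form a space that need not be complete, which suffices because only Gram matrices of
  such sequences are used.\<close>

definition ip :: "(int \<Rightarrow> 'a::complex_hilbert) \<Rightarrow> (int \<Rightarrow> 'a) \<Rightarrow> complex" where
  "ip x y = (\<Sum>n\<in>supp x. cinner (x n) (y n))"

lemma ip_eq: "finite S \<Longrightarrow> supp x \<subseteq> S \<Longrightarrow> ip x y = (\<Sum>n\<in>S. cinner (x n) (y n))"
  unfolding ip_def by (rule sum.mono_neutral_left) (auto simp: supp_def)

lemma supp_sum_scale: "supp (\<lambda>n. \<Sum>k\<in>F. c k *\<^sub>C (z k n :: 'a::complex_hilbert)) \<subseteq> (\<Union>k\<in>F. supp (z k))"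
proof
  fix n assume "n \<in> supp (\<lambda>n. \<Sum>k\<in>F. c k *\<^sub>C (z k n))"
  then have "(\<Sum>k\<in>F. c k *\<^sub>C (z k n)) \<noteq> 0" by (simp add: supp_def)
  then obtain k where "k \<in> F" "c k *\<^sub>C (z k n) \<noteq> 0" by (meson sum.neutral)
  moreover from this(2) have "z k n \<noteq> 0" by (metis scaleC_zero_right)
  ultimately show "n \<in> (\<Union>k\<in>F. supp (z k))" by (auto simp: supp_def)
qed

lemma qf_ip:
  assumes "finite F" "\<And>k. k \<in> F \<Longrightarrow> finite (supp (z k))"
  shows "qf (\<lambda>x y. ip (z x) (z y)) F c = ip (\<lambda>n. \<Sum>k\<in>F. c k *\<^sub>C z k n) (\<lambda>n. \<Sum>k\<in>F. c k *\<^sub>C z k n)"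
proof -
  let ?S = "\<Union>k\<in>F. supp (z k)"
  have S: "finite ?S" using assms by auto
  have "ip (\<lambda>n. \<Sum>k\<in>F. c k *\<^sub>C z k n) (\<lambda>n. \<Sum>k\<in>F. c k *\<^sub>C z k n)
      = (\<Sum>n\<in>?S. \<Sum>x\<in>F. \<Sum>y\<in>F. cnj (c x) * c y * cinner (z x n) (z y n))"
    unfolding ip_eq[OF S supp_sum_scale]
    by (subst cinner_sum_left, subst cinner_sum_right) (simp add: cinner_scaleC_left cinner_scaleC_right mult_ac)
  also have "\<dots> = (\<Sum>x\<in>F. \<Sum>n\<in>?S. \<Sum>y\<in>F. cnj (c x) * c y * cinner (z x n) (z y n))" by (rule sum.swap)
  also have "\<dots> = (\<Sum>x\<in>F. \<Sum>y\<in>F. \<Sum>n\<in>?S. cnj (c x) * c y * cinner (z x n) (z y n))"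
    by (intro sum.cong refl sum.swap)
  also have "\<dots> = qf (\<lambda>x y. ip (z x) (z y)) F c"
    unfolding qf_def by (intro sum.cong refl) (subst ip_eq[OF S], auto simp: sum_distrib_left)
  finally show ?thesis by simp
qed

lemma ip_self_nonneg: "0 \<le> Re (ip x x)"
  unfolding ip_def by (simp add: sum_nonneg cinner_ge_zero)

lemma psd_ip:
  assumes "\<And>k. finite (supp (z k))" shows "psd (\<lambda>x y. ip (z x) (z y))"
proof (rule psdI)
  fix x y
  have "ip (z x) (z y) = (\<Sum>n\<in>supp (z x) \<union> supp (z y). cinner (z x n) (z y n))"
    by (rule ip_eq) (use assms in auto)
  moreover have "ip (z y) (z x) = (\<Sum>n\<in>supp (z x) \<union> supp (z y). cinner (z y n) (z x n))"
    by (rule ip_eq) (use assms in auto)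
  ultimately show "ip (z x) (z y) = cnj (ip (z y) (z x))" by (simp add: cnj_cinner)
next
  show "0 \<le> Re (qf (\<lambda>x y. ip (z x) (z y)) F c)" if "finite F" for F c
    using qf_ip[OF that assms] ip_self_nonneg by simp
qed

section \<open>Ando's theorem\<close>

lemma sum_shift_int:
  fixes f :: "int \<Rightarrow> 'a::comm_monoid_add"
  assumes "finite S" "\<And>n. n \<notin> S \<Longrightarrow> f n = 0" "finite T" "(\<lambda>n. n - 1) ` S \<subseteq> T"
  shows "(\<Sum>n\<in>T. f (n + 1)) = sum f S"
proof -
  have "(\<Sum>n\<in>T. f (n + 1)) = sum f ((\<lambda>n. n + 1) ` T)" by (subst sum.reindex) (auto simp: o_def)
  also have "\<dots> = sum f S"
    by (rule sum.mono_neutral_right) (use assms in \<open>force+\<close>)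
  finally show ?thesis .
qed

lemma unitary_cinner: "unitary U \<Longrightarrow> cinner (U x) (U y) = cinner x y"
  by (simp only: unitary_def)

lemma unitary_sum:
  assumes "unitary L" shows "L (\<Sum>m\<in>A. f m) = (\<Sum>m\<in>A. L (f m))"
proof -
  have "L 0 = 0" using assms unfolding unitary_def by (metis scaleC_zero_left)
  then show ?thesis using assms by (induction A rule: infinite_finite_induct) (auto simp: unitary_def)
qed

lemma ip_pair:
  fixes x y :: "int \<Rightarrow> 'a::complex_hilbert \<times> 'b::complex_hilbert"
  shows "finite S \<Longrightarrow> supp x \<subseteq> S \<Longrightarrow>
    ip x y = (\<Sum>n\<in>S. cinner (fst (x n)) (fst (y n))) + (\<Sum>n\<in>S. cinner (snd (x n)) (snd (y n)))"
  by (simp add: ip_eq cinner_prod_def sum.distrib)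

text \<open>Weighting the monomials by the powers of a truncated shift makes the pair nilpotent and its
  orbit finite; \<open>(m, a, b)\<close> stands for \<open>T\<^sub>1\<^sup>a T\<^sub>2\<^sup>b h \<otimes> e\<^bsub>m + a + b\<^esub>\<close>. The commuting isometries are those of
  Berger, Coburn and Lebow, built from the defect vectors \<open>dA\<close> and \<open>dB\<close>.\<close>

lemma ando_truncated:
  fixes v :: "nat \<times> nat \<Rightarrow> 'h::complex_hilbert"
  assumes v1: "sdom (\<lambda>x. v (Suc (fst x), snd x)) v" and v2: "sdom (\<lambda>x. v (fst x, Suc (snd x))) v"
    and N: "N > 0"
  obtains \<mu> :: "nat \<times> nat \<Rightarrow> nat \<times> nat \<Rightarrow> complex" where "psd \<mu>"
    "\<And>x y. \<mu> (Suc (fst x), snd x) (Suc (fst y), snd y) = \<mu> x y"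
    "\<And>x y. \<mu> (fst x, Suc (snd x)) (fst y, Suc (snd y)) = \<mu> x y"
    "\<mu> (0, 0) (0, 0) = of_real ((norm (v (0, 0)))\<^sup>2)"
    "\<And>F c D. finite F \<Longrightarrow> (\<And>x. x \<in> F \<Longrightarrow> fst x + snd x \<le> D) \<Longrightarrow> D \<le> N \<Longrightarrow>
       real (N - D) / real N * (norm (comb F c v))\<^sup>2 \<le> Re (qf \<mu> F c)"
proof -
  define deg where "deg = (\<lambda>x::nat \<times> nat \<times> nat. fst x + fst (snd x) + snd (snd x))"
  define s1 where "s1 = (\<lambda>x::nat \<times> nat \<times> nat. (fst x, Suc (fst (snd x)), snd (snd x)))"
  define s2 where "s2 = (\<lambda>x::nat \<times> nat \<times> nat. (fst x, fst (snd x), Suc (snd (snd x))))"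
  have deg_s: "deg (s1 x) = Suc (deg x)" "deg (s2 x) = Suc (deg x)" for x by (auto simp: deg_def s1_def s2_def)
  have s_comm: "s2 (s1 x) = s1 (s2 x)" for x by (simp add: s1_def s2_def)
  \<comment> \<open>The Gram matrix of the vectors \<open>T1^a T2^b h\<close> tensor
    \<open>e_(m+a+b)\<close>, where the \<open>e_d\<close> are orthonormal for \<open>d < N\<close>
    and zero from \<open>N\<close> on.\<close>
  define k where "k = (\<lambda>x y. if deg x = deg y \<and> deg x < N then gram v (snd x) (snd y) else 0)"
  have pk: "psd k" unfolding k_def using psd_block_restrict[OF psd_comp[OF psd_gram[of v], of snd], of deg "\<lambda>d. d < N"] .
  have defect: "psd (\<lambda>x y. k x y - k (s x) (s y))"
    if s: "\<And>x. deg (s x) = Suc (deg x)" "\<And>x. snd (s x) = f (snd x)" and f: "sdom (\<lambda>x. v (f x)) v" for s f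
  proof -
    have "psd (\<lambda>x y. gram v x y - gram v (f x) (f y))"
      using iffD2[OF psd_diff_iff_sdom f] by (simp add: gram_def)
    \<comment> \<open>Below the top level the defect is that of \<open>v\<close>. On the level
      \<open>N - 1\<close> the shift leads to 0, so the whole kernel remains.\<close>
    from psd_add[OF psd_block_restrict[OF psd_comp[OF this, of snd], of deg "\<lambda>d. Suc d < N"]
        psd_block_restrict[OF psd_comp[OF psd_gram[of v], of snd], of deg "\<lambda>d. Suc d = N"]]
    show ?thesis by (rule back_subst[of psd]) (auto simp: fun_eq_iff k_def s)
  qed
  have pA: "psd (\<lambda>x y. k x y - k (s1 x) (s1 y))"
    by (rule defect[where f = "\<lambda>x. (Suc (fst x), snd x)"]) (simp_all only: deg_s v1, simp_all add: s1_def)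
  have pB: "psd (\<lambda>x y. k x y - k (s2 x) (s2 y))"
    by (rule defect[where f = "\<lambda>x. (fst x, Suc (snd x))"]) (simp_all only: deg_s v2, simp_all add: s2_def)
  obtain dA :: "nat \<times> nat \<times> nat \<Rightarrow> ell2" where gdA: "gram dA = (\<lambda>x y. k x y - k (s1 x) (s1 y))" by (rule kolmogorov[OF pA])
  have dA: "cinner (dA x) (dA y) = k x y - k (s1 x) (s1 y)" for x y
    using fun_cong[OF fun_cong[OF gdA, of x], of y] by (simp add: gram_def)
  obtain dB :: "nat \<times> nat \<times> nat \<Rightarrow> ell2" where gdB: "gram dB = (\<lambda>x y. k x y - k (s2 x) (s2 y))" by (rule kolmogorov[OF pB])
  have dB: "cinner (dB x) (dB y) = k x y - k (s2 x) (s2 y)" for x y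
    using fun_cong[OF fun_cong[OF gdB, of x], of y] by (simp add: gram_def)
  \<comment> \<open>With \<open>A\<close>, \<open>B\<close> the two truncated operators, the defect
    vectors of \<open>A\<close> at \<open>B x\<close> and of \<open>B\<close> at \<open>x\<close>
    together have the squared norm of \<open>x\<close> minus that of \<open>A B x\<close>. The same
    holds with the roles exchanged. So \<open>e\<close> and \<open>e'\<close> have equal Gram
    matrices.\<close>
  define e where "e = (\<lambda>x. (dA (s2 x), dB x))"
  define e' where "e' = (\<lambda>x. (dA x, dB (s1 x)))"
  have e: "cinner (e x) (e y) = k x y - k (s1 (s2 x)) (s1 (s2 y))" for x y
    by (simp add: e_def cinner_prod_def dA dB)
  have e': "cinner (e' x) (e' y) = k x y - k (s1 (s2 x)) (s1 (s2 y))" for x y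
    by (simp add: e'_def cinner_prod_def dA dB s_comm)
  have e0: "e x = 0" "e' x = 0" if "deg x \<ge> N" for x
  proof -
    have "cinner (e x) (e x) = 0" "cinner (e' x) (e' x) = 0" using that unfolding e e' by (simp_all add: k_def deg_s)
    then show "e x = 0" "e' x = 0" by (simp_all add: cinner_self)
  qed
  have fin: "finite {x. deg x < N}"
    by (rule finite_subset[of _ "{..<N} \<times> {..<N} \<times> {..<N}"]) (auto simp: deg_def)
  obtain U where U: "unitary U" and "\<And>x. x \<in> {x. deg x < N} \<Longrightarrow> U (e x) = e' x"
    by (rule unitary_extension[OF fin, of e e']) (auto simp: e e')
  moreover have U0: "U 0 = 0" using U unfolding unitary_def by (metis scaleC_zero_left)
  ultimately have Ue: "U (e x) = e' x" for x using e0[of x] by (cases "deg x < N") auto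
  define V where "V = inv U"
  have V: "unitary V" unfolding V_def by (rule unitary_inv[OF U])
  have VU: "V (U x) = x" and UV: "U (V x) = x" for x
    using unitary_inj[OF U] U by (auto simp: V_def unitary_def surj_f_inv_f)
  have Ve: "V (e' x) = e x" for x using VU[of "e x"] by (simp add: Ue)
  have V0: "V 0 = 0" using VU[of 0] U0 by simp
  define c where "c = (\<lambda>j x::nat \<times> nat \<times> nat. (fst x, fst (snd x) + j, snd (snd x) + j))"
  have c_Suc: "c (Suc j) x = s1 (s2 (c j x))" for j x by (simp add: c_def s1_def s2_def)
  \<comment> \<open>The isometric embedding of the vector \<open>x\<close> by its defects along the
    powers of \<open>A B\<close>: the inner products telescope, and the last term vanishes by
    nilpotency.\<close>
  define P where "P = (\<lambda>x n. if n \<ge> 0 then e (c (nat n) x) else 0 :: ell2 \<times> ell2)"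
  have suppP: "supp (P x) \<subseteq> int ` {..<N}" for x
  proof
    fix n assume n: "n \<in> supp (P x)"
    then have nn: "n \<ge> 0" "e (c (nat n) x) \<noteq> 0" by (auto simp: supp_def P_def split: if_splits)
    then have "deg (c (nat n) x) < N" using e0(1) not_le by blast
    then have "nat n < N" by (simp add: deg_def c_def)
    then show "n \<in> int ` {..<N}" using nn by (intro image_eqI[of _ _ "nat n"]) auto
  qed
  have ipP: "ip (P x) (P y) = k x y" for x y
  proof -
    have "ip (P x) (P y) = (\<Sum>j<N. cinner (P x (int j)) (P y (int j)))"
      by (subst ip_eq[OF _ suppP]) (auto simp: sum.reindex)
    also have "\<dots> = (\<Sum>j<N. k (c j x) (c j y) - k (c (Suc j) x) (c (Suc j) y))"
      by (simp add: P_def e c_Suc)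
    also have "\<dots> = k (c 0 x) (c 0 y) - k (c N x) (c N y)" by (rule sum_lessThan_telescope')
    also have "\<dots> = k x y" by (simp add: k_def c_def deg_def)
    finally show ?thesis .
  qed
  \<comment> \<open>The sequences are two-sided so that entries pushed below index 0 are kept, which
    makes both maps isometric. Their product in either order is the backward shift, whence they
    commute.\<close>
  define W1 where "W1 = (\<lambda>(x :: int \<Rightarrow> ell2 \<times> ell2) n. (fst (U (x (n + 1))), snd (U (x n))))"
  define W2 where "W2 = (\<lambda>(x :: int \<Rightarrow> ell2 \<times> ell2) n. V (fst (x n), snd (x (n + 1))))"
  have W_comm: "W1 (W2 x) = W2 (W1 x)" for x by (simp add: W1_def W2_def fun_eq_iff UV VU)
  have supp_W: "supp (W1 x) \<subseteq> supp x \<union> (\<lambda>n. n - 1) ` supp x" "supp (W2 x) \<subseteq> supp x \<union> (\<lambda>n. n - 1) ` supp x" for x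
  proof -
    have *: "n \<in> supp x \<union> (\<lambda>n. n - 1) ` supp x" if "x n \<noteq> 0 \<or> x (n + 1) \<noteq> 0" for n
      using that by (auto simp: supp_def image_iff intro!: exI[of _ "n + 1"])
    have "x n \<noteq> 0 \<or> x (n + 1) \<noteq> 0" if "W1 x n \<noteq> 0" for n
      using that U0 by (auto simp: W1_def zero_prod_def)
    then show "supp (W1 x) \<subseteq> supp x \<union> (\<lambda>n. n - 1) ` supp x" using * unfolding supp_def by blast
    have "x n \<noteq> 0 \<or> x (n + 1) \<noteq> 0" if "W2 x n \<noteq> 0" for n
      using that V0 by (auto simp: W2_def zero_prod_def)
    then show "supp (W2 x) \<subseteq> supp x \<union> (\<lambda>n. n - 1) ` supp x" using * unfolding supp_def by blast
  qed
  have fin_W: "finite (supp (W1 x))" "finite (supp (W2 x))" if "finite (supp x)" for x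
    using supp_W[of x] that by (auto intro: finite_subset)
  have ip_W1: "ip (W1 x) (W1 y) = ip x y" if "finite (supp x)" for x y
  proof -
    let ?T = "supp x \<union> (\<lambda>n. n - 1) ` supp x"
    have "ip (W1 x) (W1 y) = (\<Sum>n\<in>?T. cinner (fst (U (x (n + 1)))) (fst (U (y (n + 1))))) + (\<Sum>n\<in>?T. cinner (snd (U (x n))) (snd (U (y n))))"
      by (subst ip_pair[OF _ supp_W(1)]) (use that in \<open>auto simp: W1_def\<close>)
    also have "(\<Sum>n\<in>?T. cinner (fst (U (x (n + 1)))) (fst (U (y (n + 1))))) = (\<Sum>n\<in>supp x. cinner (fst (U (x n))) (fst (U (y n))))"
      using that by (intro sum_shift_int[where f = "\<lambda>n. cinner (fst (U (x n))) (fst (U (y n)))"]) (auto simp: supp_def U0)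
    also have "(\<Sum>n\<in>?T. cinner (snd (U (x n))) (snd (U (y n)))) = (\<Sum>n\<in>supp x. cinner (snd (U (x n))) (snd (U (y n))))"
      using that by (intro sum.mono_neutral_right) (auto simp: supp_def U0)
    also have "(\<Sum>n\<in>supp x. cinner (fst (U (x n))) (fst (U (y n)))) + (\<Sum>n\<in>supp x. cinner (snd (U (x n))) (snd (U (y n)))) = (\<Sum>n\<in>supp x. cinner (U (x n)) (U (y n)))"
      by (simp add: cinner_prod_def sum.distrib)
    also have "\<dots> = ip x y" by (simp add: unitary_cinner[OF U] ip_def)
    finally show ?thesis .
  qed
  have ip_W2: "ip (W2 x) (W2 y) = ip x y" if "finite (supp x)" for x y
  proof -
    let ?T = "supp x \<union> (\<lambda>n. n - 1) ` supp x"
    have "ip (W2 x) (W2 y) = (\<Sum>n\<in>?T. cinner (W2 x n) (W2 y n))"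
      by (rule ip_eq[OF _ supp_W(2)]) (use that in auto)
    also have "\<dots> = (\<Sum>n\<in>?T. cinner (fst (x n)) (fst (y n))) + (\<Sum>n\<in>?T. cinner (snd (x (n + 1))) (snd (y (n + 1))))"
      unfolding W2_def unitary_cinner[OF V] by (simp add: cinner_prod_def sum.distrib)
    also have "(\<Sum>n\<in>?T. cinner (snd (x (n + 1))) (snd (y (n + 1)))) = (\<Sum>n\<in>supp x. cinner (snd (x n)) (snd (y n)))"
      using that by (intro sum_shift_int[where f = "\<lambda>n. cinner (snd (x n)) (snd (y n))"]) (auto simp: supp_def)
    also have "(\<Sum>n\<in>?T. cinner (fst (x n)) (fst (y n))) = (\<Sum>n\<in>supp x. cinner (fst (x n)) (fst (y n)))"
      using that by (intro sum.mono_neutral_right) (auto simp: supp_def)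
    also have "(\<Sum>n\<in>supp x. cinner (fst (x n)) (fst (y n))) + (\<Sum>n\<in>supp x. cinner (snd (x n)) (snd (y n))) = ip x y"
      by (simp add: ip_def cinner_prod_def sum.distrib)
    finally show ?thesis .
  qed
  \<comment> \<open>The starting vector is spread over all \<open>N\<close> levels. A combination of
    monomials of degree at most \<open>D\<close> is complete on the levels from \<open>D\<close> to
    \<open>N - 1\<close>, which after division by \<open>N\<close> gives the factor
    \<open>(N - D) / N\<close>.\<close>
  define x0 where "x0 = (\<lambda>n. \<Sum>m<N. P (m, 0, 0) n)"
  define Z where "Z = (\<lambda>x. (W1 ^^ fst x) ((W2 ^^ snd x) x0))"
  have Z1: "Z (Suc (fst x), snd x) = W1 (Z x)" for x by (simp add: Z_def)
  have "(W1 ^^ a) (W2 y) = W2 ((W1 ^^ a) y)" for a y by (induction a) (simp_all add: W_comm)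
  then have Z2: "Z (fst x, Suc (snd x)) = W2 (Z x)" for x by (simp add: Z_def)
  have fin0: "finite (supp x0)"
  proof (rule finite_subset[of _ "int ` {..<N}"])
    show "supp x0 \<subseteq> int ` {..<N}"
    proof
      fix n assume "n \<in> supp x0"
      then have "(\<Sum>m<N. P (m, 0, 0) n) \<noteq> 0" by (simp add: supp_def x0_def)
      then obtain m where "P (m, 0, 0) n \<noteq> 0" by (meson sum.neutral)
      then show "n \<in> int ` {..<N}" using suppP[of "(m, 0, 0)"] by (auto simp: supp_def)
    qed
  qed simp
  have finZ: "finite (supp (Z x))" for x
  proof -
    have "finite (supp ((W2 ^^ j) x0))" for j by (induction j) (simp_all add: fin0 fin_W)
    then have "finite (supp ((W1 ^^ i) ((W2 ^^ j) x0)))" for i j by (induction i) (simp_all add: fin_W)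
    then show ?thesis by (simp add: Z_def)
  qed
  have Zpos: "\<forall>n\<ge>0. Z x n = (\<Sum>m<N. P (m, x) n)" for x
  proof -
    have st1: "\<forall>n\<ge>0. W1 y n = (\<Sum>m<N. P (m, Suc a, b) n)" if y: "\<forall>n\<ge>0. y n = (\<Sum>m<N. P (m, a, b) n)" for y a b
    proof (intro allI impI)
      fix n :: int assume n: "n \<ge> 0"
      have "y n = (\<Sum>m<N. e (c (nat n) (m, a, b)))" "y (n + 1) = (\<Sum>m<N. e (c (Suc (nat n)) (m, a, b)))"
        using y n by (simp_all add: P_def nat_add_distrib)
      then have "W1 y n = (fst (\<Sum>m<N. e' (c (Suc (nat n)) (m, a, b))), snd (\<Sum>m<N. e' (c (nat n) (m, a, b))))"
        unfolding W1_def by (simp add: unitary_sum[OF U] Ue)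
      also have "\<dots> = (\<Sum>m<N. P (m, Suc a, b) n)"
        using n by (intro prod_eqI) (simp_all add: fst_sum snd_sum P_def e_def e'_def c_def s1_def s2_def)
      finally show "W1 y n = (\<Sum>m<N. P (m, Suc a, b) n)" .
    qed
    have st2: "\<forall>n\<ge>0. W2 y n = (\<Sum>m<N. P (m, a, Suc b) n)" if y: "\<forall>n\<ge>0. y n = (\<Sum>m<N. P (m, a, b) n)" for y a b
    proof (intro allI impI)
      fix n :: int assume n: "n \<ge> 0"
      have "y n = (\<Sum>m<N. e (c (nat n) (m, a, b)))" "y (n + 1) = (\<Sum>m<N. e (c (Suc (nat n)) (m, a, b)))"
        using y n by (simp_all add: P_def nat_add_distrib)
      then have "(fst (y n), snd (y (n + 1))) = (\<Sum>m<N. e' (c (nat n) (m, a, Suc b)))"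
        by (intro prod_eqI) (simp_all add: fst_sum snd_sum e_def e'_def c_def s1_def s2_def)
      then have "W2 y n = (\<Sum>m<N. e (c (nat n) (m, a, Suc b)))"
        unfolding W2_def by (simp add: unitary_sum[OF V] Ve)
      then show "W2 y n = (\<Sum>m<N. P (m, a, Suc b) n)" using n by (simp add: P_def)
    qed
    have "\<forall>n\<ge>0. (W2 ^^ b) x0 n = (\<Sum>m<N. P (m, 0, b) n)" for b
    proof (induction b)
      case (Suc b)
      show ?case using st2[OF Suc] by simp
    qed (simp add: x0_def)
    then have "\<forall>n\<ge>0. (W1 ^^ a) ((W2 ^^ b) x0) n = (\<Sum>m<N. P (m, a, b) n)" for a b
    proof (induction a)
      case (Suc a)
      show ?case using st1[OF Suc.IH[OF Suc.prems]] by simp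
    qed simp
    then show ?thesis by (cases x) (simp add: Z_def)
  qed
  define \<mu> where "\<mu> = (\<lambda>x y. of_real (1 / real N) * ip (Z x) (Z y))"
  have suppP': "supp (P x) \<subseteq> S" if "int ` {..<N} \<subseteq> S" for x S using suppP that by blast
  show ?thesis
  proof (rule that[of \<mu>])
    show "psd \<mu>" unfolding \<mu>_def by (intro psd_scale psd_ip finZ) simp
    show "\<mu> (Suc (fst x), snd x) (Suc (fst y), snd y) = \<mu> x y" for x y
      unfolding \<mu>_def Z1 by (simp add: ip_W1 finZ)
    show "\<mu> (fst x, Suc (snd x)) (fst y, Suc (snd y)) = \<mu> x y" for x y
      unfolding \<mu>_def Z2 by (simp add: ip_W2 finZ)
    have "ip x0 x0 = qf (\<lambda>x y. ip (P (x, 0, 0)) (P (y, 0, 0))) {..<N} (\<lambda>_. 1)"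
      unfolding x0_def using suppP by (subst qf_ip) (auto intro: finite_subset[OF suppP])
    also have "\<dots> = (\<Sum>x<N. \<Sum>y<N. if x = y then gram v (0, 0) (0, 0) else 0)"
      unfolding qf_def ipP k_def by (intro sum.cong refl) (auto simp: deg_def)
    also have "\<dots> = of_nat N * gram v (0, 0) (0, 0)" by simp
    finally show "\<mu> (0, 0) (0, 0) = of_real ((norm (v (0, 0)))\<^sup>2)"
      using N by (simp add: \<mu>_def Z_def gram_def cinner_self)
    fix F :: "(nat \<times> nat) set" and cc :: "nat \<times> nat \<Rightarrow> complex" and D
    assume F: "finite F" and D: "\<And>x. x \<in> F \<Longrightarrow> fst x + snd x \<le> D" "D \<le> N"
    define G where "G = {..<N} \<times> F"
    define cG where "cG = (\<lambda>x::nat \<times> nat \<times> nat. cc (snd x))"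
    have G: "finite G" using F by (simp add: G_def)
    define z where "z = (\<lambda>n. \<Sum>x\<in>F. cc x *\<^sub>C Z x n)"
    define y where "y = (\<lambda>n. \<Sum>x\<in>G. cG x *\<^sub>C P x n)"
    \<comment> \<open>At nonnegative indices the orbit of the isometries agrees with that of the
      truncated pair, so \<open>y\<close> is \<open>z\<close> cut off and has the smaller
      norm.\<close>
    have y: "y n = (if n \<ge> 0 then z n else 0)" for n
    proof (cases "n \<ge> 0")
      case True
      have "z n = (\<Sum>x\<in>F. \<Sum>m<N. cc x *\<^sub>C P (m, x) n)" using Zpos True by (simp add: z_def scaleC_sum_right)
      also have "\<dots> = (\<Sum>m<N. \<Sum>x\<in>F. cc x *\<^sub>C P (m, x) n)" by (rule sum.swap)
      also have "\<dots> = y n" by (simp add: y_def G_def cG_def sum.cartesian_product case_prod_unfold)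
      finally show ?thesis using True by simp
    qed (simp add: y_def P_def)
    have "supp z \<subseteq> (\<Union>x\<in>F. supp (Z x))" unfolding z_def by (rule supp_sum_scale)
    then have finz: "finite (supp z)" by (rule finite_subset) (use F finZ in blast)
    have "Re (ip y y) \<le> Re (ip z z)"
    proof -
      have "ip y y = (\<Sum>n\<in>supp z. cinner (y n) (y n))" by (rule ip_eq[OF finz]) (auto simp: supp_def y split: if_splits)
      moreover have "Re (cinner (y n) (y n)) \<le> Re (cinner (z n) (z n))" for n using y[of n] cinner_ge_zero[of "z n"] by simp
      ultimately show ?thesis by (simp add: ip_def sum_mono)
    qed
    moreover have "ip y y = qf k G cG"
      unfolding y_def using qf_ip[OF G finite_subset[OF suppP], where c = cG] by (simp add: ipP)
    moreover have "ip z z = qf (\<lambda>x y. ip (Z x) (Z y)) F cc" unfolding z_def by (simp add: qf_ip[OF F finZ])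
    moreover have "real (N - D) * (norm (comb F cc v))\<^sup>2 \<le> Re (qf k G cG)"
    proof -
      define Gd where "Gd = (\<lambda>d. {x\<in>G. deg x = d})"
      have "qf k G cG = (\<Sum>x\<in>G. \<Sum>y\<in>G. \<Sum>d<N. if deg x = d \<and> deg y = d then cnj (cG x) * cG y * gram v (snd x) (snd y) else 0)"
        unfolding qf_def
      proof (intro sum.cong refl)
        fix x y
        have "(\<Sum>d<N. if deg x = d \<and> deg y = d then h else 0) = (if deg x = deg y \<and> deg x < N then h else 0)" for h :: complex
        proof -
          have "(\<Sum>d<N. if deg x = d \<and> deg y = d then h else 0) = (\<Sum>d<N. if d = deg x then (if deg y = deg x then h else 0) else 0)"
            by (intro sum.cong) auto
          then show ?thesis by auto
        qed
        then show "cnj (cG x) * cG y * k x y = (\<Sum>d<N. if deg x = d \<and> deg y = d then cnj (cG x) * cG y * gram v (snd x) (snd y) else 0)"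
          by (simp add: k_def)
      qed
      also have "\<dots> = (\<Sum>x\<in>G. \<Sum>d<N. \<Sum>y\<in>G. if deg x = d \<and> deg y = d then cnj (cG x) * cG y * gram v (snd x) (snd y) else 0)"
        by (intro sum.cong refl sum.swap)
      also have "\<dots> = (\<Sum>d<N. \<Sum>x\<in>G. \<Sum>y\<in>G. if deg x = d \<and> deg y = d then cnj (cG x) * cG y * gram v (snd x) (snd y) else 0)"
        by (rule sum.swap)
      also have "\<dots> = (\<Sum>d<N. qf (\<lambda>x y. gram v (snd x) (snd y)) (Gd d) cG)"
      proof (rule sum.cong[OF refl])
        fix d
        have "(\<Sum>x\<in>G. \<Sum>y\<in>G. if deg x = d \<and> deg y = d then cnj (cG x) * cG y * gram v (snd x) (snd y) else 0)
          = (\<Sum>x\<in>Gd d. \<Sum>y\<in>G. if deg x = d \<and> deg y = d then cnj (cG x) * cG y * gram v (snd x) (snd y) else 0)"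
          using G by (intro sum.mono_neutral_right) (auto simp: Gd_def)
        also have "\<dots> = (\<Sum>x\<in>Gd d. \<Sum>y\<in>Gd d. cnj (cG x) * cG y * gram v (snd x) (snd y))"
          using G by (intro sum.cong refl sum.mono_neutral_cong_right) (auto simp: Gd_def)
        finally show "(\<Sum>x\<in>G. \<Sum>y\<in>G. if deg x = d \<and> deg y = d then cnj (cG x) * cG y * gram v (snd x) (snd y) else 0)
          = qf (\<lambda>x y. gram v (snd x) (snd y)) (Gd d) cG" by (simp only: qf_def)
      qed
      finally have eq: "Re (qf k G cG) = (\<Sum>d<N. Re (qf (\<lambda>x y. gram v (snd x) (snd y)) (Gd d) cG))" by simp
      have nonneg: "0 \<le> Re (qf (\<lambda>x y. gram v (snd x) (snd y)) (Gd d) cG)" for d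
        using G by (intro psd_qf[OF psd_comp[OF psd_gram]]) (simp add: Gd_def)
      have full: "Re (qf (\<lambda>x y. gram v (snd x) (snd y)) (Gd d) cG) = (norm (comb F cc v))\<^sup>2" if "D \<le> d" "d < N" for d
      proof -
        have bij: "bij_betw snd (Gd d) F"
        proof (rule bij_betw_byWitness[of _ "\<lambda>x. (d - fst x - snd x, x)"])
          show "\<forall>a\<in>Gd d. (d - fst (snd a) - snd (snd a), snd a) = a" by (auto simp: Gd_def deg_def)
          show "(\<lambda>x. (d - fst x - snd x, x)) ` F \<subseteq> Gd d"
          proof
            fix y assume "y \<in> (\<lambda>x. (d - fst x - snd x, x)) ` F"
            then obtain x where "x \<in> F" "y = (d - fst x - snd x, x)" by auto
            then show "y \<in> Gd d" using D(1)[of x] that by (simp add: Gd_def G_def deg_def)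
          qed
        qed (auto simp: Gd_def G_def)
        have "qf (\<lambda>x y. gram v (snd x) (snd y)) (Gd d) cG = qf (gram v) F cc"
          unfolding qf_def cG_def
          by (subst sum.reindex_bij_betw[OF bij, symmetric, where g = "\<lambda>x. \<Sum>y\<in>F. cnj (cc x) * cc y * gram v x y"])
             (intro sum.cong refl sum.reindex_bij_betw[OF bij, where g = "\<lambda>y. cnj (cc (snd _)) * cc y * gram v (snd _) y"])
        then show ?thesis by (simp add: qf_gram)
      qed
      have "real (N - D) * (norm (comb F cc v))\<^sup>2 = (\<Sum>d\<in>{D..<N}. Re (qf (\<lambda>x y. gram v (snd x) (snd y)) (Gd d) cG))"
        using full by simp
      also have "\<dots> \<le> Re (qf k G cG)" unfolding eq by (intro sum_mono2) (auto intro: nonneg)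
      finally show ?thesis .
    qed
    moreover have "Re (qf \<mu> F cc) = Re (qf (\<lambda>x y. ip (Z x) (Z y)) F cc) / real N"
      unfolding \<mu>_def qf_scale by simp
    ultimately show "real (N - D) / real N * (norm (comb F cc v))\<^sup>2 \<le> Re (qf \<mu> F cc)"
      by (simp add: divide_right_mono)
  qed
qed

lemma qf_tendsto:
  assumes "\<And>x y. (\<lambda>i. k i x y) \<longlonglongrightarrow> l x y" shows "(\<lambda>i. qf (k i) F c) \<longlonglongrightarrow> qf l F c"
  unfolding qf_def by (intro tendsto_intros assms)

lemma convergent_diagonal:
  fixes f :: "nat \<Rightarrow> 'i::countable \<Rightarrow> complex"
  assumes "\<And>n x. cmod (f n x) \<le> B"
  obtains d where "strict_mono d" "\<And>x. convergent (\<lambda>i. f (d i) x)"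
proof -
  define P where "P = (\<lambda>n s. convergent (\<lambda>i. f (s i) (from_nat n :: 'i)))"
  interpret subseqs P
  proof
    fix n and s :: "nat \<Rightarrow> nat" assume "strict_mono s"
    have "bounded (range (\<lambda>i. f (s i) (from_nat n)))" using assms by (auto simp: bounded_iff)
    then obtain l r where "strict_mono r" "((\<lambda>i. f (s i) (from_nat n)) \<circ> r) \<longlonglongrightarrow> l"
      using bounded_imp_convergent_subsequence by blast
    then show "\<exists>r'. strict_mono r' \<and> P n (s \<circ> r')" by (auto simp: P_def convergent_def o_def)
  qed
  have "convergent (\<lambda>i. f (diagseq i) x)" for x
  proof -
    have "P (to_nat x) (diagseq \<circ> ((+) (Suc (to_nat x))))"
    proof (rule diagseq_holds)
      fix r s n assume "strict_mono (r :: nat \<Rightarrow> nat)" "P n s"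
      then show "P n (s \<circ> r)"
        using convergent_subseq_convergent[of "\<lambda>i. f (s i) (from_nat n)" r] by (simp add: P_def o_def)
    qed
    then have "convergent (\<lambda>i. f (diagseq (i + Suc (to_nat x))) x)" by (simp add: P_def o_def add.commute)
    then show ?thesis by (simp only: convergent_ignore_initial_segment[of "\<lambda>i. f (diagseq i) x"])
  qed
  then show ?thesis using that[OF subseq_diagseq] by blast
qed

text \<open>A stationary family dominating the orbit carries the moments of a commuting unitary dilation.\<close>

theorem ando:
  fixes v :: "nat \<times> nat \<Rightarrow> 'h::complex_hilbert"
  assumes v1: "sdom (\<lambda>x. v (Suc (fst x), snd x)) v" and v2: "sdom (\<lambda>x. v (fst x, Suc (snd x))) v"
  obtains \<omega> :: "int \<times> int \<Rightarrow> ell2" where "\<And>a x y. cinner (\<omega> (x + a)) (\<omega> (y + a)) = cinner (\<omega> x) (\<omega> y)"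
    "norm (\<omega> (0, 0)) = norm (v (0, 0))" "sdom v (\<lambda>x. \<omega> (int (fst x), int (snd x)))"
proof -
  define B where "B = (norm (v (0, 0)))\<^sup>2"
  define Q where "Q = (\<lambda>N \<mu>. psd \<mu> \<and> (\<forall>x y. \<mu> (Suc (fst x), snd x) (Suc (fst y), snd y) = \<mu> x y) \<and>
    (\<forall>x y. \<mu> (fst x, Suc (snd x)) (fst y, Suc (snd y)) = \<mu> x y) \<and> \<mu> (0, 0) (0, 0) = of_real B \<and>
    (\<forall>F c D. finite F \<longrightarrow> (\<forall>x\<in>F. fst x + snd x \<le> D) \<longrightarrow> D \<le> N \<longrightarrow>
       real (N - D) / real N * (norm (comb F c v))\<^sup>2 \<le> Re (qf \<mu> F c)))"
  have "\<exists>\<mu>. Q (Suc N) \<mu>" for N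
  proof -
    have "Suc N > 0" by simp
    from ando_truncated[OF v1 v2 this] show ?thesis unfolding Q_def B_def by metis
  qed
  then obtain \<mu> where "\<forall>N. Q (Suc N) (\<mu> N)" using choice[of "\<lambda>N. Q (Suc N)"] by blast
  then have Q: "Q (Suc N) (\<mu> N)" for N by (rule spec)
  note Q1 = Q[unfolded Q_def]
  note Q2 = Q1[THEN conjunct2] note Q3 = Q2[THEN conjunct2] note Q4 = Q3[THEN conjunct2]
  have \<mu>1: "psd (\<mu> N)" for N by (rule Q1[THEN conjunct1])
  have \<mu>2: "\<mu> N (Suc (fst x), snd x) (Suc (fst y), snd y) = \<mu> N x y" for N x y
    by (rule Q2[THEN conjunct1, rule_format])
  have \<mu>3: "\<mu> N (fst x, Suc (snd x)) (fst y, Suc (snd y)) = \<mu> N x y" for N x y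
    by (rule Q3[THEN conjunct1, rule_format])
  have \<mu>4: "\<mu> N (0, 0) (0, 0) = of_real B" for N by (rule Q4[THEN conjunct1])
  have \<mu>5: "real (Suc N - D) / real (Suc N) * (norm (comb F c v))\<^sup>2 \<le> Re (qf (\<mu> N) F c)"
    if "finite F" "\<And>x. x \<in> F \<Longrightarrow> fst x + snd x \<le> D" "D \<le> Suc N" for N F c D
    using Q4[THEN conjunct2, rule_format, of F D N c] that by blast
  have diag: "\<mu> N x x = of_real B" for N x
  proof -
    have "\<mu> N (a, b) (a, b) = \<mu> N (0, 0) (0, 0)" for a b
    proof (induction a)
      case 0
      show ?case
      proof (induction b)
        case (Suc b)
        then show ?case using \<mu>3[of N "(0, b)" "(0, b)"] by simp
      qed simp
    next
      case (Suc a)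
      then show ?case using \<mu>2[of N "(a, b)" "(a, b)"] by simp
    qed
    then show ?thesis using \<mu>4 by (cases x) simp
  qed
  have bound: "cmod (\<mu> N (fst z) (snd z)) \<le> B" for N z by (rule psd_cmod_le[OF \<mu>1 diag diag])
  obtain d where d: "strict_mono d" "\<And>z. convergent (\<lambda>i. \<mu> (d i) (fst z) (snd z))"
    using convergent_diagonal[of "\<lambda>N z. \<mu> N (fst z) (snd z)", OF bound] by metis
  define \<kappa> where "\<kappa> = (\<lambda>x y. lim (\<lambda>i. \<mu> (d i) x y))"
  have lim: "(\<lambda>i. \<mu> (d i) x y) \<longlonglongrightarrow> \<kappa> x y" for x y
    using d(2)[of "(x, y)"] by (simp add: \<kappa>_def convergent_LIMSEQ_iff)
  have qlim: "(\<lambda>i. Re (qf (\<mu> (d i)) F c)) \<longlonglongrightarrow> Re (qf \<kappa> F c)" for F c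
    by (intro tendsto_Re qf_tendsto lim)
  have psd\<kappa>: "psd \<kappa>"
  proof (rule psdI)
    show "\<kappa> x y = cnj (\<kappa> y x)" for x y
    proof (rule LIMSEQ_unique[OF lim])
      have "(\<lambda>i. cnj (\<mu> (d i) y x)) \<longlonglongrightarrow> cnj (\<kappa> y x)" by (intro tendsto_cnj lim)
      then show "(\<lambda>i. \<mu> (d i) x y) \<longlonglongrightarrow> cnj (\<kappa> y x)" by (simp flip: psd_hermitian[OF \<mu>1])
    qed
    show "0 \<le> Re (qf \<kappa> F c)" if "finite F" for F c
      by (rule tendsto_lowerbound[OF qlim]) (auto intro!: always_eventually psd_qf[OF \<mu>1 that])
  qed
  have low: "(norm (comb F c v))\<^sup>2 \<le> Re (qf \<kappa> F c)" if F: "finite F" for F c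
  proof (rule LIMSEQ_le[OF _ qlim])
    define D where "D = (\<Sum>x\<in>F. fst x + snd x)"
    have D: "fst x + snd x \<le> D" if "x \<in> F" for x unfolding D_def using F that by (intro member_le_sum) auto
    have "(\<lambda>n. real D / real n) \<longlonglongrightarrow> 0" by (rule lim_const_over_n)
    moreover have "filterlim (\<lambda>i. Suc (d i)) sequentially sequentially"
      using filterlim_compose[OF filterlim_Suc filterlim_subseq[OF d(1)]] .
    ultimately have "(\<lambda>i. real D / real (Suc (d i))) \<longlonglongrightarrow> 0" by (rule filterlim_compose)
    then have "(\<lambda>i. (1 - real D / real (Suc (d i))) * (norm (comb F c v))\<^sup>2) \<longlonglongrightarrow> (1 - 0) * (norm (comb F c v))\<^sup>2"
      by (intro tendsto_intros)
    then show "(\<lambda>i. (1 - real D / real (Suc (d i))) * (norm (comb F c v))\<^sup>2) \<longlonglongrightarrow> (norm (comb F c v))\<^sup>2" by simp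
    have "(1 - real D / real (Suc (d i))) * (norm (comb F c v))\<^sup>2 \<le> Re (qf (\<mu> (d i)) F c)" if "i \<ge> D" for i
    proof -
      have "D \<le> Suc (d i)" using seq_suble[OF d(1), of i] that by linarith
      moreover from this have "1 - real D / real (Suc (d i)) = real (Suc (d i) - D) / real (Suc (d i))"
        by (simp add: of_nat_diff field_simps del: of_nat_Suc)
      ultimately show ?thesis using \<mu>5[OF F D, of "d i" c] by simp
    qed
    then show "\<exists>N. \<forall>n\<ge>N. (1 - real D / real (Suc (d n))) * (norm (comb F c v))\<^sup>2 \<le> Re (qf (\<mu> (d n)) F c)" by blast
  qed
  have sh1: "\<kappa> (Suc a, b) (Suc a', b') = \<kappa> (a, b) (a', b')" for a b a' b'
    using \<mu>2[of _ "(a, b)" "(a', b')"] by (simp add: \<kappa>_def)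
  have sh2: "\<kappa> (a, Suc b) (a', Suc b') = \<kappa> (a, b) (a', b')" for a b a' b'
    using \<mu>3[of _ "(a, b)" "(a', b')"] by (simp add: \<kappa>_def)
  have shift: "\<kappa> (a + i, b + j) (a' + i, b' + j) = \<kappa> (a, b) (a', b')" for a b a' b' i j
    by (induction i; induction j) (simp_all add: sh1 sh2)
  \<comment> \<open>The limit kernel is invariant under translations of natural indices. It extends
    to integer indices by translating both arguments until they are nonnegative; \<open>M_eq\<close>
    says that every such translation gives the same value.\<close>
  define M where "M = (\<lambda>x y :: int \<times> int. let p = min (fst x) (fst y); q = min (snd x) (snd y) in
     \<kappa> (nat (fst x - p), nat (snd x - q)) (nat (fst y - p), nat (snd y - q)))"
  have M_eq: "M x y = \<kappa> (nat (fst x + L), nat (snd x + L)) (nat (fst y + L), nat (snd y + L))"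
    if "0 \<le> fst x + L" "0 \<le> snd x + L" "0 \<le> fst y + L" "0 \<le> snd y + L" for x y L
  proof -
    let ?p = "min (fst x) (fst y)" and ?q = "min (snd x) (snd y)"
    have "nat (fst x + L) = nat (fst x - ?p) + nat (?p + L)" "nat (fst y + L) = nat (fst y - ?p) + nat (?p + L)"
      "nat (snd x + L) = nat (snd x - ?q) + nat (?q + L)" "nat (snd y + L) = nat (snd y - ?q) + nat (?q + L)"
      using that by (auto simp: min_def)
    then show ?thesis unfolding M_def Let_def by (simp only: shift)
  qed
  have psdM: "psd M"
  proof (rule psdI)
    show "M x y = cnj (M y x)" for x y
      unfolding M_def Let_def by (simp add: min.commute psd_hermitian[OF psd\<kappa>, symmetric])
    show "0 \<le> Re (qf M F c)" if F: "finite F" for F c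
    proof -
      define L where "L = (\<Sum>x\<in>F. \<bar>fst x\<bar> + \<bar>snd x\<bar>)"
      have L: "0 \<le> fst x + L" "0 \<le> snd x + L" if "x \<in> F" for x
      proof -
        have "\<bar>fst x\<bar> + \<bar>snd x\<bar> \<le> L" unfolding L_def using F that by (intro member_le_sum) auto
        then show "0 \<le> fst x + L" "0 \<le> snd x + L" by linarith+
      qed
      have "qf M F c = qf (\<lambda>x y. \<kappa> (nat (fst x + L), nat (snd x + L)) (nat (fst y + L), nat (snd y + L))) F c"
        unfolding qf_def using L by (intro sum.cong refl) (simp add: M_eq)
      then show ?thesis
        using psd_qf[OF psd_comp[OF psd\<kappa>, of "\<lambda>x. (nat (fst x + L), nat (snd x + L))"] F] by simp
    qed
  qed
  obtain \<omega> :: "int \<times> int \<Rightarrow> ell2" where \<omega>: "gram \<omega> = M" by (rule kolmogorov[OF psdM])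
  have \<omega>': "cinner (\<omega> x) (\<omega> y) = M x y" for x y using fun_cong[OF fun_cong[OF \<omega>, of x], of y] by (simp add: gram_def)
  show ?thesis
  proof (rule that[of \<omega>])
    show "cinner (\<omega> (x + a)) (\<omega> (y + a)) = cinner (\<omega> x) (\<omega> y)" for a x y
    proof -
      have "min (i + k) (j + k) = min i j + k" for i j k :: int by (simp add: min_def)
      then show ?thesis unfolding \<omega>' M_def Let_def fst_add snd_add by simp
    qed
    have "\<kappa> (0, 0) (0, 0) = of_real B" using lim[of "(0, 0)" "(0, 0)"] by (simp add: \<mu>4 LIMSEQ_const_iff)
    then have "cinner (\<omega> (0, 0)) (\<omega> (0, 0)) = of_real B" by (simp add: \<omega>' M_eq[of _ 0])
    then have "(norm (\<omega> (0, 0)))\<^sup>2 = B" by (simp add: norm_sq_cinner)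
    then show "norm (\<omega> (0, 0)) = norm (v (0, 0))" unfolding B_def by (simp add: power2_eq_iff_nonneg)
    have g: "gram (\<lambda>x. \<omega> (int (fst x), int (snd x))) = \<kappa>"
      by (intro ext) (simp add: gram_def \<omega>' M_eq[of _ 0])
    show "sdom v (\<lambda>x. \<omega> (int (fst x), int (snd x)))"
      unfolding sdom_def
    proof (intro allI impI)
      fix F :: "(nat \<times> nat) set" and c assume F: "finite F"
      have "(norm (comb F c v))\<^sup>2 \<le> (norm (comb F c (\<lambda>x. \<omega> (int (fst x), int (snd x)))))\<^sup>2"
        using low[OF F, of c] qf_gram[of "\<lambda>x. \<omega> (int (fst x), int (snd x))" F c] g by simp
      then show "norm (comb F c v) \<le> norm (comb F c (\<lambda>x. \<omega> (int (fst x), int (snd x))))"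
        by (rule power2_le_imp_le) simp
    qed
  qed
qed

section \<open>Averaging over roots of unity\<close>

definition ru :: "nat \<Rightarrow> nat \<Rightarrow> complex" where "ru M k = cis (2 * pi * real k / real M)"

lemma cmod_ru [simp]: "cmod (ru M k) = 1" by (simp add: ru_def)

lemma ru_nonzero [simp]: "ru M k \<noteq> 0" by (simp add: ru_def)

lemma sum_ru_powi:
  assumes "M > 0" "\<bar>j\<bar> < int M" shows "(\<Sum>k<M. ru M k powi j) = (if j = 0 then of_nat M else 0)"
proof (cases "j = 0")
  case False
  define \<zeta> where "\<zeta> = cis (2 * pi * of_int j / real M)"
  have eq: "ru M k powi j = \<zeta> ^ k" for k
    by (simp add: ru_def \<zeta>_def cis_power_int Complex.DeMoivre mult_ac)
  have "\<zeta> ^ M = cis (2 * pi * of_int j)" using assms(1) by (simp add: \<zeta>_def Complex.DeMoivre)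
  then have one: "\<zeta> ^ M = 1" by (simp add: cis_multiple_2pi)
  have "\<zeta> \<noteq> 1"
  proof
    assume "\<zeta> = 1"
    then have "cos (2 * pi * of_int j / real M) = 1" by (simp add: \<zeta>_def cis.ctr complex_eq_iff)
    then obtain n :: int where "2 * pi * of_int j / real M = of_int n * 2 * pi" by (auto simp: cos_one_2pi_int)
    then have "of_int j = (of_int (n * int M) :: real)" using assms(1) by (simp add: field_simps)
    then have j: "j = n * int M" by (simp only: of_int_eq_iff)
    then have "n \<noteq> 0" using False by auto
    then have "int M \<le> \<bar>n\<bar> * int M" using mult_right_mono[of 1 "\<bar>n\<bar>" "int M"] by simp
    then show False using assms(2) j by (simp add: abs_mult)
  qed
  then show ?thesis using False one by (simp add: eq sum_gp_strict)
qed (use assms in \<open>simp\<close>)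

lemma ru_cnj_powi: "cnj (ru M k powi n) * ru M k powi m = ru M k powi (m - n)"
  by (simp add: ru_def cis_power_int cis_cnj cis_mult left_diff_distrib diff_divide_distrib add.commute)

text \<open>Roots of unity of order \<open>M\<close> replace the integral over the torus. The
  hypothesis \<open>sp\<close> keeps all differences of exponents below \<open>M\<close>, where
  distinct characters are exactly orthogonal.\<close>

lemma parseval_ru:
  fixes y :: "int \<times> int \<Rightarrow> 'a::complex_hilbert"
  assumes M: "M > 0" and F: "finite F"
    and sp: "\<And>x x'. x \<in> F \<Longrightarrow> x' \<in> F \<Longrightarrow> \<bar>fst x' - fst x\<bar> < int M \<and> \<bar>snd x' - snd x\<bar> < int M"
  shows "(\<Sum>k<M. \<Sum>l<M. (norm (comb F (\<lambda>x. ru M k powi fst x * ru M l powi snd x) y))\<^sup>2) = (real M)\<^sup>2 * (\<Sum>x\<in>F. (norm (y x))\<^sup>2)"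
proof -
  let ?\<chi> = "\<lambda>k l x. ru M k powi fst x * ru M l powi snd x"
  have "complex_of_real (\<Sum>k<M. \<Sum>l<M. (norm (comb F (?\<chi> k l) y))\<^sup>2)
      = (\<Sum>k<M. \<Sum>l<M. \<Sum>x\<in>F. \<Sum>x'\<in>F. cnj (?\<chi> k l x) * ?\<chi> k l x' * gram y x x')"
    by (simp only: of_real_sum qf_gram[symmetric] qf_def)
  also have "\<dots> = (\<Sum>k<M. \<Sum>x\<in>F. \<Sum>l<M. \<Sum>x'\<in>F. cnj (?\<chi> k l x) * ?\<chi> k l x' * gram y x x')"
    by (intro sum.cong refl sum.swap)
  also have "\<dots> = (\<Sum>k<M. \<Sum>x\<in>F. \<Sum>x'\<in>F. \<Sum>l<M. cnj (?\<chi> k l x) * ?\<chi> k l x' * gram y x x')"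
    by (intro sum.cong refl sum.swap)
  also have "\<dots> = (\<Sum>x\<in>F. \<Sum>k<M. \<Sum>x'\<in>F. \<Sum>l<M. cnj (?\<chi> k l x) * ?\<chi> k l x' * gram y x x')"
    by (rule sum.swap)
  also have "\<dots> = (\<Sum>x\<in>F. \<Sum>x'\<in>F. \<Sum>k<M. \<Sum>l<M. cnj (?\<chi> k l x) * ?\<chi> k l x' * gram y x x')"
    by (intro sum.cong refl sum.swap)
  also have "\<dots> = (\<Sum>x\<in>F. \<Sum>x'\<in>F. if x' = x then of_nat M * of_nat M * gram y x x' else 0)"
  proof (intro sum.cong refl)
    fix x x' assume x: "x \<in> F" "x' \<in> F"
    have "cnj (?\<chi> k l x) * ?\<chi> k l x' * gram y x x' = ru M k powi (fst x' - fst x) * (ru M l powi (snd x' - snd x) * gram y x x')" for k l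
      unfolding ru_cnj_powi[symmetric] by (simp add: mult_ac)
    then have "(\<Sum>k<M. \<Sum>l<M. cnj (?\<chi> k l x) * ?\<chi> k l x' * gram y x x')
        = (\<Sum>k<M. ru M k powi (fst x' - fst x)) * ((\<Sum>l<M. ru M l powi (snd x' - snd x)) * gram y x x')"
      by (simp only: sum_distrib_right[where r = "gram y x x'"] sum_product)
    also have "\<dots> = (if x' = x then of_nat M * of_nat M * gram y x x' else 0)"
      using sp[OF x] M by (auto simp: sum_ru_powi prod_eq_iff)
    finally show "(\<Sum>k<M. \<Sum>l<M. cnj (?\<chi> k l x) * ?\<chi> k l x' * gram y x x') = (if x' = x then of_nat M * of_nat M * gram y x x' else 0)" .
  qed
  also have "\<dots> = (\<Sum>x\<in>F. of_nat M * of_nat M * gram y x x)" using F by simp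
  also have "\<dots> = complex_of_real ((real M)\<^sup>2 * (\<Sum>x\<in>F. (norm (y x))\<^sup>2))"
    by (simp add: gram_def cinner_self sum_distrib_left power2_eq_square mult.assoc)
  finally show ?thesis by (simp only: of_real_eq_iff)
qed

text \<open>The spectral theorem for commuting unitaries is replaced by averaging over boxes.
  Correlating \<open>c\<close> with \<omega> cut to a box becomes multiplication by the Laurent
  polynomial on the Fourier side, so Parseval bounds the square sum by that of the box times
  \<open>B\<^sup>2\<close>. Away from the edges each value of the correlation has the norm of
  \<open>comb F c \<omega>\<close>, and the edges become negligible.\<close>

lemma stationary_von_neumann:
  fixes \<omega> :: "int \<times> int \<Rightarrow> 'a::complex_hilbert"
  assumes st: "\<And>a x y. cinner (\<omega> (x + a)) (\<omega> (y + a)) = cinner (\<omega> x) (\<omega> y)" and F: "finite F"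
    and B: "\<And>z w. cmod z = 1 \<Longrightarrow> cmod w = 1 \<Longrightarrow> cmod (laurent F c z w) \<le> B"
  shows "norm (comb F c \<omega>) \<le> B * norm (\<omega> (0, 0))"
proof -
  have B0: "0 \<le> B" by (rule order_trans[OF norm_ge_zero B[of 1 1]]) simp_all
  have nst: "norm (comb F c (\<lambda>x. \<omega> (x + a))) = norm (comb F c \<omega>)" for a
    by (rule comb_norm_eq_gram) (intro ext, simp only: gram_def st)
  have n0: "norm (\<omega> x) = norm (\<omega> (0, 0))" for x
  proof -
    have "cinner (\<omega> x) (\<omega> x) = cinner (\<omega> 0) (\<omega> 0)" using st[where a = x and x = 0 and y = 0] by simp
    then show ?thesis by (simp add: norm_eq_sqrt_cinner zero_prod_def)
  qed
  obtain D :: nat where D: "\<And>x. x \<in> F \<Longrightarrow> \<bar>fst x\<bar> \<le> int D \<and> \<bar>snd x\<bar> \<le> int D"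
  proof
    fix x assume "x \<in> F"
    then have "nat \<bar>fst x\<bar> + nat \<bar>snd x\<bar> \<le> (\<Sum>x\<in>F. nat \<bar>fst x\<bar> + nat \<bar>snd x\<bar>)"
      using F member_le_sum[of x F "\<lambda>x. nat \<bar>fst x\<bar> + nat \<bar>snd x\<bar>"] by simp
    then show "\<bar>fst x\<bar> \<le> int (\<Sum>x\<in>F. nat \<bar>fst x\<bar> + nat \<bar>snd x\<bar>) \<and> \<bar>snd x\<bar> \<le> int (\<Sum>x\<in>F. nat \<bar>fst x\<bar> + nat \<bar>snd x\<bar>)"
      by linarith
  qed
  have step: "real (N - 2 * D) * norm (comb F c \<omega>) \<le> B * (real N * norm (\<omega> (0, 0)))" for N
  proof -
    define Box where "Box = {0..<int N} \<times> {0..<int N}"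
    \<comment> \<open>\<open>R\<close> contains every position at which \<open>F\<close> meets the
      box, \<open>Box0\<close> consists of positions at which all of \<open>F\<close> stays inside
      it, and \<open>M\<close> exceeds all differences within \<open>R\<close>.\<close>
    define R where "R = {- int D..<int N + int D} \<times> {- int D..<int N + int D}"
    define Box0 where "Box0 = {int D..<int N - int D} \<times> {int D..<int N - int D}"
    define M where "M = N + 2 * D + 1"
    define g where "g = (\<lambda>b. \<Sum>x\<in>F. if b + x \<in> Box then c x *\<^sub>C \<omega> (b + x) else 0)"
    let ?\<chi> = "\<lambda>k l x. ru M k powi fst x * ru M l powi snd x"
    have M: "M > 0" by (simp add: M_def)
    have fin: "finite Box" "finite R" by (auto simp: Box_def R_def)
    have shift: "?\<chi> k l (- b) = ?\<chi> k l x * ?\<chi> k l (- (b + x))" for k l b x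
    proof -
      have p: "z powi (- i) = z powi j * z powi (- (i + j))" if "z \<noteq> 0" for z :: complex and i j
        using that by (subst power_int_add[symmetric]) auto
      show ?thesis unfolding fst_add snd_add fst_uminus snd_uminus
        by (subst p[of "ru M k" "fst b" "fst x"], simp, subst p[of "ru M l" "snd b" "snd x"], simp) (simp only: mult_ac)
    qed
    have prod: "comb R (\<lambda>b. ?\<chi> k l (- b)) g = laurent F c (ru M k) (ru M l) *\<^sub>C comb Box (\<lambda>a. ?\<chi> k l (- a)) \<omega>" for k l
    proof -
      have "comb R (\<lambda>b. ?\<chi> k l (- b)) g = (\<Sum>b\<in>R. \<Sum>x\<in>F. if b + x \<in> Box then (?\<chi> k l (- b) * c x) *\<^sub>C \<omega> (b + x) else 0)"
        unfolding comb_def g_def scaleC_sum_right by (intro sum.cong refl) (simp add: scaleC_scaleC)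
      also have "\<dots> = (\<Sum>x\<in>F. \<Sum>b\<in>R. if b + x \<in> Box then (?\<chi> k l (- b) * c x) *\<^sub>C \<omega> (b + x) else 0)" by (rule sum.swap)
      also have "\<dots> = (\<Sum>x\<in>F. \<Sum>a\<in>Box. (?\<chi> k l x * ?\<chi> k l (- a) * c x) *\<^sub>C \<omega> a)"
      proof (rule sum.cong[OF refl])
        fix x assume x: "x \<in> F"
        have "(\<Sum>b\<in>R. if b + x \<in> Box then (?\<chi> k l (- b) * c x) *\<^sub>C \<omega> (b + x) else 0)
            = (\<Sum>b\<in>{b\<in>R. b + x \<in> Box}. (?\<chi> k l x * ?\<chi> k l (- (b + x)) * c x) *\<^sub>C \<omega> (b + x))"
          using fin shift by (subst sum.inter_filter) (auto intro!: sum.cong)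
        also have "\<dots> = (\<Sum>a\<in>Box. (?\<chi> k l x * ?\<chi> k l (- a) * c x) *\<^sub>C \<omega> a)"
        proof (rule sum.reindex_bij_betw[where h = "\<lambda>b. b + x" and g = "\<lambda>a. (?\<chi> k l x * ?\<chi> k l (- a) * c x) *\<^sub>C \<omega> a"])
          show "bij_betw (\<lambda>b. b + x) {b \<in> R. b + x \<in> Box} Box"
            by (rule bij_betw_byWitness[of _ "\<lambda>a. a - x"]) (use D[OF x] in \<open>auto simp: Box_def R_def minus_prod_def plus_prod_def\<close>)
        qed
        finally show "(\<Sum>b\<in>R. if b + x \<in> Box then (?\<chi> k l (- b) * c x) *\<^sub>C \<omega> (b + x) else 0) = (\<Sum>a\<in>Box. (?\<chi> k l x * ?\<chi> k l (- a) * c x) *\<^sub>C \<omega> a)" .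
      qed
      also have "\<dots> = laurent F c (ru M k) (ru M l) *\<^sub>C comb Box (\<lambda>a. ?\<chi> k l (- a)) \<omega>"
        unfolding laurent_def comb_def scaleC_sum_left
        by (rule sum.cong[OF refl]) (simp add: scaleC_sum_right scaleC_scaleC mult_ac)
      finally show ?thesis .
    qed
    have neg: "comb A (\<lambda>b. ?\<chi> k l (- b)) y = comb (uminus ` A) (?\<chi> k l) (\<lambda>b. y (- b))" for A k l and y :: "int \<times> int \<Rightarrow> 'a"
      unfolding comb_def by (subst sum.reindex) (auto simp: inj_on_def)
    have pars: "(\<Sum>k<M. \<Sum>l<M. (norm (comb A (\<lambda>b. ?\<chi> k l (- b)) y))\<^sup>2) = (real M)\<^sup>2 * (\<Sum>x\<in>A. (norm (y x))\<^sup>2)" if "A \<subseteq> R" for A and y :: "int \<times> int \<Rightarrow> 'a"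
    proof -
      have "finite A" using that fin by (auto intro: finite_subset)
      moreover have "\<bar>fst x' - fst x\<bar> < int M \<and> \<bar>snd x' - snd x\<bar> < int M" if x: "x \<in> uminus ` A" "x' \<in> uminus ` A" for x x'
      proof -
        obtain b where "b \<in> A" "x = - b" using x(1) by blast
        moreover obtain b' where "b' \<in> A" "x' = - b'" using x(2) by blast
        ultimately have "x = - b" "x' = - b'" "b \<in> R" "b' \<in> R" using \<open>A \<subseteq> R\<close> by auto
        then show ?thesis by (auto simp: R_def M_def)
      qed
      ultimately have "(\<Sum>k<M. \<Sum>l<M. (norm (comb (uminus ` A) (?\<chi> k l) (\<lambda>b. y (- b))))\<^sup>2) = (real M)\<^sup>2 * (\<Sum>x\<in>uminus ` A. (norm (y (- x)))\<^sup>2)"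
        by (intro parseval_ru[OF M]) auto
      also have "(\<Sum>x\<in>uminus ` A. (norm (y (- x)))\<^sup>2) = (\<Sum>x\<in>A. (norm (y x))\<^sup>2)"
        by (subst sum.reindex) (auto simp: inj_on_def)
      finally show ?thesis unfolding neg .
    qed
    have "(real (N - 2 * D) * norm (comb F c \<omega>))\<^sup>2 = (\<Sum>b\<in>Box0. (norm (g b))\<^sup>2)"
    proof -
      have "norm (g b) = norm (comb F c \<omega>)" if b: "b \<in> Box0" for b
      proof -
        have "b + x \<in> Box" if "x \<in> F" for x using D[OF that] b by (auto simp: Box_def Box0_def plus_prod_def)
        then have "g b = comb F c (\<lambda>x. \<omega> (x + b))" by (simp add: g_def comb_def add.commute)
        then show ?thesis by (simp add: nst)
      qed
      then have "(\<Sum>b\<in>Box0. (norm (g b))\<^sup>2) = real (card Box0) * (norm (comb F c \<omega>))\<^sup>2" by simp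
      also have "card Box0 = (N - 2 * D) * (N - 2 * D)" 
      proof -
        have "nat (int N - 2 * int D) = N - 2 * D" by linarith
        then show ?thesis by (simp add: Box0_def card_cartesian_product)
      qed
      finally show ?thesis by (simp add: power2_eq_square)
    qed
    also have "\<dots> \<le> (\<Sum>b\<in>R. (norm (g b))\<^sup>2)"
      using fin by (intro sum_mono2) (auto simp: Box0_def R_def)
    also have "\<dots> \<le> (B * (real N * norm (\<omega> (0, 0))))\<^sup>2"
    proof -
      have "(real M)\<^sup>2 * (\<Sum>b\<in>R. (norm (g b))\<^sup>2) = (\<Sum>k<M. \<Sum>l<M. (norm (laurent F c (ru M k) (ru M l) *\<^sub>C comb Box (\<lambda>a. ?\<chi> k l (- a)) \<omega>))\<^sup>2)"
        by (simp only: pars[OF order_refl, symmetric] prod)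
      also have "\<dots> \<le> (\<Sum>k<M. \<Sum>l<M. B\<^sup>2 * (norm (comb Box (\<lambda>a. ?\<chi> k l (- a)) \<omega>))\<^sup>2)"
        unfolding norm_scaleC power_mult_distrib using B by (intro sum_mono mult_right_mono power_mono) auto
      also have "\<dots> = B\<^sup>2 * ((real M)\<^sup>2 * (\<Sum>x\<in>Box. (norm (\<omega> x))\<^sup>2))"
        unfolding sum_distrib_left[symmetric] by (subst pars) (auto simp: Box_def R_def)
      also have "(\<Sum>x\<in>Box. (norm (\<omega> x))\<^sup>2) = (real N * norm (\<omega> (0, 0)))\<^sup>2"
      proof -
        have "(norm (\<omega> x))\<^sup>2 = (norm (\<omega> (0, 0)))\<^sup>2" for x by (simp only: n0[of x])
        from sum.cong[OF refl this] have "(\<Sum>x\<in>Box. (norm (\<omega> x))\<^sup>2) = real (card Box) * (norm (\<omega> (0, 0)))\<^sup>2" by simp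
        then show ?thesis by (simp add: Box_def card_cartesian_product power2_eq_square)
      qed
      finally have "(real M)\<^sup>2 * (\<Sum>b\<in>R. (norm (g b))\<^sup>2) \<le> (real M)\<^sup>2 * (B * (real N * norm (\<omega> (0, 0))))\<^sup>2"
        by (simp add: power_mult_distrib mult_ac)
      then show ?thesis using M by (simp add: mult_le_cancel_left)
    qed
    finally show ?thesis by (rule power2_le_imp_le) (use B0 in simp)
  qed
  show ?thesis
  proof (rule LIMSEQ_le)
    have "(\<lambda>N. (1 - real (2 * D) / real N) * norm (comb F c \<omega>)) \<longlonglongrightarrow> (1 - 0) * norm (comb F c \<omega>)"
      by (intro tendsto_intros lim_const_over_n)
    then show "(\<lambda>N. (1 - real (2 * D) / real N) * norm (comb F c \<omega>)) \<longlonglongrightarrow> norm (comb F c \<omega>)" by simp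
    have "(1 - real (2 * D) / real N) * norm (comb F c \<omega>) \<le> B * norm (\<omega> (0, 0))" if N: "N \<ge> Suc (2 * D)" for N
    proof -
      have "1 - real (2 * D) / real N = real (N - 2 * D) / real N" using N by (simp add: of_nat_diff field_simps)
      then show ?thesis using step[of N] N by (simp add: field_simps)
    qed
    then show "\<exists>N0. \<forall>N\<ge>N0. (1 - real (2 * D) / real N) * norm (comb F c \<omega>) \<le> B * norm (\<omega> (0, 0))" by blast
  qed simp
qed

lemma von_neumann_pair:
  fixes v :: "nat \<times> nat \<Rightarrow> 'h::complex_hilbert" and K :: "'k set"
  assumes v: "sdom (\<lambda>x. v (Suc (fst x), snd x)) v" "sdom (\<lambda>x. v (fst x, Suc (snd x))) v" and K: "finite K"
    and B: "\<And>z w. cmod z = 1 \<Longrightarrow> cmod w = 1 \<Longrightarrow> cmod (\<Sum>x\<in>K. d x * z ^ fst (g x) * w ^ snd (g x)) \<le> B"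
  shows "norm (\<Sum>x\<in>K. d x *\<^sub>C v (g x)) \<le> B * norm (v (0, 0))"
proof -
  obtain \<omega> :: "int \<times> int \<Rightarrow> ell2" where \<omega>: "\<And>a x y. cinner (\<omega> (x + a)) (\<omega> (y + a)) = cinner (\<omega> x) (\<omega> y)"
    "norm (\<omega> (0, 0)) = norm (v (0, 0))" "sdom v (\<lambda>x. \<omega> (int (fst x), int (snd x)))"
    by (rule ando[OF v]) blast
  let ?h = "\<lambda>x. (int (fst (g x)), int (snd (g x)))"
  have "norm (\<Sum>x\<in>K. d x *\<^sub>C v (g x)) \<le> norm (\<Sum>x\<in>K. d x *\<^sub>C \<omega> (?h x))"
    using sdom_comp[OF \<omega>(3), of g] K by (simp add: sdom_def comb_def)
  also have "\<dots> \<le> B * norm (\<omega> (0, 0))"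
    unfolding comb_reindex[OF K, of d \<omega> ?h]
  proof (rule stationary_von_neumann[OF \<omega>(1)])
    show "cmod (laurent (?h ` K) (\<lambda>x. \<Sum>k | k \<in> K \<and> ?h k = x. d k) z w) \<le> B" if "cmod z = 1" "cmod w = 1" for z w
      using B[OF that] unfolding laurent_reindex[OF K, symmetric] by simp
  qed (use K in simp)
  finally show ?thesis using \<omega>(2) by simp
qed

section \<open>Splitting Laurent polynomials on an annulus\<close>

text \<open>This is \<open>parseval_ru\<close> for multiples of a single unit vector, with the
  second exponent fixed at 0.\<close>

lemma laurent1_parseval:
  assumes r: "r > 0" and G: "finite G" and B: "\<And>z. cmod z = r \<Longrightarrow> cmod (\<Sum>n\<in>G. g n * z powi n) \<le> B"
  shows "(\<Sum>n\<in>G. (cmod (g n) * r powi n)\<^sup>2) \<le> B\<^sup>2"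
proof -
  define M where "M = 2 * nat (\<Sum>n\<in>G. \<bar>n\<bar>) + 1"
  have le: "\<bar>n\<bar> \<le> (\<Sum>n\<in>G. \<bar>n\<bar>)" if "n \<in> G" for n using G that by (intro member_le_sum) auto
  have sp: "\<bar>n' - n\<bar> < int M" if "n \<in> G" "n' \<in> G" for n n'
    using le[OF that(1)] le[OF that(2)] unfolding M_def by linarith
  define y where "y = (\<lambda>x::int \<times> int. (g (fst x) * of_real r powi fst x) *\<^sub>C ell2_unit 0)"
  let ?f = "\<lambda>z. \<Sum>n\<in>G. g n * z powi n"
  have M0: "M > 0" by (simp add: M_def)
  have cp: "(\<Sum>x\<in>G \<times> {0::int}. f x) = (\<Sum>n\<in>G. f (n, 0))" for f :: "int \<times> int \<Rightarrow> 'x::comm_monoid_add"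
    by (rule sum.reindex_bij_witness[where i = "\<lambda>n. (n, 0)" and j = fst]) auto
  have cy: "comb (G \<times> {0}) (\<lambda>x. ru M k powi fst x * ru M l powi snd x) y = ?f (of_real r * ru M k) *\<^sub>C ell2_unit 0" for k l
  proof -
    have "comb (G \<times> {0}) (\<lambda>x. ru M k powi fst x * ru M l powi snd x) y = (\<Sum>n\<in>G. (ru M k powi n * (g n * of_real r powi n)) *\<^sub>C ell2_unit 0)"
      unfolding comb_def y_def cp by (simp add: scaleC_scaleC)
    then show ?thesis by (simp add: scaleC_sum_left power_int_mult_distrib mult_ac)
  qed
  have "(real M)\<^sup>2 * (\<Sum>x\<in>G \<times> {0::int}. (norm (y x))\<^sup>2)
      = (\<Sum>k<M. \<Sum>l<M. (norm (comb (G \<times> {0}) (\<lambda>x. ru M k powi fst x * ru M l powi snd x) y))\<^sup>2)"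
    by (rule parseval_ru[symmetric]) (use G sp M0 in auto)
  also have "\<dots> \<le> (\<Sum>k<M. \<Sum>l<M. B\<^sup>2)"
    unfolding cy norm_scaleC using B r by (intro sum_mono power_mono) (auto simp: norm_mult)
  also have "\<dots> = (real M)\<^sup>2 * B\<^sup>2" by (simp add: power2_eq_square)
  finally have "(\<Sum>x\<in>G \<times> {0::int}. (norm (y x))\<^sup>2) \<le> B\<^sup>2" using M0 by simp
  also have "(\<Sum>x\<in>G \<times> {0::int}. (norm (y x))\<^sup>2) = (\<Sum>n\<in>G. (cmod (g n) * r powi n)\<^sup>2)"
    using r by (simp add: y_def norm_scaleC norm_mult norm_power_int cp)
  finally show ?thesis .
qed

lemma geometric_tail_bound:
  fixes q :: real assumes q: "0 \<le> q" "q < 1" and H: "finite H" "\<And>n. n \<in> H \<Longrightarrow> int n0 \<le> n"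
  shows "(\<Sum>n\<in>H. q ^ nat n) \<le> q ^ n0 / (1 - q)"
proof -
  have inj: "inj_on (\<lambda>n. nat n - n0) H"
  proof (rule inj_onI)
    fix m n assume "m \<in> H" "n \<in> H" "nat m - n0 = nat n - n0"
    with H(2)[of m] H(2)[of n] show "m = n" by linarith
  qed
  have "(\<Sum>n\<in>H. q ^ nat n) = (\<Sum>n\<in>H. q ^ ((nat n - n0) + n0))" using H(2) by (intro sum.cong refl arg_cong[where f = "(^) q"]) force
  also have "\<dots> = (\<Sum>k\<in>(\<lambda>n. nat n - n0) ` H. q ^ (k + n0))" by (simp add: sum.reindex[OF inj])
  also have "\<dots> \<le> (\<Sum>k. q ^ (k + n0))"
    using q H by (intro sum_le_suminf) (auto intro: summable_ignore_initial_segment summable_geometric)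
  also have "\<dots> = q ^ n0 / (1 - q)" using q by (simp add: power_add suminf_mult2[symmetric] suminf_geometric summable_geometric)
  finally show ?thesis .
qed

text \<open>By Parseval and Cauchy-Schwarz, the part with exponents at least \<open>k\<close> of a Laurent polynomial
  bounded by \<open>1\<close> on the outer circle is bounded by this constant on the inner circle.\<close>

definition tail_const :: "real \<Rightarrow> nat \<Rightarrow> real" where
  "tail_const r k = sqrt ((1 / r ^ 4) ^ k / (1 - 1 / r ^ 4))"

lemma tail_const_nonneg: "r > 1 \<Longrightarrow> 0 \<le> tail_const r k"
  by (simp add: tail_const_def)

text \<open>Cauchy-Schwarz for \<open>cmod (g n) * r powi n\<close>, controlled by Parseval on the
  outer circle, and \<open>r powi (- 2 * n)\<close>, whose squares form a geometric series. The
  factor \<theta> is kept general because, via \<open>tail_bound_neg\<close>, it is also the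
  correction term of \<open>laurent1_rescale\<close>.\<close>

lemma tail_bound:
  assumes r: "r > 1" and F: "finite F" and B: "\<And>z. cmod z = r \<Longrightarrow> cmod (\<Sum>x\<in>F. a x * z powi e x) \<le> B"
    and \<theta>: "\<And>n. int n0 \<le> n \<Longrightarrow> cmod (\<theta> n) \<le> r powi (- n)"
  shows "cmod (\<Sum>x\<in>{x\<in>F. int n0 \<le> e x}. a x * \<theta> (e x)) \<le> tail_const r n0 * B"
proof -
  define g where "g = (\<lambda>n. \<Sum>x\<in>{x\<in>F. e x = n}. a x)"
  define H where "H = {n \<in> e ` F. int n0 \<le> n}"
  have H: "finite H" using F by (simp add: H_def)
  have B0: "0 \<le> B" by (rule order_trans[OF norm_ge_zero B[of "of_real r"]]) (use r in simp)
  have full: "(\<Sum>x\<in>F. a x * z powi e x) = (\<Sum>n\<in>e ` F. g n * z powi n)" for z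
  proof -
    have "(\<Sum>x\<in>F. a x * z powi e x) = (\<Sum>n\<in>e ` F. \<Sum>x\<in>{x\<in>F. e x = n}. a x * z powi e x)" using F by (rule sum.image_gen)
    also have "\<dots> = (\<Sum>n\<in>e ` F. g n * z powi n)" unfolding g_def sum_distrib_right by (intro sum.cong refl) auto
    finally show ?thesis .
  qed
  have eq: "(\<Sum>x\<in>{x\<in>F. int n0 \<le> e x}. a x * \<theta> (e x)) = (\<Sum>n\<in>H. g n * \<theta> n)"
  proof -
    have "(\<Sum>x\<in>{x\<in>F. int n0 \<le> e x}. a x * \<theta> (e x)) = (\<Sum>n\<in>e ` {x\<in>F. int n0 \<le> e x}. \<Sum>x\<in>{x\<in>{x\<in>F. int n0 \<le> e x}. e x = n}. a x * \<theta> (e x))"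
      using F by (intro sum.image_gen) simp
    also have "\<dots> = (\<Sum>n\<in>H. g n * \<theta> n)"
      unfolding g_def sum_distrib_right by (intro sum.cong) (auto simp: H_def)
    finally show ?thesis .
  qed
  have pars: "(\<Sum>n\<in>H. (cmod (g n) * r powi n)\<^sup>2) \<le> B\<^sup>2"
  proof -
    have "(\<Sum>n\<in>H. (cmod (g n) * r powi n)\<^sup>2) \<le> (\<Sum>n\<in>e ` F. (cmod (g n) * r powi n)\<^sup>2)"
      using F by (intro sum_mono2) (auto simp: H_def)
    also have "\<dots> \<le> B\<^sup>2" by (rule laurent1_parseval) (use r F B full in auto)
    finally show ?thesis .
  qed
  have "(\<Sum>n\<in>H. (r powi (- 2 * n))\<^sup>2) = (\<Sum>n\<in>H. (1 / r ^ 4) ^ nat n)"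
  proof (intro sum.cong refl)
    fix n assume "n \<in> H"
    then have "n = int (nat n)" by (auto simp: H_def)
    then obtain k where n: "n = int k" by blast
    have "- 2 * n = - int (2 * k)" by (simp add: n)
    then have e: "r powi (- 2 * n) = inverse (r ^ (2 * k))" by (simp only: power_int_minus power_int_of_nat)
    have "(r ^ (2 * k))\<^sup>2 = (r ^ 4) ^ k" unfolding power_mult[symmetric] by (rule arg_cong[where f = "(^) r"]) simp
    then have "(r powi (- 2 * n))\<^sup>2 = inverse ((r ^ 4) ^ k)" unfolding e by (simp only: power_inverse)
    then show "(r powi (- 2 * n))\<^sup>2 = (1 / r ^ 4) ^ nat n" by (simp only: n nat_int power_one_over inverse_eq_divide)
  qed
  also have "\<dots> \<le> (1 / r ^ 4) ^ n0 / (1 - 1 / r ^ 4)"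
    using H r by (intro geometric_tail_bound) (auto simp: H_def)
  finally have geo: "(\<Sum>n\<in>H. (r powi (- 2 * n))\<^sup>2) \<le> (tail_const r n0)\<^sup>2" using r by (simp add: tail_const_def)
  have "cmod (\<Sum>n\<in>H. g n * \<theta> n) \<le> (\<Sum>n\<in>H. cmod (g n) * r powi n * r powi (- 2 * n))"
  proof (intro order_trans[OF norm_sum] sum_mono)
    fix n assume "n \<in> H"
    then have "cmod (\<theta> n) \<le> r powi (- n)" by (intro \<theta>) (simp add: H_def)
    moreover have "r powi (- n) = r powi n * r powi (- 2 * n)" using r by (subst power_int_add[symmetric]) auto
    ultimately show "cmod (g n * \<theta> n) \<le> cmod (g n) * r powi n * r powi (- 2 * n)"
      by (simp only: norm_mult mult.assoc) (intro mult_left_mono, simp_all)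
  qed
  also have "\<dots> \<le> tail_const r n0 * B"
  proof (rule power2_le_imp_le)
    have "(\<Sum>n\<in>H. cmod (g n) * r powi n * r powi (- 2 * n))\<^sup>2 \<le> (\<Sum>n\<in>H. (cmod (g n) * r powi n)\<^sup>2) * (\<Sum>n\<in>H. (r powi (- 2 * n))\<^sup>2)"
      by (rule Cauchy_Schwarz_ineq_sum)
    also have "\<dots> \<le> B\<^sup>2 * (tail_const r n0)\<^sup>2" using pars geo by (intro mult_mono) (auto intro: sum_nonneg)
    finally show "(\<Sum>n\<in>H. cmod (g n) * r powi n * r powi (- 2 * n))\<^sup>2 \<le> (tail_const r n0 * B)\<^sup>2" by (simp add: power_mult_distrib mult_ac)
    show "0 \<le> tail_const r n0 * B" using B0 r by (simp add: tail_const_nonneg)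
  qed
  finally show ?thesis unfolding eq .
qed

lemma tail_bound_neg:
  assumes r: "r > 1" and F: "finite F" and B: "\<And>z. cmod z = inverse r \<Longrightarrow> cmod (\<Sum>x\<in>F. a x * z powi e x) \<le> B"
    and \<theta>: "\<And>n. n \<le> - int n0 \<Longrightarrow> cmod (\<theta> n) \<le> r powi n"
  shows "cmod (\<Sum>x\<in>{x\<in>F. e x \<le> - int n0}. a x * \<theta> (e x)) \<le> tail_const r n0 * B"
proof -
  have "cmod (\<Sum>x\<in>{x\<in>F. int n0 \<le> - e x}. a x * \<theta> (- (- e x))) \<le> tail_const r n0 * B"
  proof (rule tail_bound[OF r F, where \<theta> = "\<lambda>n. \<theta> (- n)" and e = "\<lambda>x. - e x"])
    fix z :: complex assume "cmod z = r"
    then have "cmod (inverse z) = inverse r" by (simp add: norm_inverse)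
    from B[OF this] show "cmod (\<Sum>x\<in>F. a x * z powi (- e x)) \<le> B" by (simp add: power_int_minus power_int_inverse)
  qed (use \<theta> in auto)
  moreover have "{x\<in>F. int n0 \<le> - e x} = {x\<in>F. e x \<le> - int n0}" by auto
  ultimately show ?thesis by simp
qed

definition part :: "int \<Rightarrow> int \<Rightarrow> bool" where "part s n \<longleftrightarrow> (if s = 1 then 0 \<le> n else n < 0)"

text \<open>A part is the whole minus its complement, and the complement is a tail. The exponent 0
  belongs to the part \<open>s = 1\<close>, so the complementary tail starts at -1 for
  \<open>s = 1\<close> and at 0 for \<open>s = -1\<close>; hence the two tail indices.\<close>

definition part_const :: "int \<Rightarrow> real \<Rightarrow> real" where "part_const s r = 1 + tail_const r (if s = 1 then 1 else 0)"

lemma laurent1_part: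
  assumes r: "r > 1" and s: "s = 1 \<or> s = -1" and F: "finite F"
    and B: "\<And>z. z \<in> bdry r \<Longrightarrow> cmod (\<Sum>x\<in>F. a x * z powi e x) \<le> B"
    and z: "cmod z = r powi s"
  shows "cmod (\<Sum>x\<in>{x\<in>F. part s (e x)}. a x * z powi e x) \<le> part_const s r * B"
proof -
  have split: "(\<Sum>x\<in>{x\<in>F. P x}. f x) = (\<Sum>x\<in>F. f x) - (\<Sum>x\<in>{x\<in>F. \<not> P x}. f x)" for P and f :: "_ \<Rightarrow> complex"
  proof -
    have "(\<Sum>x\<in>F. f x) = (\<Sum>x\<in>{x\<in>F. P x} \<union> {x\<in>F. \<not> P x}. f x)" by (intro sum.cong) auto
    also have "\<dots> = (\<Sum>x\<in>{x\<in>F. P x}. f x) + (\<Sum>x\<in>{x\<in>F. \<not> P x}. f x)" using F by (intro sum.union_disjoint) auto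
    finally show ?thesis by simp
  qed
  have zb: "z \<in> bdry r" using s z by (auto simp: bdry_def power_int_minus)
  show ?thesis
  proof (cases "s = 1")
    case True
    have "cmod (\<Sum>x\<in>{x\<in>F. e x \<le> - int 1}. a x * z powi e x) \<le> tail_const r 1 * B"
      using B z True by (intro tail_bound_neg[OF r F]) (auto simp: bdry_def norm_power_int)
    moreover have "{x\<in>F. e x \<le> - int 1} = {x\<in>F. \<not> 0 \<le> e x}" by auto
    ultimately have "cmod (\<Sum>x\<in>{x\<in>F. \<not> 0 \<le> e x}. a x * z powi e x) \<le> tail_const r 1 * B" by simp
    then show ?thesis using True norm_triangle_ineq4 B[OF zb] unfolding part_def part_const_def
      by (subst split) (simp add: distrib_right, smt (verit) norm_triangle_ineq4)
  next
    case False
    then have "s = -1" using s by simp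
    then have "cmod (\<Sum>x\<in>{x\<in>F. int 0 \<le> e x}. a x * z powi e x) \<le> tail_const r 0 * B"
      using B z by (intro tail_bound[OF r F]) (auto simp: bdry_def norm_power_int power_int_minus power_int_inverse)
    moreover have "{x\<in>F. int 0 \<le> e x} = {x\<in>F. \<not> e x < 0}" by auto
    ultimately have "cmod (\<Sum>x\<in>{x\<in>F. \<not> e x < 0}. a x * z powi e x) \<le> tail_const r 0 * B" by simp
    then show ?thesis using False B[OF zb] unfolding part_def part_const_def
      by (subst split) (simp add: distrib_right, smt (verit) norm_triangle_ineq4)
  qed
qed

lemma laurent_part:
  assumes r: "r1 > 1" "r2 > 1" and s: "s = 1 \<or> s = -1" and t: "t = 1 \<or> t = -1" and F: "finite F"
    and B: "\<And>z w. z \<in> bdry r1 \<Longrightarrow> w \<in> bdry r2 \<Longrightarrow> cmod (laurent F c z w) \<le> B"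
    and z: "cmod z = r1 powi s" and w: "cmod w = r2 powi t"
  shows "cmod (laurent {x\<in>F. part s (fst x) \<and> part t (snd x)} c z w) \<le> part_const s r1 * part_const t r2 * B"
proof -
  have 1: "cmod (\<Sum>x\<in>{x\<in>F. part s (fst x)}. c x * w powi snd x * z powi fst x) \<le> part_const s r1 * B" if "w \<in> bdry r2" for w
    by (rule laurent1_part[OF r(1) s F]) (use B that z in \<open>auto simp: laurent_def mult_ac\<close>)
  have "cmod (\<Sum>x\<in>{x\<in>{x\<in>F. part s (fst x)}. part t (snd x)}. c x * z powi fst x * w powi snd x) \<le> part_const t r2 * (part_const s r1 * B)"
    by (rule laurent1_part[OF r(2) t]) (use F 1 w in \<open>auto simp: mult_ac\<close>)
  moreover have "{x\<in>{x\<in>F. part s (fst x)}. part t (snd x)} = {x\<in>F. part s (fst x) \<and> part t (snd x)}" by auto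
  ultimately show ?thesis by (simp add: laurent_def mult_ac)
qed

section \<open>The upper bound\<close>

lemma comb_weight: "comb F c (\<lambda>x. w x *\<^sub>C y x) = comb F (\<lambda>x. c x * w x) y"
  by (simp add: comb_def scaleC_scaleC)

lemma sdom_weight: "sdom u v \<Longrightarrow> sdom (\<lambda>x. w x *\<^sub>C u x) (\<lambda>x. w x *\<^sub>C v x)"
  unfolding sdom_def comb_weight by blast

text \<open>In the model, \<open>v\<close> is the orbit of the contractions
  \<open>T1 powi s / r1\<close> and \<open>T2 powi t / r2\<close>.\<close>

lemma quantum_family_contractions:
  fixes u :: "int \<times> int \<Rightarrow> 'h::complex_hilbert"
  assumes u: "quantum_family r1 r2 u" and r: "r1 > 0" "r2 > 0" and s: "s = 1 \<or> s = -1" and t: "t = 1 \<or> t = -1"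
  defines "v \<equiv> \<lambda>x. complex_of_real (inverse (r1 ^ fst x * r2 ^ snd x)) *\<^sub>C u (s * int (fst x), t * int (snd x))"
  shows "sdom (\<lambda>x. v (Suc (fst x), snd x)) v" "sdom (\<lambda>x. v (fst x, Suc (snd x))) v"
proof -
  let ?\<phi> = "\<lambda>x::nat \<times> nat. (s * int (fst x), t * int (snd x))"
  have sh: "sdom (\<lambda>x. u (fst x + s, snd x)) (\<lambda>x. complex_of_real r1 *\<^sub>C u x)"
    "sdom (\<lambda>x. u (fst x, snd x + t)) (\<lambda>x. complex_of_real r2 *\<^sub>C u x)"
    using u s t by (auto simp: quantum_family_def)
  have 1: "sdom (\<lambda>x. complex_of_real (inverse (r1 ^ Suc (fst x) * r2 ^ snd x)) *\<^sub>C u (fst (?\<phi> x) + s, snd (?\<phi> x)))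
     (\<lambda>x. complex_of_real (inverse (r1 ^ Suc (fst x) * r2 ^ snd x)) *\<^sub>C (complex_of_real r1 *\<^sub>C u (?\<phi> x)))"
    by (rule sdom_weight[OF sdom_comp[OF sh(1), of ?\<phi>]])
  have 2: "sdom (\<lambda>x. complex_of_real (inverse (r1 ^ fst x * r2 ^ Suc (snd x))) *\<^sub>C u (fst (?\<phi> x), snd (?\<phi> x) + t))
     (\<lambda>x. complex_of_real (inverse (r1 ^ fst x * r2 ^ Suc (snd x))) *\<^sub>C (complex_of_real r2 *\<^sub>C u (?\<phi> x)))"
    by (rule sdom_weight[OF sdom_comp[OF sh(2), of ?\<phi>]])
  have e: "s * int (Suc n) = s * int n + s" for n s by (simp add: algebra_simps)
  have w: "complex_of_real (inverse (r1 ^ Suc a * r2 ^ b)) *\<^sub>C complex_of_real r1 *\<^sub>C h = complex_of_real (inverse (r1 ^ a * r2 ^ b)) *\<^sub>C h"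
    "complex_of_real (inverse (r1 ^ a * r2 ^ Suc b)) *\<^sub>C complex_of_real r2 *\<^sub>C h = complex_of_real (inverse (r1 ^ a * r2 ^ b)) *\<^sub>C h"
    for a b and h :: 'h
    using r unfolding scaleC_scaleC of_real_mult[symmetric] by (simp_all add: field_simps)
  show "sdom (\<lambda>x. v (Suc (fst x), snd x)) v" using 1 unfolding v_def w by (simp only: fst_conv snd_conv e)
  show "sdom (\<lambda>x. v (fst x, Suc (snd x))) v" using 2 unfolding v_def w by (simp only: fst_conv snd_conv e)
qed

lemma quantum_family_part_bound:
  fixes u :: "int \<times> int \<Rightarrow> 'h::complex_hilbert"
  assumes u: "quantum_family r1 r2 u" and r: "r1 > 1" "r2 > 1" and F: "finite F"
    and B: "\<And>z w. z \<in> bdry r1 \<Longrightarrow> w \<in> bdry r2 \<Longrightarrow> cmod (laurent F c z w) \<le> B"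
    and s: "s = 1 \<or> s = -1" and t: "t = 1 \<or> t = -1"
  shows "norm (comb {x\<in>F. part s (fst x) \<and> part t (snd x)} c u) \<le> part_const s r1 * part_const t r2 * B * norm (u (0, 0))"
proof -
  let ?K = "{x\<in>F. part s (fst x) \<and> part t (snd x)}"
  define v where "v = (\<lambda>x. complex_of_real (inverse (r1 ^ fst x * r2 ^ snd x)) *\<^sub>C u (s * int (fst x), t * int (snd x)))"
  let ?g = "\<lambda>x::int \<times> int. (nat \<bar>fst x\<bar>, nat \<bar>snd x\<bar>)"
  let ?d = "\<lambda>x. c x * complex_of_real (r1 ^ nat \<bar>fst x\<bar> * r2 ^ nat \<bar>snd x\<bar>)"
  have sg: "s * int (nat \<bar>n\<bar>) = n" if "part s n" "s = 1 \<or> s = -1" for s n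
    using that by (auto simp: part_def)
  have "comb ?K c u = (\<Sum>x\<in>?K. ?d x *\<^sub>C v (?g x))"
    unfolding comb_def
  proof (intro sum.cong refl)
    fix x assume x: "x \<in> ?K"
    have "?d x *\<^sub>C v (?g x) = c x *\<^sub>C u (s * int (nat \<bar>fst x\<bar>), t * int (nat \<bar>snd x\<bar>))"
      using r unfolding v_def scaleC_scaleC fst_conv snd_conv by (simp add: field_simps)
    then show "c x *\<^sub>C u x = ?d x *\<^sub>C v (?g x)" using x sg[OF _ s] sg[OF _ t] by simp
  qed
  also have "norm \<dots> \<le> (part_const s r1 * part_const t r2 * B) * norm (v (0, 0))"
  proof (rule von_neumann_pair)
    show "sdom (\<lambda>x. v (Suc (fst x), snd x)) v" "sdom (\<lambda>x. v (fst x, Suc (snd x))) v"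
      using quantum_family_contractions[OF u _ _ s t] r unfolding v_def by auto
    fix z w :: complex assume zw: "cmod z = 1" "cmod w = 1"
    \<comment> \<open>The substitution maps the unit circle to the circle of radius
      \<open>r1 powi s\<close>, exactly the one on which \<open>laurent_part\<close> bounds this
      part.\<close>
    define \<zeta> where "\<zeta> = (of_real r1 * z) powi s"
    define \<xi> where "\<xi> = (of_real r2 * w) powi t"
    have "cmod \<zeta> = r1 powi s" "cmod \<xi> = r2 powi t" using zw r by (simp_all add: \<zeta>_def \<xi>_def norm_power_int norm_mult)
    from laurent_part[OF r s t F B this]
    have "cmod (laurent ?K c \<zeta> \<xi>) \<le> part_const s r1 * part_const t r2 * B" by simp
    also have "laurent ?K c \<zeta> \<xi> = (\<Sum>x\<in>?K. ?d x * z ^ fst (?g x) * w ^ snd (?g x))"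
      unfolding laurent_def
    proof (intro sum.cong refl)
      fix x assume x: "x \<in> ?K"
      have p: "(y powi s) powi n = y ^ nat \<bar>n\<bar>" if "part s n" "s = 1 \<or> s = -1" for y :: complex and s n
        using that by (auto simp: part_def power_int_def power_inverse)
      show "c x * \<zeta> powi fst x * \<xi> powi snd x = ?d x * z ^ fst (?g x) * w ^ snd (?g x)"
        using x p[OF _ s] p[OF _ t] by (simp add: \<zeta>_def \<xi>_def power_mult_distrib mult_ac)
    qed
    finally show "cmod (\<Sum>x\<in>?K. ?d x * z ^ fst (?g x) * w ^ snd (?g x)) \<le> part_const s r1 * part_const t r2 * B" .
  qed (use F in simp)
  also have "v (0, 0) = u (0, 0)" by (simp add: v_def)
  finally show ?thesis .
qed

theorem laurent_const_upper:
  assumes r: "r1 > 1" "r2 > 1" shows "laurent_const r1 r2 ((part_const 1 r1 + part_const (-1) r1) * (part_const 1 r2 + part_const (-1) r2))"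
  unfolding laurent_const_def
proof (intro allI impI)
  fix u :: "int \<times> int \<Rightarrow> ell2" and F c B
  assume u: "quantum_family r1 r2 u" and F: "finite F" and B: "\<forall>z\<in>bdry r1. \<forall>w\<in>bdry r2. cmod (laurent F c z w) \<le> B"
  let ?P = "\<lambda>s t. {x\<in>F. part s (fst x) \<and> part t (snd x)}"
  have b: "norm (comb (?P s t) c u) \<le> part_const s r1 * part_const t r2 * B * norm (u (0, 0))" if "s = 1 \<or> s = -1" "t = 1 \<or> t = -1" for s t
    by (rule quantum_family_part_bound[OF u r F _ that]) (use B in blast)
  have "F = ((?P 1 1 \<union> ?P 1 (-1)) \<union> ?P (-1) 1) \<union> ?P (-1) (-1)" by (auto simp: part_def)
  then have "comb F c u = comb (((?P 1 1 \<union> ?P 1 (-1)) \<union> ?P (-1) 1) \<union> ?P (-1) (-1)) c u" by (rule arg_cong)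
  also have "\<dots> = comb (?P 1 1) c u + comb (?P 1 (-1)) c u + comb (?P (-1) 1) c u + comb (?P (-1) (-1)) c u"
    unfolding comb_def using F by (subst sum.union_disjoint, simp, simp, force simp: part_def)+ simp
  also have "norm \<dots> \<le> part_const 1 r1 * part_const 1 r2 * B * norm (u (0, 0)) + part_const 1 r1 * part_const (-1) r2 * B * norm (u (0, 0))
      + part_const (-1) r1 * part_const 1 r2 * B * norm (u (0, 0)) + part_const (-1) r1 * part_const (-1) r2 * B * norm (u (0, 0))"
    by (intro norm_triangle_mono b) auto
  finally show "norm (comb F c u) \<le> (part_const 1 r1 + part_const (-1) r1) * (part_const 1 r2 + part_const (-1) r2) * B * norm (u (0, 0))"
    by (simp add: algebra_simps)
qed

section \<open>The lower bound\<close>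

text \<open>Both Gram matrices are supported on the same blocks, and their difference is on each
  block the rank-one kernel \<open>s x * s y\<close> with \<open>s\<close> the root of
  \<open>w^2 - w'^2\<close>.\<close>

lemma sdom_weighted_units:
  assumes \<kappa>: "\<And>x y. \<kappa>' x = \<kappa>' y \<longleftrightarrow> \<kappa> x = \<kappa> y"
    and w: "\<And>x y. \<kappa> x = \<kappa> y \<Longrightarrow> w x = w y" "\<And>x y. \<kappa> x = \<kappa> y \<Longrightarrow> w' x = w' y"
    and le: "\<And>x. 0 \<le> w' x" "\<And>x. w' x \<le> w x"
  shows "sdom (\<lambda>x. complex_of_real (w' x) *\<^sub>C ell2_unit (\<kappa>' x)) (\<lambda>x. complex_of_real (w x) *\<^sub>C ell2_unit (\<kappa> x))"
proof -
  define s where "s = (\<lambda>x. sqrt ((w x)\<^sup>2 - (w' x)\<^sup>2))"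
  have s: "s x * s x = (w x)\<^sup>2 - (w' x)\<^sup>2" for x
    using power_mono[OF le(2) le(1), of x 2] by (simp add: s_def)
  have g: "gram (\<lambda>x. complex_of_real (w x) *\<^sub>C ell2_unit (\<kappa> x)) = (\<lambda>x y. if \<kappa> x = \<kappa> y then complex_of_real (w x * w y) else 0)"
    for w and \<kappa> :: "'a \<Rightarrow> nat"
    by (auto simp: fun_eq_iff gram_def cinner_scaleC_left cinner_scaleC_right cinner_ell2_unit ell2_unit.rep_eq)
  have "psd (\<lambda>x y. if \<kappa> x = \<kappa> y then cnj (complex_of_real (s x)) * complex_of_real (s y) else 0)"
    by (intro psd_block psd_rank_one)
  also have "(\<lambda>x y. if \<kappa> x = \<kappa> y then cnj (complex_of_real (s x)) * complex_of_real (s y) else 0)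
    = (\<lambda>x y. (if \<kappa> x = \<kappa> y then complex_of_real (w x * w y) else 0) - (if \<kappa>' x = \<kappa>' y then complex_of_real (w' x * w' y) else 0))"
  proof (intro ext)
    fix x y
    show "(if \<kappa> x = \<kappa> y then cnj (complex_of_real (s x)) * complex_of_real (s y) else 0)
      = (if \<kappa> x = \<kappa> y then complex_of_real (w x * w y) else 0) - (if \<kappa>' x = \<kappa>' y then complex_of_real (w' x * w' y) else 0)"
    proof (cases "\<kappa> x = \<kappa> y")
      case True
      then have "s x * s y = w x * w y - w' x * w' y"
        using w[OF True] s[of x] by (simp add: s_def power2_eq_square)
      then have "complex_of_real (s x * s y) = complex_of_real (w x * w y - w' x * w' y)" by (rule arg_cong)
      then show ?thesis using True \<kappa> by simp
    qed (simp add: \<kappa>)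
  qed
  finally show ?thesis unfolding psd_diff_iff_sdom[symmetric] g .
qed

text \<open>The distance of \<open>n\<close> from 0 on the cycle of length
  \<open>2 * N\<close>.\<close>

definition cdist :: "int \<Rightarrow> int \<Rightarrow> nat" where "cdist N n = nat (min (n mod (2 * N)) (2 * N - n mod (2 * N)))"

lemma cdist_step:
  assumes "N > 0" and s: "s = 1 \<or> s = -1" shows "cdist N (n + s) \<le> Suc (cdist N n)"
proof -
  define p where "p = n mod (2 * N)"
  have p: "0 \<le> p" "p < 2 * N" using assms by (auto simp: p_def)
  have e: "(n + s) mod (2 * N) = (p + s) mod (2 * N)" by (simp add: p_def mod_add_left_eq)
  consider "0 \<le> p + s" "p + s < 2 * N" | "p + s = 2 * N" "s = 1" | "p = 0" "s = -1" using p s by linarith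
  then show ?thesis
  proof cases
    case 1
    then have "(n + s) mod (2 * N) = p + s" unfolding e by (rule mod_pos_pos_trivial)
    then show ?thesis using s p unfolding cdist_def p_def[symmetric] by auto
  next
    case 2
    then show ?thesis using p unfolding cdist_def p_def[symmetric] e by auto
  next
    case 3
    have "(- 1) mod (2 * N) = 2 * N - 1" using assms by (simp add: zmod_minus1)
    then show ?thesis using 3 p unfolding cdist_def p_def[symmetric] e by auto
  qed
qed

text \<open>The orbit of a pair of weighted cyclic shifts of period \<open>2 N\<close>: the four monomials
  \<open>z\<^sup>\<plusminus>\<^sup>N w\<^sup>\<plusminus>\<^sup>N\<close> all reach the same unit vector, with the extremal weight \<open>r\<^sup>2\<^sup>N\<close>.\<close>

definition cyc :: "real \<Rightarrow> int \<Rightarrow> int \<times> int \<Rightarrow> ell2" where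
  "cyc r N x = complex_of_real (r ^ (cdist N (fst x) + cdist N (snd x))) *\<^sub>C ell2_unit (to_nat (fst x mod (2 * N), snd x mod (2 * N)))"

lemma quantum_family_cyc:
  assumes r: "r > 1" and N: "N > 0" shows "quantum_family r r (cyc r N)"
proof -
  have *: "sdom (\<lambda>x. cyc r N (fst x + a, snd x + b)) (\<lambda>x. complex_of_real r *\<^sub>C cyc r N x)"
    if ab: "(a = 0 \<and> (b = 1 \<or> b = -1)) \<or> (b = 0 \<and> (a = 1 \<or> a = -1))" for a b
  proof -
    have "sdom (\<lambda>x. complex_of_real (r ^ (cdist N (fst x + a) + cdist N (snd x + b))) *\<^sub>C ell2_unit (to_nat ((fst x + a) mod (2 * N), (snd x + b) mod (2 * N))))
      (\<lambda>x. complex_of_real (r ^ Suc (cdist N (fst x) + cdist N (snd x))) *\<^sub>C ell2_unit (to_nat (fst x mod (2 * N), snd x mod (2 * N))))"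
    proof (rule sdom_weighted_units)
      have m: "(m + a) mod (2 * N) = (n + a) mod (2 * N) \<longleftrightarrow> m mod (2 * N) = n mod (2 * N)" for m n a
        by (simp add: mod_eq_dvd_iff)
      fix x y :: "int \<times> int"
      show "to_nat ((fst x + a) mod (2 * N), (snd x + b) mod (2 * N)) = to_nat ((fst y + a) mod (2 * N), (snd y + b) mod (2 * N))
        \<longleftrightarrow> to_nat (fst x mod (2 * N), snd x mod (2 * N)) = to_nat (fst y mod (2 * N), snd y mod (2 * N))"
        by (simp only: to_nat_split inj_eq[OF inj_to_nat] prod.inject m)
      assume "to_nat (fst x mod (2 * N), snd x mod (2 * N)) = to_nat (fst y mod (2 * N), snd y mod (2 * N))"
      then have e: "fst x mod (2 * N) = fst y mod (2 * N)" "snd x mod (2 * N) = snd y mod (2 * N)" by auto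
      then show "r ^ Suc (cdist N (fst x) + cdist N (snd x)) = r ^ Suc (cdist N (fst y) + cdist N (snd y))"
        by (simp add: cdist_def)
      show "r ^ (cdist N (fst x + a) + cdist N (snd x + b)) = r ^ (cdist N (fst y + a) + cdist N (snd y + b))"
        using e[folded m[of "fst x" a] m[of "snd x" b]] by (simp add: cdist_def)
    next
      fix x :: "int \<times> int"
      have "cdist N (fst x + a) + cdist N (snd x + b) \<le> Suc (cdist N (fst x) + cdist N (snd x))"
        using ab cdist_step[OF N, of a "fst x"] cdist_step[OF N, of b "snd x"] by auto
      then show "r ^ (cdist N (fst x + a) + cdist N (snd x + b)) \<le> r ^ Suc (cdist N (fst x) + cdist N (snd x))"
        using r by (intro power_increasing) auto
    qed (use r in simp)
    then show ?thesis by (simp add: cyc_def scaleC_scaleC)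
  qed
  show ?thesis unfolding quantum_family_def
    using *[of 1 0] *[of "-1" 0] *[of 0 1] *[of 0 "-1"] by simp
qed

lemma bdry_sum_bound:
  assumes r: "r > 1" and z: "z \<in> bdry r" shows "cmod (z powi int N + z powi (- int N)) \<le> r ^ N + inverse (r ^ N)"
proof -
  have "cmod (z powi int N) = cmod z ^ N" "cmod (z powi (- int N)) = inverse (cmod z ^ N)"
    by (simp_all add: norm_power norm_inverse power_int_minus)
  then show ?thesis using norm_triangle_ineq[of "z powi int N" "z powi (- int N)"] z
    by (auto simp: bdry_def power_inverse)
qed

theorem laurent_const_lower:
  assumes r: "r > 1" and K: "laurent_const r r K" shows "4 \<le> K"
proof -
  have step: "4 \<le> K * (1 + (1 / r\<^sup>2) ^ N)\<^sup>2" if N: "N > 0" for N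
  proof -
    let ?N = "int N"
    let ?F = "{?N, - ?N} \<times> {?N, - ?N}"
    define A where "A = r ^ N"
    have A: "A > 0" using r by (simp add: A_def)
    let ?c = "\<lambda>x::int \<times> int. complex_of_real (inverse (A * A))"
    have sp: "(\<Sum>x\<in>?F. f x) = f (?N, ?N) + f (?N, - ?N) + f (- ?N, ?N) + f (- ?N, - ?N)"
      for f :: "int \<times> int \<Rightarrow> 'b::comm_monoid_add"
      using N by (simp add: sum.cartesian_product[symmetric] split_def add_ac flip: sum.cartesian_product)
    have B: "cmod (laurent ?F ?c z w) \<le> (1 + (1 / r\<^sup>2) ^ N)\<^sup>2" if "z \<in> bdry r" "w \<in> bdry r" for z w
    proof -
      have "laurent ?F ?c z w = complex_of_real (inverse (A * A)) * ((z powi ?N + z powi (- ?N)) * (w powi ?N + w powi (- ?N)))"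
        unfolding laurent_def sp by (simp add: algebra_simps)
      also have "cmod \<dots> \<le> inverse (A * A) * ((A + inverse A) * (A + inverse A))"
        unfolding norm_mult[of "complex_of_real _"] norm_of_real norm_mult[of "z powi _ + _"]
        using bdry_sum_bound[OF r that(1), of N] bdry_sum_bound[OF r that(2), of N] A
        by (intro mult_mono) (auto simp: A_def[symmetric] abs_mult)
      also have "\<dots> = (1 + inverse (A * A))\<^sup>2" using A by (simp add: power2_eq_square field_simps)
      finally have "cmod (laurent ?F ?c z w) \<le> (1 + inverse (A * A))\<^sup>2" .
      moreover have "inverse (A * A) = (1 / r\<^sup>2) ^ N"
        by (simp add: A_def power_one_over inverse_eq_divide power2_eq_square power_mult_distrib)
      ultimately show ?thesis by metis
    qed
    have m: "?N mod (2 * ?N) = ?N" "(- ?N) mod (2 * ?N) = ?N" using N by (auto simp: zmod_zminus1_eq_if)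
    then have d: "cdist ?N ?N = N" "cdist ?N (- ?N) = N" "cdist ?N 0 = 0" by (auto simp: cdist_def)
    let ?e = "ell2_unit (to_nat (?N, ?N))"
    have "comb ?F ?c (cyc r ?N) = (4::complex) *\<^sub>C ?e"
    proof -
      have "inverse (A * A) * r ^ (N + N) = 1" using A by (simp add: A_def[symmetric] power_add field_simps)
      then have e: "complex_of_real (inverse (A * A)) *\<^sub>C complex_of_real (r ^ (N + N)) *\<^sub>C ?e = 1 *\<^sub>C ?e"
        unfolding scaleC_scaleC of_real_mult[symmetric] by simp
      have four: "(4::complex) = 1 + 1 + 1 + 1" by simp
      show ?thesis
        unfolding comb_def sp cyc_def fst_conv snd_conv m d e four by (simp only: scaleC_add_left)
    qed
    then have "norm (comb ?F ?c (cyc r ?N)) = 4" by (simp add: norm_scaleC)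
    moreover have "norm (cyc r ?N (0, 0)) = 1" by (simp add: cyc_def d norm_scaleC)
    ultimately show ?thesis using laurent_constD[OF K quantum_family_cyc[OF r, of ?N] _ B] N by fastforce
  qed
  have "(\<lambda>N. K * (1 + (1 / r\<^sup>2) ^ N)\<^sup>2) \<longlonglongrightarrow> K * (1 + 0)\<^sup>2"
    using r by (intro tendsto_intros LIMSEQ_realpow_zero) auto
  then have "(\<lambda>N. K * (1 + (1 / r\<^sup>2) ^ N)\<^sup>2) \<longlonglongrightarrow> K" by simp
  then show ?thesis by (rule LIMSEQ_le_const) (use step in \<open>auto intro!: exI[of _ 1]\<close>)
qed

section \<open>Orthogonal projections and compressions\<close>

lemma comb_Pair: "comb F c (\<lambda>x. (f x, g x)) = (comb F c f, comb F c g)"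
  by (simp add: comb_def scaleC_prod_def prod_eq_iff fst_sum snd_sum)

lemma sdom_Pair: "sdom f f' \<Longrightarrow> sdom g g' \<Longrightarrow> sdom (\<lambda>x. (f x, g x)) (\<lambda>x. (f' x, g' x))"
  unfolding sdom_def comb_Pair norm_Pair by (auto intro!: add_mono power_mono)

lemma sdom_fst: "sdom f (\<lambda>x. (f x, g x))"
  unfolding sdom_def comb_Pair norm_Pair by (simp add: real_le_rsqrt)

lemma sdom_snd: "sdom g (\<lambda>x. (f x, g x))"
  unfolding sdom_def comb_Pair norm_Pair by (simp add: real_le_rsqrt)

definition csubspace :: "'a::complex_hilbert set \<Rightarrow> bool" where
  "csubspace M \<longleftrightarrow> 0 \<in> M \<and> (\<forall>x\<in>M. \<forall>y\<in>M. x + y \<in> M) \<and> (\<forall>a. \<forall>x\<in>M. a *\<^sub>C x \<in> M)"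

lemma csubspace_cspan: "csubspace (cspan u)"
  by (simp add: csubspace_def cspan_zero cspan_add cspan_scale)

lemma csubspace_diff: "csubspace M \<Longrightarrow> x \<in> M \<Longrightarrow> y \<in> M \<Longrightarrow> x - y \<in> M"
proof -
  assume M: "csubspace M" "x \<in> M" "y \<in> M"
  have "x - y = x + (-1) *\<^sub>C y" by (simp add: scaleC_minus_left)
  then show ?thesis using M unfolding csubspace_def by metis
qed

text \<open>The vector \<open>y\<close> is the component of \<open>x\<close> orthogonal to the closure of \<open>M\<close>.\<close>

definition residual :: "'a::complex_hilbert set \<Rightarrow> 'a \<Rightarrow> 'a \<Rightarrow> bool" where
  "residual M x y \<longleftrightarrow> (\<forall>m\<in>M. cinner m y = 0) \<and> (\<forall>e>0. \<exists>m\<in>M. norm (x - y - m) < e)"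

text \<open>Minimal distance and the parallelogram law. Since \<open>M\<close> need not be closed,
  the limit \<open>p\<close> of the minimizing sequence may lie outside \<open>M\<close>; this is
  why \<open>residual\<close> asks for approximation only.\<close>

lemma residual_exists:
  assumes M: "csubspace M" shows "\<exists>y. residual M x y"
proof -
  have M0: "0 \<in> M" and Madd: "\<And>a b. a \<in> M \<Longrightarrow> b \<in> M \<Longrightarrow> a + b \<in> M" and Msc: "\<And>c a. a \<in> M \<Longrightarrow> c *\<^sub>C a \<in> M"
    using M by (auto simp: csubspace_def)
  define Q where "Q = (\<lambda>m. (norm (x - m))\<^sup>2)"
  define D where "D = (INF m\<in>M. Q m)"
  have bdd: "bdd_below (Q ` M)" by (rule bdd_belowI[of _ 0]) (auto simp: Q_def)
  have low: "D \<le> Q m" if "m \<in> M" for m unfolding D_def using bdd that by (rule cINF_lower)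
  have "\<exists>m\<in>M. Q m < D + 1 / real (Suc n)" for n
  proof -
    have "D < D + 1 / real (Suc n)" by simp
    then show ?thesis using cINF_less_iff[of M Q "D + 1 / real (Suc n)"] M0 bdd unfolding D_def by blast
  qed
  then obtain m where m: "\<And>n. m n \<in> M" "\<And>n. Q (m n) < D + 1 / real (Suc n)" by metis
  have par: "(norm (m j - m k))\<^sup>2 \<le> 2 * (1 / real (Suc j)) + 2 * (1 / real (Suc k))" for j k
  proof -
    let ?a = "x - m j" and ?b = "x - m k"
    let ?h = "(1 / 2 :: complex) *\<^sub>C (m j + m k)"
    have h: "?h \<in> M" by (intro Msc Madd m)
    have "complex_of_real 2 *\<^sub>C ?h = m j + m k" unfolding scaleC_scaleC by simp
    then have "?a + ?b = complex_of_real 2 *\<^sub>C (x - ?h)"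
      unfolding scaleC_diff_right by (simp only: scaleC_of_real) (simp add: scaleR_2)
    then have "(norm (?a + ?b))\<^sup>2 = 4 * Q ?h" by (simp add: norm_scaleC Q_def power_mult_distrib)
    moreover have "(norm (?a - ?b))\<^sup>2 + (norm (?a + ?b))\<^sup>2 = 2 * Q (m j) + 2 * Q (m k)"
      unfolding norm_diff_sq norm_add_sq Q_def by simp
    moreover have "(norm (m j - m k))\<^sup>2 = (norm (?a - ?b))\<^sup>2" by (simp add: norm_minus_commute)
    ultimately show ?thesis using m(2)[of j] m(2)[of k] low[OF h] by linarith
  qed
  have "Cauchy m"
  proof (rule metric_CauchyI)
    fix e :: real assume e: "e > 0"
    then obtain N where N: "inverse (real (Suc N)) < e\<^sup>2 / 4" using reals_Archimedean[of "e\<^sup>2 / 4"] by auto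
    have "dist (m j) (m k) < e" if "j \<ge> N" "k \<ge> N" for j k
    proof -
      have i: "1 / real (Suc i) \<le> inverse (real (Suc N))" if "i \<ge> N" for i
        using that by (simp add: field_simps)
      have "(norm (m j - m k))\<^sup>2 < e\<^sup>2" using par[of j k] i[OF that(1)] i[OF that(2)] N by linarith
      then show ?thesis using e by (simp add: dist_norm power2_less_imp_less)
    qed
    then show "\<exists>N. \<forall>j\<ge>N. \<forall>k\<ge>N. dist (m j) (m k) < e" by blast
  qed
  then obtain p where p: "m \<longlonglongrightarrow> p" using Cauchy_convergent convergent_def by blast
  define y where "y = x - p"
  have "(norm y)\<^sup>2 \<le> D"
  proof (rule LIMSEQ_le)
    show "(\<lambda>n. Q (m n)) \<longlonglongrightarrow> (norm y)\<^sup>2" unfolding Q_def y_def by (intro tendsto_intros p)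
    show "(\<lambda>n. D + 1 / real (Suc n)) \<longlonglongrightarrow> D"
      using tendsto_add[OF tendsto_const[of D] LIMSEQ_Suc[OF lim_1_over_n]] by simp
  qed (use m(2) less_imp_le in blast)
  moreover have "D \<le> (norm (y - z))\<^sup>2" if "z \<in> M" for z
  proof (rule LIMSEQ_le_const)
    have "(\<lambda>n. Q (m n + z)) \<longlonglongrightarrow> (norm (x - (p + z)))\<^sup>2" unfolding Q_def by (intro tendsto_intros p)
    then show "(\<lambda>n. Q (m n + z)) \<longlonglongrightarrow> (norm (y - z))\<^sup>2" by (simp add: y_def diff_diff_eq)
  qed (use low Madd m(1) that in blast)
  ultimately have min: "(norm y)\<^sup>2 \<le> (norm (y - z))\<^sup>2" if "z \<in> M" for z using that by (blast intro: order_trans)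
  have "cinner z y = 0" if z: "z \<in> M" for z
  proof (rule ccontr)
    assume nz: "cinner z y \<noteq> 0"
    then have z0: "norm z > 0" by auto
    define a where "a = cinner z y / complex_of_real ((norm z)\<^sup>2)"
    have "cinner y (a *\<^sub>C z) = complex_of_real ((cmod (cinner z y))\<^sup>2 / (norm z)\<^sup>2)"
      unfolding cinner_scaleC_right a_def using cnj_cinner[of z y] complex_norm_square[of "cinner z y"] by simp
    moreover have ca: "cmod a = cmod (cinner z y) / (norm z)\<^sup>2" by (simp add: a_def norm_divide norm_power)
    have "(norm (a *\<^sub>C z))\<^sup>2 = (cmod (cinner z y))\<^sup>2 / (norm z)\<^sup>2"
      using z0 unfolding norm_scaleC ca by (simp add: power2_eq_square field_simps)
    ultimately have "(norm (y - a *\<^sub>C z))\<^sup>2 = (norm y)\<^sup>2 - (cmod (cinner z y))\<^sup>2 / (norm z)\<^sup>2"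
      unfolding norm_diff_sq by simp
    moreover have "(cmod (cinner z y))\<^sup>2 / (norm z)\<^sup>2 > 0" using nz z0 by simp
    ultimately show False using min[OF Msc[OF z, of a]] by linarith
  qed
  moreover have "\<exists>q\<in>M. norm (x - y - q) < e" if e: "e > 0" for e
  proof -
    obtain n where "norm (m n - p) < e" using LIMSEQ_D[OF p e] by blast
    then show ?thesis using m(1) by (intro bexI[of _ "m n"]) (auto simp: y_def norm_minus_commute)
  qed
  ultimately show ?thesis unfolding residual_def by blast
qed

lemma residual_add:
  assumes "csubspace M" "residual M x y" "residual M x' y'" shows "residual M (x + x') (y + y')"
  unfolding residual_def
proof (intro conjI ballI allI impI)
  fix e :: real assume "e > 0"
  then obtain m m' where m: "m \<in> M" "norm (x - y - m) < e / 2" "m' \<in> M" "norm (x' - y' - m') < e / 2"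
    using assms(2,3) unfolding residual_def by (meson half_gt_zero)
  have "norm (x + x' - (y + y') - (m + m')) < e"
    using norm_triangle_ineq[of "x - y - m" "x' - y' - m'"] m by (simp add: algebra_simps)
  then show "\<exists>m\<in>M. norm (x + x' - (y + y') - m) < e" using assms(1) m by (auto simp: csubspace_def)
qed (use assms in \<open>auto simp: residual_def cinner_add_right\<close>)

lemma residual_scale:
  assumes "csubspace M" "residual M x y" shows "residual M (a *\<^sub>C x) (a *\<^sub>C y)"
  unfolding residual_def
proof (intro conjI ballI allI impI)
  fix e :: real assume e: "e > 0"
  have a: "cmod a + 1 > 0" by (simp add: add_nonneg_pos)
  with e have "e / (cmod a + 1) > 0" by simp
  then obtain m where m: "m \<in> M" "norm (x - y - m) < e / (cmod a + 1)" using assms(2) unfolding residual_def by blast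
  have "norm (a *\<^sub>C x - a *\<^sub>C y - a *\<^sub>C m) = cmod a * norm (x - y - m)" by (simp add: norm_scaleC flip: scaleC_diff_right)
  also have "\<dots> \<le> (cmod a + 1) * norm (x - y - m)" by (intro mult_right_mono) auto
  also have "\<dots> < e" using m(2) a by (simp add: pos_less_divide_eq mult.commute)
  finally show "\<exists>m\<in>M. norm (a *\<^sub>C x - a *\<^sub>C y - m) < e" using assms(1) m by (auto simp: csubspace_def)
qed (use assms in \<open>auto simp: residual_def cinner_scaleC_right\<close>)

lemma residual_zero: "csubspace M \<Longrightarrow> residual M 0 0"
  unfolding residual_def csubspace_def by (auto intro!: bexI[of _ 0])

lemma residual_comb:
  assumes "csubspace M" "\<And>x. residual M (f x) (h x)" shows "residual M (comb F c f) (comb F c h)"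
  unfolding comb_def
proof (induction F rule: infinite_finite_induct)
  case (insert x F)
  then show ?case by (simp add: residual_add residual_scale assms)
qed (simp_all add: residual_zero assms)

lemma residual_norm_le:
  assumes "csubspace M" "residual M x y" "m \<in> M" shows "norm y \<le> norm (x - m)"
proof (rule field_le_epsilon)
  fix e :: real assume "e > 0"
  then obtain m' where m': "m' \<in> M" "norm (x - y - m') < e" using assms(2) unfolding residual_def by blast
  have "cinner (m' - m) y = 0" using csubspace_diff[OF assms(1) m'(1) assms(3)] assms(2) by (simp add: residual_def)
  then have 0: "cinner y (m' - m) = 0" using cnj_cinner[of "m' - m" y] by simp
  have "y = (x - m) - (x - y - m') - (m' - m)" by simp
  then have "cinner y y = cinner y ((x - m) - (x - y - m') - (m' - m))" by (rule arg_cong)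
  also have "\<dots> = cinner y (x - m) - cinner y (x - y - m')" unfolding cinner_diff_right[of _ _ "m' - m"] 0 cinner_diff_right[of _ "x - m"] by simp
  finally have "(norm y)\<^sup>2 = Re (cinner y (x - m) - cinner y (x - y - m'))" by (simp only: norm_sq_cinner)
  also have "\<dots> \<le> cmod (cinner y (x - m)) + cmod (cinner y (x - y - m'))"
    using complex_Re_le_cmod norm_triangle_ineq4 order_trans by blast
  also have "\<dots> \<le> norm y * norm (x - m) + norm y * e"
    using m'(2) by (intro add_mono order_trans[OF cmod_cinner_le] mult_left_mono) auto
  finally have "norm y * norm y \<le> norm y * (norm (x - m) + e)" by (simp add: power2_eq_square distrib_left)
  then show "norm y \<le> norm (x - m) + e" using \<open>e > 0\<close>
    by (cases "norm y = 0") (auto simp: mult_le_cancel_left add_nonneg_nonneg)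
qed

lemma residual_approx:
  assumes "residual M x y" "e > 0" obtains m where "m \<in> M" "norm (x - m) < norm y + e"
proof -
  obtain m where m: "m \<in> M" "norm (x - y - m) < e" using assms unfolding residual_def by blast
  have "norm (x - m) \<le> norm y + norm (x - y - m)" using norm_triangle_ineq[of y "x - y - m"] by simp
  then show ?thesis using that m by force
qed

lemma residual_self: "residual {0} x x"
  by (simp add: residual_def)

lemma residual_in: "csubspace M \<Longrightarrow> residual M x y \<Longrightarrow> x \<in> M \<Longrightarrow> y = 0"
  using residual_norm_le[of M x y x] by simp

text \<open>A bounded map passes to quotients: it takes the relation vectors of \<beta> into
  \<open>M'\<close>, so distances to \<open>M'\<close> are at most \<rho> times distances to the
  span of those vectors.\<close>

lemma sdom_residual:
  fixes f :: "'i \<Rightarrow> 'b::complex_hilbert" and \<beta> :: "'i \<Rightarrow> 'a::complex_hilbert"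
  assumes f: "sdom f (\<lambda>x. complex_of_real \<rho> *\<^sub>C \<beta> x)" and \<rho>: "\<rho> > 0"
    and M': "csubspace M'" and fM: "\<And>k. f (D k) - z *\<^sub>C f k \<in> M'"
    and \<beta>h: "\<And>x. residual (cspan (\<lambda>k. \<beta> (D k) - z *\<^sub>C \<beta> k)) (\<beta> x) (\<beta>h x)"
    and fh: "\<And>x. residual M' (f x) (fh x)"
  shows "sdom fh (\<lambda>x. complex_of_real \<rho> *\<^sub>C \<beta>h x)"
  unfolding sdom_def
proof (intro allI impI)
  fix F :: "'i set" and c assume F: "finite F"
  define v where "v = (\<lambda>x. complex_of_real \<rho> *\<^sub>C \<beta> x)"
  have f: "sdom f v" using f by (simp add: v_def)
  let ?\<nu> = "\<lambda>k. \<beta> (D k) - z *\<^sub>C \<beta> k"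
  let ?L = "transfer_map v f"
  have "norm (comb F c fh) \<le> \<rho> * norm (comb F c \<beta>h)"
  proof (rule field_le_epsilon)
    \<comment> \<open>The distance to the span need not be attained, so a near-optimal
      \<open>m\<close> is used.\<close>
    fix e :: real assume e: "e > 0"
    have r: "residual (cspan ?\<nu>) (comb F c \<beta>) (comb F c \<beta>h)" by (rule residual_comb[OF csubspace_cspan \<beta>h])
    obtain m where "m \<in> cspan ?\<nu>" and m: "norm (comb F c \<beta> - m) < norm (comb F c \<beta>h) + e / \<rho>"
      using residual_approx[OF r, of "e / \<rho>"] e \<rho> by auto
    then obtain G d where G: "finite G" and md: "m = comb G d ?\<nu>" unfolding cspan_def by blast
    let ?w = "\<lambda>g k. (- d k) *\<^sub>C g (D k) + (d k * z) *\<^sub>C g k"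
    have diff: "comb F c g + (\<Sum>k\<in>G. ?w g k) = comb F c g - comb G d (\<lambda>k. g (D k) - z *\<^sub>C g k)"
      for g :: "'i \<Rightarrow> 'x::complex_hilbert"
      by (simp add: comb_def scaleC_diff_right scaleC_scaleC scaleC_minus_left sum.distrib sum_subtractf sum_negf)
    have wv: "(\<Sum>k\<in>G. ?w v k) \<in> cspan v"
      by (intro cspan_sum cspan_add cspan_scale cspan_base)
    have "?L (comb F c v + (\<Sum>k\<in>G. ?w v k)) = comb F c f + (\<Sum>k\<in>G. ?w f k)"
    proof -
      have 1: "?L (?w v k) = ?w f k" for k
        unfolding transfer_add[OF f cspan_scale[OF cspan_base] cspan_scale[OF cspan_base]]
          transfer_scale[OF f cspan_base] transfer_base[OF f] by (rule refl)
      have 2: "?L (\<Sum>k\<in>G. ?w v k) = (\<Sum>k\<in>G. ?L (?w v k))"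
        by (rule transfer_sum[OF f]) (intro cspan_add cspan_scale cspan_base)
      show ?thesis
        unfolding transfer_add[OF f cspanI[OF F] wv] transfer_comb[OF f F] 2 1 by (rule refl)
    qed
    moreover have "norm (?L (comb F c v + (\<Sum>k\<in>G. ?w v k))) \<le> norm (comb F c v + (\<Sum>k\<in>G. ?w v k))"
      by (intro norm_transfer[OF f] cspan_add cspanI F wv)
    ultimately have "norm (comb F c f - comb G d (\<lambda>k. f (D k) - z *\<^sub>C f k)) \<le> norm (comb F c v - comb G d (\<lambda>k. v (D k) - z *\<^sub>C v k))"
      unfolding diff by simp
    also have "comb F c v - comb G d (\<lambda>k. v (D k) - z *\<^sub>C v k) = complex_of_real \<rho> *\<^sub>C (comb F c \<beta> - m)"
    proof -
      have "(\<lambda>k. v (D k) - z *\<^sub>C v k) = (\<lambda>k. complex_of_real \<rho> *\<^sub>C ?\<nu> k)"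
        by (simp add: v_def scaleC_diff_right scaleC_scaleC mult.commute fun_eq_iff)
      then show ?thesis
        unfolding md v_def comb_scale_fam by (simp only: comb_scale_fam scaleC_diff_right[symmetric])
    qed
    finally have 1: "norm (comb F c f - comb G d (\<lambda>k. f (D k) - z *\<^sub>C f k)) \<le> \<rho> * norm (comb F c \<beta> - m)"
      using \<rho> by (simp add: norm_scaleC)
    have "comb G d (\<lambda>k. f (D k) - z *\<^sub>C f k) \<in> M'"
      unfolding comb_def using G by (induction rule: finite_induct) (use M' fM in \<open>auto simp: csubspace_def\<close>)
    then have "norm (comb F c fh) \<le> norm (comb F c f - comb G d (\<lambda>k. f (D k) - z *\<^sub>C f k))"
      by (rule residual_norm_le[OF M' residual_comb[OF M' fh]])
    also note 1
    also have "\<rho> * norm (comb F c \<beta> - m) \<le> \<rho> * (norm (comb F c \<beta>h) + e / \<rho>)" using m \<rho> by (intro mult_left_mono) auto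
    also have "\<dots> = \<rho> * norm (comb F c \<beta>h) + e" using \<rho> by (simp add: distrib_left)
    finally show "norm (comb F c fh) \<le> \<rho> * norm (comb F c \<beta>h) + e" .
  qed
  then show "norm (comb F c fh) \<le> norm (comb F c (\<lambda>x. complex_of_real \<rho> *\<^sub>C \<beta>h x))"
    using \<rho> by (simp add: comb_scale_fam norm_scaleC)
qed

section \<open>Auxiliary stationary families\<close>

definition bounded_by :: "real \<Rightarrow> ('i \<Rightarrow> 'a::complex_hilbert) \<Rightarrow> ('i \<Rightarrow> 'b::complex_hilbert) \<Rightarrow> bool" where
  "bounded_by C u v \<longleftrightarrow> (\<forall>F c. finite F \<longrightarrow> norm (comb F c u) \<le> C * norm (comb F c v))"

definition restrict_family :: "('i \<Rightarrow> bool) \<Rightarrow> ('i \<Rightarrow> 'a::complex_hilbert) \<Rightarrow> 'i \<Rightarrow> 'a" where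
  "restrict_family P u = (\<lambda>x. if P x then u x else 0)"

lemma sdom_bounded_by: "sdom u v \<Longrightarrow> bounded_by 1 u v"
  by (simp add: sdom_def bounded_by_def)

lemma bounded_by_sdom_trans: "bounded_by C u v \<Longrightarrow> sdom v w \<Longrightarrow> 0 \<le> C \<Longrightarrow> bounded_by C u w"
  unfolding bounded_by_def sdom_def by (meson order_trans mult_left_mono)

lemma sdom_bounded_by_trans: "sdom u v \<Longrightarrow> bounded_by C v w \<Longrightarrow> bounded_by C u w"
  unfolding bounded_by_def sdom_def by (meson order_trans)

lemma bounded_by_mono: "bounded_by C u v \<Longrightarrow> C \<le> D \<Longrightarrow> bounded_by D u v"
  unfolding bounded_by_def by (meson order_trans mult_right_mono norm_ge_zero)

lemma comb_plus_fam: "comb F c (\<lambda>x. u x + v x) = comb F c u + comb F c v"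
  by (simp add: comb_def scaleC_add_right sum.distrib)

lemma comb_minus_fam: "comb F c (\<lambda>x. u x - v x) = comb F c u - comb F c v"
  by (simp add: comb_def scaleC_diff_right sum_subtractf)

lemma bounded_by_add: "bounded_by C u w \<Longrightarrow> bounded_by D v w \<Longrightarrow> bounded_by (C + D) (\<lambda>x. u x + v x) w"
  unfolding bounded_by_def comb_plus_fam distrib_right by (blast intro: norm_triangle_mono)

lemma bounded_by_diff: "bounded_by C u w \<Longrightarrow> bounded_by D v w \<Longrightarrow> bounded_by (C + D) (\<lambda>x. u x - v x) w"
  unfolding bounded_by_def comb_minus_fam distrib_right by (blast intro: order_trans[OF norm_triangle_ineq4] add_mono)

lemma bounded_by_scale: "bounded_by C u w \<Longrightarrow> bounded_by (cmod a * C) (\<lambda>x. a *\<^sub>C u x) w"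
  unfolding bounded_by_def comb_scale_fam norm_scaleC by (simp add: mult.assoc mult_left_mono)

text \<open>The fibres of \<kappa> are combined by the triangle inequality. There may be infinitely
  many, but each combination meets only finitely many, so a bound for all finite sums of constants
  is enough.\<close>

lemma bounded_by_split:
  fixes \<kappa> :: "'i \<Rightarrow> 'k"
  assumes b: "\<And>k. k \<in> \<kappa> ` Collect P \<Longrightarrow> bounded_by (C k) (restrict_family (\<lambda>x. P x \<and> \<kappa> x = k) u) v"
    and D: "\<And>J. finite J \<Longrightarrow> J \<subseteq> \<kappa> ` Collect P \<Longrightarrow> sum C J \<le> D"
  shows "bounded_by D (restrict_family P u) v"
  unfolding bounded_by_def
proof (intro allI impI)
  fix F :: "'i set" and c assume F: "finite F"
  define J where "J = \<kappa> ` {x\<in>F. P x}"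
  have J: "finite J" "J \<subseteq> \<kappa> ` Collect P" using F by (auto simp: J_def)
  have "comb F c (restrict_family P u) = (\<Sum>x\<in>F. \<Sum>k\<in>J. c x *\<^sub>C restrict_family (\<lambda>x. P x \<and> \<kappa> x = k) u x)"
    unfolding comb_def
  proof (rule sum.cong[OF refl])
    fix x assume x: "x \<in> F"
    have "(\<Sum>k\<in>J. c x *\<^sub>C restrict_family (\<lambda>x. P x \<and> \<kappa> x = k) u x) = (\<Sum>k\<in>J. if k = \<kappa> x then c x *\<^sub>C restrict_family P u x else 0)"
      by (rule sum.cong) (auto simp: restrict_family_def)
    also have "\<dots> = (if \<kappa> x \<in> J then c x *\<^sub>C restrict_family P u x else 0)" using J(1) by (rule sum.delta)
    also have "\<dots> = c x *\<^sub>C restrict_family P u x" using x by (auto simp: J_def restrict_family_def)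
    finally show "c x *\<^sub>C restrict_family P u x = (\<Sum>k\<in>J. c x *\<^sub>C restrict_family (\<lambda>x. P x \<and> \<kappa> x = k) u x)" by (rule sym)
  qed
  also have "\<dots> = (\<Sum>k\<in>J. comb F c (restrict_family (\<lambda>x. P x \<and> \<kappa> x = k) u))" unfolding comb_def by (rule sum.swap)
  also have "norm \<dots> \<le> (\<Sum>k\<in>J. C k * norm (comb F c v))"
    using b J(2) F unfolding bounded_by_def by (intro order_trans[OF norm_sum] sum_mono) blast
  also have "\<dots> = sum C J * norm (comb F c v)" by (simp add: sum_distrib_right)
  also have "\<dots> \<le> D * norm (comb F c v)" by (intro mult_right_mono D J) auto
  finally show "norm (comb F c (restrict_family P u)) \<le> D * norm (comb F c v)" .
qed

text \<open>The blocks are mutually orthogonal in \<gamma>, so dropping all but one lowers the norm.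
  This bounds each block of \<open>W\<close> by \<gamma>, whatever the correlations between blocks
  of \<open>W\<close> are.\<close>

lemma block_res:
  assumes g: "gram \<gamma> = (\<lambda>x y. if \<kappa> x = \<kappa> y then gram W x y else 0)" shows "sdom (restrict_family (\<lambda>x. \<kappa> x = k) W) \<gamma>"
proof -
  have "psd (\<lambda>x y. if \<kappa> x = \<kappa> y \<and> \<kappa> x \<noteq> k then gram W x y else 0)" by (rule psd_block_restrict[OF psd_gram])
  also have "(\<lambda>x y. if \<kappa> x = \<kappa> y \<and> \<kappa> x \<noteq> k then gram W x y else 0)
    = (\<lambda>x y. gram \<gamma> x y - gram (restrict_family (\<lambda>x. \<kappa> x = k) W) x y)"
    unfolding g by (auto simp: fun_eq_iff gram_def restrict_family_def)
  finally show ?thesis by (simp only: psd_diff_iff_sdom)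
qed

lemma block_shift:
  assumes g: "gram \<gamma> = (\<lambda>x y. if \<kappa> x = \<kappa> y then gram W x y else 0)"
    and \<kappa>: "\<And>x y. \<kappa> (g x) = \<kappa> (g y) \<longleftrightarrow> \<kappa> x = \<kappa> y"
    and W: "\<And>x y. gram W (g x) (g y) = complex_of_real (\<rho>\<^sup>2) * gram W x y" and \<rho>: "\<rho>\<^sup>2 \<le> T\<^sup>2"
  shows "sdom (\<lambda>x. \<gamma> (g x)) (\<lambda>x. complex_of_real T *\<^sub>C \<gamma> x)"
proof -
  have "psd (\<lambda>x y. complex_of_real (T\<^sup>2 - \<rho>\<^sup>2) * gram \<gamma> x y)" by (intro psd_scale psd_gram) (use \<rho> in simp)
  also have "(\<lambda>x y. complex_of_real (T\<^sup>2 - \<rho>\<^sup>2) * gram \<gamma> x y)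
    = (\<lambda>x y. gram (\<lambda>x. complex_of_real T *\<^sub>C \<gamma> x) x y - gram (\<lambda>x. \<gamma> (g x)) x y)"
  proof (intro ext)
    fix x y
    have "gram (\<lambda>x. \<gamma> (g x)) x y = complex_of_real (\<rho>\<^sup>2) * gram \<gamma> x y"
      unfolding gram_comp by (subst (1 2) g) (simp add: \<kappa> W)
    then show "complex_of_real (T\<^sup>2 - \<rho>\<^sup>2) * gram \<gamma> x y = gram (\<lambda>x. complex_of_real T *\<^sub>C \<gamma> x) x y - gram (\<lambda>x. \<gamma> (g x)) x y"
      unfolding gram_scale by (simp add: left_diff_distrib power2_eq_square)
  qed
  finally show ?thesis by (simp only: psd_diff_iff_sdom)
qed

text \<open>The term \<open>k = 0\<close> vanishes. For \<open>k = n + 1\<close> the first factor is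
  at most \<open>c / 4^n\<close> and the second is \<open>3 n + 9 \<le> 9 * 2^n\<close>; summing
  \<open>9 c / 2^n\<close> gives \<open>18 c\<close>.\<close>

lemma error_coeff_sum:
  assumes c: "0 \<le> d" "d \<le> c" "c \<le> 1 / 4" and J: "finite J"
  shows "(\<Sum>k\<in>J. (c ^ k - d ^ k) * (3 * real k + 6)) \<le> 18 * c"
proof -
  have nine: "3 * real n + 9 \<le> 9 * 2 ^ n" for n
    by (induction n) simp_all
  have "(c ^ k - d ^ k) * (3 * real k + 6) \<le> (if k = 0 then 0 else 18 * c * (1 / 2) ^ k)" for k
  proof (cases k)
    case (Suc n)
    have "c ^ n \<le> (1 / 4) ^ n" using c by (intro power_mono) auto
    then have "c * c ^ n \<le> c * (1 / 4) ^ n" using c by (intro mult_left_mono) auto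
    moreover have "0 \<le> d * d ^ n" using c by simp
    ultimately have "c ^ k - d ^ k \<le> c * (1 / 4) ^ n" unfolding Suc power_Suc by linarith
    then have "(c ^ k - d ^ k) * (3 * real k + 6) \<le> c * (1 / 4) ^ n * (9 * 2 ^ n)"
      using nine[of n] c by (intro mult_mono) (auto simp: Suc)
    also have "\<dots> = 9 * c * ((1 / 4) * 2) ^ n" unfolding power_mult_distrib by simp
    also have "\<dots> = 18 * c * (1 / 2) ^ k" by (simp add: Suc)
    finally show ?thesis using Suc by simp
  qed simp
  then have "(\<Sum>k\<in>J. (c ^ k - d ^ k) * (3 * real k + 6)) \<le> (\<Sum>k\<in>J. if k = 0 then 0 else 18 * c * (1 / 2) ^ k)" by (rule sum_mono)
  also have "\<dots> = (\<Sum>k\<in>J - {0}. 18 * c * (1 / 2) ^ k)" using J by (intro sum.mono_neutral_cong_right) auto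
  also have "\<dots> = 18 * c * (\<Sum>n\<in>int ` (J - {0}). (1 / 2) ^ nat n)"
    by (subst sum.reindex) (simp_all add: sum_distrib_left)
  also have "\<dots> \<le> 18 * c * ((1 / 2) ^ 1 / (1 - 1 / 2))"
    using J c by (intro mult_left_mono geometric_tail_bound) (auto simp: Suc_le_eq)
  finally show ?thesis by simp
qed

text \<open>The dilation with the contraction in the second variable scaled back by
  \<open>t\<close>. Under a unit shift of \<open>lam\<close> either sign of \<open>e\<close> changes
  the norm by a factor at most \<open>t\<close>, provided \<open>t \<ge> 1\<close>. The sign -1 is
  large where \<open>lam\<close> is negative, which makes the sum over the unwanted exponents
  converge.\<close>

definition wst :: "real \<Rightarrow> (int \<times> int \<Rightarrow> ell2) \<Rightarrow> ('i \<Rightarrow> nat) \<Rightarrow> ('i \<Rightarrow> int) \<Rightarrow> int \<Rightarrow> 'i \<Rightarrow> ell2" where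
  "wst t \<omega> p lam e x = complex_of_real (t powi (e * lam x)) *\<^sub>C \<omega> (int (p x), lam x)"

text \<open>On the slice \<open>lam = l\<close> the weight \<open>t powi l\<close> is
  \<open>t powi (2 * l)\<close> times the weight \<open>t powi (- l)\<close> of the dominated
  family. As \<open>a \<le> 1\<close>, only \<open>l \<le> 0\<close> occurs, and the factors, at
  most powers of 1/4, sum to at most 4/3.\<close>

lemma wst_negative_part:
  assumes t: "t \<ge> 2" and a: "a \<le> 1"
    and G: "\<And>l. sdom (restrict_family (\<lambda>x. P x \<and> lam x = l) (wst t \<omega> p lam (-1))) \<gamma>"
  shows "bounded_by 2 (restrict_family (\<lambda>x. P x \<and> lam x < a) (wst t \<omega> p lam 1)) \<gamma>"
proof (rule bounded_by_split[where \<kappa> = lam and C = "\<lambda>l. (1 / 4) ^ nat (- l)"])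
  fix l assume "l \<in> lam ` Collect (\<lambda>x. P x \<and> lam x < a)"
  then have l: "l \<le> 0" "l < a" using a by auto
  have "restrict_family (\<lambda>x. (P x \<and> lam x < a) \<and> lam x = l) (wst t \<omega> p lam 1)
    = (\<lambda>x. complex_of_real (t powi (2 * l)) *\<^sub>C restrict_family (\<lambda>x. P x \<and> lam x = l) (wst t \<omega> p lam (-1)) x)"
  proof
    fix x
    have "t powi l = t powi (2 * l) * t powi (- l)" using t by (subst power_int_add[symmetric]) auto
    then have "complex_of_real (t powi l) = complex_of_real (t powi (2 * l)) * complex_of_real (t powi (- l))" by (simp only: of_real_mult)
    then show "restrict_family (\<lambda>x. (P x \<and> lam x < a) \<and> lam x = l) (wst t \<omega> p lam 1) x
      = complex_of_real (t powi (2 * l)) *\<^sub>C restrict_family (\<lambda>x. P x \<and> lam x = l) (wst t \<omega> p lam (-1)) x"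
      using l(2) by (simp add: restrict_family_def wst_def scaleC_scaleC)
  qed
  moreover have "bounded_by (cmod (complex_of_real (t powi (2 * l))) * 1) (\<lambda>x. complex_of_real (t powi (2 * l)) *\<^sub>C restrict_family (\<lambda>x. P x \<and> lam x = l) (wst t \<omega> p lam (-1)) x) \<gamma>"
    by (intro bounded_by_scale sdom_bounded_by G)
  moreover have "cmod (complex_of_real (t powi (2 * l))) * 1 \<le> (1 / 4) ^ nat (- l)"
  proof -
    obtain n where n: "l = - int n" using l by (metis nonpos_int_cases)
    have e: "2 * l = - int (2 * n)" by (simp add: n)
    have "4 ^ n \<le> (t\<^sup>2) ^ n" using power_mono[OF t, of 2] by (intro power_mono) auto
    then have "inverse (t ^ (2 * n)) \<le> inverse (4 ^ n)" unfolding power_mult by (intro le_imp_inverse_le) auto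
    then show ?thesis using t unfolding norm_of_real e power_int_minus power_int_of_nat
      by (simp add: n power_one_over inverse_eq_divide)
  qed
  ultimately show "bounded_by ((1 / 4) ^ nat (- l)) (restrict_family (\<lambda>x. (P x \<and> lam x < a) \<and> lam x = l) (wst t \<omega> p lam 1)) \<gamma>"
    by (simp only:) (rule bounded_by_mono)
next
  fix J assume J: "finite J" "J \<subseteq> lam ` Collect (\<lambda>x. P x \<and> lam x < a)"
  have "(\<Sum>l\<in>J. (1 / 4 :: real) ^ nat (- l)) = (\<Sum>n\<in>uminus ` J. (1 / 4) ^ nat n)" by (subst sum.reindex) simp_all
  also have "\<dots> \<le> (1 / 4) ^ 0 / (1 - 1 / 4)" using J a by (intro geometric_tail_bound) auto
  finally show "(\<Sum>l\<in>J. (1 / 4 :: real) ^ nat (- l)) \<le> 2" by simp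
qed

text \<open>The four dominated families are what is needed to cut a quadrant out of a stationary family
  by inclusion and exclusion.\<close>

lemma quadrant_bound:
  fixes p q :: "'i \<Rightarrow> nat" and lam :: "'i \<Rightarrow> int"
  assumes t: "t \<ge> 2" and c: "0 \<le> d" "d \<le> c" "c \<le> 1 / 4" and a: "a \<le> 1" "0 \<le> a'" "a' \<le> 1"
    and st: "\<And>a x y. cinner (\<omega> (x + a)) (\<omega> (y + a)) = cinner (\<omega> x) (\<omega> y)"
    and v: "sdom v (\<lambda>x. \<omega> (int (fst x), int (snd x)))"
    and G1: "\<And>k. sdom (restrict_family (\<lambda>x. q x = k) (wst t \<omega> p lam 1)) \<gamma>"
    and G2: "\<And>k l. sdom (restrict_family (\<lambda>x. q x = k \<and> lam x = l) (wst t \<omega> p lam (-1))) \<gamma>"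
    and G3: "\<And>k p0. sdom (restrict_family (\<lambda>x. q x = k \<and> p x = p0) (wst t \<omega> p lam 1)) \<gamma>"
    and G4: "\<And>k p0 l. sdom (restrict_family (\<lambda>x. (q x = k \<and> p x = p0) \<and> lam x = l) (wst t \<omega> p lam (-1))) \<gamma>"
    and E: "\<And>x. q x + a \<le> p x \<Longrightarrow> a' \<le> lam x \<Longrightarrow>
      E x = complex_of_real ((c ^ q x - d ^ q x) * t ^ nat (lam x)) *\<^sub>C v (p x - q x, nat (lam x))"
  shows "bounded_by (18 * c) (restrict_family (\<lambda>x. q x + a \<le> p x \<and> a' \<le> lam x) E) \<gamma>"
proof (rule bounded_by_split[where \<kappa> = q and C = "\<lambda>k. (c ^ k - d ^ k) * (3 * real k + 6)"])
  fix k
  let ?W = "wst t \<omega> p lam 1"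
  let ?P = "\<lambda>x. q x = k \<and> k + a \<le> p x \<and> a' \<le> lam x"
  have b1: "bounded_by 1 (restrict_family (\<lambda>x. q x = k) ?W) \<gamma>" by (rule sdom_bounded_by[OF G1])
  have b2: "bounded_by 2 (restrict_family (\<lambda>x. q x = k \<and> lam x < a') ?W) \<gamma>" by (rule wst_negative_part[OF t a(3) G2])
  have card: "real (card J) \<le> real k + 1" if "J \<subseteq> p ` Collect (\<lambda>x. q x = k \<and> p x < k + a)" for J
  proof -
    have "card J \<le> card {..<k + a}" using that by (intro card_mono) auto
    then show ?thesis using a by simp
  qed
  have b3: "bounded_by (real k + 1) (restrict_family (\<lambda>x. q x = k \<and> p x < k + a) ?W) \<gamma>"
  proof (rule bounded_by_split[where \<kappa> = p and C = "\<lambda>_. 1"])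
    fix p0 assume "p0 \<in> p ` Collect (\<lambda>x. q x = k \<and> p x < k + a)"
    then have "(\<lambda>x. (q x = k \<and> p x < k + a) \<and> p x = p0) = (\<lambda>x. q x = k \<and> p x = p0)" by auto
    then show "bounded_by 1 (restrict_family (\<lambda>x. (q x = k \<and> p x < k + a) \<and> p x = p0) ?W) \<gamma>" using sdom_bounded_by[OF G3] by simp
  qed (use card in simp)
  have b4: "bounded_by (2 * (real k + 1)) (restrict_family (\<lambda>x. (q x = k \<and> p x < k + a) \<and> lam x < a') ?W) \<gamma>"
  proof (rule bounded_by_split[where \<kappa> = p and C = "\<lambda>_. 2"])
    fix p0 assume "p0 \<in> p ` Collect (\<lambda>x. (q x = k \<and> p x < k + a) \<and> lam x < a')"
    then have "(\<lambda>x. ((q x = k \<and> p x < k + a) \<and> lam x < a') \<and> p x = p0) = (\<lambda>x. (q x = k \<and> p x = p0) \<and> lam x < a')" by auto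
    then show "bounded_by 2 (restrict_family (\<lambda>x. ((q x = k \<and> p x < k + a) \<and> lam x < a') \<and> p x = p0) ?W) \<gamma>"
      using wst_negative_part[OF t a(3) G4] by simp
  next
    fix J assume "finite J" "J \<subseteq> p ` Collect (\<lambda>x. (q x = k \<and> p x < k + a) \<and> lam x < a')"
    then have "J \<subseteq> p ` Collect (\<lambda>x. q x = k \<and> p x < k + a)" by blast
    from card[OF this] show "(\<Sum>_\<in>J. 2) \<le> 2 * (real k + 1)" by simp
  qed
  \<comment> \<open>Inclusion and exclusion for the quadrant. At most \<open>k + 1\<close> values of
    \<open>p\<close> lie below \<open>k + a\<close>, and the four costs add up to
    \<open>3 k + 6\<close>.\<close>
  have "bounded_by (((1 + 2) + (real k + 1)) + 2 * (real k + 1))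
    (\<lambda>x. ((restrict_family (\<lambda>x. q x = k) ?W x - restrict_family (\<lambda>x. q x = k \<and> lam x < a') ?W x)
      - restrict_family (\<lambda>x. q x = k \<and> p x < k + a) ?W x) + restrict_family (\<lambda>x. (q x = k \<and> p x < k + a) \<and> lam x < a') ?W x) \<gamma>"
    by (intro bounded_by_add bounded_by_diff b1 b2 b3 b4)
  moreover have "(\<lambda>x. ((restrict_family (\<lambda>x. q x = k) ?W x - restrict_family (\<lambda>x. q x = k \<and> lam x < a') ?W x)
      - restrict_family (\<lambda>x. q x = k \<and> p x < k + a) ?W x) + restrict_family (\<lambda>x. (q x = k \<and> p x < k + a) \<and> lam x < a') ?W x) = restrict_family ?P ?W"
    by (auto simp: restrict_family_def fun_eq_iff)
  ultimately have R: "bounded_by (3 * real k + 6) (restrict_family ?P ?W) \<gamma>" by (simp add: algebra_simps)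
  let ?w = "\<lambda>x. if ?P x then complex_of_real (t powi lam x) else 0"
  \<comment> \<open>The index of \<open>v\<close> is lower by \<open>k\<close> than that of the
    weighted family. Stationarity of \<omega> under translation by \<open>(k, 0)\<close> removes
    this difference on the quadrant.\<close>
  have "sdom (\<lambda>x. ?w x *\<^sub>C v (p x - k, nat (lam x))) (\<lambda>x. ?w x *\<^sub>C \<omega> (int (p x - k), int (nat (lam x))))"
    using sdom_weight[OF sdom_comp[OF v, of "\<lambda>x. (p x - k, nat (lam x))"], of ?w] by simp
  moreover have "sdom (\<lambda>x. ?w x *\<^sub>C \<omega> (int (p x - k), int (nat (lam x)))) (restrict_family ?P ?W)"
  proof -
    have "gram (\<lambda>x. ?w x *\<^sub>C \<omega> (int (p x - k), int (nat (lam x)))) = gram (restrict_family ?P ?W)"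
    proof (intro ext)
      fix x y
      have st': "cinner (\<omega> (int (p x - k), int (nat (lam x)))) (\<omega> (int (p y - k), int (nat (lam y)))) = cinner (\<omega> (int (p x), lam x)) (\<omega> (int (p y), lam y))"
        if P: "?P x" "?P y"
      proof -
        have e: "(int (p x - k), int (nat (lam x))) + (int k, 0) = (int (p x), lam x)" "(int (p y - k), int (nat (lam y))) + (int k, 0) = (int (p y), lam y)"
          using P a by auto
        show ?thesis using st[of "(int (p x - k), int (nat (lam x)))" "(int k, 0)" "(int (p y - k), int (nat (lam y)))"] unfolding e by (rule sym)
      qed
      consider (in_P) "?P x" "?P y" | (x) "\<not> ?P x" | (y) "\<not> ?P y" by blast
      then show "gram (\<lambda>x. ?w x *\<^sub>C \<omega> (int (p x - k), int (nat (lam x)))) x y = gram (restrict_family ?P ?W) x y"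
      proof cases
        case in_P
        show ?thesis
          unfolding gram_def restrict_family_def wst_def if_P[OF in_P(1)] if_P[OF in_P(2)] cinner_scaleC_left cinner_scaleC_right
            st'[OF in_P] mult_1 by (rule refl)
      next
        case x
        show ?thesis unfolding gram_def restrict_family_def if_not_P[OF x] by simp
      next
        case y
        show ?thesis unfolding gram_def restrict_family_def if_not_P[OF y] by simp
      qed
    qed
    then have "psd (\<lambda>x y. gram (restrict_family ?P ?W) x y - gram (\<lambda>x. ?w x *\<^sub>C \<omega> (int (p x - k), int (nat (lam x)))) x y)"
      by (simp only: diff_self) (use psd_scale[of 0, OF _ psd_gram] in simp)
    then show ?thesis by (simp only: psd_diff_iff_sdom)
  qed
  ultimately have "bounded_by (3 * real k + 6) (\<lambda>x. ?w x *\<^sub>C v (p x - k, nat (lam x))) \<gamma>"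
    using R by (blast intro: sdom_bounded_by_trans)
  from bounded_by_scale[OF this, of "complex_of_real (c ^ k - d ^ k)"]
  have "bounded_by ((c ^ k - d ^ k) * (3 * real k + 6)) (\<lambda>x. complex_of_real (c ^ k - d ^ k) *\<^sub>C ?w x *\<^sub>C v (p x - k, nat (lam x))) \<gamma>"
    unfolding norm_of_real using power_mono[OF c(2) c(1), of k] by simp
  also have "(\<lambda>x. complex_of_real (c ^ k - d ^ k) *\<^sub>C ?w x *\<^sub>C v (p x - k, nat (lam x))) = restrict_family (\<lambda>x. (q x + a \<le> p x \<and> a' \<le> lam x) \<and> q x = k) E"
  proof
    fix x
    have "t powi lam x = t ^ nat (lam x)" if "?P x" using that a by (simp add: power_int_def)
    then show "complex_of_real (c ^ k - d ^ k) *\<^sub>C ?w x *\<^sub>C v (p x - k, nat (lam x)) = restrict_family (\<lambda>x. (q x + a \<le> p x \<and> a' \<le> lam x) \<and> q x = k) E x"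
      unfolding restrict_family_def using E[of x] by (auto simp: scaleC_scaleC)
  qed
  finally show "bounded_by ((c ^ k - d ^ k) * (3 * real k + 6)) (restrict_family (\<lambda>x. (q x + a \<le> p x \<and> a' \<le> lam x) \<and> q x = k) E) \<gamma>" .
qed (rule error_coeff_sum[OF c])

text \<open>The family \<gamma> is the direct sum of four pinched copies of the weighted dilation,
  with blocks given by \<open>q\<close>, \<open>(q, lam)\<close>, \<open>(q, p)\<close> and
  \<open>((q, p), lam)\<close>. They supply the four dominations of \<open>quadrant_bound\<close>,
  and the factor 2 in the norm is the square root of their number.\<close>

lemma quadrant_family:
  fixes p q :: "'i::countable \<Rightarrow> nat" and lam :: "'i \<Rightarrow> int" and v :: "nat \<times> nat \<Rightarrow> 'h::complex_hilbert"
  assumes v1: "sdom (\<lambda>x. v (Suc (fst x), snd x)) v" and v2: "sdom (\<lambda>x. v (fst x, Suc (snd x))) v" and t: "t \<ge> 2"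
  obtains \<gamma> :: "'i \<Rightarrow> (ell2 \<times> ell2) \<times> (ell2 \<times> ell2)" where
    "\<And>x. lam x = 0 \<Longrightarrow> norm (\<gamma> x) = 2 * norm (v (0, 0))"
    "\<And>g dp dq dl. (\<And>x. int (p (g x)) = int (p x) + dp) \<Longrightarrow> (\<And>x. int (q (g x)) = int (q x) + dq) \<Longrightarrow>
      (\<And>x. lam (g x) = lam x + dl) \<Longrightarrow> \<bar>dl\<bar> \<le> 1 \<Longrightarrow> sdom (\<lambda>x. \<gamma> (g x)) (\<lambda>x. complex_of_real (t ^ nat \<bar>dl\<bar>) *\<^sub>C \<gamma> x)"
    "\<And>E c d a a'. 0 \<le> d \<Longrightarrow> d \<le> c \<Longrightarrow> c \<le> 1 / 4 \<Longrightarrow> a \<le> 1 \<Longrightarrow> 0 \<le> a' \<Longrightarrow> a' \<le> 1 \<Longrightarrow>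
      (\<And>x. q x + a \<le> p x \<Longrightarrow> a' \<le> lam x \<Longrightarrow>
        E x = complex_of_real ((c ^ q x - d ^ q x) * t ^ nat (lam x)) *\<^sub>C v (p x - q x, nat (lam x))) \<Longrightarrow>
      bounded_by (18 * c) (restrict_family (\<lambda>x. q x + a \<le> p x \<and> a' \<le> lam x) E) \<gamma>"
proof -
  obtain \<omega> :: "int \<times> int \<Rightarrow> ell2" where st: "\<And>a x y. cinner (\<omega> (x + a)) (\<omega> (y + a)) = cinner (\<omega> x) (\<omega> y)"
    and \<omega>0: "norm (\<omega> (0, 0)) = norm (v (0, 0))" and vd: "sdom v (\<lambda>x. \<omega> (int (fst x), int (snd x)))"
    by (rule ando[OF v1 v2]) blast
  let ?W = "wst t \<omega> p lam"
  obtain g1 :: "'i \<Rightarrow> ell2" where g1: "gram g1 = (\<lambda>x y. if q x = q y then gram (?W 1) x y else 0)"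
    by (rule kolmogorov[OF psd_block[OF psd_gram]])
  obtain g2 :: "'i \<Rightarrow> ell2" where g2: "gram g2 = (\<lambda>x y. if (q x, lam x) = (q y, lam y) then gram (?W (-1)) x y else 0)"
    by (rule kolmogorov[OF psd_block[OF psd_gram, where \<kappa> = "\<lambda>x. (q x, lam x)"]])
  obtain g3 :: "'i \<Rightarrow> ell2" where g3: "gram g3 = (\<lambda>x y. if (q x, p x) = (q y, p y) then gram (?W 1) x y else 0)"
    by (rule kolmogorov[OF psd_block[OF psd_gram, where \<kappa> = "\<lambda>x. (q x, p x)"]])
  obtain g4 :: "'i \<Rightarrow> ell2" where g4: "gram g4 = (\<lambda>x y. if ((q x, p x), lam x) = ((q y, p y), lam y) then gram (?W (-1)) x y else 0)"
    by (rule kolmogorov[OF psd_block[OF psd_gram, where \<kappa> = "\<lambda>x. ((q x, p x), lam x)"]])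
  define \<gamma> where "\<gamma> = (\<lambda>x. ((g1 x, g2 x), (g3 x, g4 x)))"
  have s: "sdom g1 \<gamma>" "sdom g2 \<gamma>" "sdom g3 \<gamma>" "sdom g4 \<gamma>"
    unfolding \<gamma>_def
    by (rule sdom_trans[OF sdom_fst sdom_fst] sdom_trans[OF sdom_snd sdom_fst] sdom_trans[OF sdom_fst sdom_snd] sdom_trans[OF sdom_snd sdom_snd])+
  have nW: "norm (?W e x) = norm (v (0, 0))" if "lam x = 0" for e x
  proof -
    have "cinner (\<omega> ((0, 0) + (int (p x), 0))) (\<omega> ((0, 0) + (int (p x), 0))) = cinner (\<omega> (0, 0)) (\<omega> (0, 0))" by (rule st)
    then have "norm (\<omega> (int (p x), 0)) = norm (\<omega> (0, 0))" by (simp add: norm_eq_sqrt_cinner)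
    then show ?thesis using \<omega>0 that by (simp add: wst_def norm_scaleC)
  qed
  have ng: "norm (g x) = norm (w x)" if "gram g x x = gram w x x" for g w :: "'i \<Rightarrow> ell2" and x
    using that by (simp add: gram_def norm_eq_sqrt_cinner)
  show ?thesis
  proof (rule that[of \<gamma>])
    fix x assume x: "lam x = 0"
    have "norm (g1 x) = norm (v (0, 0))" "norm (g2 x) = norm (v (0, 0))" "norm (g3 x) = norm (v (0, 0))" "norm (g4 x) = norm (v (0, 0))"
      using ng[of g1 x "?W 1"] ng[of g2 x "?W (-1)"] ng[of g3 x "?W 1"] ng[of g4 x "?W (-1)"] nW[OF x]
      by (simp_all add: g1 g2 g3 g4)
    then have "norm (\<gamma> x) = sqrt ((2 * norm (v (0, 0)))\<^sup>2)" by (simp add: \<gamma>_def norm_Pair power_mult_distrib)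
    then show "norm (\<gamma> x) = 2 * norm (v (0, 0))" by (simp only: real_sqrt_abs) simp
  next
    fix g dp dq dl
    assume dp: "\<And>x. int (p (g x)) = int (p x) + dp" and dq: "\<And>x. int (q (g x)) = int (q x) + dq"
      and dl: "\<And>x. lam (g x) = lam x + dl" "\<bar>dl\<bar> \<le> 1"
    have ip: "p (g x) = p (g y) \<longleftrightarrow> p x = p y" for x y using dp[of x] dp[of y] by linarith
    have iq: "q (g x) = q (g y) \<longleftrightarrow> q x = q y" for x y using dq[of x] dq[of y] by linarith
    have W: "gram (?W e) (g x) (g y) = complex_of_real ((t powi (e * dl))\<^sup>2) * gram (?W e) x y" for e x y
    proof -
      have t0: "t \<noteq> 0" using t by simp
      have "cinner (\<omega> (int (p x) + dp, lam x + dl)) (\<omega> (int (p y) + dp, lam y + dl)) = cinner (\<omega> (int (p x), lam x)) (\<omega> (int (p y), lam y))"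
        using st[of "(int (p x), lam x)" "(dp, dl)" "(int (p y), lam y)"] by simp
      then show ?thesis
        unfolding gram_def wst_def cinner_scaleC_left cinner_scaleC_right dp dl distrib_left power_int_add[OF disjI1[OF t0]]
        by (simp add: power2_eq_square)
    qed
    have \<rho>: "(t powi (e * dl))\<^sup>2 \<le> (t ^ nat \<bar>dl\<bar>)\<^sup>2" if "e = 1 \<or> e = -1" for e
    proof -
      have "dl = 0 \<or> dl = 1 \<or> dl = -1" using dl(2) by linarith
      moreover have "inverse t \<le> t" using t by (simp add: field_simps) (smt (verit) mult_le_cancel_left1)
      ultimately show ?thesis using that t by (intro power_mono) (auto simp: power_int_minus)
    qed
    let ?T = "t ^ nat \<bar>dl\<bar>"
    have "sdom (\<lambda>x. g1 (g x)) (\<lambda>x. complex_of_real ?T *\<^sub>C g1 x)" by (rule block_shift[OF g1 _ W \<rho>]) (auto simp: iq)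
    moreover have "sdom (\<lambda>x. g2 (g x)) (\<lambda>x. complex_of_real ?T *\<^sub>C g2 x)" by (rule block_shift[OF g2 _ W \<rho>]) (auto simp: iq dl)
    moreover have "sdom (\<lambda>x. g3 (g x)) (\<lambda>x. complex_of_real ?T *\<^sub>C g3 x)" by (rule block_shift[OF g3 _ W \<rho>]) (auto simp: iq ip)
    moreover have "sdom (\<lambda>x. g4 (g x)) (\<lambda>x. complex_of_real ?T *\<^sub>C g4 x)" by (rule block_shift[OF g4 _ W \<rho>]) (auto simp: iq ip dl)
    ultimately show "sdom (\<lambda>x. \<gamma> (g x)) (\<lambda>x. complex_of_real ?T *\<^sub>C \<gamma> x)"
      unfolding \<gamma>_def scaleC_prod_def fst_conv snd_conv by (intro sdom_Pair)
  next
    fix E c d a a'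
    assume "(0::real) \<le> d" "d \<le> c" "c \<le> 1 / 4" "a \<le> (1::nat)" "0 \<le> (a'::int)" "a' \<le> 1"
      and E: "\<And>x. q x + a \<le> p x \<Longrightarrow> a' \<le> lam x \<Longrightarrow>
        E x = complex_of_real ((c ^ q x - d ^ q x) * t ^ nat (lam x)) *\<^sub>C v (p x - q x, nat (lam x))"
    then show "bounded_by (18 * c) (restrict_family (\<lambda>x. q x + a \<le> p x \<and> a' \<le> lam x) E) \<gamma>"
    proof (intro quadrant_bound[OF t _ _ _ _ _ _ st vd])
      show "sdom (restrict_family (\<lambda>x. q x = k) (?W 1)) \<gamma>" for k by (rule sdom_trans[OF block_res[OF g1] s(1)])
      show "sdom (restrict_family (\<lambda>x. q x = k \<and> lam x = l) (?W (-1))) \<gamma>" for k l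
        using sdom_trans[OF block_res[OF g2, of "(k, l)"] s(2)] by simp
      show "sdom (restrict_family (\<lambda>x. q x = k \<and> p x = p0) (?W 1)) \<gamma>" for k p0
        using sdom_trans[OF block_res[OF g3, of "(k, p0)"] s(3)] by simp
      show "sdom (restrict_family (\<lambda>x. (q x = k \<and> p x = p0) \<and> lam x = l) (?W (-1))) \<gamma>" for k p0 l
        using sdom_trans[OF block_res[OF g4, of "((k, p0), l)"] s(4)] by simp
    qed
  qed
qed

section \<open>Comparing annuli\<close>

text \<open>The index \<open>(i, j, l)\<close> stands for \<open>A^i B^j T2^l h\<close> with
  \<open>A = T1 / s\<close> and \<open>B = T1^-1 / s\<close>, where each of the
  \<open>min i j\<close> products \<open>A B\<close> is replaced by the scalar \<epsilon>. Leaving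
  \<epsilon> free allows the true value s^-2 to be compared with another one.\<close>

definition dilated_family :: "real \<Rightarrow> real \<Rightarrow> (int \<times> int \<Rightarrow> 'a::complex_hilbert) \<Rightarrow> nat \<times> nat \<times> int \<Rightarrow> 'a" where
  "dilated_family \<epsilon> s u x = complex_of_real (\<epsilon> ^ min (fst x) (fst (snd x)) * inverse (s ^ nat \<bar>int (fst x) - int (fst (snd x))\<bar>))
    *\<^sub>C u (int (fst x) - int (fst (snd x)), snd (snd x))"

lemma dilated_family_alt:
  assumes "s > 0"
  shows "dilated_family (inverse (s\<^sup>2)) s u x = complex_of_real (inverse (s ^ (fst x + fst (snd x)))) *\<^sub>C u (int (fst x) - int (fst (snd x)), snd (snd x))"
proof -
  have "fst x + fst (snd x) = 2 * min (fst x) (fst (snd x)) + nat \<bar>int (fst x) - int (fst (snd x))\<bar>" by linarith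
  then have "inverse (s\<^sup>2) ^ min (fst x) (fst (snd x)) * inverse (s ^ nat \<bar>int (fst x) - int (fst (snd x))\<bar>) = inverse (s ^ (fst x + fst (snd x)))"
    by (simp only: power_add power_mult power_inverse inverse_mult_distrib)
  then show ?thesis by (simp only: dilated_family_def)
qed

lemma sdom_dilated_family:
  fixes u :: "int \<times> int \<Rightarrow> 'h::complex_hilbert"
  assumes u: "quantum_family s t u" and s: "s > 0"
  defines "U \<equiv> dilated_family (inverse (s\<^sup>2)) s u"
  shows "sdom (\<lambda>x. U (Suc (fst x), snd x)) U" "sdom (\<lambda>x. U (fst x, Suc (fst (snd x)), snd (snd x))) U"
    "e = 1 \<or> e = -1 \<Longrightarrow> sdom (\<lambda>x. U (fst x, fst (snd x), snd (snd x) + e)) (\<lambda>x. complex_of_real t *\<^sub>C U x)"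
proof -
  let ?\<phi> = "\<lambda>x::nat \<times> nat \<times> int. (int (fst x) - int (fst (snd x)), snd (snd x))"
  let ?w = "\<lambda>x::nat \<times> nat \<times> int. complex_of_real (inverse (s ^ (fst x + fst (snd x))))"
  let ?w' = "\<lambda>x::nat \<times> nat \<times> int. complex_of_real (inverse (s ^ Suc (fst x + fst (snd x))))"
  have U: "U = (\<lambda>x. ?w x *\<^sub>C u (?\<phi> x))" unfolding U_def using dilated_family_alt[OF s] by blast
  have w: "?w' x *\<^sub>C complex_of_real s *\<^sub>C h = ?w x *\<^sub>C h" for x and h :: 'h
    using s unfolding scaleC_scaleC of_real_mult[symmetric] by (simp add: field_simps)
  have step: "sdom (\<lambda>x. ?w' x *\<^sub>C u (fst (?\<phi> x) + k, snd (?\<phi> x))) (\<lambda>x. ?w' x *\<^sub>C (complex_of_real s *\<^sub>C u (?\<phi> x)))"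
    if "k = 1 \<or> k = -1" for k
    by (rule sdom_weight[OF sdom_comp[of "\<lambda>x. u (fst x + k, snd x)" "\<lambda>x. complex_of_real s *\<^sub>C u x" ?\<phi>]])
      (use u that in \<open>auto simp: quantum_family_def\<close>)
  have i: "U (Suc (fst x), snd x) = ?w' x *\<^sub>C u (fst (?\<phi> x) + 1, snd (?\<phi> x))" for x
    unfolding U by (simp add: algebra_simps)
  show "sdom (\<lambda>x. U (Suc (fst x), snd x)) U" unfolding i using step[of 1] unfolding w U by simp
  have j: "U (fst x, Suc (fst (snd x)), snd (snd x)) = ?w' x *\<^sub>C u (fst (?\<phi> x) + (-1), snd (?\<phi> x))" for x
    unfolding U by (simp add: algebra_simps)
  show "sdom (\<lambda>x. U (fst x, Suc (fst (snd x)), snd (snd x))) U" unfolding j using step[of "-1"] unfolding w U by simp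
  assume e: "e = 1 \<or> e = -1"
  have "sdom (\<lambda>x. ?w x *\<^sub>C u (fst (?\<phi> x), snd (?\<phi> x) + e)) (\<lambda>x. ?w x *\<^sub>C (complex_of_real t *\<^sub>C u (?\<phi> x)))"
    by (rule sdom_weight[OF sdom_comp[of "\<lambda>x. u (fst x, snd x + e)" "\<lambda>x. complex_of_real t *\<^sub>C u x" ?\<phi>]])
      (use u e in \<open>auto simp: quantum_family_def\<close>)
  then show "sdom (\<lambda>x. U (fst x, fst (snd x), snd (snd x) + e)) (\<lambda>x. complex_of_real t *\<^sub>C U x)"
    unfolding U fst_conv snd_conv scaleC_scaleC by (simp only: mult.commute)
qed

lemma scaleC_Pair: "a *\<^sub>C (x, y) = (a *\<^sub>C x, a *\<^sub>C y)"
  by (simp add: scaleC_prod_def)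

text \<open>On a fixed quadrant \<open>q\<close> is the smaller and \<open>p\<close> the larger of
  the two exponents. The difference of the two families then has coefficient
  \<open>\<epsilon>^q - \<delta>^q\<close>, the shape that \<open>quadrant_family\<close>
  controls.\<close>

lemma signed_quadrant:
  fixes u :: "int \<times> int \<Rightarrow> 'h::complex_hilbert"
  assumes u: "quantum_family s t u" and s: "s > 0" and t: "t \<ge> 2" and e: "0 \<le> \<delta>" "\<delta> \<le> \<epsilon>" "\<epsilon> \<le> 1 / 4"
    and \<sigma>: "\<sigma> = 1 \<or> \<sigma> = -1" and \<tau>: "\<tau> = 1 \<or> \<tau> = -1"
  obtains \<gamma> :: "nat \<times> nat \<times> int \<Rightarrow> (ell2 \<times> ell2) \<times> (ell2 \<times> ell2)" where
    "norm (\<gamma> (0, 0, 0)) = 2 * norm (u (0, 0))"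
    "sdom (\<lambda>x. \<gamma> (Suc (fst x), snd x)) \<gamma>"
    "sdom (\<lambda>x. \<gamma> (fst x, Suc (fst (snd x)), snd (snd x))) \<gamma>"
    "\<And>k. k = 1 \<or> k = -1 \<Longrightarrow> sdom (\<lambda>x. \<gamma> (fst x, fst (snd x), snd (snd x) + k)) (\<lambda>x. complex_of_real t *\<^sub>C \<gamma> x)"
    "bounded_by (18 * \<epsilon>) (restrict_family (\<lambda>x. part \<sigma> (int (fst x) - int (fst (snd x))) \<and> part \<tau> (snd (snd x))) (\<lambda>x. dilated_family \<epsilon> s u x - dilated_family \<delta> s u x)) \<gamma>"
proof -
  define v where "v = (\<lambda>x. complex_of_real (inverse (s ^ fst x * t ^ snd x)) *\<^sub>C u (\<sigma> * int (fst x), \<tau> * int (snd x)))"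
  have t0: "t > 0" using t by simp
  have vc: "sdom (\<lambda>x. v (Suc (fst x), snd x)) v" "sdom (\<lambda>x. v (fst x, Suc (snd x))) v"
    using quantum_family_contractions[OF u s t0 \<sigma> \<tau>] by (simp_all only: v_def)
  define p where "p = (\<lambda>x::nat \<times> nat \<times> int. if \<sigma> = 1 then fst x else fst (snd x))"
  define q where "q = (\<lambda>x::nat \<times> nat \<times> int. if \<sigma> = 1 then fst (snd x) else fst x)"
  define lam where "lam = (\<lambda>x::nat \<times> nat \<times> int. \<tau> * snd (snd x))"
  \<comment> \<open>Exponent 0 belongs to the sign 1; the offsets \<open>a\<close> and
    \<open>a'\<close> make the inequalities strict for the sign -1, so that the four quadrants are
    disjoint.\<close>
  define a where "a = (if \<sigma> = 1 then 0 else 1 :: nat)"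
  define a' where "a' = (if \<tau> = 1 then 0 else 1 :: int)"
  show ?thesis
  proof (rule quadrant_family[OF vc t, where p = p and q = q and lam = lam])
    fix \<gamma> :: "nat \<times> nat \<times> int \<Rightarrow> (ell2 \<times> ell2) \<times> (ell2 \<times> ell2)"
    assume N: "\<And>x. lam x = 0 \<Longrightarrow> norm (\<gamma> x) = 2 * norm (v (0, 0))"
    assume S: "\<And>g dp dq dl. (\<And>x. int (p (g x)) = int (p x) + dp) \<Longrightarrow> (\<And>x. int (q (g x)) = int (q x) + dq) \<Longrightarrow>
      (\<And>x. lam (g x) = lam x + dl) \<Longrightarrow> \<bar>dl\<bar> \<le> 1 \<Longrightarrow> sdom (\<lambda>x. \<gamma> (g x)) (\<lambda>x. complex_of_real (t ^ nat \<bar>dl\<bar>) *\<^sub>C \<gamma> x)"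
    assume Q: "\<And>(E :: nat \<times> nat \<times> int \<Rightarrow> 'h) c d a a'. 0 \<le> d \<Longrightarrow> d \<le> c \<Longrightarrow> c \<le> 1 / 4 \<Longrightarrow> a \<le> 1 \<Longrightarrow> 0 \<le> a' \<Longrightarrow> a' \<le> 1 \<Longrightarrow>
      (\<And>x. q x + a \<le> p x \<Longrightarrow> a' \<le> lam x \<Longrightarrow>
        E x = complex_of_real ((c ^ q x - d ^ q x) * t ^ nat (lam x)) *\<^sub>C v (p x - q x, nat (lam x))) \<Longrightarrow>
      bounded_by (18 * c) (restrict_family (\<lambda>x. q x + a \<le> p x \<and> a' \<le> lam x) E) \<gamma>"
    have v0: "v (0, 0) = u (0, 0)" by (simp add: v_def)
    show thesis
    proof (rule that[of \<gamma>])
      show "norm (\<gamma> (0, 0, 0)) = 2 * norm (u (0, 0))" using N[of "(0, 0, 0)"] by (simp add: lam_def v0)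
      show "sdom (\<lambda>x. \<gamma> (Suc (fst x), snd x)) \<gamma>"
        using S[of "\<lambda>x. (Suc (fst x), snd x)" "if \<sigma> = 1 then 1 else 0" "if \<sigma> = 1 then 0 else 1" 0]
        by (auto simp: p_def q_def lam_def)
      show "sdom (\<lambda>x. \<gamma> (fst x, Suc (fst (snd x)), snd (snd x))) \<gamma>"
        using S[of "\<lambda>x. (fst x, Suc (fst (snd x)), snd (snd x))" "if \<sigma> = 1 then 0 else 1" "if \<sigma> = 1 then 1 else 0" 0]
        by (auto simp: p_def q_def lam_def)
      show "sdom (\<lambda>x. \<gamma> (fst x, fst (snd x), snd (snd x) + k)) (\<lambda>x. complex_of_real t *\<^sub>C \<gamma> x)" if k: "k = 1 \<or> k = -1" for k
      proof -
        have "nat \<bar>\<tau> * k\<bar> = 1" using k \<tau> by auto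
        then show ?thesis
          using S[of "\<lambda>x. (fst x, fst (snd x), snd (snd x) + k)" 0 0 "\<tau> * k"] k \<tau>
          by (auto simp: p_def q_def lam_def distrib_left)
      qed
      have "bounded_by (18 * \<epsilon>) (restrict_family (\<lambda>x. q x + a \<le> p x \<and> a' \<le> lam x) (\<lambda>x. dilated_family \<epsilon> s u x - dilated_family \<delta> s u x)) \<gamma>"
      proof (rule Q[OF e])
        fix x assume qp: "q x + a \<le> p x" and al: "a' \<le> lam x"
        have m: "min (fst x) (fst (snd x)) = q x" using qp \<sigma> by (auto simp: p_def q_def a_def)
        have n: "nat \<bar>int (fst x) - int (fst (snd x))\<bar> = p x - q x" using qp \<sigma> by (auto simp: p_def q_def a_def)
        have i: "int (fst x) - int (fst (snd x)) = \<sigma> * int (p x - q x)" using qp \<sigma> by (auto simp: p_def q_def a_def of_nat_diff)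
        have l: "snd (snd x) = \<tau> * int (nat (lam x))" using al \<tau> by (auto simp: lam_def a'_def)
        let ?h = "u (\<sigma> * int (p x - q x), \<tau> * int (nat (lam x)))"
        have d: "dilated_family \<epsilon> s u x = complex_of_real (\<epsilon> ^ q x * inverse (s ^ (p x - q x))) *\<^sub>C ?h" for \<epsilon>
          unfolding dilated_family_def m n i[symmetric] l[symmetric] by (rule refl)
        have T: "t ^ nat (lam x) * inverse (s ^ (p x - q x) * t ^ nat (lam x)) = inverse (s ^ (p x - q x))"
          using t0 s by (simp add: field_simps)
        have "\<epsilon> ^ q x * inverse (s ^ (p x - q x)) - \<delta> ^ q x * inverse (s ^ (p x - q x))
          = (\<epsilon> ^ q x - \<delta> ^ q x) * t ^ nat (lam x) * inverse (s ^ (p x - q x) * t ^ nat (lam x))"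
          by (simp only: mult.assoc T left_diff_distrib)
        then show "dilated_family \<epsilon> s u x - dilated_family \<delta> s u x = complex_of_real ((\<epsilon> ^ q x - \<delta> ^ q x) * t ^ nat (lam x)) *\<^sub>C v (p x - q x, nat (lam x))"
          unfolding d v_def fst_conv snd_conv scaleC_diff_left[symmetric] of_real_diff[symmetric] scaleC_scaleC of_real_mult[symmetric]
          by (simp only:)
      qed (simp_all add: a_def a'_def)
      moreover have "(\<lambda>x. q x + a \<le> p x \<and> a' \<le> lam x) = (\<lambda>x. part \<sigma> (int (fst x) - int (fst (snd x))) \<and> part \<tau> (snd (snd x)))"
        using \<sigma> \<tau> by (auto simp: fun_eq_iff p_def q_def lam_def a_def a'_def part_def)
      ultimately show "bounded_by (18 * \<epsilon>) (restrict_family (\<lambda>x. part \<sigma> (int (fst x) - int (fst (snd x))) \<and> part \<tau> (snd (snd x))) (\<lambda>x. dilated_family \<epsilon> s u x - dilated_family \<delta> s u x)) \<gamma>"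
        by (simp only:)
    qed
  qed
qed

text \<open>With \<open>y = (s / S) z\<close> on the circle of radius \<open>s\<close>, the rescaled
  monomials with nonnegative exponent are powers of \<open>y\<close>. Those with negative exponent
  differ from them by \<theta>, which is at most \<open>s powi n\<close> and hence a tail starting
  at -1.\<close>

lemma laurent1_rescale:
  assumes s: "1 < s" "s \<le> S" and F: "finite F" and B: "\<And>z. z \<in> bdry s \<Longrightarrow> cmod (\<Sum>x\<in>F. a x * z powi e x) \<le> B"
    and z: "cmod z = S"
  shows "cmod (\<Sum>x\<in>F. a x * (complex_of_real (s ^ nat \<bar>e x\<bar> * inverse (S ^ nat \<bar>e x\<bar>)) * z powi e x)) \<le> (1 + tail_const s 1) * B"
proof -
  define y where "y = complex_of_real (s / S) * z"
  have y: "cmod y = s" using s z by (simp add: y_def norm_mult norm_divide)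
  define \<theta> where "\<theta> = (\<lambda>n. complex_of_real (s ^ nat \<bar>n\<bar> * inverse (S ^ nat \<bar>n\<bar>)) * z powi n - y powi n)"
  have \<theta>0: "\<theta> n = 0" if "n \<ge> 0" for n
    using that by (simp add: \<theta>_def y_def power_int_def power_mult_distrib power_divide divide_inverse power_inverse)
  have \<theta>1: "cmod (\<theta> n) \<le> s powi n" if n: "n \<le> - int 1" for n
  proof -
    obtain k where k: "n = - int k" using n by (metis nonpos_int_cases order_trans neg_le_0_iff_le of_nat_0_le_iff)
    have sS: "0 < s ^ k" "s ^ k \<le> S ^ k" "0 < S ^ k" using s by (auto intro: power_mono)
    let ?A = "s ^ k" and ?B = "S ^ k"
    have "\<theta> n = complex_of_real (?A * inverse ?B - inverse ?A * ?B) * z powi n"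
    proof -
      have "complex_of_real (s / S) powi n = complex_of_real (inverse ?A * ?B)"
        by (simp add: k power_int_minus power_divide) (simp add: divide_inverse mult.commute)
      then have "y powi n = complex_of_real (inverse ?A * ?B) * z powi n" by (simp only: y_def power_int_mult_distrib)
      moreover have "nat \<bar>n\<bar> = k" by (simp add: k)
      ultimately show ?thesis unfolding \<theta>_def by (simp only: left_diff_distrib of_real_diff)
    qed
    moreover have "cmod (z powi n) = inverse ?B" by (simp add: k power_int_minus norm_inverse norm_power z)
    ultimately have "cmod (\<theta> n) = \<bar>?A * inverse ?B - inverse ?A * ?B\<bar> * inverse ?B" by (simp only: norm_mult norm_of_real)
    also have "\<dots> \<le> (inverse ?A * ?B) * inverse ?B"
    proof (intro mult_right_mono)
      have "?A * inverse ?B \<le> 1" "1 \<le> inverse ?A * ?B" using sS by (simp_all add: field_simps)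
      moreover have "0 \<le> ?A * inverse ?B" using sS by simp
      ultimately show "\<bar>?A * inverse ?B - inverse ?A * ?B\<bar> \<le> inverse ?A * ?B" by linarith
    qed (use sS in simp)
    also have "\<dots> = inverse ?A" by (simp only: mult.assoc right_inverse[OF less_imp_neq[OF sS(3), symmetric]] mult_1_right)
    also have "\<dots> = s powi n" by (simp add: k power_int_minus)
    finally show ?thesis .
  qed
  have "(\<Sum>x\<in>F. a x * (complex_of_real (s ^ nat \<bar>e x\<bar> * inverse (S ^ nat \<bar>e x\<bar>)) * z powi e x)) = (\<Sum>x\<in>F. a x * y powi e x) + (\<Sum>x\<in>F. a x * \<theta> (e x))"
    unfolding sum.distrib[symmetric] by (rule sum.cong) (simp_all add: \<theta>_def algebra_simps)
  also have "(\<Sum>x\<in>F. a x * \<theta> (e x)) = (\<Sum>x\<in>{x\<in>F. e x \<le> - int 1}. a x * \<theta> (e x))"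
  proof (rule sum.mono_neutral_right[OF F])
    show "\<forall>x\<in>F - {x\<in>F. e x \<le> - int 1}. a x * \<theta> (e x) = 0"
    proof
      fix x assume "x \<in> F - {x\<in>F. e x \<le> - int 1}"
      then have "0 \<le> e x" by auto
      then show "a x * \<theta> (e x) = 0" by (simp add: \<theta>0)
    qed
  qed auto
  also have "cmod ((\<Sum>x\<in>F. a x * y powi e x) + (\<Sum>x\<in>{x\<in>F. e x \<le> - int 1}. a x * \<theta> (e x))) \<le> B + tail_const s 1 * B"
  proof (intro norm_triangle_mono)
    show "cmod (\<Sum>x\<in>F. a x * y powi e x) \<le> B" using y by (intro B) (simp add: bdry_def)
    show "cmod (\<Sum>x\<in>{x\<in>F. e x \<le> - int 1}. a x * \<theta> (e x)) \<le> tail_const s 1 * B"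
      by (rule tail_bound_neg[OF s(1) F _ \<theta>1]) (auto intro: B simp: bdry_def)
  qed
  finally show ?thesis by (simp add: distrib_right)
qed

lemma laurent_rescale:
  assumes s: "1 < s" "s \<le> S" and F: "finite F"
    and B: "\<And>z w. z \<in> bdry s \<Longrightarrow> w \<in> bdry t \<Longrightarrow> cmod (laurent F c z w) \<le> B"
    and z: "z \<in> bdry S" and w: "w \<in> bdry t"
  shows "cmod (laurent F (\<lambda>x. c x * complex_of_real (s ^ nat \<bar>fst x\<bar> * inverse (S ^ nat \<bar>fst x\<bar>))) z w) \<le> (1 + tail_const s 1) * B"
proof -
  have B1: "cmod (\<Sum>x\<in>F. (c x * w powi snd x) * z powi fst x) \<le> B" if "z \<in> bdry s" for z
    using B[OF that w] by (simp add: laurent_def mult_ac)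
  let ?k = "\<lambda>n. complex_of_real (s ^ nat \<bar>n\<bar> * inverse (S ^ nat \<bar>n\<bar>))"
  have L: "laurent F (\<lambda>x. c x * ?k (fst x)) z w = (\<Sum>x\<in>F. (c x * w powi snd x) * (?k (fst x) * z powi fst x))"
    unfolding laurent_def by (simp only: mult_ac)
  show ?thesis
  proof (cases "cmod z = S")
    case True
    show ?thesis unfolding L by (rule laurent1_rescale[OF s F B1 True])
  next
    case False
    \<comment> \<open>The weights depend on the absolute exponent only and \<open>bdry s\<close> is
      stable under inversion, so the inner circle reduces to the outer one.\<close>
    then have z': "cmod (inverse z) = S" using z by (auto simp: bdry_def norm_inverse)
    have "cmod (\<Sum>x\<in>F. (c x * w powi snd x) * (?k (- fst x) * inverse z powi (- fst x))) \<le> (1 + tail_const s 1) * B"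
    proof (rule laurent1_rescale[OF s F _ z'])
      fix y assume "y \<in> bdry s"
      then have "inverse y \<in> bdry s" by (auto simp: bdry_def norm_inverse)
      from B1[OF this] show "cmod (\<Sum>x\<in>F. (c x * w powi snd x) * y powi (- fst x)) \<le> B"
        by (simp only: power_int_inverse power_int_minus)
    qed
    then show ?thesis unfolding L by (simp only: abs_minus_cancel power_int_inverse power_int_minus inverse_inverse_eq)
  qed
qed

text \<open>On \<open>dilated_family (s\<^sup>-\<^sup>2) s u\<close> the first two shifts are the contractions \<open>T\<^sub>1/s\<close> and
  \<open>T\<^sub>1\<^sup>-\<^sup>1/s\<close>, whose product is \<open>s\<^sup>-\<^sup>2\<close>. Adding a small multiple of the auxiliary families and projecting
  out the span of \<open>\<beta> (i + 1, j + 1, l) - \<delta> \<beta> (i, j, l)\<close> replaces this scalar by \<open>\<delta> = S\<^sup>-\<^sup>2\<close>; the auxiliary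
  families pay for the change of the functional that recovers \<open>u\<close>.\<close>

lemma compression:
  fixes u :: "int \<times> int \<Rightarrow> 'h::complex_hilbert"
  assumes u: "quantum_family s t u" and s: "s \<ge> 2" and t: "t \<ge> 2" and \<delta>: "0 \<le> \<delta>" "\<delta> \<le> inverse (s\<^sup>2)"
  defines "U \<equiv> dilated_family (inverse (s\<^sup>2)) s u"
  obtains b :: "nat \<times> nat \<times> int \<Rightarrow> 'h \<times> (((ell2 \<times> ell2) \<times> (ell2 \<times> ell2)) \<times> ((ell2 \<times> ell2) \<times> (ell2 \<times> ell2)))
      \<times> (((ell2 \<times> ell2) \<times> (ell2 \<times> ell2)) \<times> ((ell2 \<times> ell2) \<times> (ell2 \<times> ell2)))" where
    "sdom (\<lambda>x. b (Suc (fst x), snd x)) b"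
    "sdom (\<lambda>x. b (fst x, Suc (fst (snd x)), snd (snd x))) b"
    "\<And>k. k = 1 \<or> k = -1 \<Longrightarrow> sdom (\<lambda>x. b (fst x, fst (snd x), snd (snd x) + k)) (\<lambda>x. complex_of_real t *\<^sub>C b x)"
    "\<And>i j l. b (Suc i, Suc j, l) = complex_of_real \<delta> *\<^sub>C b (i, j, l)"
    "sdom (dilated_family \<delta> s u) (\<lambda>x. complex_of_real (sqrt (1 + (72 / s)\<^sup>2)) *\<^sub>C b x)"
    "norm (b (0, 0, 0)) \<le> sqrt (1 + 16 / s\<^sup>2) * norm (u (0, 0))"
proof -
  have s0: "s > 0" using s by simp
  define \<epsilon> where "\<epsilon> = inverse (s\<^sup>2)"
  have "4 \<le> s\<^sup>2" using power_mono[OF s, of 2] by simp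
  then have e: "0 \<le> \<delta>" "\<delta> \<le> \<epsilon>" "\<epsilon> \<le> 1 / 4" "0 < \<epsilon>" using \<delta> s0 by (simp_all add: \<epsilon>_def field_simps)
  have sqe: "sqrt \<epsilon> = inverse s" using s0 by (simp add: \<epsilon>_def real_sqrt_inverse)
  let ?E = "\<lambda>x. dilated_family \<epsilon> s u x - dilated_family \<delta> s u x"
  let ?P = "\<lambda>\<sigma> \<tau> x. part \<sigma> (int (fst x) - int (fst (snd x))) \<and> part \<tau> (snd (snd x))"
  note sq = signed_quadrant[OF u s0 t e(1-3)]
  obtain g1 :: "nat \<times> nat \<times> int \<Rightarrow> (ell2 \<times> ell2) \<times> (ell2 \<times> ell2)" where
    g1: "norm (g1 (0, 0, 0)) = 2 * norm (u (0, 0))" "sdom (\<lambda>x. g1 (Suc (fst x), snd x)) g1"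
      "sdom (\<lambda>x. g1 (fst x, Suc (fst (snd x)), snd (snd x))) g1"
      "\<And>k. k = 1 \<or> k = -1 \<Longrightarrow> sdom (\<lambda>x. g1 (fst x, fst (snd x), snd (snd x) + k)) (\<lambda>x. complex_of_real t *\<^sub>C g1 x)"
      "bounded_by (18 * \<epsilon>) (restrict_family (?P 1 1) ?E) g1"
    by (rule sq[of 1 1]) (simp, simp, (assumption | rule that)+)
  obtain g2 :: "nat \<times> nat \<times> int \<Rightarrow> (ell2 \<times> ell2) \<times> (ell2 \<times> ell2)" where
    g2: "norm (g2 (0, 0, 0)) = 2 * norm (u (0, 0))" "sdom (\<lambda>x. g2 (Suc (fst x), snd x)) g2"
      "sdom (\<lambda>x. g2 (fst x, Suc (fst (snd x)), snd (snd x))) g2"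
      "\<And>k. k = 1 \<or> k = -1 \<Longrightarrow> sdom (\<lambda>x. g2 (fst x, fst (snd x), snd (snd x) + k)) (\<lambda>x. complex_of_real t *\<^sub>C g2 x)"
      "bounded_by (18 * \<epsilon>) (restrict_family (?P 1 (-1)) ?E) g2"
    by (rule sq[of 1 "-1"]) (simp, simp, (assumption | rule that)+)
  obtain g3 :: "nat \<times> nat \<times> int \<Rightarrow> (ell2 \<times> ell2) \<times> (ell2 \<times> ell2)" where
    g3: "norm (g3 (0, 0, 0)) = 2 * norm (u (0, 0))" "sdom (\<lambda>x. g3 (Suc (fst x), snd x)) g3"
      "sdom (\<lambda>x. g3 (fst x, Suc (fst (snd x)), snd (snd x))) g3"
      "\<And>k. k = 1 \<or> k = -1 \<Longrightarrow> sdom (\<lambda>x. g3 (fst x, fst (snd x), snd (snd x) + k)) (\<lambda>x. complex_of_real t *\<^sub>C g3 x)"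
      "bounded_by (18 * \<epsilon>) (restrict_family (?P (-1) 1) ?E) g3"
    by (rule sq[of "-1" 1]) (simp, simp, (assumption | rule that)+)
  obtain g4 :: "nat \<times> nat \<times> int \<Rightarrow> (ell2 \<times> ell2) \<times> (ell2 \<times> ell2)" where
    g4: "norm (g4 (0, 0, 0)) = 2 * norm (u (0, 0))" "sdom (\<lambda>x. g4 (Suc (fst x), snd x)) g4"
      "sdom (\<lambda>x. g4 (fst x, Suc (fst (snd x)), snd (snd x))) g4"
      "\<And>k. k = 1 \<or> k = -1 \<Longrightarrow> sdom (\<lambda>x. g4 (fst x, fst (snd x), snd (snd x) + k)) (\<lambda>x. complex_of_real t *\<^sub>C g4 x)"
      "bounded_by (18 * \<epsilon>) (restrict_family (?P (-1) (-1)) ?E) g4"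
    by (rule sq[of "-1" "-1"]) (simp, simp, (assumption | rule that)+)
  define \<gamma> where "\<gamma> = (\<lambda>x. ((g1 x, g2 x), (g3 x, g4 x)))"
  have sg: "sdom g1 \<gamma>" "sdom g2 \<gamma>" "sdom g3 \<gamma>" "sdom g4 \<gamma>"
    unfolding \<gamma>_def
    by (rule sdom_trans[OF sdom_fst sdom_fst] sdom_trans[OF sdom_snd sdom_fst] sdom_trans[OF sdom_fst sdom_snd] sdom_trans[OF sdom_snd sdom_snd])+
  have \<gamma>i: "sdom (\<lambda>x. \<gamma> (Suc (fst x), snd x)) \<gamma>" unfolding \<gamma>_def by (intro sdom_Pair g1 g2 g3 g4)
  have \<gamma>j: "sdom (\<lambda>x. \<gamma> (fst x, Suc (fst (snd x)), snd (snd x))) \<gamma>" unfolding \<gamma>_def by (intro sdom_Pair g1 g2 g3 g4)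
  have \<gamma>l: "sdom (\<lambda>x. \<gamma> (fst x, fst (snd x), snd (snd x) + k)) (\<lambda>x. complex_of_real t *\<^sub>C \<gamma> x)" if "k = 1 \<or> k = -1" for k
    unfolding \<gamma>_def scaleC_Pair by (intro sdom_Pair g1(4) g2(4) g3(4) g4(4) that)
  have "norm (\<gamma> (0, 0, 0)) = sqrt ((4 * norm (u (0, 0)))\<^sup>2)"
    by (simp add: \<gamma>_def norm_Pair g1 g2 g3 g4 power_mult_distrib)
  then have \<gamma>0: "norm (\<gamma> (0, 0, 0)) = 4 * norm (u (0, 0))" by (simp only: real_sqrt_abs) simp
  have err: "bounded_by (72 * \<epsilon>) ?E \<gamma>"
  proof -
    have e18: "0 \<le> 18 * \<epsilon>" using e by simp
    have "bounded_by ((18 * \<epsilon> + 18 * \<epsilon>) + (18 * \<epsilon> + 18 * \<epsilon>))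
      (\<lambda>x. (restrict_family (?P 1 1) ?E x + restrict_family (?P 1 (-1)) ?E x) + (restrict_family (?P (-1) 1) ?E x + restrict_family (?P (-1) (-1)) ?E x)) \<gamma>"
      by (intro bounded_by_add bounded_by_sdom_trans[OF g1(5) sg(1) e18] bounded_by_sdom_trans[OF g2(5) sg(2) e18]
          bounded_by_sdom_trans[OF g3(5) sg(3) e18] bounded_by_sdom_trans[OF g4(5) sg(4) e18])
    moreover have "(\<lambda>x. (restrict_family (?P 1 1) ?E x + restrict_family (?P 1 (-1)) ?E x) + (restrict_family (?P (-1) 1) ?E x + restrict_family (?P (-1) (-1)) ?E x)) = ?E"
      by (auto simp: fun_eq_iff restrict_family_def part_def)
    ultimately show ?thesis by simp
  qed
  \<comment> \<open>The weight \<open>sqrt \<epsilon> = 1/s\<close> balances two costs. The error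
    \<open>72 \<epsilon> G\<close>, with 72 = 4 * 18 from the four quadrants, becomes
    \<open>72 / s\<close> times a component of \<beta>; the initial vector gains
    \<open>(4 / s)^2\<close> in squared norm. Both contribute \<open>O(s^-2)\<close>
    relatively.\<close>
  define w where "w = (\<lambda>x. complex_of_real (sqrt \<epsilon>) *\<^sub>C \<gamma> x)"
  define \<beta> where "\<beta> = (\<lambda>x. (U x, w x))"
  have U: "U = dilated_family \<epsilon> s u" by (simp add: U_def \<epsilon>_def)
  have \<beta>1: "sdom (\<lambda>x. \<beta> (Suc (fst x), snd x)) (\<lambda>x. complex_of_real 1 *\<^sub>C \<beta> x)"
    unfolding \<beta>_def w_def of_real_1 scaleC_one by (intro sdom_Pair sdom_weight[OF \<gamma>i] sdom_dilated_family(1)[OF u s0, folded U_def])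
  have \<beta>2: "sdom (\<lambda>x. \<beta> (fst x, Suc (fst (snd x)), snd (snd x))) (\<lambda>x. complex_of_real 1 *\<^sub>C \<beta> x)"
    unfolding \<beta>_def w_def of_real_1 scaleC_one by (intro sdom_Pair sdom_weight[OF \<gamma>j] sdom_dilated_family(2)[OF u s0, folded U_def])
  have \<beta>3: "sdom (\<lambda>x. \<beta> (fst x, fst (snd x), snd (snd x) + k)) (\<lambda>x. complex_of_real t *\<^sub>C \<beta> x)" if k: "k = 1 \<or> k = -1" for k
  proof -
    have "sdom (\<lambda>x. w (fst x, fst (snd x), snd (snd x) + k)) (\<lambda>x. complex_of_real t *\<^sub>C w x)"
      using sdom_weight[OF \<gamma>l[OF k], of "\<lambda>_. complex_of_real (sqrt \<epsilon>)"] unfolding w_def scaleC_scaleC by (simp only: mult.commute)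
    then show ?thesis unfolding \<beta>_def scaleC_Pair
      by (intro sdom_Pair sdom_dilated_family(3)[OF u s0 k, folded U_def])
  qed
  have \<beta>4: "sdom (dilated_family \<delta> s u) (\<lambda>x. complex_of_real (sqrt (1 + (72 / s)\<^sup>2)) *\<^sub>C \<beta> x)"
    unfolding sdom_def
  proof (intro allI impI)
    fix F :: "(nat \<times> nat \<times> int) set" and c assume F: "finite F"
    define A where "A = norm (comb F c U)"
    define G where "G = norm (comb F c \<gamma>)"
    have "comb F c (dilated_family \<delta> s u) = comb F c U - comb F c ?E" by (simp add: comb_minus_fam U)
    then have "norm (comb F c (dilated_family \<delta> s u)) \<le> A + norm (comb F c ?E)"
      unfolding A_def by (simp only: norm_triangle_ineq4)
    also have "\<dots> \<le> A + 72 * \<epsilon> * G" using err F unfolding bounded_by_def G_def by (intro add_left_mono) blast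
    also have "\<dots> = 1 * A + (72 / s) * (sqrt \<epsilon> * G)"
    proof -
      have "72 * \<epsilon> * G = (72 / s) * (inverse s * G)" by (simp add: \<epsilon>_def power2_eq_square divide_inverse)
      then show ?thesis by (simp only: sqe mult_1)
    qed
    also have "\<dots> \<le> sqrt (1 + (72 / s)\<^sup>2) * sqrt (A\<^sup>2 + (sqrt \<epsilon> * G)\<^sup>2)"
    proof -
      have "(1 * A + a * b)\<^sup>2 \<le> (1 + a\<^sup>2) * (A\<^sup>2 + b\<^sup>2)" for a b :: real
        using zero_le_power2[of "b - a * A"] by (simp add: power2_eq_square algebra_simps)
      then show ?thesis unfolding real_sqrt_mult[symmetric] by (rule real_le_rsqrt)
    qed
    also have "sqrt (A\<^sup>2 + (sqrt \<epsilon> * G)\<^sup>2) = norm (comb F c \<beta>)"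
      using e by (simp add: \<beta>_def comb_Pair norm_Pair w_def comb_scale_fam norm_scaleC A_def G_def)
    finally show "norm (comb F c (dilated_family \<delta> s u)) \<le> norm (comb F c (\<lambda>x. complex_of_real (sqrt (1 + (72 / s)\<^sup>2)) *\<^sub>C \<beta> x))"
      by (simp add: comb_scale_fam norm_scaleC)
  qed
  define D where "D = (\<lambda>x::nat \<times> nat \<times> int. (Suc (fst x), Suc (fst (snd x)), snd (snd x)))"
  define N where "N = cspan (\<lambda>k. \<beta> (D k) - complex_of_real \<delta> *\<^sub>C \<beta> k)"
  have N: "csubspace N" unfolding N_def by (rule csubspace_cspan)
  define b where "b = (\<lambda>x. SOME y. residual N (\<beta> x) y)"
  have rb: "residual N (\<beta> x) (b x)" for x unfolding b_def by (rule someI_ex[OF residual_exists[OF N]])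
  have shift: "sdom (\<lambda>x. b (g x)) (\<lambda>x. complex_of_real \<rho> *\<^sub>C b x)"
    if g: "sdom (\<lambda>x. \<beta> (g x)) (\<lambda>x. complex_of_real \<rho> *\<^sub>C \<beta> x)" "\<rho> > 0" "\<And>x. g (D x) = D (g x)" for g \<rho>
  proof (rule sdom_residual[OF g(1,2) N _ rb[unfolded N_def] rb])
    show "\<beta> (g (D k)) - complex_of_real \<delta> *\<^sub>C \<beta> (g k) \<in> N" for k
      unfolding g(3) N_def by (rule cspan_base[of "\<lambda>k. \<beta> (D k) - complex_of_real \<delta> *\<^sub>C \<beta> k" "g k"])
  qed
  show ?thesis
  proof (rule that[of b])
    show "sdom (\<lambda>x. b (Suc (fst x), snd x)) b" using shift[OF \<beta>1] by (simp add: D_def)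
    show "sdom (\<lambda>x. b (fst x, Suc (fst (snd x)), snd (snd x))) b" using shift[OF \<beta>2] by (simp add: D_def)
    show "sdom (\<lambda>x. b (fst x, fst (snd x), snd (snd x) + k)) (\<lambda>x. complex_of_real t *\<^sub>C b x)" if "k = 1 \<or> k = -1" for k
      using shift[OF \<beta>3[OF that]] t by (simp add: D_def)
    show "b (Suc i, Suc j, l) = complex_of_real \<delta> *\<^sub>C b (i, j, l)" for i j l
    proof -
      let ?x = "(i, j, l)"
      have "residual N (\<beta> (D ?x) + (- complex_of_real \<delta>) *\<^sub>C \<beta> ?x) (b (D ?x) + (- complex_of_real \<delta>) *\<^sub>C b ?x)"
        by (intro residual_add residual_scale N rb)
      moreover have "\<beta> (D ?x) + (- complex_of_real \<delta>) *\<^sub>C \<beta> ?x \<in> N"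
        using cspan_base[of "\<lambda>k. \<beta> (D k) - complex_of_real \<delta> *\<^sub>C \<beta> k" ?x] by (simp add: N_def scaleC_minus_left)
      ultimately have "b (D ?x) + (- complex_of_real \<delta>) *\<^sub>C b ?x = 0" by (rule residual_in[OF N])
      then show ?thesis by (simp add: D_def scaleC_minus_left)
    qed
    show "sdom (dilated_family \<delta> s u) (\<lambda>x. complex_of_real (sqrt (1 + (72 / s)\<^sup>2)) *\<^sub>C b x)"
    proof (rule sdom_residual[OF \<beta>4 _ _ _ rb[unfolded N_def] residual_self])
      show "sqrt (1 + (72 / s)\<^sup>2) > 0" by (simp add: add_pos_nonneg)
      show "csubspace {0 :: 'h}" by (simp add: csubspace_def)
      \<comment> \<open>The family with parameter \<delta> satisfies the imposed relation exactly,
        so its relation vectors are 0 and its domination survives the projection.\<close>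
      show "dilated_family \<delta> s u (D k) - complex_of_real \<delta> *\<^sub>C dilated_family \<delta> s u k \<in> {0}" for k
        by (simp add: dilated_family_def D_def scaleC_scaleC mult.assoc)
    qed
    have "norm (b (0, 0, 0)) \<le> norm (\<beta> (0, 0, 0))"
      using residual_norm_le[OF N rb, of 0 "(0, 0, 0)"] N by (simp add: csubspace_def)
    also have "\<dots> = sqrt ((1 + 16 / s\<^sup>2) * (norm (u (0, 0)))\<^sup>2)"
      using s0 e by (simp add: \<beta>_def w_def norm_Pair U dilated_family_def norm_scaleC \<gamma>0 power_mult_distrib distrib_right) (simp add: \<epsilon>_def divide_inverse mult_ac)
    also have "\<dots> = sqrt (1 + 16 / s\<^sup>2) * norm (u (0, 0))" by (simp add: real_sqrt_mult)
    finally show "norm (b (0, 0, 0)) \<le> sqrt (1 + 16 / s\<^sup>2) * norm (u (0, 0))" .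
  qed
qed

text \<open>The three losses of the comparison: recovering \<open>u\<close> from the compression,
  rescaling the Laurent polynomial, and the longer initial vector.\<close>

definition shrink :: "real \<Rightarrow> real" where
  "shrink s = sqrt (1 + (72 / s)\<^sup>2) * (1 + tail_const s 1) * sqrt (1 + 16 / s\<^sup>2)"

text \<open>In the model for \<open>b\<close> the first two shifts are contractions with product
  S^-2, so \<open>S\<close> times them are mutually inverse with norms at most \<open>S\<close>.
  Their orbit \<open>y\<close> is a family for \<open>S\<close>, to which \<open>K\<close>
  applies.\<close>

theorem laurent_const_shrink:
  assumes K: "laurent_const S t K" "K \<ge> 0" and s: "2 \<le> s" "s \<le> S" and t: "t \<ge> 2"
  shows "laurent_const s t (K * shrink s)"
  unfolding laurent_const_def
proof (intro allI impI)
  fix u :: "int \<times> int \<Rightarrow> ell2" and F c B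
  assume u: "quantum_family s t u" and F: "finite F" and B: "\<forall>z\<in>bdry s. \<forall>w\<in>bdry t. cmod (laurent F c z w) \<le> B"
  have s1: "s > 1" "S > 0" and t0: "t > 0" using s t by auto
  have "complex_of_real s \<in> bdry s" "complex_of_real t \<in> bdry t" using s1 t by (auto simp: bdry_def)
  then have B0: "0 \<le> B" using B by (meson norm_ge_zero order_trans)
  define \<delta> where "\<delta> = inverse (S\<^sup>2)"
  have \<delta>: "0 \<le> \<delta>" "\<delta> \<le> inverse (s\<^sup>2)" using s unfolding \<delta>_def by (auto intro!: le_imp_inverse_le power_mono)
  show "norm (comb F c u) \<le> K * shrink s * B * norm (u (0, 0))"
  proof (rule compression[OF u s(1) t \<delta>])
    fix b :: "nat \<times> nat \<times> int \<Rightarrow> ell2 \<times> (((ell2 \<times> ell2) \<times> (ell2 \<times> ell2)) \<times> ((ell2 \<times> ell2) \<times> (ell2 \<times> ell2)))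
      \<times> (((ell2 \<times> ell2) \<times> (ell2 \<times> ell2)) \<times> ((ell2 \<times> ell2) \<times> (ell2 \<times> ell2)))"
    assume b1: "sdom (\<lambda>x. b (Suc (fst x), snd x)) b"
      and b2: "sdom (\<lambda>x. b (fst x, Suc (fst (snd x)), snd (snd x))) b"
      and b3: "\<And>k. k = 1 \<or> k = -1 \<Longrightarrow> sdom (\<lambda>x. b (fst x, fst (snd x), snd (snd x) + k)) (\<lambda>x. complex_of_real t *\<^sub>C b x)"
      and b4: "\<And>i j l. b (Suc i, Suc j, l) = complex_of_real \<delta> *\<^sub>C b (i, j, l)"
      and b5: "sdom (dilated_family \<delta> s u) (\<lambda>x. complex_of_real (sqrt (1 + (72 / s)\<^sup>2)) *\<^sub>C b x)"
      and b6: "norm (b (0, 0, 0)) \<le> sqrt (1 + 16 / s\<^sup>2) * norm (u (0, 0))"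
    define g where "g = (\<lambda>x::int \<times> int. (nat (fst x), nat (- fst x), snd x))"
    define y where "y = (\<lambda>x. complex_of_real (S ^ nat \<bar>fst x\<bar>) *\<^sub>C b (g x))"
    have right: "y (n + 1, l) = complex_of_real (S ^ nat \<bar>n\<bar>) *\<^sub>C complex_of_real S *\<^sub>C b (Suc (nat n), nat (- n), l)" for n l
    proof (cases "n \<ge> 0")
      case True
      then have "nat \<bar>n + 1\<bar> = Suc (nat \<bar>n\<bar>)" "nat (n + 1) = Suc (nat n)" "nat (- (n + 1)) = nat (- n)" by auto
      then show ?thesis by (simp add: y_def g_def scaleC_scaleC mult.commute)
    next
      case False
      define k where "k = nat (- n) - 1"
      have n: "n = - int (Suc k)" using False by (simp add: k_def)
      \<comment> \<open>A forward step at a negative position cancels one backward step, and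
        \<delta> = S^-2 accounts exactly for the two factors \<open>S\<close> that are lost.\<close>
      have "S ^ Suc k * (S * \<delta>) = S ^ k" using s1 by (simp add: \<delta>_def power2_eq_square field_simps)
      then have "complex_of_real (S ^ Suc k) * (complex_of_real S * complex_of_real \<delta>) = complex_of_real (S ^ k)" by (simp only: of_real_mult[symmetric])
      moreover have "nat (n + 1) = 0" "nat (- (n + 1)) = k" "nat \<bar>n + 1\<bar> = k" "nat n = 0" "nat (- n) = Suc k" "nat \<bar>n\<bar> = Suc k" unfolding n by auto
      ultimately show ?thesis unfolding y_def g_def fst_conv snd_conv by (simp only: b4 scaleC_scaleC)
    qed
    have left: "y (n - 1, l) = complex_of_real (S ^ nat \<bar>n\<bar>) *\<^sub>C complex_of_real S *\<^sub>C b (nat n, Suc (nat (- n)), l)" for n l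
    proof (cases "n \<le> 0")
      case True
      then have "nat \<bar>n - 1\<bar> = Suc (nat \<bar>n\<bar>)" "nat (n - 1) = nat n" "nat (- (n - 1)) = Suc (nat (- n))" by auto
      then show ?thesis by (simp add: y_def g_def scaleC_scaleC mult.commute)
    next
      case False
      define k where "k = nat n - 1"
      have n: "n = int (Suc k)" using False by (simp add: k_def)
      have "S ^ Suc k * (S * \<delta>) = S ^ k" using s1 by (simp add: \<delta>_def power2_eq_square field_simps)
      then have "complex_of_real (S ^ Suc k) * (complex_of_real S * complex_of_real \<delta>) = complex_of_real (S ^ k)" by (simp only: of_real_mult[symmetric])
      moreover have "nat (n - 1) = k" "nat (- (n - 1)) = 0" "nat \<bar>n - 1\<bar> = k" "nat n = Suc k" "nat (- n) = 0" "nat \<bar>n\<bar> = Suc k" unfolding n by auto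
      ultimately show ?thesis unfolding y_def g_def fst_conv snd_conv by (simp only: b4 scaleC_scaleC)
    qed
    let ?w = "\<lambda>x::int \<times> int. complex_of_real (S ^ nat \<bar>fst x\<bar>)"
    have wS: "?w x *\<^sub>C complex_of_real r *\<^sub>C h = complex_of_real r *\<^sub>C ?w x *\<^sub>C h" for x r and h :: "'x::complex_hilbert"
      unfolding scaleC_scaleC by (simp only: mult.commute)
    have q1: "sdom (\<lambda>x. y (fst x + 1, snd x)) (\<lambda>x. complex_of_real S *\<^sub>C y x)"
      unfolding right unfolding y_def wS
      using sdom_weight[OF sdom_comp[OF b1, of g], of "\<lambda>x. complex_of_real S * ?w x"] by (simp add: g_def scaleC_scaleC)
    have q2: "sdom (\<lambda>x. y (fst x - 1, snd x)) (\<lambda>x. complex_of_real S *\<^sub>C y x)"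
      unfolding left unfolding y_def wS
      using sdom_weight[OF sdom_comp[OF b2, of g], of "\<lambda>x. complex_of_real S * ?w x"] by (simp add: g_def scaleC_scaleC)
    have q3: "sdom (\<lambda>x. y (fst x, snd x + k)) (\<lambda>x. complex_of_real t *\<^sub>C y x)" if "k = 1 \<or> k = -1" for k
      unfolding y_def
      using sdom_weight[OF sdom_comp[OF b3[OF that], of g], of ?w] by (simp add: g_def scaleC_scaleC mult.commute)
    have q: "quantum_family S t y" unfolding quantum_family_def using q1 q2 q3[of 1] q3[of "-1"] by simp
    define d where "d = (\<lambda>x. c x * complex_of_real (s ^ nat \<bar>fst x\<bar>))"
    have "comb F c u = comb F d (\<lambda>x. dilated_family \<delta> s u (g x))"
      unfolding comb_def
    proof (rule sum.cong[OF refl])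
      fix x :: "int \<times> int"
      have m: "min (nat (fst x)) (nat (- fst x)) = 0" "int (nat (fst x)) - int (nat (- fst x)) = fst x" by auto
      have "s ^ nat \<bar>fst x\<bar> * inverse (s ^ nat \<bar>fst x\<bar>) = 1" using s1 by simp
      then have "complex_of_real (s ^ nat \<bar>fst x\<bar>) * complex_of_real (inverse (s ^ nat \<bar>fst x\<bar>)) = 1" by (simp only: of_real_mult[symmetric] of_real_1)
      then show "c x *\<^sub>C u x = d x *\<^sub>C dilated_family \<delta> s u (g x)"
        unfolding dilated_family_def g_def d_def fst_conv snd_conv m power_0 mult_1 scaleC_scaleC mult.assoc by simp
    qed
    also have "norm \<dots> \<le> norm (comb F d (\<lambda>x. complex_of_real (sqrt (1 + (72 / s)\<^sup>2)) *\<^sub>C b (g x)))"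
      using sdom_comp[OF b5, of g] F unfolding sdom_def by blast
    also have "\<dots> = sqrt (1 + (72 / s)\<^sup>2) * norm (comb F d (\<lambda>x. b (g x)))" by (simp add: comb_scale_fam norm_scaleC)
    also have "comb F d (\<lambda>x. b (g x)) = comb F (\<lambda>x. c x * complex_of_real (s ^ nat \<bar>fst x\<bar> * inverse (S ^ nat \<bar>fst x\<bar>))) y"
      unfolding comb_def y_def d_def scaleC_scaleC using s1 by (simp add: mult.assoc)
    also have "norm \<dots> \<le> K * ((1 + tail_const s 1) * B) * norm (y (0, 0))"
      by (rule laurent_constD[OF K(1) q F]) (rule laurent_rescale[OF s1(1) s(2) F], use B in auto)
    also have "y (0, 0) = b (0, 0, 0)" by (simp add: y_def g_def)
    also have "K * ((1 + tail_const s 1) * B) * norm (b (0, 0, 0)) \<le> K * ((1 + tail_const s 1) * B) * (sqrt (1 + 16 / s\<^sup>2) * norm (u (0, 0)))"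
      using K B0 tail_const_nonneg[OF s1(1), of 1] by (intro mult_left_mono[OF b6]) auto
    finally have "norm (comb F c u) \<le> sqrt (1 + (72 / s)\<^sup>2) * (K * ((1 + tail_const s 1) * B) * (sqrt (1 + 16 / s\<^sup>2) * norm (u (0, 0))))"
      by (simp add: mult_left_mono)
    then show "norm (comb F c u) \<le> K * shrink s * B * norm (u (0, 0))" by (simp only: shrink_def mult_ac)
  qed
qed

lemma shrink_tendsto: "(shrink \<longlongrightarrow> 1) at_top"
  unfolding shrink_def tail_const_def by real_asymp

lemma shrink_ge_1: "s > 1 \<Longrightarrow> 1 \<le> shrink s"
proof -
  assume s: "s > 1"
  have "1 \<le> sqrt (1 + (72 / s)\<^sup>2)" "1 \<le> 1 + tail_const s 1" "1 \<le> sqrt (1 + 16 / s\<^sup>2)"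
    using s tail_const_nonneg[OF s, of 1] by auto
  then show ?thesis unfolding shrink_def by (meson mult_ge1_I)
qed

section \<open>The spectral constant\<close>

lemma laurent_const_swap: "laurent_const r1 r2 K \<Longrightarrow> laurent_const r2 r1 K"
  unfolding laurent_const_def[of r2 r1 K]
proof (intro allI impI)
  fix u :: "int \<times> int \<Rightarrow> ell2" and F c B
  assume K: "laurent_const r1 r2 K" and u: "quantum_family r2 r1 u" and F: "finite F" and B: "\<forall>z\<in>bdry r2. \<forall>w\<in>bdry r1. cmod (laurent F c z w) \<le> B"
  let ?s = "\<lambda>x::int \<times> int. (snd x, fst x)"
  have s: "sdom f g \<Longrightarrow> sdom (\<lambda>x. f (?s x)) (\<lambda>x. g (?s x))" for f g :: "int \<times> int \<Rightarrow> ell2"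
    by (rule sdom_comp)
  have q: "quantum_family r1 r2 (\<lambda>x. u (?s x))"
    using u[unfolded quantum_family_def, THEN conjunct1, THEN s]
      u[unfolded quantum_family_def, THEN conjunct2, THEN conjunct1, THEN s]
      u[unfolded quantum_family_def, THEN conjunct2, THEN conjunct2, THEN conjunct1, THEN s]
      u[unfolded quantum_family_def, THEN conjunct2, THEN conjunct2, THEN conjunct2, THEN s]
    unfolding quantum_family_def fst_conv snd_conv by blast
  have inj: "inj_on ?s F" by (auto simp: inj_on_def prod_eq_iff)
  have "comb F c u = comb (?s ` F) (\<lambda>x. c (?s x)) (\<lambda>x. u (?s x))"
    unfolding comb_def by (simp add: sum.reindex[OF inj])
  also have "norm \<dots> \<le> K * B * norm (u (?s (0, 0)))"
  proof (rule laurent_constD[OF K q])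
    fix z w assume "z \<in> bdry r1" "w \<in> bdry r2"
    then have "cmod (laurent F c w z) \<le> B" using B by blast
    also have "laurent F c w z = laurent (?s ` F) (\<lambda>x. c (?s x)) z w"
      unfolding laurent_def by (simp add: sum.reindex[OF inj] mult_ac)
    finally show "cmod (laurent (?s ` F) (\<lambda>x. c (?s x)) z w) \<le> B" .
  qed (use F in simp)
  finally show "norm (comb F c u) \<le> K * B * norm (u (0, 0))" by simp
qed

lemma admissible_iff_laurent_const:
  assumes r: "r > 1" shows "admissible_const TYPE(ell2) r K \<longleftrightarrow> laurent_const r r K"
proof
  assume K: "laurent_const r r K"
  then have "0 < K" using laurent_const_lower[OF r K] by simp
  then show "admissible_const TYPE(ell2) r K" using laurent_const_imp_K_spectral_set[OF r _ K] by (auto simp: admissible_const_def)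
qed (rule admissible_imp_laurent_const[OF r])

lemma biannulus_const_le:
  assumes r: "r > 1" and K: "laurent_const r r K" shows "biannulus_const r \<le> K"
  unfolding biannulus_const_def using K laurent_const_lower[OF r]
  by (intro cInf_lower bdd_belowI[of _ 4]) (auto simp: admissible_iff_laurent_const[OF r])

text \<open>The infimum is attained: for fixed data the admissible \<open>K\<close> satisfy a closed
  inequality. If the right-hand side has \<open>C = 0\<close>, any admissible constant already gives
  the claim.\<close>

lemma laurent_const_biannulus_const:
  assumes r: "r > 1" shows "laurent_const r r (biannulus_const r)"
  unfolding laurent_const_def
proof (intro allI impI)
  fix u :: "int \<times> int \<Rightarrow> ell2" and F c B
  assume u: "quantum_family r r u" and F: "finite F" and B: "\<forall>z\<in>bdry r. \<forall>w\<in>bdry r. cmod (laurent F c z w) \<le> B"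
  have le: "norm (comb F c u) \<le> K * B * norm (u (0, 0))" if "laurent_const r r K" for K
    using that u F B unfolding laurent_const_def by blast
  have ne: "{K. admissible_const TYPE(ell2) r K} \<noteq> {}" using laurent_const_upper[OF r r] by (auto simp: admissible_iff_laurent_const[OF r])
  have "complex_of_real r \<in> bdry r" using r by (auto simp: bdry_def)
  then have B0: "0 \<le> B" using B by (meson norm_ge_zero order_trans)
  define C where "C = B * norm (u (0, 0))"
  show "norm (comb F c u) \<le> biannulus_const r * B * norm (u (0, 0))"
  proof (cases "C = 0")
    case True
    then show ?thesis using le[OF laurent_const_upper[OF r r]] by (auto simp: C_def)
  next
    case False
    then have C: "C > 0" using B0 by (auto simp: C_def less_le)
    have "norm (comb F c u) / C \<le> biannulus_const r"
      unfolding biannulus_const_def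
    proof (rule cInf_greatest[OF ne])
      fix K assume "K \<in> {K. admissible_const TYPE(ell2) r K}"
      then have "norm (comb F c u) \<le> K * C" using le[of K] by (simp add: admissible_iff_laurent_const[OF r] C_def mult.assoc)
      then show "norm (comb F c u) / C \<le> K" using C by (simp add: pos_divide_le_eq)
    qed
    then show ?thesis using C by (simp add: pos_divide_le_eq C_def mult.assoc)
  qed
qed

lemma biannulus_const_upper:
  assumes r: "r > 1"
  defines "a \<equiv> (r\<^sup>2 + 1) / (r\<^sup>2 - 1)"
  shows "biannulus_const r \<le> 4 + 4 * a powr (1 / 2) + a\<^sup>2"
proof -
  have r2: "r\<^sup>2 > 1" using r by simp
  have a1: "a \<ge> 1" using r2 by (simp add: a_def field_simps)
  have "r ^ 4 = r\<^sup>2 * r\<^sup>2" by (simp flip: power_add)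
  moreover have "1 - 1 / (y * y) = (y - 1) * (y + 1) / (y * y)" if "y > 1" for y :: real
    using that by (simp add: field_simps)
  ultimately have D: "1 - 1 / r ^ 4 = (r\<^sup>2 - 1) * (r\<^sup>2 + 1) / (r\<^sup>2 * r\<^sup>2)" using r2 by (simp only:)
  \<comment> \<open>The two tails are proportional, so the square of their sum is
    \<open>(1 + r^-2)^2 / (1 - r^-4)\<close>, which simplifies to \<open>a\<close>.\<close>
  have t: "tail_const r 1 = (1 / r\<^sup>2) * tail_const r 0"
  proof -
    have "(1 / r ^ 4) ^ 1 / (1 - 1 / r ^ 4) = (1 / r\<^sup>2)\<^sup>2 * ((1 / r ^ 4) ^ 0 / (1 - 1 / r ^ 4))"
      by (simp add: power_divide flip: power_mult)
    then show ?thesis unfolding tail_const_def by (simp only: real_sqrt_mult real_sqrt_abs) simp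
  qed
  have "(tail_const r 1 + tail_const r 0)\<^sup>2 = (1 / r\<^sup>2 + 1)\<^sup>2 * (tail_const r 0)\<^sup>2"
    unfolding t power_mult_distrib[symmetric] by (simp add: distrib_right)
  also have "(tail_const r 0)\<^sup>2 = 1 / (1 - 1 / r ^ 4)" using r by (simp add: tail_const_def)
  also have "(1 / r\<^sup>2 + 1)\<^sup>2 * (1 / (1 - 1 / r ^ 4)) = a"
    unfolding D a_def using r2
  proof -
    define y where "y = r\<^sup>2"
    have y: "y > 1" using r2 by (simp add: y_def)
    have "(1 / y + 1)\<^sup>2 * (1 / ((y - 1) * (y + 1) / (y * y))) = ((1 + y) / y)\<^sup>2 * (y * y / ((y - 1) * (y + 1)))"
      using y by (simp add: field_simps)
    also have "\<dots> = (y + 1) / (y - 1)" using y by (simp add: power2_eq_square add.commute)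
    finally show "(1 / r\<^sup>2 + 1)\<^sup>2 * (1 / ((r\<^sup>2 - 1) * (r\<^sup>2 + 1) / (r\<^sup>2 * r\<^sup>2))) = (r\<^sup>2 + 1) / (r\<^sup>2 - 1)"
      by (simp only: y_def)
  qed
  finally have "tail_const r 1 + tail_const r 0 = sqrt a" using tail_const_nonneg[OF r] by (metis add_nonneg_nonneg real_sqrt_unique)
  then have "part_const 1 r + part_const (-1) r = 2 + sqrt a" by (simp add: part_const_def)
  then have "biannulus_const r \<le> (2 + sqrt a) * (2 + sqrt a)" using biannulus_const_le[OF r laurent_const_upper[OF r r]] by simp
  also have "\<dots> = 4 + 4 * sqrt a + a" using a1 by (simp add: algebra_simps)
  \<comment> \<open>The argument yields \<open>a\<close> as last summand; it is at most
    \<open>a^2\<close> because \<open>a \<ge> 1\<close>.\<close>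
  also have "\<dots> \<le> 4 + 4 * a powr (1 / 2) + a\<^sup>2"
    using a1 by (simp add: powr_half_sqrt power2_eq_square)
  finally show ?thesis .
qed

lemma biannulus_const_mono:
  assumes s: "2 \<le> s" "s \<le> S" shows "biannulus_const s \<le> biannulus_const S * (shrink s)\<^sup>2"
proof -
  have S: "S > 1" "S \<ge> 2" "s > 1" using s by auto
  have k: "laurent_const S S (biannulus_const S)" by (rule laurent_const_biannulus_const[OF S(1)])
  have 0: "0 \<le> biannulus_const S" "0 \<le> biannulus_const S * shrink s"
    using laurent_const_lower[OF S(1) k] shrink_ge_1[OF S(3)] by auto
  \<comment> \<open>One radius is lowered, the variables are exchanged, and then the other one is
    lowered; this accounts for the square of \<open>shrink s\<close>.\<close>
  have "laurent_const S s (biannulus_const S * shrink s)" by (rule laurent_const_swap[OF laurent_const_shrink[OF k 0(1) s S(2)]])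
  from biannulus_const_le[OF S(3) laurent_const_shrink[OF this 0(2) s s(1)]]
  show ?thesis by (simp add: power2_eq_square mult.assoc)
qed

lemma biannulus_const_convergent:
  obtains L where "(biannulus_const \<longlongrightarrow> L) at_top" "4 \<le> L" "L \<le> 9"
proof -
  let ?up = "\<lambda>r::real. 4 + 4 * ((r\<^sup>2 + 1) / (r\<^sup>2 - 1)) powr (1 / 2) + ((r\<^sup>2 + 1) / (r\<^sup>2 - 1))\<^sup>2"
  have up: "(?up \<longlongrightarrow> 9) at_top" by real_asymp
  have ev: "eventually (\<lambda>r::real. r > 1) at_top" by (rule eventually_gt_at_top)
  \<comment> \<open>Every \<open>g s\<close> is a lower bound for the constant at all larger radii,
    so the supremum \<open>L\<close> of \<open>g\<close> bounds the lower limit from below.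
    Conversely the constant is at most \<open>L\<close> times the squared factor, which tends to
    \<open>L\<close>.\<close>
  define g where "g = (\<lambda>s. biannulus_const s / (shrink s)\<^sup>2)"
  have sh: "(shrink s)\<^sup>2 > 0" if "s \<ge> 2" for s using shrink_ge_1[of s] that by simp
  have g: "g s \<le> biannulus_const S" if "2 \<le> s" "s \<le> S" for s S
    using biannulus_const_mono[OF that] sh[OF that(1)] by (simp add: g_def pos_divide_le_eq)
  \<comment> \<open>Any number above the limit 9 of the upper bounds would do, because
    \<open>g s\<close> can be compared with an arbitrarily large radius.\<close>
  have bound: "g s \<le> 10" if "2 \<le> s" for s
  proof -
    have "eventually (\<lambda>r. ?up r < 10 \<and> s \<le> r) at_top"
      using order_tendstoD(2)[OF up, of 10] eventually_ge_at_top[of s] by (simp add: eventually_conj)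
    then obtain S where S: "?up S < 10" "s \<le> S" by (auto simp: eventually_at_top_linorder)
    then show ?thesis using g[OF that S(2)] biannulus_const_upper[of S] that by simp
  qed
  define L where "L = (SUP s\<in>{2..}. g s)"
  have bdd: "bdd_above (g ` {2..})" by (rule bdd_aboveI[of _ 10]) (auto intro: bound)
  have gL: "g s \<le> L" if "2 \<le> s" for s unfolding L_def using bdd that by (intro cSUP_upper) auto
  have lim: "(biannulus_const \<longlongrightarrow> L) at_top"
  proof (rule order_tendstoI)
    fix x assume "x < L"
    then obtain s where s: "2 \<le> s" "x < g s" unfolding L_def using less_cSUP_iff[OF _ bdd] by auto
    show "eventually (\<lambda>r. x < biannulus_const r) at_top"
      using eventually_ge_at_top[of s] by eventually_elim (use s g in \<open>blast intro: less_le_trans\<close>)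
  next
    fix x assume x: "L < x"
    have "((\<lambda>s. L * (shrink s)\<^sup>2) \<longlongrightarrow> L * 1\<^sup>2) at_top" by (intro tendsto_intros shrink_tendsto)
    then have "eventually (\<lambda>s. L * (shrink s)\<^sup>2 < x) at_top" using x by (intro order_tendstoD(2)) auto
    then show "eventually (\<lambda>r. biannulus_const r < x) at_top"
      using eventually_ge_at_top[of 2]
    proof eventually_elim
      case (elim s)
      then show ?case using gL[of s] sh[of s] by (simp add: g_def pos_divide_le_eq)
    qed
  qed
  show ?thesis
  proof (rule that[OF lim])
    show "4 \<le> L"
      by (rule tendsto_lowerbound[OF lim]) (rule eventually_mono[OF ev laurent_const_lower[OF _ laurent_const_biannulus_const]], simp_all)
    show "L \<le> 9"
      by (rule tendsto_le[OF _ up lim]) (simp, rule eventually_mono[OF ev biannulus_const_upper])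
  qed
qed

theorem theorem5p2:
  shows "(\<forall>r>1. admissible_const TYPE('h::complex_hilbert) r (biannulus_const r) \<and>
                (\<forall>K. admissible_const TYPE(ell2) r K \<longrightarrow> biannulus_const r \<le> K))
       \<and> (\<forall>r>1. 2^2 \<le> biannulus_const r \<and>
                biannulus_const r \<le> 4 + 4 * ((r^2 + 1) / (r^2 - 1)) powr (1/2)
                                      + ((r^2 + 1) / (r^2 - 1))^2)
       \<and> (\<exists>L. (biannulus_const \<longlongrightarrow> L) at_top \<and> 2^2 \<le> L \<and> L \<le> 3^2)"
proof (intro conjI allI impI)
  fix r :: real assume r: "r > 1"
  have laurent_const: "laurent_const r r (biannulus_const r)" by (rule laurent_const_biannulus_const[OF r])
  have four: "4 \<le> biannulus_const r" by (rule laurent_const_lower[OF r laurent_const])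
  then have "0 < biannulus_const r" by simp
  then show "admissible_const TYPE('h) r (biannulus_const r)"
    using laurent_const_imp_K_spectral_set[OF r _ laurent_const] by (auto simp: admissible_const_def)
  show "biannulus_const r \<le> K" if "admissible_const TYPE(ell2) r K" for K
    using biannulus_const_le[OF r] that by (simp add: admissible_iff_laurent_const[OF r])
  show "2^2 \<le> biannulus_const r" using four by simp
  show "biannulus_const r \<le> 4 + 4 * ((r^2 + 1) / (r^2 - 1)) powr (1/2) + ((r^2 + 1) / (r^2 - 1))^2"
    by (rule biannulus_const_upper[OF r])
next
  obtain L where "(biannulus_const \<longlongrightarrow> L) at_top" "4 \<le> L" "L \<le> 9" by (rule biannulus_const_convergent)
  then show "\<exists>L. (biannulus_const \<longlongrightarrow> L) at_top \<and> 2^2 \<le> L \<and> L \<le> 3^2" by auto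
qed

end
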